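(* Let $\alpha\in(1,2)$ and $H\in(0,1)$, and let $X$ be linear fractional stable motion with stability parameter $\alpha$ and self-similarity parameter $H$. Let $\psi$ be a bounded, compactly supported wavelet with $Q\ge1$ zero moments, let $d_{j,k}$ be the corresponding discrete wavelet transform coefficients of $X$, and let $$\widehat H=\sum_j w_j\frac1{N_j}\sum_{n=1}^{N_j}\log_2|d_{j,n}|-\frac12$$ be the associated estimator of $H$. Suppose that $$Q-H>\frac1{\alpha(\alpha-1)}.$$ Then, as $N\to\infty$, $$N^{1/2}(\widehat H-H)\xrightarrow{d}\mathcal N(0,\sigma^2),$$ where $$\sigma^2=\sum_{j,k}w_jw_k2^{j/2}2^{k/2}\sigma_{j,k},$$ with $$\sigma_{j,k}=2^{(j-k)/2}\sum_{n=-\infty}^\infty\mathrm{Cov}(\log_2|d_{j,n}|,\log_2|d_{k,0}|)$$ if $k\ge j$, and $\sigma_{j,k}=\sigma_{k,j}$ if $j>k$. Moreover, $$\sigma^2=\lim_{N\to\infty}N\,E(\widehat H-H)^2.$$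
   Context: Linear fractional stable motion: $X(t)=\int_{\mathbb R}\{(t-u)_+^\kappa-(-u)_+^\kappa\}M(du)$, $t\in\mathbb R$, where $\kappa=H-1/\alpha$, $x_+=\max(x,0)$ (with $x_+^\kappa=0$ for $x\le 0$), and $M$ is a symmetric $\alpha$-stable random measure on $\mathbb R$ with Lebesgue control measure. Wavelet: $\psi:\mathbb R\to\mathbb R$ has $Q\ge1$ zero moments, i.e. $\int_{\mathbb R}\psi(t)t^m\,dt=0$ for $m=0,\dots,Q-1$ and $\int_{\mathbb R}\psi(t)t^Q\,dt\ne0$. Wavelet coefficients: $d_{j,k}=\int_{\mathbb R}X(t)2^{-j/2}\psi(2^{-j}t-k)\,dt$, $j,k\in\mathbb Z$. For bounded compactly supported $\psi$ and $H-1/\alpha>-1$ these are well defined and (known) have the representation $d_{j,k}=\int_{\mathbb R}2^{j(\kappa+1/2)}h(k-2^{-j}u)M(du)$ with $h(u)=\int_{\mathbb R}(s+u)_+^\kappa\psi(s)\,ds$. Estimator: sums over $j$ (and $k$) in the definitions of $\widehat H$ and $\sigma^2$ run over a fixed finite set of consecutive integers (octaves); the real weights $w_j$ satisfy $\sum_jw_j=0$ and $\sum_jjw_j=1$; $N_j=N_j(N)$ is the number of available wavelet coefficients at octave $j$ over the time interval $[0,N]$, i.e. positive integers with $N_j\sim2^{-j}N$ as $N\to\infty$. $\xrightarrow{d}$ is convergence in distribution. *)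

theory Defs
  imports "HOL-Probability.Probability" "HOL-Library.Landau_Symbols"
begin

(* Symmetric alpha-stable law S_alpha(s,0,0), with scale parameter s. *)
definition sas_distributed :: "'a measure \<Rightarrow> real \<Rightarrow> real \<Rightarrow> ('a \<Rightarrow> real) \<Rightarrow> bool" where
  "sas_distributed P \<alpha> s Y \<longleftrightarrow>
     Y \<in> borel_measurable P \<and>
     (\<forall>\<theta>. char (distr P borel Y) \<theta> = complex_of_real (exp (- ((s * \<bar>\<theta>\<bar>) powr \<alpha>))))"

definition finite_lborel_sets :: "real set set" where
  "finite_lborel_sets = {A \<in> sets lborel. emeasure lborel A < \<infinity>}"

(* Symmetric alpha-stable random measure on the real line with Lebesgue control measure: an
   independently scattered set function, countably additive almost surely, with M(A) of scale
   (Lebesgue measure of A)^(1/alpha). Independence of finite disjoint families is the case of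
   sequences that are eventually empty. The values of M outside finite_lborel_sets are irrelevant. *)
definition sas_random_measure ::
  "'a measure \<Rightarrow> real \<Rightarrow> (real set \<Rightarrow> 'a \<Rightarrow> real) \<Rightarrow> bool" where
  "sas_random_measure P \<alpha> M \<longleftrightarrow>
     (\<forall>A \<in> finite_lborel_sets. sas_distributed P \<alpha> (measure lborel A powr (1 / \<alpha>)) (M A)) \<and>
     (\<forall>A :: nat \<Rightarrow> real set. range A \<subseteq> finite_lborel_sets \<and> disjoint_family A \<longrightarrow>
        prob_space.indep_vars P (\<lambda>_. borel) (\<lambda>i. M (A i)) UNIV) \<and>
     (\<forall>A :: nat \<Rightarrow> real set. range A \<subseteq> finite_lborel_sets \<and> disjoint_family A \<and>
          (\<Union>i. A i) \<in> finite_lborel_sets \<longrightarrow>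
        (AE \<omega> in P. (\<lambda>i. M (A i) \<omega>) sums M (\<Union>i. A i) \<omega>))"

(* Integral of a simple function; the term y = 0, whose level set has infinite measure, vanishes. *)
definition simple_stable_integral ::
  "(real set \<Rightarrow> 'a \<Rightarrow> real) \<Rightarrow> (real \<Rightarrow> real) \<Rightarrow> 'a \<Rightarrow> real" where
  "simple_stable_integral M g \<omega> = (\<Sum>y\<in>range g. y * M {u. g u = y} \<omega>)"

definition tendsto_in_probability ::
  "'a measure \<Rightarrow> (nat \<Rightarrow> 'a \<Rightarrow> real) \<Rightarrow> ('a \<Rightarrow> real) \<Rightarrow> bool" where
  "tendsto_in_probability P Z Y \<longleftrightarrow>
     (\<forall>\<epsilon>>0. (\<lambda>n. measure P {\<omega> \<in> space P. \<bar>Z n \<omega> - Y \<omega>\<bar> > \<epsilon>}) \<longlonglongrightarrow> 0)"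

(* Y is (a version of) the integral of f with respect to M, obtained as the limit in probability of
   integrals of simple functions that approximate f in L^alpha. The limit does not depend on
   the approximating sequence, up to almost sure equality. *)
definition has_stable_integral ::
  "'a measure \<Rightarrow> real \<Rightarrow> (real set \<Rightarrow> 'a \<Rightarrow> real) \<Rightarrow> (real \<Rightarrow> real) \<Rightarrow> ('a \<Rightarrow> real) \<Rightarrow> bool" where
  "has_stable_integral P \<alpha> M f Y \<longleftrightarrow>
     f \<in> borel_measurable borel \<and> Y \<in> borel_measurable P \<and>
     (\<exists>g :: nat \<Rightarrow> real \<Rightarrow> real.
        (\<forall>n. simple_function lborel (g n) \<and> emeasure lborel {u. g n u \<noteq> 0} < \<infinity>) \<and>
        (\<lambda>n. \<integral>\<^sup>+u. ennreal (\<bar>g n u - f u\<bar> powr \<alpha>) \<partial>lborel) \<longlonglongrightarrow> 0 \<and>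
        tendsto_in_probability P (\<lambda>n. simple_stable_integral M (g n)) Y)"

(* As 0 powr a = 0 for every a (including a = 0), the positive part power is 0 for x <= 0. *)
definition pos_power :: "real \<Rightarrow> real \<Rightarrow> real" where
  "pos_power \<kappa> x = (max x 0) powr \<kappa>"

(* The stochastic integral determines X t only up to a P-null set depending on t. A jointly
   measurable version is required, so that time integrals of the paths make sense. *)
definition linear_fractional_stable_motion ::
  "'a measure \<Rightarrow> real \<Rightarrow> real \<Rightarrow> (real set \<Rightarrow> 'a \<Rightarrow> real) \<Rightarrow> (real \<Rightarrow> 'a \<Rightarrow> real) \<Rightarrow> bool" where
  "linear_fractional_stable_motion P \<alpha> H M X \<longleftrightarrow>
     (\<lambda>(t, \<omega>). X t \<omega>) \<in> borel_measurable (borel \<Otimes>\<^sub>M P) \<and>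
     (\<forall>t. has_stable_integral P \<alpha> M
            (\<lambda>u. pos_power (H - 1 / \<alpha>) (t - u) - pos_power (H - 1 / \<alpha>) (- u)) (X t))"

definition zero_moments :: "nat \<Rightarrow> (real \<Rightarrow> real) \<Rightarrow> bool" where
  "zero_moments Q \<psi> \<longleftrightarrow>
     (\<forall>m<Q. (\<integral>t. \<psi> t * t ^ m \<partial>lborel) = 0) \<and> (\<integral>t. \<psi> t * t ^ Q \<partial>lborel) \<noteq> 0"

definition wavelet_coeff ::
  "(real \<Rightarrow> 'a \<Rightarrow> real) \<Rightarrow> (real \<Rightarrow> real) \<Rightarrow> int \<Rightarrow> int \<Rightarrow> 'a \<Rightarrow> real" where
  "wavelet_coeff X \<psi> j k \<omega> =
     (\<integral>t. X t \<omega> * (2 powr (- real_of_int j / 2) * \<psi> (2 powr (- real_of_int j) * t - real_of_int k))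
       \<partial>lborel)"

definition hurst_estimator ::
  "int set \<Rightarrow> (int \<Rightarrow> real) \<Rightarrow> (int \<Rightarrow> nat \<Rightarrow> nat) \<Rightarrow> (int \<Rightarrow> int \<Rightarrow> 'a \<Rightarrow> real) \<Rightarrow> nat \<Rightarrow> 'a \<Rightarrow> real"
  where
  "hurst_estimator J w Nc d N \<omega> =
     (\<Sum>j\<in>J. w j * (1 / real (Nc j N) * (\<Sum>n = 1..Nc j N. log 2 \<bar>d j (int n) \<omega>\<bar>))) - 1 / 2"

definition covariance :: "'a measure \<Rightarrow> ('a \<Rightarrow> real) \<Rightarrow> ('a \<Rightarrow> real) \<Rightarrow> real" where
  "covariance P Y Z =
     (\<integral>\<omega>. (Y \<omega> - (\<integral>\<omega>'. Y \<omega>' \<partial>P)) * (Z \<omega> - (\<integral>\<omega>'. Z \<omega>' \<partial>P)) \<partial>P)"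

definition log_cov :: "'a measure \<Rightarrow> (int \<Rightarrow> int \<Rightarrow> 'a \<Rightarrow> real) \<Rightarrow> int \<Rightarrow> int \<Rightarrow> int \<Rightarrow> real" where
  "log_cov P d j k n = covariance P (\<lambda>\<omega>. log 2 \<bar>d j n \<omega>\<bar>) (\<lambda>\<omega>. log 2 \<bar>d k 0 \<omega>\<bar>)"

definition asym_cov :: "'a measure \<Rightarrow> (int \<Rightarrow> int \<Rightarrow> 'a \<Rightarrow> real) \<Rightarrow> int \<Rightarrow> int \<Rightarrow> real" where
  "asym_cov P d j k =
     (if j \<le> k then 2 powr (real_of_int (j - k) / 2) * (\<Sum>\<^sub>\<infinity>n\<in>UNIV. log_cov P d j k n)
      else 2 powr (real_of_int (k - j) / 2) * (\<Sum>\<^sub>\<infinity>n\<in>UNIV. log_cov P d k j n))"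

definition asym_var ::
  "int set \<Rightarrow> (int \<Rightarrow> real) \<Rightarrow> 'a measure \<Rightarrow> (int \<Rightarrow> int \<Rightarrow> 'a \<Rightarrow> real) \<Rightarrow> real" where
  "asym_var J w P d =
     (\<Sum>j\<in>J. \<Sum>k\<in>J. w j * w k * 2 powr (real_of_int j / 2) * 2 powr (real_of_int k / 2)
        * asym_cov P d j k)"

(* The normal law with mean m and variance v >= 0; the point mass at m when v = 0. *)
definition normal_law :: "real \<Rightarrow> real \<Rightarrow> real measure" where
  "normal_law m v = distr std_normal_distribution borel (\<lambda>x. m + sqrt v * x)"

end

theory Submission
  imports Defs
begin

text \<open>For jointly stable \<open>Y = \<integral> f dM\<close> and \<open>Z = \<integral> g dM\<close> the covariance of \<open>ln |Y|\<close> and \<open>ln |Z|\<close> is, by a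
  Frullani-type representation of the logarithm, an integral of differences of characteristic
  functions, hence at most a constant times \<open>\<integral> |f g| powr (\<alpha> / 2)\<close>. The zero moments of the wavelet give
  the kernel of \<open>d\<^bsub>j,k\<^esub>\<close> a decay of order \<open>Q - \<kappa>\<close>, and \<open>Q - H > 1 / (\<alpha> (\<alpha> - 1))\<close> makes
  \<open>(Q - \<kappa>) \<alpha> / 2\<close> exceed 1; so the covariances are summable and the variance converges as for a
  Toeplitz form. For the normal limit, kernels are replaced by simple functions of bounded support;
  a Schur test, applied with a geometric mean of the covariance bound and of the \<open>L\<^sup>2\<close> distance of the
  logarithms, keeps the error small uniformly in \<open>N\<close>. Blocks separated by gaps are then i.i.d. and
  the classical central limit theorem applies.\<close>

text \<open>For \<alpha> < 2 stable integrals have no variance and in general no explicit density,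
  and the logarithm is unbounded at 0 and at infinity. What is accessible is \<open>powint\<close>
  of linear combinations, that is, characteristic functions; from them come the moments of order 1/2
  and -1/2, the covariances of cosines and finally those of logarithms. A change of scale only
  translates the logarithm, so all centred logarithms share one variance, and estimates are uniform
  over kernels whose \<open>powint\<close> is bounded below. Hence \<open>h\<close> must be shown
  not to vanish almost everywhere. Under approximation of a kernel the covariance bound does not
  become small, whereas the distance of the logarithms is small but does not decay in the lag; their
  geometric mean does both. The approximants must therefore inherit the envelope of the kernel. The
  mean of \<open>ln |d j n|\<close> is affine in \<open>j\<close>. The two conditions on the weights
  remove its constant and extract its slope, so that \<open>sqrt N\<close> times the estimation
  error is exactly a weighted sum of centred logarithms, without a bias term.\<close>

lemmas integrable_dominated = Bochner_Integration.integrable_bound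

abbreviation env :: "real \<Rightarrow> real \<Rightarrow> real" where
  "env p x \<equiv> (1 + \<bar>x\<bar>) powr (- p)"

section \<open>Power integrals and simple functions\<close>

text \<open>As p/2 < 1 and |x| \<le> 1, both |x| and \<open>|x| powr p\<close> are at most
  \<open>|x| powr (p / 2)\<close>, so a linear bound on \<open>|1 + x| powr p - 1\<close> suffices.
  Replacing the exponent p by 2 gives it: from above when x \<ge> 0, from below when x < 0, where
  the base is at most 1.\<close>

lemma abs_powr_add_bound_aux:
  fixes p x :: real
  assumes p: "1 < p" "p < 2" and x: "\<bar>x\<bar> \<le> 1"
  shows "\<bar>\<bar>1 + x\<bar> powr p - 1 - \<bar>x\<bar> powr p\<bar> \<le> 4 * \<bar>x\<bar> powr (p / 2)"
proof -
  have a: "\<bar>x\<bar> powr p \<le> \<bar>x\<bar> powr (p / 2)"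
    using p x by (intro powr_mono') auto
  have "\<bar>x\<bar> powr 1 \<le> \<bar>x\<bar> powr (p / 2)"
    using p x by (intro powr_mono') auto
  then have b: "\<bar>x\<bar> \<le> \<bar>x\<bar> powr (p / 2)" by simp
  have c: "\<bar>x\<bar> powr p \<ge> 0" by simp
  show ?thesis
  proof (cases "x \<ge> 0")
    case True
    have "(1 + x) powr p \<le> (1 + x) powr 2"
      using True p by (intro powr_mono) auto
    also have "\<dots> = 1 + 2 * x + x * x"
      using True by (simp add: powr_numeral power2_eq_square algebra_simps)
    also have "x * x \<le> x" using True x by (simp add: mult_left_le)
    finally have u: "(1 + x) powr p \<le> 1 + 3 * x" by simp
    have l: "(1 + x) powr p \<ge> 1" using True p by (simp add: ge_one_powr_ge_zero)
    have "\<bar>(1 + x) powr p - 1 - \<bar>x\<bar> powr p\<bar> \<le> 4 * \<bar>x\<bar> powr (p / 2)"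
      using u l a b c True by linarith
    then show ?thesis using True by simp
  next
    case False
    have y: "0 \<le> 1 + x" "1 + x \<le> 1" using False x by auto
    have "(1 + x) powr 2 \<le> (1 + x) powr p"
      using y p by (intro powr_mono') auto
    moreover have "(1 + x) powr 2 = 1 + 2 * x + x * x"
      using y by (simp add: powr_numeral power2_eq_square algebra_simps)
    moreover have "x * x \<ge> 0" by simp
    ultimately have l: "(1 + x) powr p \<ge> 1 + 2 * x" by linarith
    have u: "(1 + x) powr p \<le> 1"
      using y p powr_mono'[of 0 p "1 + x"] by (cases "x = -1") auto
    have "\<bar>(1 + x) powr p - 1 - \<bar>x\<bar> powr p\<bar> \<le> 4 * \<bar>x\<bar> powr (p / 2)"
      using u l a b c False by linarith
    then show ?thesis using y by simp
  qed
qed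

text \<open>Homogeneity reduces everything to the ratio of the smaller to the larger number. Half
  powers make the error symmetric in \<open>a\<close> and \<open>b\<close>; their product is the
  integrand of \<open>crossint\<close>.\<close>

lemma abs_powr_add_bound:
  fixes a b p :: real
  assumes p: "1 < p" "p < 2"
  shows "\<bar>\<bar>a + b\<bar> powr p - \<bar>a\<bar> powr p - \<bar>b\<bar> powr p\<bar> \<le> 4 * (\<bar>a\<bar> powr (p / 2) * \<bar>b\<bar> powr (p / 2))"
proof -
  have *: "\<bar>\<bar>a + b\<bar> powr p - \<bar>a\<bar> powr p - \<bar>b\<bar> powr p\<bar> \<le> 4 * (\<bar>a\<bar> powr (p / 2) * \<bar>b\<bar> powr (p / 2))"
    if "\<bar>b\<bar> \<le> \<bar>a\<bar>" for a b :: real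
  proof (cases "a = 0")
    case True
    then show ?thesis using that by simp
  next
    case False
    define x where "x = b / a"
    have b: "b = a * x" using False by (simp add: x_def)
    have x: "\<bar>x\<bar> \<le> 1" using that False by (simp add: x_def abs_divide)
    have "a + b = a * (1 + x)" by (simp add: b algebra_simps)
    then have "\<bar>a + b\<bar> powr p - \<bar>a\<bar> powr p - \<bar>b\<bar> powr p
        = \<bar>a\<bar> powr p * (\<bar>1 + x\<bar> powr p - 1 - \<bar>x\<bar> powr p)"
      unfolding \<open>a + b = a * (1 + x)\<close> by (simp add: b abs_mult powr_mult right_diff_distrib del: distrib_left distrib_right)
    then have "\<bar>\<bar>a + b\<bar> powr p - \<bar>a\<bar> powr p - \<bar>b\<bar> powr p\<bar>
        = \<bar>a\<bar> powr p * \<bar>\<bar>1 + x\<bar> powr p - 1 - \<bar>x\<bar> powr p\<bar>"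
      by (simp add: abs_mult)
    also have "\<dots> \<le> \<bar>a\<bar> powr p * (4 * \<bar>x\<bar> powr (p / 2))"
      by (intro mult_left_mono abs_powr_add_bound_aux p x) simp
    finally have "\<bar>\<bar>a + b\<bar> powr p - \<bar>a\<bar> powr p - \<bar>b\<bar> powr p\<bar> \<le> \<bar>a\<bar> powr p * (4 * \<bar>x\<bar> powr (p / 2))" .
    moreover have "\<bar>a\<bar> powr p = \<bar>a\<bar> powr (p/2) * \<bar>a\<bar> powr (p/2)"
      by (simp flip: powr_add)
    moreover have "\<bar>b\<bar> powr (p / 2) = \<bar>a\<bar> powr (p / 2) * \<bar>x\<bar> powr (p / 2)"
      by (simp add: b abs_mult powr_mult)
    ultimately show ?thesis by (metis mult.assoc mult.left_commute)
  qed
  show ?thesis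
  proof (cases "\<bar>b\<bar> \<le> \<bar>a\<bar>")
    case False
    then show ?thesis using *[of a b] by (simp add: add.commute mult.commute algebra_simps)
  qed (rule *)
qed

lemma cauchy_schwarz_integral:
  fixes f g :: "'a \<Rightarrow> real"
  assumes [measurable]: "f \<in> borel_measurable N" "g \<in> borel_measurable N"
    and f: "integrable N (\<lambda>x. (f x)\<^sup>2)" and g: "integrable N (\<lambda>x. (g x)\<^sup>2)"
  shows "integrable N (\<lambda>x. f x * g x)"
    and "(\<integral>x. \<bar>f x * g x\<bar> \<partial>N) \<le> sqrt (\<integral>x. (f x)\<^sup>2 \<partial>N) * sqrt (\<integral>x. (g x)\<^sup>2 \<partial>N)"
    and "\<bar>\<integral>x. f x * g x \<partial>N\<bar> \<le> sqrt (\<integral>x. (f x)\<^sup>2 \<partial>N) * sqrt (\<integral>x. (g x)\<^sup>2 \<partial>N)"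
proof -
  show i: "integrable N (\<lambda>x. f x * g x)"
  proof (rule integrable_dominated[OF Bochner_Integration.integrable_add[OF f g]])
    show "AE x in N. norm (f x * g x) \<le> norm ((f x)\<^sup>2 + (g x)\<^sup>2)"
    proof (rule AE_I2)
      fix x
      have "0 \<le> (\<bar>f x\<bar> - \<bar>g x\<bar>)\<^sup>2" by simp
      then have "2 * \<bar>f x * g x\<bar> \<le> (f x)\<^sup>2 + (g x)\<^sup>2" by (simp add: power2_diff abs_mult)
      then show "norm (f x * g x) \<le> norm ((f x)\<^sup>2 + (g x)\<^sup>2)"
        using abs_ge_zero[of "f x * g x"] by simp
    qed
  qed simp
  have i': "integrable N (\<lambda>x. \<bar>f x * g x\<bar>)" using i by simp
  have "(\<integral>\<^sup>+x. ennreal \<bar>f x\<bar> * ennreal \<bar>g x\<bar> \<partial>N)\<^sup>2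
      \<le> (\<integral>\<^sup>+x. (ennreal \<bar>f x\<bar>)\<^sup>2 \<partial>N) * (\<integral>\<^sup>+x. (ennreal \<bar>g x\<bar>)\<^sup>2 \<partial>N)"
    by (intro Cauchy_Schwarz_nn_integral) auto
  also have "(\<integral>\<^sup>+x. (ennreal \<bar>f x\<bar>)\<^sup>2 \<partial>N) = (\<integral>\<^sup>+x. ennreal ((f x)\<^sup>2) \<partial>N)"
    by (simp add: ennreal_power)
  also have "\<dots> = ennreal (\<integral>x. (f x)\<^sup>2 \<partial>N)" by (rule nn_integral_eq_integral[OF f]) simp
  also have "(\<integral>\<^sup>+x. (ennreal \<bar>g x\<bar>)\<^sup>2 \<partial>N) = (\<integral>\<^sup>+x. ennreal ((g x)\<^sup>2) \<partial>N)"
    by (simp add: ennreal_power)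
  also have "\<dots> = ennreal (\<integral>x. (g x)\<^sup>2 \<partial>N)" by (rule nn_integral_eq_integral[OF g]) simp
  also have "(\<integral>\<^sup>+x. ennreal \<bar>f x\<bar> * ennreal \<bar>g x\<bar> \<partial>N) = (\<integral>\<^sup>+x. ennreal \<bar>f x * g x\<bar> \<partial>N)"
    by (simp add: abs_mult ennreal_mult)
  also have "\<dots> = ennreal (\<integral>x. \<bar>f x * g x\<bar> \<partial>N)" by (rule nn_integral_eq_integral[OF i']) simp
  finally have "(\<integral>x. \<bar>f x * g x\<bar> \<partial>N)\<^sup>2 \<le> (\<integral>x. (f x)\<^sup>2 \<partial>N) * (\<integral>x. (g x)\<^sup>2 \<partial>N)"
    by (simp add: ennreal_power flip: ennreal_mult)
  then have "(\<integral>x. \<bar>f x * g x\<bar> \<partial>N) \<le> sqrt ((\<integral>x. (f x)\<^sup>2 \<partial>N) * (\<integral>x. (g x)\<^sup>2 \<partial>N))"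
    by (rule real_le_rsqrt)
  then show *: "(\<integral>x. \<bar>f x * g x\<bar> \<partial>N) \<le> sqrt (\<integral>x. (f x)\<^sup>2 \<partial>N) * sqrt (\<integral>x. (g x)\<^sup>2 \<partial>N)"
    by (simp add: real_sqrt_mult)
  show "\<bar>\<integral>x. f x * g x \<partial>N\<bar> \<le> sqrt (\<integral>x. (f x)\<^sup>2 \<partial>N) * sqrt (\<integral>x. (g x)\<^sup>2 \<partial>N)"
    using order_trans[OF integral_abs_bound *] .
qed

definition in_Lp :: "real \<Rightarrow> (real \<Rightarrow> real) \<Rightarrow> bool" where
  "in_Lp p f \<longleftrightarrow> f \<in> borel_measurable borel \<and> integrable lborel (\<lambda>u. \<bar>f u\<bar> powr p)"

definition powint :: "real \<Rightarrow> (real \<Rightarrow> real) \<Rightarrow> real" where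
  "powint p f = (\<integral>u. \<bar>f u\<bar> powr p \<partial>lborel)"

text \<open>The measure of dependence that replaces the covariance of two stable integrals, which
  does not exist. For p = 2 it would be the integral of |f g|.\<close>

definition crossint :: "real \<Rightarrow> (real \<Rightarrow> real) \<Rightarrow> (real \<Rightarrow> real) \<Rightarrow> real" where
  "crossint p f g = (\<integral>u. \<bar>f u\<bar> powr (p / 2) * \<bar>g u\<bar> powr (p / 2) \<partial>lborel)"

lemma in_LpD [dest]:
  assumes "in_Lp p f"
  shows "f \<in> borel_measurable borel" "integrable lborel (\<lambda>u. \<bar>f u\<bar> powr p)"
  using assms by (auto simp: in_Lp_def)

lemma powint_nonneg [simp]: "0 \<le> powint p f"
  by (simp add: powint_def)

lemma crossint_nonneg [simp]: "0 \<le> crossint p f g"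
  by (simp add: crossint_def)

lemma powr_half_squared: "((x::real) powr (p / 2))\<^sup>2 = x powr p"
  by (simp add: power2_eq_square flip: powr_add)

lemma crossint_integrable:
  assumes "in_Lp p f" "in_Lp p g"
  shows "integrable lborel (\<lambda>u. \<bar>f u\<bar> powr (p / 2) * \<bar>g u\<bar> powr (p / 2))"
    and "crossint p f g \<le> sqrt (powint p f) * sqrt (powint p g)"
proof -
  have [measurable]: "f \<in> borel_measurable borel" "g \<in> borel_measurable borel"
    using assms by auto
  have 1: "integrable lborel (\<lambda>u. (\<bar>f u\<bar> powr (p / 2))\<^sup>2)" "integrable lborel (\<lambda>u. (\<bar>g u\<bar> powr (p / 2))\<^sup>2)"
    using assms by (auto simp: powr_half_squared)
  show "integrable lborel (\<lambda>u. \<bar>f u\<bar> powr (p / 2) * \<bar>g u\<bar> powr (p / 2))"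
    by (rule cauchy_schwarz_integral(1)[OF _ _ 1]) simp_all
  show "crossint p f g \<le> sqrt (powint p f) * sqrt (powint p g)"
    using cauchy_schwarz_integral(2)[OF _ _ 1]
    by (simp add: powr_half_squared crossint_def powint_def abs_mult)
qed

lemma in_Lp_cmult: "in_Lp p f \<Longrightarrow> in_Lp p (\<lambda>u. c * f u)"
  by (auto simp: in_Lp_def abs_mult powr_mult)

lemma powint_cmult: "powint p (\<lambda>u. c * f u) = \<bar>c\<bar> powr p * powint p f"
  by (simp add: powint_def abs_mult powr_mult)

text \<open>The pointwise bound integrated. In terms of characteristic functions, the second claim
  says that the integrals of \<open>f\<close> and \<open>g\<close> behave like independent variables
  up to an error controlled by their overlap.\<close>

lemma in_Lp_add:
  assumes p: "1 < p" "p < 2" and fg: "in_Lp p f" "in_Lp p g"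
  shows "in_Lp p (\<lambda>u. f u + g u)"
    and "\<bar>powint p (\<lambda>u. f u + g u) - powint p f - powint p g\<bar> \<le> 4 * crossint p f g"
proof -
  have [measurable]: "f \<in> borel_measurable borel" "g \<in> borel_measurable borel"
    using fg by auto
  note i = in_LpD(2)[OF fg(1)] in_LpD(2)[OF fg(2)] crossint_integrable(1)[OF fg]
  have 1: "integrable lborel (\<lambda>u. \<bar>f u + g u\<bar> powr p)"
  proof (rule integrable_dominated)
    show "integrable lborel (\<lambda>u. \<bar>f u\<bar> powr p + \<bar>g u\<bar> powr p + 4 * (\<bar>f u\<bar> powr (p / 2) * \<bar>g u\<bar> powr (p / 2)))"
      using i by (intro Bochner_Integration.integrable_add integrable_mult_right)
    show "AE u in lborel. norm (\<bar>f u + g u\<bar> powr p) \<le>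
       norm (\<bar>f u\<bar> powr p + \<bar>g u\<bar> powr p + 4 * (\<bar>f u\<bar> powr (p / 2) * \<bar>g u\<bar> powr (p / 2)))"
    proof (rule AE_I2)
      fix u
      have "\<bar>f u + g u\<bar> powr p \<le> \<bar>f u\<bar> powr p + \<bar>g u\<bar> powr p + 4 * (\<bar>f u\<bar> powr (p / 2) * \<bar>g u\<bar> powr (p / 2))"
        using abs_powr_add_bound[OF p, of "f u" "g u"] by linarith
      then show "norm (\<bar>f u + g u\<bar> powr p) \<le>
       norm (\<bar>f u\<bar> powr p + \<bar>g u\<bar> powr p + 4 * (\<bar>f u\<bar> powr (p / 2) * \<bar>g u\<bar> powr (p / 2)))"
        by (simp add: abs_of_nonneg)
    qed
  qed simp
  then show "in_Lp p (\<lambda>u. f u + g u)" by (simp add: in_Lp_def)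
  have eq: "powint p (\<lambda>u. f u + g u) - powint p f - powint p g
      = (\<integral>u. \<bar>f u + g u\<bar> powr p - \<bar>f u\<bar> powr p - \<bar>g u\<bar> powr p \<partial>lborel)"
    using 1 i by (simp add: powint_def)
  have "\<bar>powint p (\<lambda>u. f u + g u) - powint p f - powint p g\<bar> \<le> (\<integral>u. \<bar>\<bar>f u + g u\<bar> powr p - \<bar>f u\<bar> powr p - \<bar>g u\<bar> powr p\<bar> \<partial>lborel)"
    unfolding eq by (rule integral_abs_bound)
  also have "\<dots> \<le> (\<integral>u. 4 * (\<bar>f u\<bar> powr (p / 2) * \<bar>g u\<bar> powr (p / 2)) \<partial>lborel)"
    using 1 i by (intro integral_mono abs_powr_add_bound p) auto
  finally show "\<bar>powint p (\<lambda>u. f u + g u) - powint p f - powint p g\<bar> \<le> 4 * crossint p f g"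
    by (simp add: crossint_def)
qed

lemma in_Lp_lincomb:
  assumes p: "1 < p" "p < 2" and fg: "in_Lp p f" "in_Lp p g"
  shows "in_Lp p (\<lambda>u. a * f u + b * g u)"
  by (intro in_Lp_add(1) in_Lp_cmult assms)

lemma in_Lp_diff:
  assumes p: "1 < p" "p < 2" and fg: "in_Lp p f" "in_Lp p g"
  shows "in_Lp p (\<lambda>u. f u - g u)"
  using in_Lp_lincomb[OF assms, of 1 "-1"] by simp

text \<open>A quasi-triangle inequality for the p-th power of the norm. The constant is 1 + 4/2:
  four times the overlap, and the overlap is at most the mean of the two integrals.\<close>

lemma powint_add_le:
  assumes p: "1 < p" "p < 2" and fg: "in_Lp p f" "in_Lp p g"
  shows "powint p (\<lambda>u. f u + g u) \<le> 3 * (powint p f + powint p g)"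
proof -
  have "crossint p f g \<le> sqrt (powint p f) * sqrt (powint p g)"
    by (rule crossint_integrable(2)[OF fg])
  also have "\<dots> \<le> (powint p f + powint p g) / 2"
    using arith_geo_mean_sqrt[of "powint p f" "powint p g"] by (simp add: real_sqrt_mult)
  finally have c: "crossint p f g \<le> (powint p f + powint p g) / 2" .
  have *: "x \<le> 3 * (a + b)" if "\<bar>x - a - b\<bar> \<le> 4 * c" "c \<le> (a + b) / 2" for x a b c :: real
    using that by (simp add: abs_le_iff field_simps)
  show ?thesis by (rule *[OF in_Lp_add(2)[OF assms] c])
qed

text \<open>Write \<open>g n\<close> as \<open>f\<close> plus the error: \<open>in_Lp_add\<close>
  bounds the change of \<open>powint\<close> by the error and the overlap of the error with
  \<open>f\<close>, and Cauchy-Schwarz makes the overlap vanish as well.\<close>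

lemma powint_tendsto:
  assumes p: "1 < p" "p < 2" and f: "in_Lp p f" and g: "\<And>n. in_Lp p (g n)"
    and lim: "((\<lambda>n. powint p (\<lambda>u. g n u - f u)) \<longlongrightarrow> 0) F"
  shows "((\<lambda>n. powint p (g n)) \<longlongrightarrow> powint p f) F"
proof -
  let ?e = "\<lambda>n. powint p (\<lambda>u. g n u - f u)"
  have e: "in_Lp p (\<lambda>u. g n u - f u)" for n by (intro in_Lp_diff p g f)
  have b: "\<bar>powint p (g n) - powint p f\<bar> \<le> ?e n + 4 * (sqrt (powint p f) * sqrt (?e n))" for n
  proof -
    have "\<bar>powint p (g n) - powint p f - ?e n\<bar> \<le> 4 * crossint p f (\<lambda>u. g n u - f u)"
      using in_Lp_add(2)[OF p f e[of n]] by simp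
    moreover have "\<bar>x - y\<bar> \<le> e + 4 * c'" if "\<bar>x - y - e\<bar> \<le> 4 * c" "0 \<le> e" "c \<le> c'" for x y e c c' :: real
      using that by linarith
    ultimately show ?thesis
      using crossint_integrable(2)[OF f e[of n]] powint_nonneg[of p "\<lambda>u. g n u - f u"] by blast
  qed
  have "((\<lambda>n. ?e n + 4 * (sqrt (powint p f) * sqrt (?e n))) \<longlongrightarrow> 0 + 4 * (sqrt (powint p f) * sqrt 0)) F"
    by (intro tendsto_intros lim)
  then have l: "((\<lambda>n. ?e n + 4 * (sqrt (powint p f) * sqrt (?e n))) \<longlongrightarrow> 0) F" by simp
  have "((\<lambda>n. powint p (g n) - powint p f) \<longlongrightarrow> 0) F"
    by (rule Lim_null_comparison[OF always_eventually l]) (use b in simp)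
  then show ?thesis by (simp add: LIM_zero_iff)
qed

lemma powint_shift: "powint p (\<lambda>u. f (u - x)) = powint p f"
  unfolding powint_def
  by (subst (2) lborel_integral_real_affine[where c=1 and t="-x"]) (simp_all add: algebra_simps)

text \<open>Exactly what \<open>has_stable_integral\<close> asks of its approximants: every nonzero
  level set has finite measure, which is where the random measure is controlled.\<close>

definition fin_simple :: "(real \<Rightarrow> real) \<Rightarrow> bool" where
  "fin_simple g \<longleftrightarrow> simple_function lborel g \<and> emeasure lborel {u. g u \<noteq> 0} < \<infinity>"

lemma fin_simpleD:
  assumes "fin_simple g"
  shows "finite (range g)" "g \<in> borel_measurable borel" "y \<noteq> 0 \<Longrightarrow> {u. g u = y} \<in> finite_lborel_sets"
proof -
  show "finite (range g)" using assms simple_functionD(1)[of lborel g] by (simp add: fin_simple_def)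
  show g [measurable]: "g \<in> borel_measurable borel"
    using assms borel_measurable_simple_function[of lborel g] by (simp add: fin_simple_def)
  assume "y \<noteq> 0"
  then have "emeasure lborel {u. g u = y} \<le> emeasure lborel {u. g u \<noteq> 0}"
    by (intro emeasure_mono) auto
  moreover have "{u. g u = y} \<in> sets lborel" by simp
  ultimately show "{u. g u = y} \<in> finite_lborel_sets"
    using assms by (auto simp: finite_lborel_sets_def fin_simple_def)
qed

lemma finite_lborel_sets_empty [simp]: "{} \<in> finite_lborel_sets"
  by (simp add: finite_lborel_sets_def)

lemma finite_lborel_sets_UN:
  assumes "finite I" "\<And>i. i \<in> I \<Longrightarrow> B i \<in> finite_lborel_sets"
  shows "(\<Union>i\<in>I. B i) \<in> finite_lborel_sets"
  using assms
proof (induction I rule: finite_induct)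
  case (insert i I)
  have "emeasure lborel (B i \<union> (\<Union>i\<in>I. B i)) \<le> emeasure lborel (B i) + emeasure lborel (\<Union>i\<in>I. B i)"
    using insert by (intro emeasure_subadditive) (auto simp: finite_lborel_sets_def)
  also have "\<dots> < \<infinity>" using insert by (auto simp: finite_lborel_sets_def)
  finally show ?case using insert by (auto simp: finite_lborel_sets_def)
qed simp

lemma finite_lborel_sets_Int:
  assumes "A \<in> finite_lborel_sets" "B \<in> sets borel"
  shows "A \<inter> B \<in> finite_lborel_sets" "B \<inter> A \<in> finite_lborel_sets"
proof -
  have "emeasure lborel (A \<inter> B) \<le> emeasure lborel A"
    using assms by (intro emeasure_mono) (auto simp: finite_lborel_sets_def)
  then show "A \<inter> B \<in> finite_lborel_sets" using assms by (auto simp: finite_lborel_sets_def)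
  then show "B \<inter> A \<in> finite_lborel_sets" by (simp add: Int_commute)
qed

lemma simple_powint:
  assumes I: "finite I" and dis: "disjoint_family_on B I" and B: "\<And>i. i \<in> I \<Longrightarrow> B i \<in> finite_lborel_sets"
    and gc: "\<And>i u. i \<in> I \<Longrightarrow> u \<in> B i \<Longrightarrow> g u = c i" and g0: "\<And>u. u \<notin> (\<Union>i\<in>I. B i) \<Longrightarrow> g u = 0"
  shows "has_bochner_integral lborel (\<lambda>u. \<bar>g u\<bar> powr p) (\<Sum>i\<in>I. \<bar>c i\<bar> powr p * measure lborel (B i))"
proof -
  have *: "\<bar>g u\<bar> powr p = (\<Sum>i\<in>I. \<bar>c i\<bar> powr p * indicator (B i) u)" for u
  proof (cases "u \<in> (\<Union>i\<in>I. B i)")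
    case True
    then obtain i where i: "i \<in> I" "u \<in> B i" by auto
    have "u \<notin> B k" if "k \<in> I - {i}" for k
      using dis i that by (auto simp: disjoint_family_on_def)
    then have "(\<Sum>k\<in>I. \<bar>c k\<bar> powr p * indicator (B k) u) = (\<Sum>k\<in>{i}. \<bar>c k\<bar> powr p * indicator (B k) u)"
      using i I by (intro sum.mono_neutral_right) auto
    then show ?thesis using i gc[OF i] by simp
  next
    case False
    then show ?thesis using g0[OF False] by (auto intro!: sum.neutral[symmetric])
  qed
  show ?thesis unfolding *
    using B by (intro has_bochner_integral_sum has_bochner_integral_mult_right has_bochner_integral_real_indicator)
       (auto simp: finite_lborel_sets_def)
qed

lemma fin_simple_partition:
  assumes "fin_simple g"
  shows "finite (range g - {0})" "disjoint_family_on (\<lambda>y. {u. g u = y}) (range g - {0})"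
    "\<And>y. y \<in> range g - {0} \<Longrightarrow> {u. g u = y} \<in> finite_lborel_sets"
    "\<And>y u. u \<in> {u. g u = y} \<Longrightarrow> g u = y"
    "\<And>u. u \<notin> (\<Union>y\<in>range g - {0}. {u. g u = y}) \<Longrightarrow> g u = 0"
  using fin_simpleD[OF assms] by (auto simp: disjoint_family_on_def)

lemma fin_simple_in_Lp:
  assumes "fin_simple g"
  shows "in_Lp p g"
proof -
  note * = fin_simple_partition[OF assms]
  have "has_bochner_integral lborel (\<lambda>u. \<bar>g u\<bar> powr p)
      (\<Sum>i\<in>range g - {0}. \<bar>i\<bar> powr p * measure lborel {u. g u = i})"
    by (rule simple_powint[OF *(1-3), where c="\<lambda>y. y"]) (blast, blast, rule *(5), blast)
  then show ?thesis
    using fin_simpleD(2)[OF assms] by (simp add: in_Lp_def has_bochner_integral_iff)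
qed

text \<open>The pieces may be empty and may share values, as happens for common refinements; a level
  set is therefore recovered as a union of pieces.\<close>

lemma fin_simpleI:
  assumes I: "finite I" and B: "\<And>i. i \<in> I \<Longrightarrow> B i \<in> finite_lborel_sets"
    and gc: "\<And>i u. i \<in> I \<Longrightarrow> u \<in> B i \<Longrightarrow> g u = c i" and g0: "\<And>u. u \<notin> (\<Union>i\<in>I. B i) \<Longrightarrow> g u = 0"
  shows "fin_simple g"
proof -
  have r: "finite (range g)"
  proof (rule finite_subset)
    show "range g \<subseteq> insert 0 (c ` I)" proof
      fix y assume "y \<in> range g"
      then obtain u where u: "y = g u" by auto
      show "y \<in> insert 0 (c ` I)"
      proof (cases "u \<in> (\<Union>i\<in>I. B i)")
        case True
        then obtain i where "i \<in> I" "u \<in> B i" by auto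
        then show ?thesis using gc[of i u] u by simp
      qed (use g0 u in simp)
    qed
  qed (use I in auto)
  have U: "(\<Union>i\<in>I. B i) \<in> finite_lborel_sets" by (intro finite_lborel_sets_UN I B)
  have meas: "{u. g u = y} \<in> sets borel" for y
  proof -
    have "{u. g u = y} = (\<Union>i\<in>{i\<in>I. c i = y}. B i) \<union> (if y = 0 then - (\<Union>i\<in>I. B i) else {})"
    proof (intro set_eqI iffI)
      fix u assume u: "u \<in> {u. g u = y}"
      show "u \<in> (\<Union>i\<in>{i\<in>I. c i = y}. B i) \<union> (if y = 0 then - (\<Union>i\<in>I. B i) else {})"
      proof (cases "u \<in> (\<Union>i\<in>I. B i)")
        case True
        then show ?thesis using u gc by auto
      next
        case False
        then show ?thesis using u g0[OF False] by auto
      qed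
    next
      fix u assume "u \<in> (\<Union>i\<in>{i\<in>I. c i = y}. B i) \<union> (if y = 0 then - (\<Union>i\<in>I. B i) else {})"
      then show "u \<in> {u. g u = y}" using gc g0 by (auto split: if_splits)
    qed
    moreover have "(\<Union>i\<in>{i\<in>I. c i = y}. B i) \<in> sets borel"
      using I B by (intro sets.finite_UN) (auto simp: finite_lborel_sets_def)
    moreover have "- (\<Union>i\<in>I. B i) \<in> sets borel"
      using borel_comp[of "\<Union>i\<in>I. B i"] U unfolding finite_lborel_sets_def by simp
    ultimately show ?thesis by auto
  qed
  have "simple_function lborel g"
    unfolding simple_function_def using r meas by (auto simp: vimage_def)
  moreover have "emeasure lborel {u. g u \<noteq> 0} \<le> emeasure lborel (\<Union>i\<in>I. B i)"
  proof (rule emeasure_mono)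
    show "{u. g u \<noteq> 0} \<subseteq> (\<Union>i\<in>I. B i)" using g0 by blast
  qed (use U in \<open>simp add: finite_lborel_sets_def\<close>)
  moreover have "emeasure lborel (\<Union>i\<in>I. B i) < \<infinity>" using U by (simp add: finite_lborel_sets_def)
  ultimately show ?thesis unfolding fin_simple_def by (meson order_le_less_trans)
qed

section \<open>Stable integrals\<close>

locale sas_noise = prob_space P for P :: "'a measure" +
  fixes \<alpha> :: real and M :: "real set \<Rightarrow> 'a \<Rightarrow> real"
  assumes \<alpha>: "1 < \<alpha>" "\<alpha> < 2" and noise: "sas_random_measure P \<alpha> M"
begin

lemma M_sas: "A \<in> finite_lborel_sets \<Longrightarrow> sas_distributed P \<alpha> (measure lborel A powr (1 / \<alpha>)) (M A)"
  using noise by (auto simp: sas_random_measure_def)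

lemma M_measurable [measurable]: "A \<in> finite_lborel_sets \<Longrightarrow> M A \<in> borel_measurable P"
  using M_sas by (auto simp: sas_distributed_def)

lemma M_char:
  assumes "A \<in> finite_lborel_sets"
  shows "char (distr P borel (M A)) \<theta> = complex_of_real (exp (- (\<bar>\<theta>\<bar> powr \<alpha> * measure lborel A)))"
proof -
  have "(measure lborel A powr (1 / \<alpha>) * \<bar>\<theta>\<bar>) powr \<alpha> = \<bar>\<theta>\<bar> powr \<alpha> * measure lborel A"
    using \<alpha> by (simp add: powr_mult powr_powr)
  then show ?thesis using M_sas[OF assms] by (auto simp: sas_distributed_def)
qed

lemma M_indep:
  assumes "range A \<subseteq> finite_lborel_sets" "disjoint_family (A :: nat \<Rightarrow> real set)"
  shows "indep_vars (\<lambda>_. borel) (\<lambda>i. M (A i)) UNIV"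
  using noise assms unfolding sas_random_measure_def by blast

lemma M_sums:
  assumes "range A \<subseteq> finite_lborel_sets" "disjoint_family (A :: nat \<Rightarrow> real set)"
    "(\<Union>i. A i) \<in> finite_lborel_sets"
  shows "AE x in P. (\<lambda>i. M (A i) x) sums M (\<Union>i. A i) x"
  using noise assms unfolding sas_random_measure_def by blast

text \<open>Countable additivity along the constant sequence of empty sets makes a constant series
  converge, which forces its terms to be 0.\<close>

lemma M_empty: "AE x in P. M {} x = 0"
proof -
  have "AE x in P. (\<lambda>i::nat. M {} x) sums M (\<Union>i::nat. {}) x"
    using M_sums[of "\<lambda>_. {}"] by (simp add: disjoint_family_on_def)
  then show ?thesis
  proof eventually_elim
    case (elim x)
    then have "(\<lambda>i::nat. M {} x) \<longlonglongrightarrow> 0" by (intro summable_LIMSEQ_zero) (auto simp: sums_iff)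
    then show ?case by (simp add: LIMSEQ_const_iff)
  qed
qed

text \<open>Additivity and independence of the noise are stated for sequences of sets. A finite
  family is therefore enumerated and padded with empty sets, whose noise vanishes by
  \<open>M_empty\<close>.\<close>

definition enum_sets :: "('i \<Rightarrow> real set) \<Rightarrow> (nat \<Rightarrow> 'i) \<Rightarrow> 'i set \<Rightarrow> nat \<Rightarrow> real set" where
  "enum_sets B h I n = (if n < card I then B (h n) else {})"

lemma enum_sets_props:
  assumes I: "finite I" and h: "bij_betw h {0..<card I} I" and dis: "disjoint_family_on B I"
    and B: "\<And>i. i \<in> I \<Longrightarrow> B i \<in> finite_lborel_sets"
  shows "range (enum_sets B h I) \<subseteq> finite_lborel_sets" "disjoint_family (enum_sets B h I)"
    "(\<Union>n. enum_sets B h I n) = (\<Union>i\<in>I. B i)"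
proof -
  have hI: "h n \<in> I" if "n < card I" for n using h that by (auto simp: bij_betw_def)
  then show "range (enum_sets B h I) \<subseteq> finite_lborel_sets"
    using B by (auto simp: enum_sets_def)
  have "enum_sets B h I m \<inter> enum_sets B h I n = {}" if "m \<noteq> n" for m n
  proof (cases "m < card I \<and> n < card I")
    case True
    then have "h m \<noteq> h n" using h that by (auto simp: bij_betw_def inj_on_def)
    then show ?thesis using dis True hI by (auto simp: disjoint_family_on_def enum_sets_def)
  qed (auto simp: enum_sets_def)
  then show "disjoint_family (enum_sets B h I)" by (auto simp: disjoint_family_on_def)
  have "(\<Union>n. enum_sets B h I n) = (\<Union>n\<in>{0..<card I}. B (h n))"
    by (auto simp: enum_sets_def split: if_splits)
  also have "\<dots> = (\<Union>i\<in>h ` {0..<card I}. B i)" by auto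
  also have "h ` {0..<card I} = I" using h by (simp add: bij_betw_def)
  finally show "(\<Union>n. enum_sets B h I n) = (\<Union>i\<in>I. B i)" .
qed

lemma M_finite_UN:
  assumes I: "finite I" and dis: "disjoint_family_on B I" and B: "\<And>i. i \<in> I \<Longrightarrow> B i \<in> finite_lborel_sets"
  shows "AE x in P. M (\<Union>i\<in>I. B i) x = (\<Sum>i\<in>I. M (B i) x)"
proof -
  obtain h where h: "bij_betw h {0..<card I} I" using ex_bij_betw_nat_finite[OF I] by blast
  note * = enum_sets_props[OF I h dis B]
  have "AE x in P. (\<lambda>n. M (enum_sets B h I n) x) sums M (\<Union>i\<in>I. B i) x"
    using M_sums[OF *(1,2)] finite_lborel_sets_UN[OF I B] *(3) by simp
  then show ?thesis using M_empty
  proof eventually_elim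
    case (elim x)
    have "(\<lambda>n. M (enum_sets B h I n) x) sums (\<Sum>n\<in>{0..<card I}. M (enum_sets B h I n) x)"
      using elim(2) by (intro sums_finite) (auto simp: enum_sets_def)
    moreover have "(\<Sum>n\<in>{0..<card I}. M (enum_sets B h I n) x) = (\<Sum>n\<in>{0..<card I}. M (B (h n)) x)"
      by (intro sum.cong) (auto simp: enum_sets_def)
    moreover have "\<dots> = (\<Sum>i\<in>I. M (B i) x)"
      by (rule sum.reindex_bij_betw[OF h])
    ultimately show ?case using elim(1) sums_unique2 by metis
  qed
qed

text \<open>Independence turns the characteristic function of the sum into a product, and the
  exponents add up to what is, by \<open>simple_powint\<close>, the power integral of the
  corresponding step function.\<close>

lemma M_char_sum:
  assumes I: "finite I" and dis: "disjoint_family_on B I" and B: "\<And>i. i \<in> I \<Longrightarrow> B i \<in> finite_lborel_sets"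
  shows "char (distr P borel (\<lambda>x. \<Sum>i\<in>I. c i * M (B i) x)) \<theta>
    = complex_of_real (exp (- (\<bar>\<theta>\<bar> powr \<alpha> * (\<Sum>i\<in>I. \<bar>c i\<bar> powr \<alpha> * measure lborel (B i)))))"
proof -
  obtain h where h: "bij_betw h {0..<card I} I" using ex_bij_betw_nat_finite[OF I] by blast
  note * = enum_sets_props[OF I h dis B]
  have hI: "h n \<in> I" if "n < card I" for n using h that by (auto simp: bij_betw_def)
  have "indep_vars (\<lambda>_. borel) (\<lambda>n. M (enum_sets B h I n)) {0..<card I}"
    by (rule indep_vars_subset[OF M_indep[OF *(1,2)] subset_UNIV])
  then have ind: "indep_vars (\<lambda>_. borel) (\<lambda>n x. c (h n) * M (B (h n)) x) {0..<card I}"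
  proof -
    assume *: "indep_vars (\<lambda>_. borel) (\<lambda>n. M (enum_sets B h I n)) {0..<card I}"
    have "indep_vars (\<lambda>_. borel) (\<lambda>n x. c (h n) * M (enum_sets B h I n) x) {0..<card I}"
      by (rule indep_vars_compose2[OF *]) simp
    then show ?thesis
      by (rule indep_vars_cong[THEN iffD1, rotated -1]) (auto simp: enum_sets_def)
  qed
  have one: "char (distr P borel (\<lambda>x. c (h n) * M (B (h n)) x)) \<theta>
      = complex_of_real (exp (- (\<bar>\<theta>\<bar> powr \<alpha> * (\<bar>c (h n)\<bar> powr \<alpha> * measure lborel (B (h n))))))"
    if "n < card I" for n
  proof -
    have [measurable]: "M (B (h n)) \<in> borel_measurable P" using B hI[OF that] by (intro M_measurable) auto
    have "char (distr P borel (\<lambda>x. c (h n) * M (B (h n)) x)) \<theta> = char (distr P borel (M (B (h n)))) (\<theta> * c (h n))"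
      by (simp add: char_def integral_distr mult_ac)
    then show ?thesis using M_char[of "B (h n)" "\<theta> * c (h n)"] B hI[OF that]
      by (simp add: abs_mult powr_mult mult_ac)
  qed
  have "(\<lambda>x. \<Sum>i\<in>I. c i * M (B i) x) = (\<lambda>x. \<Sum>n\<in>{0..<card I}. c (h n) * M (B (h n)) x)"
    using sum.reindex_bij_betw[OF h, of "\<lambda>i. c i * M (B i) x" for x] by simp
  then have "char (distr P borel (\<lambda>x. \<Sum>i\<in>I. c i * M (B i) x)) \<theta>
     = (\<Prod>n\<in>{0..<card I}. char (distr P borel (\<lambda>x. c (h n) * M (B (h n)) x)) \<theta>)"
    using char_distr_sum[OF ind, of \<theta>] by simp
  also have "\<dots> = (\<Prod>n\<in>{0..<card I}. complex_of_real (exp (- (\<bar>\<theta>\<bar> powr \<alpha> * (\<bar>c (h n)\<bar> powr \<alpha> * measure lborel (B (h n)))))))"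
    by (intro prod.cong one) auto
  also have "\<dots> = complex_of_real (exp (\<Sum>n\<in>{0..<card I}. - (\<bar>\<theta>\<bar> powr \<alpha> * (\<bar>c (h n)\<bar> powr \<alpha> * measure lborel (B (h n))))))"
    by (simp only: exp_sum[OF finite_atLeastLessThan] of_real_prod)
  also have "(\<Sum>n\<in>{0..<card I}. - (\<bar>\<theta>\<bar> powr \<alpha> * (\<bar>c (h n)\<bar> powr \<alpha> * measure lborel (B (h n)))))
     = (\<Sum>i\<in>I. - (\<bar>\<theta>\<bar> powr \<alpha> * (\<bar>c i\<bar> powr \<alpha> * measure lborel (B i))))"
    by (rule sum.reindex_bij_betw[OF h])
  finally show ?thesis by (simp add: sum_negf sum_distrib_left)
qed

abbreviation S where "S \<equiv> simple_stable_integral M"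

lemma S_measurable:
  assumes "fin_simple g"
  shows "S g \<in> borel_measurable P"
proof -
  have "S g = (\<lambda>x. \<Sum>y\<in>range g - {0}. y * M {u. g u = y} x)"
    unfolding simple_stable_integral_def[abs_def] using fin_simpleD(1)[OF assms]
    by (intro ext sum.mono_neutral_right) auto
  moreover have "\<dots> \<in> borel_measurable P"
    using fin_simpleD(3)[OF assms] by (intro borel_measurable_sum borel_measurable_times M_measurable) auto
  ultimately show ?thesis by simp
qed

text \<open>\<open>S\<close> is defined through level sets; this frees it from that particular
  partition. The level 0 may have infinite measure, where \<open>M\<close> is arbitrary, but there
  it is multiplied by 0.\<close>

lemma S_rep:
  assumes I: "finite I" and dis: "disjoint_family_on B I" and B: "\<And>i. i \<in> I \<Longrightarrow> B i \<in> finite_lborel_sets"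
    and gc: "\<And>i u. i \<in> I \<Longrightarrow> u \<in> B i \<Longrightarrow> g u = c i" and g0: "\<And>u. u \<notin> (\<Union>i\<in>I. B i) \<Longrightarrow> g u = 0"
  shows "AE x in P. S g x = (\<Sum>i\<in>I. c i * M (B i) x)"
proof -
  have fs: "fin_simple g" by (rule fin_simpleI[OF I B gc g0])
  \<comment> \<open>An empty piece may carry a value \<open>c i\<close> that \<open>g\<close> never
    takes. Such a value has an empty level set and contributes nothing by
    \<open>M_empty\<close>.\<close>
  define R where "R = range g \<union> c ` I"
  have R: "finite R" using fin_simpleD(1)[OF fs] I by (simp add: R_def)
  have lev: "{u. g u = y} = (\<Union>i\<in>{i\<in>I. c i = y}. B i)" if "y \<noteq> 0" for y
    using gc g0 that by (auto, metis UN_E)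
  have "AE x in P. \<forall>y\<in>R. y \<noteq> 0 \<longrightarrow> M {u. g u = y} x = (\<Sum>i\<in>{i\<in>I. c i = y}. M (B i) x)"
  proof (rule AE_finite_allI[OF R])
    fix y assume "y \<in> R"
    show "AE x in P. y \<noteq> 0 \<longrightarrow> M {u. g u = y} x = (\<Sum>i\<in>{i\<in>I. c i = y}. M (B i) x)"
    proof (cases "y = 0")
      case False
      have "AE x in P. M (\<Union>i\<in>{i\<in>I. c i = y}. B i) x = (\<Sum>i\<in>{i\<in>I. c i = y}. M (B i) x)"
        using dis I B by (intro M_finite_UN) (auto simp: disjoint_family_on_def)
      then show ?thesis by (simp only: lev[OF False]) auto
    qed simp
  qed
  then show ?thesis using M_empty
  proof eventually_elim
    case (elim x)
    have "S g x = (\<Sum>y\<in>R. y * M {u. g u = y} x)"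
      unfolding simple_stable_integral_def
    proof (rule sum.mono_neutral_left[OF R])
      show "\<forall>y\<in>R - range g. y * M {u. g u = y} x = 0"
      proof
        fix y assume "y \<in> R - range g"
        then have "{u. g u = y} = {}" by auto
        then show "y * M {u. g u = y} x = 0" using elim(2) by simp
      qed
    qed (auto simp: R_def)
    also have "\<dots> = (\<Sum>y\<in>R. \<Sum>i\<in>{i\<in>I. c i = y}. c i * M (B i) x)"
    proof (rule sum.cong[OF refl])
      fix y assume y: "y \<in> R"
      show "y * M {u. g u = y} x = (\<Sum>i\<in>{i\<in>I. c i = y}. c i * M (B i) x)"
        using elim(1) y by (cases "y = 0") (auto simp: sum_distrib_left)
    qed
    also have "\<dots> = (\<Sum>i\<in>I. c i * M (B i) x)"
      by (rule sum.group[OF I R]) (auto simp: R_def)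
    finally show ?case .
  qed
qed

text \<open>Both integrands are written over their common refinement, indexed by pairs of values.
  The pair (0, 0) is removed because its cell may have infinite measure. Linearity then holds only
  almost surely, since additivity of \<open>M\<close> does.\<close>

lemma S_lincomb:
  assumes g: "fin_simple g" and g': "fin_simple g'"
  shows "fin_simple (\<lambda>u. a * g u + b * g' u)"
    and "AE x in P. S (\<lambda>u. a * g u + b * g' u) x = a * S g x + b * S g' x"
proof -
  define I where "I = (range g \<times> range g') - {(0,0)}"
  define B where "B = (\<lambda>(y,y'). {u. g u = y} \<inter> {u. g' u = y'})"
  have I: "finite I" using fin_simpleD(1) g g' by (simp add: I_def)
  have dis: "disjoint_family_on B I" by (auto simp: disjoint_family_on_def B_def)
  have [measurable]: "g \<in> borel_measurable borel" "g' \<in> borel_measurable borel"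
    using fin_simpleD(2) g g' by auto
  have m: "{u. g u = y} \<in> sets borel" "{u. g' u = y} \<in> sets borel" for y
    using borel_measurable_vimage[of g borel] borel_measurable_vimage[of g' borel] by (auto simp: vimage_def)
  have B: "B i \<in> finite_lborel_sets" if "i \<in> I" for i
  proof (cases i)
    case (Pair y y')
    then have "y \<noteq> 0 \<or> y' \<noteq> 0" using that by (auto simp: I_def)
    then show ?thesis using finite_lborel_sets_Int[OF _ m(2)] finite_lborel_sets_Int[OF _ m(1)]
        fin_simpleD(3)[OF g] fin_simpleD(3)[OF g'] by (auto simp: B_def Pair)
  qed
  have c: "g u = fst i" "g' u = snd i" if "u \<in> B i" for u i
    using that by (auto simp: B_def split: prod.splits)
  have z: "g u = 0 \<and> g' u = 0" if "u \<notin> (\<Union>i\<in>I. B i)" for u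
  proof -
    have "(g u, g' u) \<notin> I" using that by (auto simp: B_def)
    then show ?thesis by (auto simp: I_def)
  qed
  show "fin_simple (\<lambda>u. a * g u + b * g' u)"
    by (rule fin_simpleI[OF I B, where c="\<lambda>i. a * fst i + b * snd i"]) (use c z in auto)
  have 1: "AE x in P. S (\<lambda>u. a * g u + b * g' u) x = (\<Sum>i\<in>I. (a * fst i + b * snd i) * M (B i) x)"
    by (rule S_rep[OF I dis B]) (use c z in auto)
  have 2: "AE x in P. S g x = (\<Sum>i\<in>I. fst i * M (B i) x)"
    by (rule S_rep[OF I dis B]) (use c z in auto)
  have 3: "AE x in P. S g' x = (\<Sum>i\<in>I. snd i * M (B i) x)"
    by (rule S_rep[OF I dis B]) (use c z in auto)
  from 1 2 3 show "AE x in P. S (\<lambda>u. a * g u + b * g' u) x = a * S g x + b * S g' x"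
  proof eventually_elim
    case (elim x)
    then show ?case by (simp add: sum_distrib_left sum.distrib algebra_simps)
  qed
qed

lemma char_cong_AE:
  assumes [measurable]: "Y \<in> borel_measurable P" "Z \<in> borel_measurable P" and "AE x in P. Y x = Z x"
  shows "char (distr P borel Y) \<theta> = char (distr P borel Z) \<theta>"
  using distr_cong_AE[OF refl refl assms(3,1,2)] by simp

lemma S_char:
  assumes g: "fin_simple g"
  shows "char (distr P borel (S g)) \<theta> = complex_of_real (exp (- (\<bar>\<theta>\<bar> powr \<alpha> * powint \<alpha> g)))"
proof -
  note * = fin_simple_partition[OF g]
  have "AE x in P. S g x = (\<Sum>y\<in>range g - {0}. y * M {u. g u = y} x)"
    by (rule S_rep[OF *(1-3), where c="\<lambda>y. y"]) (blast, blast, rule *(5), blast)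
  then have "char (distr P borel (S g)) \<theta>
     = char (distr P borel (\<lambda>x. \<Sum>y\<in>range g - {0}. y * M {u. g u = y} x)) \<theta>"
    using *(3) by (intro char_cong_AE S_measurable g borel_measurable_sum borel_measurable_times M_measurable) auto
  also have "\<dots> = complex_of_real (exp (- (\<bar>\<theta>\<bar> powr \<alpha> * (\<Sum>y\<in>range g - {0}. \<bar>y\<bar> powr \<alpha> * measure lborel {u. g u = y}))))"
    by (rule M_char_sum[OF *(1-3)])
  also have "(\<Sum>y\<in>range g - {0}. \<bar>y\<bar> powr \<alpha> * measure lborel {u. g u = y}) = powint \<alpha> g"
  proof -
    have "has_bochner_integral lborel (\<lambda>u. \<bar>g u\<bar> powr \<alpha>)
        (\<Sum>i\<in>range g - {0}. \<bar>i\<bar> powr \<alpha> * measure lborel {u. g u = i})"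
      by (rule simple_powint[OF *(1-3), where c="\<lambda>y. y"]) (blast, blast, rule *(5), blast)
    then show ?thesis by (simp add: powint_def has_bochner_integral_iff)
  qed
  finally show ?thesis .
qed

end

section \<open>Convergence in probability and characteristic functions\<close>

lemma tendsto_zero_le:
  fixes a b :: "'b \<Rightarrow> real"
  assumes "\<And>n. 0 \<le> a n" "\<And>n. a n \<le> b n" "(b \<longlongrightarrow> 0) F"
  shows "(a \<longlongrightarrow> 0) F"
  by (rule tendsto_sandwich[OF _ _ tendsto_const assms(3)]) (simp_all add: assms)

lemma norm_iexp_diff_le: "norm (iexp x - iexp y) \<le> \<bar>x - y\<bar>"
proof -
  have "iexp x = iexp y * iexp (x - y)"
    by (subst exp_add[symmetric]) (simp add: algebra_simps)
  then have "iexp x - iexp y = iexp y * (iexp (x - y) - 1)"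
    by (simp add: right_diff_distrib)
  then have "norm (iexp x - iexp y) = norm (iexp (x - y) - 1)"
    by (simp add: norm_mult)
  also have "\<dots> \<le> \<bar>x - y\<bar>" using iexp_approx1[of "x - y" 0] by simp
  finally show ?thesis .
qed

context prob_space begin

abbreviation msq :: "('a \<Rightarrow> real) \<Rightarrow> real" where
  "msq Y \<equiv> expectation (\<lambda>x. (Y x)\<^sup>2)"

abbreviation sqint :: "('a \<Rightarrow> real) \<Rightarrow> bool" where
  "sqint Y \<equiv> integrable M (\<lambda>x. (Y x)\<^sup>2)"

lemma char_diff_eq:
  assumes [measurable]: "Y \<in> borel_measurable M" "Z \<in> borel_measurable M"
  shows "char (distr M borel Y) \<theta> - char (distr M borel Z) \<theta> = (CLINT x|M. iexp (\<theta> * Y x) - iexp (\<theta> * Z x))"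
proof -
  have i: "complex_integrable M (\<lambda>x. iexp (\<theta> * W x))" if [measurable]: "W \<in> borel_measurable M" for W
    by (rule integrable_const_bound[of _ 1]) auto
  have "char (distr M borel Y) \<theta> - char (distr M borel Z) \<theta>
      = (CLINT x|M. iexp (\<theta> * Y x)) - (CLINT x|M. iexp (\<theta> * Z x))"
    unfolding char_def by (subst (1 2) integral_distr) simp_all
  also have "\<dots> = (CLINT x|M. iexp (\<theta> * Y x) - iexp (\<theta> * Z x))"
    by (rule Bochner_Integration.integral_diff[symmetric]) (intro i assms)+
  finally show ?thesis .
qed

lemma char_diff_le:
  assumes [measurable]: "Y \<in> borel_measurable M" "Z \<in> borel_measurable M"
    and i: "integrable M (\<lambda>x. Y x - Z x)"
  shows "norm (char (distr M borel Y) \<theta> - char (distr M borel Z) \<theta>) \<le> \<bar>\<theta>\<bar> * expectation (\<lambda>x. \<bar>Y x - Z x\<bar>)"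
proof -
  have "norm (CLINT x|M. iexp (\<theta> * Y x) - iexp (\<theta> * Z x)) \<le> (\<integral>x. norm (iexp (\<theta> * Y x) - iexp (\<theta> * Z x)) \<partial>M)"
    by (rule integral_norm_bound)
  also have "\<dots> \<le> (\<integral>x. \<bar>\<theta>\<bar> * \<bar>Y x - Z x\<bar> \<partial>M)"
  proof (rule integral_mono_AE')
    show "integrable M (\<lambda>x. \<bar>\<theta>\<bar> * \<bar>Y x - Z x\<bar>)" using i by simp
    show "AE x in M. norm (iexp (\<theta> * Y x) - iexp (\<theta> * Z x)) \<le> \<bar>\<theta>\<bar> * \<bar>Y x - Z x\<bar>"
      using norm_iexp_diff_le[of "\<theta> * Y x" "\<theta> * Z x" for x]
      by (simp flip: abs_mult right_diff_distrib)
  qed auto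
  finally show ?thesis by (simp add: char_diff_eq)
qed

lemma tip_le:
  assumes [measurable]: "\<And>n. Z n \<in> borel_measurable M" "Y \<in> borel_measurable M"
    "\<And>n. U n \<in> borel_measurable M" "V \<in> borel_measurable M"
    "\<And>n. U' n \<in> borel_measurable M" "V' \<in> borel_measurable M"
    and t: "tendsto_in_probability M U V" "tendsto_in_probability M U' V'"
    and le: "\<And>n. AE \<omega> in M. \<bar>Z n \<omega> - Y \<omega>\<bar> \<le> c * \<bar>U n \<omega> - V \<omega>\<bar> + c * \<bar>U' n \<omega> - V' \<omega>\<bar>"
  shows "tendsto_in_probability M Z Y"
  unfolding tendsto_in_probability_def
proof (intro allI impI)
  fix \<epsilon> :: real assume \<epsilon>: "\<epsilon> > 0"
  \<comment> \<open>Each of the two errors may use half of \<epsilon>; adding 1 to |c| keeps the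
    denominator positive when c = 0.\<close>
  define d where "d = \<epsilon> / (2 * (\<bar>c\<bar> + 1))"
  have d: "d > 0" using \<epsilon> by (simp add: d_def)
  have cd: "\<bar>c\<bar> * d \<le> \<epsilon> / 2"
  proof -
    have "\<bar>c\<bar> * d \<le> (\<bar>c\<bar> + 1) * d" using d by (simp add: distrib_right)
    also have "\<dots> = \<epsilon> / 2" by (simp add: d_def field_simps add_nonneg_eq_0_iff)
    finally show ?thesis .
  qed
  let ?A = "\<lambda>n. {\<omega>\<in>space M. \<bar>U n \<omega> - V \<omega>\<bar> > d}" and ?B = "\<lambda>n. {\<omega>\<in>space M. \<bar>U' n \<omega> - V' \<omega>\<bar> > d}"
  have lim: "(\<lambda>n. measure M (?A n) + measure M (?B n)) \<longlonglongrightarrow> 0 + 0"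
    using t d unfolding tendsto_in_probability_def by (intro tendsto_add) auto
  have le': "measure M {\<omega>\<in>space M. \<bar>Z n \<omega> - Y \<omega>\<bar> > \<epsilon>} \<le> measure M (?A n) + measure M (?B n)" for n
  proof -
    have "measure M {\<omega>\<in>space M. \<bar>Z n \<omega> - Y \<omega>\<bar> > \<epsilon>} \<le> measure M (?A n \<union> ?B n)"
    proof (rule finite_measure_mono_AE)
      show "AE \<omega> in M. \<omega> \<in> {\<omega>\<in>space M. \<bar>Z n \<omega> - Y \<omega>\<bar> > \<epsilon>} \<longrightarrow> \<omega> \<in> ?A n \<union> ?B n"
        using le[of n]
      proof eventually_elim
        case (elim \<omega>)
        have "\<bar>Z n \<omega> - Y \<omega>\<bar> \<le> \<epsilon>" if "\<bar>U n \<omega> - V \<omega>\<bar> \<le> d" "\<bar>U' n \<omega> - V' \<omega>\<bar> \<le> d"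
        proof -
          have "c * x \<le> \<epsilon> / 2" if "0 \<le> x" "x \<le> d" for x
          proof -
            have "c * x \<le> \<bar>c\<bar> * d" using that by (intro mult_mono) auto
            then show ?thesis using cd by simp
          qed
          from this[of "\<bar>U n \<omega> - V \<omega>\<bar>"] this[of "\<bar>U' n \<omega> - V' \<omega>\<bar>"] that elim show ?thesis by simp
        qed
        then show ?case by (auto simp: not_less[symmetric])
      qed
    qed simp
    also have "\<dots> \<le> measure M (?A n) + measure M (?B n)" by (rule measure_Un_le) simp_all
    finally show ?thesis .
  qed
  show "(\<lambda>n. measure M {\<omega>\<in>space M. \<bar>Z n \<omega> - Y \<omega>\<bar> > \<epsilon>}) \<longlonglongrightarrow> 0"
    by (rule tendsto_zero_le[OF _ le' lim[simplified]]) simp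
qed

lemma tip_const: "tendsto_in_probability M (\<lambda>_. Y) Y"
  by (simp add: tendsto_in_probability_def)

lemma tip_L1:
  assumes [measurable]: "\<And>n. Z n \<in> borel_measurable M" "Y \<in> borel_measurable M"
    and i: "\<And>n. integrable M (\<lambda>x. Z n x - Y x)"
    and l: "(\<lambda>n. expectation (\<lambda>x. \<bar>Z n x - Y x\<bar>)) \<longlonglongrightarrow> 0"
  shows "tendsto_in_probability M Z Y"
  unfolding tendsto_in_probability_def
proof (intro allI impI)
  fix \<epsilon> :: real assume \<epsilon>: "\<epsilon> > 0"
  have le: "measure M {x\<in>space M. \<bar>Z n x - Y x\<bar> > \<epsilon>} \<le> expectation (\<lambda>x. \<bar>Z n x - Y x\<bar>) / \<epsilon>" for n
  proof -
    have "measure M {x\<in>space M. \<bar>Z n x - Y x\<bar> > \<epsilon>} \<le> measure M {x\<in>space M. \<bar>Z n x - Y x\<bar> \<ge> \<epsilon>}"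
      by (intro finite_measure_mono) auto
    also have "\<dots> \<le> expectation (\<lambda>x. \<bar>Z n x - Y x\<bar>) / \<epsilon>"
      using i \<epsilon> by (intro integral_Markov_inequality_measure[where A="{}"]) auto
    finally show ?thesis .
  qed
  have l': "(\<lambda>n. expectation (\<lambda>x. \<bar>Z n x - Y x\<bar>) / \<epsilon>) \<longlonglongrightarrow> 0"
    using tendsto_divide[OF l tendsto_const, of \<epsilon>] \<epsilon> by simp
  show "(\<lambda>n. measure M {x\<in>space M. \<bar>Z n x - Y x\<bar> > \<epsilon>}) \<longlonglongrightarrow> 0"
    by (rule tendsto_zero_le[OF _ le l']) simp
qed

text \<open>The exponentials differ by at most |\<theta>| d where the variables are within d of each
  other, and by at most 2 on the exceptional event, whose probability tends to 0.\<close>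

lemma tip_char:
  assumes [measurable]: "\<And>n. Z n \<in> borel_measurable M" "Y \<in> borel_measurable M"
    and t: "tendsto_in_probability M Z Y"
  shows "(\<lambda>n. char (distr M borel (Z n)) \<theta>) \<longlonglongrightarrow> char (distr M borel Y) \<theta>"
proof (rule LIMSEQ_I)
  fix r :: real assume r: "0 < r"
  define d where "d = r / (2 * (\<bar>\<theta>\<bar> + 1))"
  have d: "d > 0" using r by (simp add: d_def)
  have td: "\<bar>\<theta>\<bar> * d \<le> r / 2"
  proof -
    have "\<bar>\<theta>\<bar> * d \<le> (\<bar>\<theta>\<bar> + 1) * d" using d by (simp add: distrib_right)
    also have "\<dots> = r / 2" by (simp add: d_def field_simps add_nonneg_eq_0_iff)
    finally show ?thesis .
  qed
  let ?A = "\<lambda>n. {x\<in>space M. \<bar>Z n x - Y x\<bar> > d}"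
  have "(\<lambda>n. measure M (?A n)) \<longlonglongrightarrow> 0" using t d by (simp add: tendsto_in_probability_def)
  then have "\<forall>\<^sub>F n in sequentially. measure M (?A n) < r / 4"
    using r by (intro order_tendstoD(2)) auto
  then obtain no where no: "\<And>n. n \<ge> no \<Longrightarrow> measure M (?A n) < r / 4"
    by (auto simp: eventually_sequentially)
  have "norm (char (distr M borel (Z n)) \<theta> - char (distr M borel Y) \<theta>) < r" if "n \<ge> no" for n
  proof -
    have "norm (char (distr M borel (Z n)) \<theta> - char (distr M borel Y) \<theta>)
        \<le> (\<integral>x. norm (iexp (\<theta> * Z n x) - iexp (\<theta> * Y x)) \<partial>M)"
      unfolding char_diff_eq[OF assms(1,2)] by (rule integral_norm_bound)
    also have "\<dots> \<le> (\<integral>x. \<bar>\<theta>\<bar> * d + 2 * indicator (?A n) x \<partial>M)"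
    proof (rule integral_mono_AE')
      have "integrable M (indicator (?A n) :: 'a \<Rightarrow> real)"
        by (intro integrable_real_indicator) (auto simp: less_top[symmetric])
      then show "integrable M (\<lambda>x. \<bar>\<theta>\<bar> * d + 2 * indicator (?A n) x)" by simp
      show "AE x in M. norm (iexp (\<theta> * Z n x) - iexp (\<theta> * Y x)) \<le> \<bar>\<theta>\<bar> * d + 2 * indicator (?A n) x"
      proof (rule AE_I2)
        fix x assume x: "x \<in> space M"
        show "norm (iexp (\<theta> * Z n x) - iexp (\<theta> * Y x)) \<le> \<bar>\<theta>\<bar> * d + 2 * indicator (?A n) x"
        proof (cases "x \<in> ?A n")
          case True
          have "norm (iexp (\<theta> * Z n x) - iexp (\<theta> * Y x)) \<le> 1 + 1"
            by (rule order_trans[OF norm_triangle_ineq4]) simp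
          moreover have "0 \<le> \<bar>\<theta>\<bar> * d" using d by simp
          ultimately show ?thesis using True by simp
        next
          case False
          have "norm (iexp (\<theta> * Z n x) - iexp (\<theta> * Y x)) \<le> \<bar>\<theta> * Z n x - \<theta> * Y x\<bar>"
            by (rule norm_iexp_diff_le)
          also have "\<dots> = \<bar>\<theta>\<bar> * \<bar>Z n x - Y x\<bar>" by (simp flip: abs_mult right_diff_distrib)
          also have "\<dots> \<le> \<bar>\<theta>\<bar> * d" using False x by (intro mult_left_mono) auto
          finally show ?thesis using False by simp
        qed
      qed
    qed (use d in auto)
    also have "\<dots> = \<bar>\<theta>\<bar> * d + 2 * measure M (?A n)"
      by (subst Bochner_Integration.integral_add) (auto simp: prob_space less_top[symmetric])
    also have "\<dots> < r" using no[OF that] td r by linarith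
    finally show ?thesis .
  qed
  then show "\<exists>no. \<forall>n\<ge>no. norm (char (distr M borel (Z n)) \<theta> - char (distr M borel Y) \<theta>) < r" by blast
qed

end

section \<open>Linearity, law and closedness of the stable integral\<close>

context sas_noise begin

abbreviation stable_int where "stable_int \<equiv> has_stable_integral P \<alpha> M"

lemma stable_intE:
  assumes "stable_int f Y"
  obtains g where "in_Lp \<alpha> f" "Y \<in> borel_measurable P" "\<And>n. fin_simple (g n)"
    "(\<lambda>n. powint \<alpha> (\<lambda>u. g n u - f u)) \<longlonglongrightarrow> 0" "tendsto_in_probability P (\<lambda>n. S (g n)) Y"
proof -
  from assms obtain g where f [measurable]: "f \<in> borel_measurable borel" and Y: "Y \<in> borel_measurable P"
    and g: "\<And>n. simple_function lborel (g n) \<and> emeasure lborel {u. g n u \<noteq> 0} < \<infinity>"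
    and l: "(\<lambda>n. \<integral>\<^sup>+u. ennreal (\<bar>g n u - f u\<bar> powr \<alpha>) \<partial>lborel) \<longlonglongrightarrow> 0"
    and t: "tendsto_in_probability P (\<lambda>n. simple_stable_integral M (g n)) Y"
    unfolding has_stable_integral_def by blast
  have fs: "fin_simple (g n)" for n using g by (simp add: fin_simple_def)
  have [measurable]: "g n \<in> borel_measurable borel" for n using fin_simpleD(2)[OF fs] .
  have "\<forall>\<^sub>F n in sequentially. (\<integral>\<^sup>+u. ennreal (\<bar>g n u - f u\<bar> powr \<alpha>) \<partial>lborel) < 1"
    using l by (rule order_tendstoD(2)) simp
  then obtain m where m: "\<And>n. n \<ge> m \<Longrightarrow> (\<integral>\<^sup>+u. ennreal (\<bar>g n u - f u\<bar> powr \<alpha>) \<partial>lborel) < 1"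
    by (auto simp: eventually_sequentially)
  have d: "in_Lp \<alpha> (\<lambda>u. g n u - f u)" if "n \<ge> m" for n
    unfolding in_Lp_def using order.strict_trans[OF m[OF that]]
    by (auto intro!: integrableI_bounded simp: less_top)
  \<comment> \<open>The definition does not state that \<open>f\<close> is in L^\<alpha>. It is the
    difference of a simple function and an error with finite integral, and only now may
    \<open>powint\<close> replace the nonnegative integral for all n.\<close>
  have "in_Lp \<alpha> (\<lambda>u. g m u - (g m u - f u))"
    by (intro in_Lp_diff \<alpha> d fin_simple_in_Lp fs) simp
  then have f': "in_Lp \<alpha> f" by simp
  have "in_Lp \<alpha> (\<lambda>u. g n u - f u)" for n by (intro in_Lp_diff \<alpha> f' fin_simple_in_Lp fs)
  then have "(\<integral>\<^sup>+u. ennreal (\<bar>g n u - f u\<bar> powr \<alpha>) \<partial>lborel) = ennreal (powint \<alpha> (\<lambda>u. g n u - f u))" for n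
    unfolding powint_def by (intro nn_integral_eq_integral) auto
  with l have "(\<lambda>n. ennreal (powint \<alpha> (\<lambda>u. g n u - f u))) \<longlonglongrightarrow> ennreal 0" by simp
  then have "(\<lambda>n. powint \<alpha> (\<lambda>u. g n u - f u)) \<longlonglongrightarrow> 0"
    by (subst (asm) tendsto_ennreal_iff) auto
  then show ?thesis using that f' Y fs t by blast
qed

lemma stable_intI:
  assumes f: "in_Lp \<alpha> f" and Y: "Y \<in> borel_measurable P" and g: "\<And>n. fin_simple (g n)"
    and l: "(\<lambda>n. powint \<alpha> (\<lambda>u. g n u - f u)) \<longlonglongrightarrow> 0"
    and t: "tendsto_in_probability P (\<lambda>n. S (g n)) Y"
  shows "stable_int f Y"
proof -
  have "in_Lp \<alpha> (\<lambda>u. g n u - f u)" for n by (intro in_Lp_diff \<alpha> f fin_simple_in_Lp g)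
  then have "(\<integral>\<^sup>+u. ennreal (\<bar>g n u - f u\<bar> powr \<alpha>) \<partial>lborel) = ennreal (powint \<alpha> (\<lambda>u. g n u - f u))" for n
    unfolding powint_def by (intro nn_integral_eq_integral) auto
  moreover have "(\<lambda>n. ennreal (powint \<alpha> (\<lambda>u. g n u - f u))) \<longlonglongrightarrow> ennreal 0"
    using l by (intro tendsto_ennrealI)
  ultimately have "(\<lambda>n. \<integral>\<^sup>+u. ennreal (\<bar>g n u - f u\<bar> powr \<alpha>) \<partial>lborel) \<longlonglongrightarrow> 0" by simp
  then show ?thesis unfolding has_stable_integral_def
    using f Y g t by (auto simp: fin_simple_def intro!: exI[of _ g])
qed

lemma stable_int_in_Lp: "stable_int f Y \<Longrightarrow> in_Lp \<alpha> f"
  and stable_int_measurable: "stable_int f Y \<Longrightarrow> Y \<in> borel_measurable P"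
  by (elim stable_intE; assumption)+

text \<open>Both sides are limits along the approximating simple functions. The law of a stable
  integral thus depends on its integrand through \<open>powint\<close> alone.\<close>

lemma stable_int_char:
  assumes "stable_int f Y"
  shows "char (distr P borel Y) \<theta> = complex_of_real (exp (- (\<bar>\<theta>\<bar> powr \<alpha> * powint \<alpha> f)))"
proof -
  from stable_intE[OF assms] obtain g where *: "in_Lp \<alpha> f" "Y \<in> borel_measurable P" "\<And>n. fin_simple (g n)"
    "(\<lambda>n. powint \<alpha> (\<lambda>u. g n u - f u)) \<longlonglongrightarrow> 0" "tendsto_in_probability P (\<lambda>n. S (g n)) Y" by blast
  have "(\<lambda>n. char (distr P borel (S (g n))) \<theta>) \<longlonglongrightarrow> char (distr P borel Y) \<theta>"
    by (intro tip_char * S_measurable)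
  then have 1: "(\<lambda>n. complex_of_real (exp (- (\<bar>\<theta>\<bar> powr \<alpha> * powint \<alpha> (g n))))) \<longlonglongrightarrow> char (distr P borel Y) \<theta>"
    by (simp add: S_char[OF *(3)])
  have "(\<lambda>n. powint \<alpha> (g n)) \<longlonglongrightarrow> powint \<alpha> f"
    by (intro powint_tendsto \<alpha> * fin_simple_in_Lp)
  then have "(\<lambda>n. complex_of_real (exp (- (\<bar>\<theta>\<bar> powr \<alpha> * powint \<alpha> (g n)))))
      \<longlonglongrightarrow> complex_of_real (exp (- (\<bar>\<theta>\<bar> powr \<alpha> * powint \<alpha> f)))"
    by (intro tendsto_intros)
  with 1 show ?thesis by (rule LIMSEQ_unique)
qed

lemma stable_int_lincomb:
  assumes f: "stable_int f Y" and f': "stable_int f' Y'"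
  shows "stable_int (\<lambda>u. a * f u + b * f' u) (\<lambda>x. a * Y x + b * Y' x)"
proof -
  from stable_intE[OF f] obtain g where g: "in_Lp \<alpha> f" "Y \<in> borel_measurable P" "\<And>n. fin_simple (g n)"
    "(\<lambda>n. powint \<alpha> (\<lambda>u. g n u - f u)) \<longlonglongrightarrow> 0" "tendsto_in_probability P (\<lambda>n. S (g n)) Y" by blast
  from stable_intE[OF f'] obtain g' where g': "in_Lp \<alpha> f'" "Y' \<in> borel_measurable P" "\<And>n. fin_simple (g' n)"
    "(\<lambda>n. powint \<alpha> (\<lambda>u. g' n u - f' u)) \<longlonglongrightarrow> 0" "tendsto_in_probability P (\<lambda>n. S (g' n)) Y'" by blast
  note [measurable] = g(2) g'(2)
  let ?G = "\<lambda>n u. a * g n u + b * g' n u"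
  have d: "in_Lp \<alpha> (\<lambda>u. g n u - f u)" "in_Lp \<alpha> (\<lambda>u. g' n u - f' u)" for n
    by (intro in_Lp_diff \<alpha> g g' fin_simple_in_Lp)+
  show ?thesis
  proof (rule stable_intI[where g="?G"])
    show "in_Lp \<alpha> (\<lambda>u. a * f u + b * f' u)" by (intro in_Lp_lincomb \<alpha> g g')
    show "fin_simple (?G n)" for n by (intro S_lincomb g g')
    have e: "powint \<alpha> (\<lambda>u. ?G n u - (a * f u + b * f' u))
       \<le> 3 * (\<bar>a\<bar> powr \<alpha> * powint \<alpha> (\<lambda>u. g n u - f u) + \<bar>b\<bar> powr \<alpha> * powint \<alpha> (\<lambda>u. g' n u - f' u))" for n
    proof -
      have "(\<lambda>u. ?G n u - (a * f u + b * f' u)) = (\<lambda>u. a * (g n u - f u) + b * (g' n u - f' u))"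
        by (simp add: algebra_simps)
      then show ?thesis
        using powint_add_le[OF \<alpha> in_Lp_cmult[OF d(1)[of n], of a] in_Lp_cmult[OF d(2)[of n], of b]]
        by (simp add: powint_cmult)
    qed
    have "(\<lambda>n. 3 * (\<bar>a\<bar> powr \<alpha> * powint \<alpha> (\<lambda>u. g n u - f u) + \<bar>b\<bar> powr \<alpha> * powint \<alpha> (\<lambda>u. g' n u - f' u)))
       \<longlonglongrightarrow> 3 * (\<bar>a\<bar> powr \<alpha> * 0 + \<bar>b\<bar> powr \<alpha> * 0)"
      by (intro tendsto_intros g g')
    then have l: "(\<lambda>n. 3 * (\<bar>a\<bar> powr \<alpha> * powint \<alpha> (\<lambda>u. g n u - f u) + \<bar>b\<bar> powr \<alpha> * powint \<alpha> (\<lambda>u. g' n u - f' u)))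
       \<longlonglongrightarrow> 0" by simp
    show "(\<lambda>n. powint \<alpha> (\<lambda>u. ?G n u - (a * f u + b * f' u))) \<longlonglongrightarrow> 0"
      by (rule tendsto_zero_le[OF powint_nonneg e l])
    show "tendsto_in_probability P (\<lambda>n. S (?G n)) (\<lambda>x. a * Y x + b * Y' x)"
    proof (rule tip_le[OF _ _ _ _ _ _ g(5) g'(5)])
      show "AE x in P. \<bar>S (?G n) x - (a * Y x + b * Y' x)\<bar>
         \<le> (\<bar>a\<bar> + \<bar>b\<bar>) * \<bar>S (g n) x - Y x\<bar> + (\<bar>a\<bar> + \<bar>b\<bar>) * \<bar>S (g' n) x - Y' x\<bar>" for n
        using S_lincomb(2)[OF g(3) g'(3), where a=a and b=b, of n n]
      proof eventually_elim
        case (elim x)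
        have "\<bar>S (?G n) x - (a * Y x + b * Y' x)\<bar> = \<bar>a * (S (g n) x - Y x) + b * (S (g' n) x - Y' x)\<bar>"
          by (simp add: elim algebra_simps)
        also have "\<dots> \<le> \<bar>a\<bar> * \<bar>S (g n) x - Y x\<bar> + \<bar>b\<bar> * \<bar>S (g' n) x - Y' x\<bar>"
          by (rule order_trans[OF abs_triangle_ineq]) (simp add: abs_mult)
        also have "\<dots> \<le> (\<bar>a\<bar> + \<bar>b\<bar>) * \<bar>S (g n) x - Y x\<bar> + (\<bar>a\<bar> + \<bar>b\<bar>) * \<bar>S (g' n) x - Y' x\<bar>"
          by (intro add_mono mult_right_mono) auto
        finally show ?case .
      qed
    qed (auto intro!: S_measurable S_lincomb g g')
  qed simp
qed

lemma stable_int_simple: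
  assumes g: "fin_simple g"
  shows "stable_int g (S g)"
  by (rule stable_intI[where g="\<lambda>_. g"])
     (use g in \<open>auto intro: fin_simple_in_Lp S_measurable tip_const simp: powint_def\<close>)

lemma stable_int_sum:
  assumes "finite K" "K \<noteq> {}" "\<And>k. k \<in> K \<Longrightarrow> stable_int (f k) (Y k)"
  shows "stable_int (\<lambda>u. \<Sum>k\<in>K. c k * f k u) (\<lambda>x. \<Sum>k\<in>K. c k * Y k x)"
  using assms
proof (induction K rule: finite_ne_induct)
  case (singleton k)
  then show ?case using stable_int_lincomb[of "f k" "Y k" "f k" "Y k" "c k" 0] by simp
next
  case (insert k K)
  then show ?case using stable_int_lincomb[of "f k" "Y k" "\<lambda>u. \<Sum>k\<in>K. c k * f k u" "\<lambda>x. \<Sum>k\<in>K. c k * Y k x" "c k" 1]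
    by simp
qed

text \<open>Joint limits of integrands and integrals are again a pair of this kind. The definition
  wants simple integrands, so a diagonal choice replaces each \<open>F m\<close> by a simple
  function within \<open>1 / Suc m\<close>, both in \<open>powint\<close> and in
  probability.\<close>

lemma stable_int_limit:
  assumes F: "\<And>m. stable_int (F m) (Z m)" and f [measurable]: "f \<in> borel_measurable borel"
    and Y [measurable]: "Y \<in> borel_measurable P"
    and fl: "in_Lp \<alpha> f" "(\<lambda>m. powint \<alpha> (\<lambda>u. F m u - f u)) \<longlonglongrightarrow> 0"
    and t: "tendsto_in_probability P Z Y"
  shows "stable_int f Y"
proof -
  have FL: "in_Lp \<alpha> (F m)" and [measurable]: "Z m \<in> borel_measurable P" for m
    using stable_int_in_Lp[OF F] stable_int_measurable[OF F] by auto
  have "\<exists>g. fin_simple g \<and> powint \<alpha> (\<lambda>u. g u - F m u) < 1 / Suc m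
    \<and> measure P {x\<in>space P. \<bar>S g x - Z m x\<bar> > 1 / Suc m} < 1 / Suc m" for m
  proof -
    from stable_intE[OF F[of m]] obtain g where g: "\<And>n. fin_simple (g n)"
      "(\<lambda>n. powint \<alpha> (\<lambda>u. g n u - F m u)) \<longlonglongrightarrow> 0" "tendsto_in_probability P (\<lambda>n. S (g n)) (Z m)" by blast
    have "\<forall>\<^sub>F n in sequentially. powint \<alpha> (\<lambda>u. g n u - F m u) < 1 / Suc m"
      using g(2) by (rule order_tendstoD(2)) simp
    moreover have "\<forall>\<^sub>F n in sequentially. measure P {x\<in>space P. \<bar>S (g n) x - Z m x\<bar> > 1 / Suc m} < 1 / Suc m"
      using g(3) by (intro order_tendstoD(2)[where y=0]) (auto simp: tendsto_in_probability_def)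
    ultimately have "\<forall>\<^sub>F n in sequentially. powint \<alpha> (\<lambda>u. g n u - F m u) < 1 / Suc m \<and> measure P {x\<in>space P. \<bar>S (g n) x - Z m x\<bar> > 1 / Suc m} < 1 / Suc m"
      by eventually_elim simp
    then obtain n where "powint \<alpha> (\<lambda>u. g n u - F m u) < 1 / Suc m \<and> measure P {x\<in>space P. \<bar>S (g n) x - Z m x\<bar> > 1 / Suc m} < 1 / Suc m"
      by (auto simp: eventually_sequentially)
    then show ?thesis using g(1) by blast
  qed
  then have "\<forall>m. \<exists>g. fin_simple g \<and> powint \<alpha> (\<lambda>u. g u - F m u) < 1 / Suc m
    \<and> measure P {x\<in>space P. \<bar>S g x - Z m x\<bar> > 1 / Suc m} < 1 / Suc m" by blast
  from choice[OF this] obtain g where g: "\<And>m. fin_simple (g m)" "\<And>m. powint \<alpha> (\<lambda>u. g m u - F m u) < 1 / Suc m"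
    "\<And>m. measure P {x\<in>space P. \<bar>S (g m) x - Z m x\<bar> > 1 / Suc m} < 1 / Suc m"
    by blast
  note [measurable] = S_measurable[OF g(1)]
  have z: "(\<lambda>m. 1 / real (Suc m)) \<longlonglongrightarrow> 0" using LIMSEQ_inverse_real_of_nat by (simp add: inverse_eq_divide)
  show ?thesis
  proof (rule stable_intI[OF fl(1) Y g(1)])
    have le: "powint \<alpha> (\<lambda>u. g m u - f u) \<le> 3 * (1 / Suc m + powint \<alpha> (\<lambda>u. F m u - f u))" for m
    proof -
      have "powint \<alpha> (\<lambda>u. (g m u - F m u) + (F m u - f u)) \<le> 3 * (powint \<alpha> (\<lambda>u. g m u - F m u) + powint \<alpha> (\<lambda>u. F m u - f u))"
        by (intro powint_add_le in_Lp_diff \<alpha> FL fl fin_simple_in_Lp g)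
      also have "\<dots> \<le> 3 * (1 / Suc m + powint \<alpha> (\<lambda>u. F m u - f u))"
        using less_imp_le[OF g(2)] by (intro mult_left_mono add_right_mono) auto
      finally show ?thesis by simp
    qed
    have "(\<lambda>m. 3 * (1 / Suc m + powint \<alpha> (\<lambda>u. F m u - f u))) \<longlonglongrightarrow> 3 * (0 + 0)"
      by (intro tendsto_intros z fl(2))
    then have l: "(\<lambda>m. 3 * (1 / Suc m + powint \<alpha> (\<lambda>u. F m u - f u))) \<longlonglongrightarrow> 0" by simp
    show "(\<lambda>m. powint \<alpha> (\<lambda>u. g m u - f u)) \<longlonglongrightarrow> 0"
      by (rule tendsto_zero_le[OF powint_nonneg le l])
    have 1: "tendsto_in_probability P (\<lambda>m x. S (g m) x - Z m x) (\<lambda>_. 0)"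
      unfolding tendsto_in_probability_def
    proof (intro allI impI)
      fix \<epsilon> :: real assume "\<epsilon> > 0"
      with z have "\<forall>\<^sub>F m in sequentially. 1 / real (Suc m) < \<epsilon>" by (rule order_tendstoD(2))
      then have "\<forall>\<^sub>F m in sequentially. measure P {x \<in> space P. \<epsilon> < \<bar>S (g m) x - Z m x - 0\<bar>} \<le> 1 / real (Suc m)"
      proof eventually_elim
        case (elim m)
        have "measure P {x \<in> space P. \<epsilon> < \<bar>S (g m) x - Z m x - 0\<bar>} \<le> measure P {x\<in>space P. \<bar>S (g m) x - Z m x\<bar> > 1 / Suc m}"
          using elim by (intro finite_measure_mono) auto
        then show ?case using g(3)[of m] by linarith
      qed
      then show "(\<lambda>n. measure P {x \<in> space P. \<epsilon> < \<bar>S (g n) x - Z n x - 0\<bar>}) \<longlonglongrightarrow> 0"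
        by (intro tendsto_sandwich[OF _ _ tendsto_const z]) auto
    qed
    show "tendsto_in_probability P (\<lambda>m. S (g m)) Y"
      by (rule tip_le[OF _ _ _ _ _ _ 1 t, where c=1]) (auto intro!: AE_I2)
  qed
qed

end

section \<open>An integral representation of the logarithm\<close>

lemma nn_powr_0:
  fixes a c :: real
  assumes "a > -1" "c \<ge> 0"
  shows "(\<integral>\<^sup>+x. ennreal (x powr a) * indicator {0..c} x \<partial>lborel) = ennreal (c powr (a + 1) / (a + 1))"
  by (rule nn_integral_has_integral_lebesgue'[OF _ has_integral_powr_from_0[OF assms]]) simp

lemma nn_powr_inf:
  fixes a c :: real
  assumes "a < -1" "c > 0"
  shows "(\<integral>\<^sup>+x. ennreal (x powr a) * indicator {c..} x \<partial>lborel) = ennreal (- (c powr (a + 1)) / (a + 1))"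
  by (rule nn_integral_has_integral_lebesgue'[OF _ has_integral_powr_to_inf[OF assms]]) simp

lemma integrable_powr_0:
  fixes a c :: real
  assumes "a > -1"
  shows "integrable lborel (\<lambda>x. x powr a * indicator {0..c} x)"
proof (cases "c \<ge> 0")
  case True
  have "(\<integral>\<^sup>+x. ennreal (norm (x powr a * indicator {0..c} x)) \<partial>lborel) = (\<integral>\<^sup>+x. ennreal (x powr a) * indicator {0..c} x \<partial>lborel)"
    by (intro nn_integral_cong) (auto simp: indicator_def)
  then show ?thesis using nn_powr_0[OF assms True] by (intro integrableI_bounded) auto
qed simp

lemma integrable_powr_inf:
  fixes a c :: real
  assumes "a < -1" "c > 0"
  shows "integrable lborel (\<lambda>x. x powr a * indicator {c..} x)"
proof -
  have "(\<integral>\<^sup>+x. ennreal (norm (x powr a * indicator {c..} x)) \<partial>lborel) = (\<integral>\<^sup>+x. ennreal (x powr a) * indicator {c..} x \<partial>lborel)"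
    by (intro nn_integral_cong) (auto simp: indicator_def)
  then show ?thesis using nn_powr_inf[OF assms] by (intro integrableI_bounded) auto
qed

lemma integrable_envelope:
  fixes p :: real
  assumes p: "p > 1"
  shows "integrable lborel (\<lambda>u. env p u)"
proof -
  have i: "integrable lborel (\<lambda>x. x powr (-p) * indicator {1..} x)"
    by (rule integrable_powr_inf) (use p in auto)
  have i': "integrable lborel (\<lambda>x. (-x) powr (-p) * indicator {1..} (-x))"
    using lborel_integrable_real_affine[OF i, of "-1" 0] by simp
  have j: "integrable lborel (indicator {-1..1} :: real \<Rightarrow> real)"
    by (intro integrable_real_indicator) auto
  show ?thesis
  proof (rule integrable_dominated[OF Bochner_Integration.integrable_add[OF j Bochner_Integration.integrable_add[OF i i']]])
    have "env p u \<le> indicator {-1..1} u + (u powr (-p) * indicator {1..} u + (-u) powr (-p) * indicator {1..} (-u))" for u :: real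
    proof -
      have "env p u \<le> 1" using p powr_mono[of "-p" 0 "1 + \<bar>u\<bar>"] by (simp split: if_splits)
      moreover have "env p u \<le> \<bar>u\<bar> powr (- p)" if "\<bar>u\<bar> \<ge> 1"
        using that p by (intro powr_mono2') auto
      ultimately show ?thesis by (cases "\<bar>u\<bar> \<le> 1"; cases "u \<ge> 0") (auto simp: indicator_def)
    qed
    then show "AE u in lborel. norm (env p u)
      \<le> norm (indicator {-1..1} u + (u powr (-p) * indicator {1..} u + (-u) powr (-p) * indicator {1..} (-u)))"
      by (intro AE_I2) (smt (verit) norm_of_real real_norm_def powr_ge_zero abs_of_nonneg)
  qed simp
qed

text \<open>The weight that remains when the factor \<open>t powr (a / 2)\<close> of
  \<open>cos_cov_bound\<close> meets the 1/t of the logarithm kernel. It is integrable at 0 because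
  a > 0, and at infinity because exp (- y) \<le> 1/y and a > 1.\<close>

lemma integrable_weight:
  fixes a c :: real
  assumes a: "1 < a" "a < 2" and c: "c > 0"
  shows "integrable lborel (\<lambda>t. t powr (a / 2 - 1) * exp (- (c * t powr a)) * indicator {0<..} t)"
proof (rule integrable_dominated)
  show "integrable lborel (\<lambda>t. t powr (a / 2 - 1) * indicator {0..1} t + (t powr (- a) * indicator {1..} t) / c)"
    using a by (intro Bochner_Integration.integrable_add integrable_divide integrable_powr_0 integrable_powr_inf) auto
  have "t powr (a / 2 - 1) * exp (- (c * t powr a)) * indicator {0<..} t
     \<le> t powr (a / 2 - 1) * indicator {0..1} t + (t powr (- a) * indicator {1..} t) / c" for t :: real
  proof (cases "t \<le> 1")
    case True
    have "exp (- (c * t powr a)) \<le> 1" using c by simp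
    then have "t powr (a / 2 - 1) * exp (- (c * t powr a)) \<le> t powr (a / 2 - 1) * 1"
      by (intro mult_left_mono) auto
    moreover have "0 \<le> (t powr (- a) * indicator {1..} t) / c" using c by simp
    ultimately show ?thesis using True by (simp add: indicator_def)
  next
    case False
    have "t powr (a / 2 - 1) \<le> t powr 0" using False a by (intro powr_mono) auto
    then have 1: "t powr (a / 2 - 1) \<le> 1" using False by simp
    have y: "c * t powr a > 0" using False c by simp
    have "1 + c * t powr a \<le> exp (c * t powr a)" by (rule exp_ge_add_one_self)
    then have "c * t powr a \<le> exp (c * t powr a)" by linarith
    then have "exp (- (c * t powr a)) \<le> inverse (c * t powr a)"
      unfolding exp_minus using y by (intro le_imp_inverse_le) auto
    also have "\<dots> = t powr (-a) / c" using False c by (simp add: powr_minus field_simps)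
    finally have "t powr (a / 2 - 1) * exp (- (c * t powr a)) \<le> 1 * (t powr (-a) / c)"
      using 1 by (intro mult_mono) auto
    then show ?thesis using False by (simp add: indicator_def)
  qed
  then show "AE t in lborel. norm (t powr (a / 2 - 1) * exp (- (c * t powr a)) * indicator {0<..} t)
     \<le> norm (t powr (a / 2 - 1) * indicator {0..1} t + (t powr (- a) * indicator {1..} t) / c)"
    using c by (intro AE_I2) (simp add: abs_of_nonneg)
qed simp

lemma tendsto_exp_mult_bounded:
  fixes h :: "real \<Rightarrow> real"
  assumes b: "b > 0" and h: "\<And>t. \<bar>h t\<bar> \<le> C"
  shows "((\<lambda>t. exp (- (b * t)) * h t) \<longlongrightarrow> 0) at_top"
proof (rule Lim_null_comparison)
  have "filterlim (\<lambda>t. b * t) at_top at_top"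
    by (rule filterlim_tendsto_pos_mult_at_top[OF tendsto_const b filterlim_ident])
  then have "((\<lambda>t. exp (- (b * t))) \<longlongrightarrow> 0) at_top"
    by (intro filterlim_compose[OF exp_at_bot] filterlim_compose[OF filterlim_uminus_at_bot_at_top])
  then show "((\<lambda>t. exp (- (b * t)) * C) \<longlongrightarrow> 0) at_top" by (rule tendsto_mult_left_zero)
  show "\<forall>\<^sub>F t in at_top. norm (exp (- (b * t)) * h t) \<le> exp (- (b * t)) * C"
    using h by (intro always_eventually) (auto simp: abs_mult intro!: mult_left_mono)
qed

text \<open>The function \<open>F\<close> is the antiderivative that vanishes at infinity, found by
  integrating the exponential and its product with the cosine separately.\<close>

lemma nn_exp_one_minus_cos:
  fixes b x :: real
  assumes b: "b > 0"
  shows "(\<integral>\<^sup>+t. ennreal (exp (- (b * t)) * (1 - cos (t * x))) * indicator {0..} t \<partial>lborel) = ennreal (1 / b - b / (b\<^sup>2 + x\<^sup>2))"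
proof -
  define r where "r = inverse (b\<^sup>2 + x\<^sup>2)"
  define F where "F = (\<lambda>t. - exp (- (b * t)) * (inverse b + (x * sin (t * x) - b * cos (t * x)) * r))"
  have nz: "b\<^sup>2 + x\<^sup>2 \<noteq> 0" using b by (simp add: sum_power2_eq_zero_iff)
  then have r: "b * b * r + x * x * r = 1" by (simp add: r_def power2_eq_square flip: distrib_right)
  have D: "(F has_real_derivative exp (- (b * t)) * (1 - cos (t * x))) (at t)" for t
  proof -
    have "(F has_real_derivative (b * exp (- (b * t)) * (inverse b + (x * sin (t * x) - b * cos (t * x)) * r)
       - exp (- (b * t)) * ((x * (cos (t * x) * x) + b * (sin (t * x) * x)) * r))) (at t)"
      unfolding F_def by (auto intro!: derivative_eq_intros simp: algebra_simps)
    also have "b * exp (- (b * t)) * (inverse b + (x * sin (t * x) - b * cos (t * x)) * r)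
       - exp (- (b * t)) * ((x * (cos (t * x) * x) + b * (sin (t * x) * x)) * r)
       = exp (- (b * t)) * (b * inverse b - cos (t * x) * (b * b * r + x * x * r))"
      by (simp add: algebra_simps)
    finally show ?thesis using r b by simp
  qed
  have lim: "(F \<longlongrightarrow> 0) at_top"
  proof -
    have "\<bar>- (inverse b + (x * sin (t * x) - b * cos (t * x)) * r)\<bar> \<le> inverse b + (\<bar>x\<bar> + b) * r" for t
    proof -
      have "\<bar>x * sin (t * x) - b * cos (t * x)\<bar> \<le> \<bar>x * sin (t * x)\<bar> + \<bar>b * cos (t * x)\<bar>"
        by (rule abs_triangle_ineq4)
      also have "\<dots> \<le> \<bar>x\<bar> * 1 + b * 1"
        unfolding abs_mult using b by (intro add_mono mult_mono abs_sin_le_one abs_cos_le_one) auto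
      finally have "\<bar>(x * sin (t * x) - b * cos (t * x)) * r\<bar> \<le> (\<bar>x\<bar> + b) * r"
        unfolding abs_mult by (simp add: mult_right_mono r_def)
      moreover have "\<bar>inverse b\<bar> = inverse b" using b by simp
      ultimately show ?thesis by linarith
    qed
    from tendsto_exp_mult_bounded[where h="\<lambda>t. - (inverse b + (x * sin (t * x) - b * cos (t * x)) * r)", OF b this]
    show ?thesis by (simp only: F_def mult_minus_left mult_minus_right)
  qed
  have "(\<integral>\<^sup>+t. ennreal (exp (- (b * t)) * (1 - cos (t * x))) * indicator {0..} t \<partial>lborel) = ennreal (0 - F 0)"
    by (rule nn_integral_FTC_atLeast[OF _ D _ lim]) auto
  also have "0 - F 0 = 1 / b - b / (b\<^sup>2 + x\<^sup>2)" by (simp add: F_def r_def divide_inverse)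
  finally show ?thesis .
qed

lemma nn_exp_decay:
  fixes b c :: real
  assumes b: "b > 0"
  shows "(\<integral>\<^sup>+t. ennreal (exp (- (b * t))) * indicator {c..} t \<partial>lborel) = ennreal (exp (- (b * c)) / b)"
proof -
  have "(\<integral>\<^sup>+t. ennreal (exp (- (b * t))) * indicator {c..} t \<partial>lborel) = ennreal (0 - (- (exp (- (b * c)) / b)))"
  proof (rule nn_integral_FTC_atLeast)
    show "((\<lambda>t. - (exp (- (b * t)) / b)) has_real_derivative exp (- (b * t))) (at t)" for t
      using b by (auto intro!: derivative_eq_intros)
    have "((\<lambda>t. exp (- (b * t)) * (- (1 / b))) \<longlongrightarrow> 0) at_top"
      by (rule tendsto_exp_mult_bounded[OF b order_refl])
    then show "((\<lambda>t. - (exp (- (b * t)) / b)) \<longlongrightarrow> 0) at_top" by simp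
  qed auto
  then show ?thesis by simp
qed

lemma integral_exp_cos:
  fixes b x :: real
  assumes b: "b > 0"
  shows "has_bochner_integral lborel (\<lambda>t. exp (- (b * t)) * cos (t * x) * indicator {0..} t) (b / (b\<^sup>2 + x\<^sup>2))"
proof -
  have i1: "has_bochner_integral lborel (\<lambda>t. exp (- (b * t)) * indicator {0..} t) (1 / b)"
    using nn_exp_decay[OF b, of 0] b
    by (intro has_bochner_integral_nn_integral) (auto simp: ennreal_mult' ennreal_indicator)
  have "b / (b\<^sup>2 + x\<^sup>2) \<le> b / b\<^sup>2" using b by (intro divide_left_mono) (auto intro!: mult_pos_pos add_pos_nonneg)
  then have "0 \<le> 1 / b - b / (b\<^sup>2 + x\<^sup>2)" using b by (simp add: power2_eq_square)
  then have i2: "has_bochner_integral lborel (\<lambda>t. exp (- (b * t)) * (1 - cos (t * x)) * indicator {0..} t) (1 / b - b / (b\<^sup>2 + x\<^sup>2))"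
    using nn_exp_one_minus_cos[OF b, of x]
    by (intro has_bochner_integral_nn_integral) (auto simp: ennreal_mult' ennreal_indicator)
  show ?thesis using has_bochner_integral_diff[OF i1 i2] by (simp add: algebra_simps)
qed

text \<open>Frullani's device: \<open>exp (- (b * t)) / t\<close> is the integral of
  \<open>exp (- (y * t))\<close> over y \<ge> b. Exchanging the integrals leaves 1/y - y/(y^2 +
  x^2), the derivative of minus half of ln (1 + x^2/y^2).\<close>

lemma integral_log_kernel:
  fixes b x :: real
  assumes b: "b > 0"
  shows "has_bochner_integral lborel (\<lambda>t. exp (- (b * t)) * (1 - cos (t * x)) / t * indicator {0<..} t) (ln (1 + x\<^sup>2 / b\<^sup>2) / 2)"
proof (rule has_bochner_integral_nn_integral)
  have "(\<integral>\<^sup>+t. ennreal (exp (- (b * t)) * (1 - cos (t * x)) / t * indicator {0<..} t) \<partial>lborel)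
     = (\<integral>\<^sup>+t. (\<integral>\<^sup>+y. ennreal (exp (- (y * t)) * (1 - cos (t * x))) * indicator {0<..} t * indicator {b..} y \<partial>lborel) \<partial>lborel)"
  proof (intro nn_integral_cong)
    fix t :: real
    show "ennreal (exp (- (b * t)) * (1 - cos (t * x)) / t * indicator {0<..} t)
      = (\<integral>\<^sup>+y. ennreal (exp (- (y * t)) * (1 - cos (t * x))) * indicator {0<..} t * indicator {b..} y \<partial>lborel)"
    proof (cases "t > 0")
      case True
      have "(\<integral>\<^sup>+y. ennreal (exp (- (y * t)) * (1 - cos (t * x))) * indicator {0<..} t * indicator {b..} y \<partial>lborel)
        = (\<integral>\<^sup>+y. ennreal (1 - cos (t * x)) * (ennreal (exp (- (t * y))) * indicator {b..} y) \<partial>lborel)"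
        using True by (intro nn_integral_cong) (simp add: ennreal_mult' ennreal_mult mult_ac)
      also have "\<dots> = ennreal (1 - cos (t * x)) * ennreal (exp (- (t * b)) / t)"
        using nn_exp_decay[OF True, of b] by (simp add: nn_integral_cmult)
      finally show ?thesis using True by (simp add: mult_ac flip: ennreal_mult)
    qed simp
  qed
  also have "\<dots> = (\<integral>\<^sup>+y. (\<integral>\<^sup>+t. ennreal (exp (- (y * t)) * (1 - cos (t * x))) * indicator {0<..} t * indicator {b..} y \<partial>lborel) \<partial>lborel)"
    by (rule lborel_pair.Fubini') measurable
  also have "\<dots> = (\<integral>\<^sup>+y. ennreal (1 / y - y / (y\<^sup>2 + x\<^sup>2)) * indicator {b..} y \<partial>lborel)"
  proof (intro nn_integral_cong)
    fix y :: real
    show "(\<integral>\<^sup>+t. ennreal (exp (- (y * t)) * (1 - cos (t * x))) * indicator {0<..} t * indicator {b..} y \<partial>lborel)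
      = ennreal (1 / y - y / (y\<^sup>2 + x\<^sup>2)) * indicator {b..} y"
    proof (cases "y \<ge> b")
      case True
      then have y: "y > 0" using b by simp
      have "(\<integral>\<^sup>+t. ennreal (exp (- (y * t)) * (1 - cos (t * x))) * indicator {0<..} t * indicator {b..} y \<partial>lborel)
        = (\<integral>\<^sup>+t. ennreal (exp (- (y * t)) * (1 - cos (t * x))) * indicator {0..} t \<partial>lborel)"
      proof (intro nn_integral_cong)
        fix t :: real
        show "ennreal (exp (- (y * t)) * (1 - cos (t * x))) * indicator {0<..} t * indicator {b..} y
          = ennreal (exp (- (y * t)) * (1 - cos (t * x))) * indicator {0..} t"
          using True by (cases "t = 0") (auto simp: indicator_def)
      qed
      then show ?thesis using nn_exp_one_minus_cos[OF y, of x] True by simp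
    qed simp
  qed
  also have "\<dots> = ennreal (0 - (- (ln (1 + x\<^sup>2 / b\<^sup>2) / 2)))"
  proof (rule nn_integral_FTC_atLeast)
    fix y assume "b \<le> y"
    then have y: "y > 0" using b by simp
    have p: "1 + x\<^sup>2 / y\<^sup>2 > 0" using y by (intro add_pos_nonneg) auto
    have q: "y\<^sup>2 + x\<^sup>2 > 0" using y by (intro add_pos_nonneg) auto
    have e: "1 + x\<^sup>2 / y\<^sup>2 = (y\<^sup>2 + x\<^sup>2) / y\<^sup>2" using y by (simp add: add_divide_distrib)
    have "((\<lambda>y. - (ln (1 + x\<^sup>2 / y\<^sup>2) / 2)) has_real_derivative
       - ((- (x\<^sup>2 * (2 * y)) / (y\<^sup>2 * y\<^sup>2)) / (1 + x\<^sup>2 / y\<^sup>2) / 2)) (at y)"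
      using y p by (auto intro!: derivative_eq_intros simp: power2_eq_square)
    also have "- ((- (x\<^sup>2 * (2 * y)) / (y\<^sup>2 * y\<^sup>2)) / (1 + x\<^sup>2 / y\<^sup>2) / 2) = x\<^sup>2 / (y * (y\<^sup>2 + x\<^sup>2))"
    proof -
      have "- ((- (x\<^sup>2 * (2 * y)) / (y\<^sup>2 * y\<^sup>2)) / (q / y\<^sup>2) / 2) = x\<^sup>2 / (y * q)" if "q > 0" for q
        using y that by (simp add: field_simps power2_eq_square)
      then show ?thesis unfolding e using q .
    qed
    also have "\<dots> = 1 / y - y / (y\<^sup>2 + x\<^sup>2)"
      using y q by (simp add: field_simps power2_eq_square)
    finally show "((\<lambda>y. - (ln (1 + x\<^sup>2 / y\<^sup>2) / 2)) has_real_derivative 1 / y - y / (y\<^sup>2 + x\<^sup>2)) (at y)" .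
    have "y / (y\<^sup>2 + x\<^sup>2) \<le> y / y\<^sup>2" using y by (intro divide_left_mono) (auto intro!: mult_pos_pos add_pos_nonneg)
    then show "0 \<le> 1 / y - y / (y\<^sup>2 + x\<^sup>2)" using y by (simp add: power2_eq_square)
  next
    have "((\<lambda>y::real. x\<^sup>2 * (inverse y)\<^sup>2) \<longlongrightarrow> x\<^sup>2 * 0\<^sup>2) at_top"
      by (intro tendsto_intros tendsto_inverse_0_at_top filterlim_ident)
    then have l: "((\<lambda>y::real. x\<^sup>2 / y\<^sup>2) \<longlongrightarrow> 0) at_top"
      by (simp add: divide_inverse power_inverse)
    have "((\<lambda>y. - (ln (1 + x\<^sup>2 / y\<^sup>2) / 2)) \<longlongrightarrow> - (ln (1 + 0) / 2)) at_top"
      by (intro tendsto_intros l) auto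
    then show "((\<lambda>y. - (ln (1 + x\<^sup>2 / y\<^sup>2) / 2)) \<longlongrightarrow> 0) at_top" by simp
  qed simp
  finally show "(\<integral>\<^sup>+t. ennreal (exp (- (b * t)) * (1 - cos (t * x)) / t * indicator {0<..} t) \<partial>lborel)
     = ennreal (ln (1 + x\<^sup>2 / b\<^sup>2) / 2)" by simp
  show "AE t in lborel. 0 \<le> exp (- (b * t)) * (1 - cos (t * x)) / t * indicator {0<..} t"
    by (auto simp: indicator_def)
  show "0 \<le> ln (1 + x\<^sup>2 / b\<^sup>2) / 2" by simp
qed simp

text \<open>The exponent 1/8 is chosen for later use: squaring yields 1/4, and Cauchy-Schwarz then
  yields moments of order 1/2 and -1/2, the ones that are available. The constant 9 is 1 + 8, from
  ln 2 < 1 and from the bound on ln x.\<close>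

lemma ln_one_plus_le:
  fixes x :: real
  assumes "x \<ge> 0"
  shows "ln (1 + x) \<le> 9 * x powr (1/8)"
proof (cases "x \<le> 1")
  case True
  have "ln (1 + x) \<le> x" using assms by (rule ln_add_one_self_le_self)
  also have "x = x powr 1" using assms by simp
  also have "x powr 1 \<le> x powr (1/8)" using assms True by (intro powr_mono') auto
  finally show ?thesis using powr_ge_zero[of x "1/8"] by linarith
next
  case False
  have "ln (1 + x) \<le> ln (2 * x)" using False by (subst ln_le_cancel_iff) auto
  also have "\<dots> = ln 2 + ln x" using False by (simp add: ln_mult)
  also have "ln 2 \<le> (1::real)" using ln_2_less_1 by simp
  also have "ln x \<le> x powr (1/8) / (1/8)" using False by (intro ln_powr_bound) auto
  finally have "ln (1 + x) \<le> 1 + 8 * x powr (1/8)" by simp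
  moreover have "1 \<le> x powr (1/8)" using False by (intro ge_one_powr_ge_zero) auto
  ultimately show ?thesis by simp
qed

text \<open>The logarithm of the ratio of the larger to the smaller modulus is at most ln (1 + |a -
  b| / smaller). Both possible denominators are kept in the sum, so that no case distinction on
  random values is needed afterwards; 81 is the square of 9.\<close>

lemma ln_diff_square_le:
  fixes a b :: real
  assumes "a \<noteq> 0" "b \<noteq> 0"
  shows "(ln \<bar>a\<bar> - ln \<bar>b\<bar>)\<^sup>2 \<le> 81 * (\<bar>a - b\<bar> powr (1/4) * \<bar>a\<bar> powr (-1/4) + \<bar>a - b\<bar> powr (1/4) * \<bar>b\<bar> powr (-1/4))"
proof -
  have *: "(ln \<bar>a\<bar> - ln \<bar>b\<bar>)\<^sup>2 \<le> 81 * (\<bar>a - b\<bar> powr (1/4) * \<bar>b\<bar> powr (-1/4))"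
    if "a \<noteq> 0" "b \<noteq> 0" "\<bar>b\<bar> \<le> \<bar>a\<bar>" for a b :: real
  proof -
    have "ln \<bar>a\<bar> - ln \<bar>b\<bar> = ln (\<bar>a\<bar> / \<bar>b\<bar>)" using that by (simp add: ln_div)
    also have "\<dots> \<le> ln (1 + \<bar>a - b\<bar> / \<bar>b\<bar>)"
      using that by (subst ln_le_cancel_iff) (auto simp: field_simps add_pos_nonneg)
    also have "\<dots> \<le> 9 * (\<bar>a - b\<bar> / \<bar>b\<bar>) powr (1/8)" by (rule ln_one_plus_le) simp
    finally have "ln \<bar>a\<bar> - ln \<bar>b\<bar> \<le> 9 * (\<bar>a - b\<bar> / \<bar>b\<bar>) powr (1/8)" .
    moreover have "0 \<le> ln \<bar>a\<bar> - ln \<bar>b\<bar>" using that by simp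
    ultimately have "(ln \<bar>a\<bar> - ln \<bar>b\<bar>)\<^sup>2 \<le> (9 * (\<bar>a - b\<bar> / \<bar>b\<bar>) powr (1/8))\<^sup>2"
      by (intro power_mono)
    also have "\<dots> = 81 * (\<bar>a - b\<bar> / \<bar>b\<bar>) powr (1/4)"
      by (simp add: power_mult_distrib power2_eq_square flip: powr_add)
    also have "(\<bar>a - b\<bar> / \<bar>b\<bar>) powr (1/4) = \<bar>a - b\<bar> powr (1/4) * \<bar>b\<bar> powr (-1/4)"
    proof -
      have "\<bar>b\<bar> powr (-1/4) = 1 / \<bar>b\<bar> powr (1/4)"
        by (metis minus_divide_left powr_minus_divide)
      then show ?thesis by (simp only: powr_divide abs_ge_zero times_divide_eq_right mult_1_right)
    qed
    finally show ?thesis .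
  qed
  show ?thesis
  proof (cases "\<bar>b\<bar> \<le> \<bar>a\<bar>")
    case True
    show ?thesis by (rule order_trans[OF *[OF assms True]]) simp
  next
    case False
    then have "(ln \<bar>b\<bar> - ln \<bar>a\<bar>)\<^sup>2 \<le> 81 * (\<bar>b - a\<bar> powr (1/4) * \<bar>a\<bar> powr (-1/4))"
      by (intro * assms) simp
    then have "(ln \<bar>a\<bar> - ln \<bar>b\<bar>)\<^sup>2 \<le> 81 * (\<bar>a - b\<bar> powr (1/4) * \<bar>a\<bar> powr (-1/4))"
      by (simp only: power2_commute[of "ln \<bar>b\<bar>"] abs_minus_commute[of b])
    then show ?thesis by (rule order_trans) simp
  qed
qed

text \<open>Quarter powers dominate the logarithm in both directions, so that its square is
  controlled by the moments of order 1/2 and -1/2.\<close>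

lemma ln_square_le:
  fixes y :: real
  assumes "y > 0"
  shows "(ln y)\<^sup>2 \<le> 16 * (y powr (1/2) + y powr (-1/2))"
proof -
  have *: "(ln y)\<^sup>2 \<le> 16 * y powr (1/2)" if "y \<ge> 1" for y :: real
  proof -
    have "ln y \<le> y powr (1/4) / (1/4)" using that by (intro ln_powr_bound) auto
    then have "(ln y)\<^sup>2 \<le> (4 * y powr (1/4))\<^sup>2" using that by (intro power_mono) auto
    also have "\<dots> = 16 * y powr (1/2)" by (simp add: power_mult_distrib power2_eq_square flip: powr_add)
    finally show ?thesis .
  qed
  show ?thesis
  proof (cases "y \<ge> 1")
    case True
    show ?thesis by (rule order_trans[OF *[OF True]]) simp
  next
    case False
    have "(ln (1 / y))\<^sup>2 \<le> 16 * (1 / y) powr (1/2)"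
      using False assms by (intro *) (simp add: field_simps)
    moreover have "(1 / y) powr (1/2) = y powr (-1/2)" using assms by (simp add: powr_divide powr_minus_divide)
    moreover have "(ln (1 / y))\<^sup>2 = (ln y)\<^sup>2" using assms by (simp add: ln_div)
    ultimately have "(ln y)\<^sup>2 \<le> 16 * y powr (-1/2)" by simp
    then show ?thesis by (rule order_trans) simp
  qed
qed

section \<open>Logarithmic moments of stable integrals\<close>

lemma (in pair_sigma_finite) integrable_prod_dominated:
  fixes f :: "'a \<times> 'b \<Rightarrow> real" and a :: "'a \<Rightarrow> real" and A :: "'b \<Rightarrow> real"
  assumes f [measurable]: "f \<in> borel_measurable (M1 \<Otimes>\<^sub>M M2)"
    and a: "integrable M1 a" and A: "integrable M2 A"
    and le: "\<And>x y. \<bar>f (x, y)\<bar> \<le> a x * A y"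
  shows "integrable (M1 \<Otimes>\<^sub>M M2) f"
proof -
  have [measurable]: "a \<in> borel_measurable M1" "A \<in> borel_measurable M2" using a A by auto
  have "integrable (M1 \<Otimes>\<^sub>M M2) (\<lambda>p. a (fst p) * A (snd p))"
  proof (rule Fubini_integrable)
    show "integrable M1 (\<lambda>x. \<integral>y. norm (a (fst (x, y)) * A (snd (x, y))) \<partial>M2)"
      using a by (simp add: abs_mult)
    show "AE x in M1. integrable M2 (\<lambda>y. a (fst (x, y)) * A (snd (x, y)))"
      using A by simp
  qed simp
  then show ?thesis
  proof (rule integrable_dominated)
    show "AE p in M1 \<Otimes>\<^sub>M M2. norm (f p) \<le> norm (a (fst p) * A (snd p))"
      using le by (auto intro!: AE_I2 intro: order_trans[OF _ abs_ge_self])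
  qed simp
qed

lemma (in prob_space) expectation_cos_char:
  assumes [measurable]: "Y \<in> borel_measurable M"
  shows "expectation (\<lambda>x. cos (\<theta> * Y x)) = Re (char (distr M borel Y) \<theta>)"
proof -
  have "complex_integrable M (\<lambda>x. iexp (\<theta> * Y x))"
    by (rule integrable_const_bound[of _ 1]) auto
  then have "Re (CLINT x|M. iexp (\<theta> * Y x)) = expectation (\<lambda>x. Re (iexp (\<theta> * Y x)))"
    by (rule integral_Re[symmetric])
  then show ?thesis by (simp add: char_def integral_distr Re_exp)
qed

context sas_noise begin

lemma expectation_cos:
  assumes Y: "stable_int f Y"
  shows "expectation (\<lambda>x. cos (\<theta> * Y x)) = exp (- (\<bar>\<theta>\<bar> powr \<alpha> * powint \<alpha> f))"
  using expectation_cos_char[OF stable_int_measurable[OF Y], of \<theta>] stable_int_char[OF Y, of \<theta>] by simp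

lemma stable_int_law:
  assumes "stable_int f Y" "stable_int g Z" "powint \<alpha> f = powint \<alpha> g"
  shows "distr P borel Y = distr P borel Z"
proof (rule Levy_uniqueness)
  have [measurable]: "Y \<in> borel_measurable P" "Z \<in> borel_measurable P"
    using assms stable_int_measurable by auto
  show "real_distribution (distr P borel Y)" "real_distribution (distr P borel Z)"
    by (intro real_distribution_distr; simp)+
  show "char (distr P borel Y) = char (distr P borel Z)"
    using assms by (auto simp: stable_int_char)
qed

text \<open>A standard symmetric stable variable, of scale 1. By \<open>stable_int_scale\<close>
  every stable integral has the law of a multiple of it, so moments are computed once.\<close>

definition Z0 :: "'a \<Rightarrow> real" where "Z0 = S (indicator {0..1})"

lemma stable_int_Z0: "stable_int (indicator {0..1}) Z0"
  unfolding Z0_def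
proof (rule stable_int_simple, rule fin_simpleI[where I="{()}" and B="\<lambda>_. {0..1}" and c="\<lambda>_. 1"])
qed (auto simp: finite_lborel_sets_def)

lemma Z0_measurable [measurable]: "Z0 \<in> borel_measurable P"
  by (rule stable_int_measurable[OF stable_int_Z0])

lemma powint_indicator: "powint \<alpha> (indicator {0..1}) = 1"
proof -
  have "(\<lambda>u. \<bar>indicator {0..1} u :: real\<bar> powr \<alpha>) = (indicator {0..1} :: real \<Rightarrow> real)"
    by (auto simp: indicator_def)
  then show ?thesis by (simp add: powint_def)
qed

lemma stable_int_scale:
  assumes Y: "stable_int f Y"
  shows "distr P borel Y = distr P borel (\<lambda>x. powint \<alpha> f powr (1 / \<alpha>) * Z0 x)"
proof (rule stable_int_law[OF Y])
  let ?s = "powint \<alpha> f powr (1 / \<alpha>)"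
  show "stable_int (\<lambda>u. ?s * indicator {0..1} u) (\<lambda>x. ?s * Z0 x)"
    using stable_int_lincomb[OF stable_int_Z0 stable_int_Z0, of ?s 0] by simp
  show "powint \<alpha> f = powint \<alpha> (\<lambda>u. ?s * indicator {0..1} u)"
    using \<alpha> by (simp add: powint_cmult powint_indicator powr_powr)
qed

lemma scale_transfer:
  assumes Y: "stable_int f Y" and [measurable]: "\<phi> \<in> borel_measurable borel"
  shows "integrable P (\<lambda>x. \<phi> (Y x)) \<longleftrightarrow> integrable P (\<lambda>x. \<phi> (powint \<alpha> f powr (1 / \<alpha>) * Z0 x) :: real)"
    and "expectation (\<lambda>x. \<phi> (Y x)) = expectation (\<lambda>x. \<phi> (powint \<alpha> f powr (1 / \<alpha>) * Z0 x) :: real)"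
proof -
  have [measurable]: "Y \<in> borel_measurable P" by (rule stable_int_measurable[OF Y])
  note e = stable_int_scale[OF Y]
  have "integrable P (\<lambda>x. \<phi> (Y x)) \<longleftrightarrow> integrable (distr P borel Y) \<phi>"
    by (simp add: integrable_distr_eq)
  then show "integrable P (\<lambda>x. \<phi> (Y x)) \<longleftrightarrow> integrable P (\<lambda>x. \<phi> (powint \<alpha> f powr (1 / \<alpha>) * Z0 x) :: real)"
    unfolding e by (simp add: integrable_distr_eq)
  have "expectation (\<lambda>x. \<phi> (Y x)) = integral\<^sup>L (distr P borel Y) \<phi>"
    by (simp add: integral_distr)
  then show "expectation (\<lambda>x. \<phi> (Y x)) = expectation (\<lambda>x. \<phi> (powint \<alpha> f powr (1 / \<alpha>) * Z0 x) :: real)"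
    unfolding e by (simp add: integral_distr)
qed

text \<open>The integral of (1 - cos (t z)) / t^2 over t > 0 is at least a multiple of |z|. Taking
  expectations inside turns the numerator into 1 - exp (- t^\<alpha>), which is of order t^\<alpha>
  at 0, so that \<alpha> > 1 makes the integral finite.\<close>

lemma Z0_integrable: "integrable P (\<lambda>x. \<bar>Z0 x\<bar>)"
proof -
  interpret PP: pair_sigma_finite P lborel ..
  \<comment> \<open>Only t between 1/|z| and 2/|z| is used: there t |z| lies in [1, 2], so the
    numerator is at least 1 - cos 1 and 1/t^2 is at least z^2/4, on an interval of length
    1/|z|.\<close>
  define c where "c = (1 - cos 1) / (4::real)"
  have "cos 1 < cos (0::real)" using pi_gt3 by (intro cos_monotone_0_pi) auto
  then have c: "c > 0" by (simp add: c_def)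
  have low: "ennreal (c * \<bar>z\<bar>) \<le> (\<integral>\<^sup>+t. ennreal ((1 - cos (t * z)) / t\<^sup>2) * indicator {0<..} t \<partial>lborel)" for z :: real
  proof (cases "z = 0")
    case False
    have "ennreal (c * \<bar>z\<bar>) = ennreal (c * z\<^sup>2) * ennreal (1 / \<bar>z\<bar>)"
    proof -
      have "z\<^sup>2 = \<bar>z\<bar> * \<bar>z\<bar>" by (simp add: power2_eq_square)
      have "z\<^sup>2 * (1 / \<bar>z\<bar>) = \<bar>z\<bar>" unfolding \<open>z\<^sup>2 = \<bar>z\<bar> * \<bar>z\<bar>\<close> using False by (simp del: abs_mult_self_eq)
      then have "c * \<bar>z\<bar> = c * z\<^sup>2 * (1 / \<bar>z\<bar>)" by (simp only: mult.assoc)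
      moreover have "ennreal (c * z\<^sup>2 * (1 / \<bar>z\<bar>)) = ennreal (c * z\<^sup>2) * ennreal (1 / \<bar>z\<bar>)"
        using c by (intro ennreal_mult) auto
      ultimately show ?thesis by simp
    qed
    also have "ennreal (1 / \<bar>z\<bar>) = emeasure lborel {1 / \<bar>z\<bar>..2 / \<bar>z\<bar>}"
      using False by (simp add: divide_right_mono diff_divide_distrib[symmetric])
    also have "ennreal (c * z\<^sup>2) * \<dots> = (\<integral>\<^sup>+t. ennreal (c * z\<^sup>2) * indicator {1 / \<bar>z\<bar>..2 / \<bar>z\<bar>} t \<partial>lborel)"
      by (rule nn_integral_cmult_indicator[symmetric]) simp
    also have "\<dots> \<le> (\<integral>\<^sup>+t. ennreal ((1 - cos (t * z)) / t\<^sup>2) * indicator {0<..} t \<partial>lborel)"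
    proof (intro nn_integral_mono)
      fix t :: real
      show "ennreal (c * z\<^sup>2) * indicator {1 / \<bar>z\<bar>..2 / \<bar>z\<bar>} t \<le> ennreal ((1 - cos (t * z)) / t\<^sup>2) * indicator {0<..} t"
      proof (cases "t \<in> {1 / \<bar>z\<bar>..2 / \<bar>z\<bar>}")
        case True
        have "0 < 1 / \<bar>z\<bar>" using False by simp
        moreover have "1 / \<bar>z\<bar> \<le> t" using True by (simp only: atLeastAtMost_iff)
        ultimately have t: "t > 0" by (rule less_le_trans)
        have b: "1 \<le> t * \<bar>z\<bar>" "t * \<bar>z\<bar> \<le> 2" using True False by (auto simp: field_simps)
        have "cos (t * z) = cos (t * \<bar>z\<bar>)" by (cases "z \<ge> 0") (auto simp: abs_if)
        also have "\<dots> \<le> cos 1" using b pi_gt3 by (intro cos_monotone_0_pi_le) auto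
        finally have 1: "1 - cos 1 \<le> 1 - cos (t * z)" by simp
        have "(t * \<bar>z\<bar>)\<^sup>2 \<le> 2\<^sup>2" using b by (intro power_mono) auto
        then have "z\<^sup>2 * t\<^sup>2 \<le> 4" by (simp add: power_mult_distrib mult.commute)
        then have 2: "z\<^sup>2 / 4 \<le> 1 / t\<^sup>2" using t by (simp add: field_simps)
        have "(1 - cos 1) * (z\<^sup>2 / 4) \<le> (1 - cos (t * z)) * (1 / t\<^sup>2)"
          using 1 2 by (intro mult_mono) auto
        then show ?thesis using True t by (simp add: c_def ennreal_leI)
      qed simp
    qed
    finally show ?thesis .
  qed simp
  have up: "(\<integral>\<^sup>+x. ennreal ((1 - cos (t * Z0 x)) / t\<^sup>2) * indicator {0<..} t \<partial>P)
     \<le> ennreal (t powr (\<alpha> - 2)) * indicator {0..1} t + ennreal (t powr (-2)) * indicator {1..} t" for t :: real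
  proof (cases "t > 0")
    case True
    have i: "integrable P (\<lambda>x. cos (t * Z0 x))" by (rule integrable_const_bound[of _ 1]) auto
    have "(\<integral>\<^sup>+x. ennreal ((1 - cos (t * Z0 x)) / t\<^sup>2) * indicator {0<..} t \<partial>P)
      = (\<integral>\<^sup>+x. ennreal ((1 - cos (t * Z0 x)) / t\<^sup>2) \<partial>P)" using True by simp
    also have "\<dots> = ennreal (expectation (\<lambda>x. (1 - cos (t * Z0 x)) / t\<^sup>2))"
      using i by (intro nn_integral_eq_integral) auto
    also have "expectation (\<lambda>x. (1 - cos (t * Z0 x)) / t\<^sup>2) = (1 - exp (- (t powr \<alpha>))) / t\<^sup>2"
      using i expectation_cos[OF stable_int_Z0, of t] True by (simp add: prob_space powint_indicator)
    also have "ennreal \<dots> \<le> ennreal (t powr (\<alpha> - 2)) * indicator {0..1} t + ennreal (t powr (-2)) * indicator {1..} t"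
    proof (cases "t \<le> 1")
      case t: True
      have "1 - exp (- (t powr \<alpha>)) \<le> t powr \<alpha>" using exp_ge_add_one_self[of "- (t powr \<alpha>)"] by simp
      then have "(1 - exp (- (t powr \<alpha>))) / t\<^sup>2 \<le> t powr \<alpha> / t powr 2"
        using True by (simp add: divide_right_mono powr_numeral)
      also have "\<dots> = t powr (\<alpha> - 2)" by (simp add: powr_diff)
      finally have "ennreal ((1 - exp (- (t powr \<alpha>))) / t\<^sup>2) \<le> ennreal (t powr (\<alpha> - 2)) * indicator {0..1} t"
        using True t by (simp add: ennreal_leI)
      then show ?thesis by (rule order_trans) simp
    next
      case False
      have "(1 - exp (- (t powr \<alpha>))) / t\<^sup>2 \<le> 1 / t powr 2"
        using True by (simp add: divide_right_mono powr_numeral)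
      also have "\<dots> = t powr (-2)" by (simp add: powr_minus_divide)
      finally show ?thesis using False by (simp add: ennreal_leI)
    qed
    finally show ?thesis .
  qed simp
  have "(\<integral>\<^sup>+x. ennreal (c * \<bar>Z0 x\<bar>) \<partial>P) \<le> (\<integral>\<^sup>+x. (\<integral>\<^sup>+t. ennreal ((1 - cos (t * Z0 x)) / t\<^sup>2) * indicator {0<..} t \<partial>lborel) \<partial>P)"
    by (intro nn_integral_mono low)
  also have "\<dots> = (\<integral>\<^sup>+t. (\<integral>\<^sup>+x. ennreal ((1 - cos (t * Z0 x)) / t\<^sup>2) * indicator {0<..} t \<partial>P) \<partial>lborel)"
    by (rule PP.Fubini'[symmetric]) measurable
  also have "\<dots> \<le> (\<integral>\<^sup>+t. ennreal (t powr (\<alpha> - 2)) * indicator {0..1} t + ennreal (t powr (-2)) * indicator {1..} t \<partial>lborel)"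
    by (intro nn_integral_mono up)
  also have "\<dots> = (\<integral>\<^sup>+t. ennreal (t powr (\<alpha> - 2)) * indicator {0..1} t \<partial>lborel) + (\<integral>\<^sup>+t. ennreal (t powr (-2)) * indicator {1..} t \<partial>lborel)"
    by (intro nn_integral_add) auto
  also have "\<dots> < \<infinity>" using \<alpha> by (simp add: nn_powr_0 nn_powr_inf)
  finally have "(\<integral>\<^sup>+x. ennreal (norm (c * \<bar>Z0 x\<bar>)) \<partial>P) < \<infinity>" using c by (simp add: abs_mult)
  then have "integrable P (\<lambda>x. c * \<bar>Z0 x\<bar>)" by (intro integrableI_bounded) auto
  then show ?thesis using c by simp
qed

text \<open>Up to the factor pi this is the Poisson average at 0 of the law of \<open>Z0\<close>,
  and a bound uniform in x stands in for a bounded density near 0. The kernel is the Laplace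
  integral of a cosine, so its expectation is an integral dominated by exp (- t^\<alpha>).\<close>

lemma Z0_resolvent_bound:
  obtains C where "C > 0" "\<And>x. x > 0 \<Longrightarrow> expectation (\<lambda>\<omega>. x / (x\<^sup>2 + (Z0 \<omega>)\<^sup>2)) \<le> C"
proof -
  interpret LP: pair_sigma_finite lborel P ..
  define C where "C = 1 + (\<integral>t. indicator {0..1} t + t powr (- \<alpha>) * indicator {1..} t \<partial>lborel)"
  have i: "integrable lborel (\<lambda>t. indicator {0..1} t + t powr (- \<alpha>) * indicator {1..} t)"
    using \<alpha> by (intro Bochner_Integration.integrable_add integrable_real_indicator integrable_powr_inf) auto
  have "0 \<le> (\<integral>t. indicator {0..1} t + t powr (- \<alpha>) * indicator {1..} t \<partial>lborel)"
    by (intro integral_nonneg_AE AE_I2) (auto simp: indicator_def)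
  then have C: "C > 0" unfolding C_def by linarith
  show ?thesis
  proof (rule that[OF C])
    fix x :: real assume x: "x > 0"
    have e: "integrable lborel (\<lambda>t. exp (- (x * t)) * indicator {0..} t)"
      using integral_exp_cos[OF x, of 0] by (auto simp: has_bochner_integral_iff)
    have int: "integrable (lborel \<Otimes>\<^sub>M P) (\<lambda>(t, \<omega>). exp (- (x * t)) * cos (t * Z0 \<omega>) * indicator {0..} t)"
      by (rule LP.integrable_prod_dominated[OF _ e, of _ "\<lambda>_. 1"])
         (auto simp: abs_mult indicator_def mult_left_le)
    have "expectation (\<lambda>\<omega>. x / (x\<^sup>2 + (Z0 \<omega>)\<^sup>2))
       = (\<integral>\<omega>. (\<integral>t. exp (- (x * t)) * cos (t * Z0 \<omega>) * indicator {0..} t \<partial>lborel) \<partial>P)"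
      using integral_exp_cos[OF x] by (intro Bochner_Integration.integral_cong) (auto simp: has_bochner_integral_iff)
    also have "\<dots> = (\<integral>t. (\<integral>\<omega>. exp (- (x * t)) * cos (t * Z0 \<omega>) * indicator {0..} t \<partial>P) \<partial>lborel)"
      by (rule LP.Fubini_integral[OF int])
    also have "\<dots> = (\<integral>t. exp (- (x * t)) * exp (- (\<bar>t\<bar> powr \<alpha>)) * indicator {0..} t \<partial>lborel)"
      using expectation_cos[OF stable_int_Z0] by (simp add: powint_indicator)
    also have "\<dots> \<le> (\<integral>t. indicator {0..1} t + t powr (- \<alpha>) * indicator {1..} t \<partial>lborel)"
    proof (rule integral_mono_AE'[OF i])
      have "exp (- (x * t)) * exp (- (\<bar>t\<bar> powr \<alpha>)) * indicator {0..} t \<le> indicator {0..1} t + t powr (- \<alpha>) * indicator {1..} t" for t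
      proof (cases "t \<ge> 0")
        case True
        have "exp (- (x * t)) * exp (- (\<bar>t\<bar> powr \<alpha>)) \<le> 1 * exp (- (t powr \<alpha>))"
          using x True by (intro mult_mono) auto
        also have "1 * exp (- (t powr \<alpha>)) \<le> indicator {0..1} t + t powr (- \<alpha>) * indicator {1..} t"
        proof (cases "t \<le> 1")
          case False
          have "1 + t powr \<alpha> \<le> exp (t powr \<alpha>)" by (rule exp_ge_add_one_self)
          then have "t powr \<alpha> \<le> exp (t powr \<alpha>)" by linarith
          then have "exp (- (t powr \<alpha>)) \<le> inverse (t powr \<alpha>)"
            unfolding exp_minus using False by (intro le_imp_inverse_le) auto
          then show ?thesis using False by (simp add: powr_minus)
        next
          case t: True
          have "exp (- (t powr \<alpha>)) \<le> 1" by simp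
          moreover have "0 \<le> t powr (- \<alpha>) * indicator {1..} t" by simp
          ultimately have "exp (- (t powr \<alpha>)) \<le> 1 + t powr (- \<alpha>) * indicator {1..} t" by linarith
          then show ?thesis using True t by (simp only: indicator_simps atLeastAtMost_iff simp_thms)
        qed
        finally show ?thesis using True by simp
      qed simp
      then show "AE t in lborel. exp (- (x * t)) * exp (- (\<bar>t\<bar> powr \<alpha>)) * indicator {0..} t \<le> indicator {0..1} t + t powr (- \<alpha>) * indicator {1..} t"
        by simp
    qed (auto simp: indicator_def)
    also have "\<dots> \<le> C" by (simp add: C_def)
    finally show "expectation (\<lambda>\<omega>. x / (x\<^sup>2 + (Z0 \<omega>)\<^sup>2)) \<le> C" .
  qed
qed

lemma resolvent_integrable:
  assumes [measurable]: "Y \<in> borel_measurable P" and x: "x > 0"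
  shows "integrable P (\<lambda>\<omega>. x / (x\<^sup>2 + (Y \<omega>)\<^sup>2) :: real)"
proof (rule integrable_const_bound[of _ "x / x\<^sup>2"])
  show "AE \<omega> in P. norm (x / (x\<^sup>2 + (Y \<omega>)\<^sup>2)) \<le> x / x\<^sup>2"
  proof (rule AE_I2)
    fix \<omega>
    have "x / (x\<^sup>2 + (Y \<omega>)\<^sup>2) \<le> x / x\<^sup>2"
      using x by (intro divide_left_mono) (auto intro!: mult_pos_pos add_pos_nonneg)
    then show "norm (x / (x\<^sup>2 + (Y \<omega>)\<^sup>2)) \<le> x / x\<^sup>2" using x by simp
  qed
qed simp

text \<open>At \<open>Z0 = 0\<close> the Poisson kernel equals 1/x. Hence an atom at 0 has mass at
  most C x for every x > 0.\<close>

lemma Z0_nonzero: "AE \<omega> in P. Z0 \<omega> \<noteq> 0"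
proof -
  obtain C where C: "C > 0" "\<And>x. x > 0 \<Longrightarrow> expectation (\<lambda>\<omega>. x / (x\<^sup>2 + (Z0 \<omega>)\<^sup>2)) \<le> C"
    using Z0_resolvent_bound by blast
  let ?A = "{\<omega>\<in>space P. Z0 \<omega> = 0}"
  have "prob ?A \<le> C * x" if x: "x > 0" for x
  proof -
    have "prob ?A / x = expectation (\<lambda>\<omega>. indicator ?A \<omega> / x)"
      by simp
    also have "\<dots> \<le> expectation (\<lambda>\<omega>. x / (x\<^sup>2 + (Z0 \<omega>)\<^sup>2))"
    proof (rule integral_mono)
      have "integrable P (indicator ?A :: 'a \<Rightarrow> real)"
        by (intro integrable_real_indicator) (auto simp: less_top[symmetric])
      then show "integrable P (\<lambda>\<omega>. indicator ?A \<omega> / x)" by (rule integrable_divide)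
      show "indicator ?A \<omega> / x \<le> x / (x\<^sup>2 + (Z0 \<omega>)\<^sup>2)" for \<omega>
        using x by (auto simp: indicator_def power2_eq_square)
    qed (intro resolvent_integrable x Z0_measurable)
    also have "\<dots> \<le> C" by (rule C(2)[OF x])
    finally show ?thesis using x by (simp add: field_simps)
  qed
  from this[of "e / C" for e] have "prob ?A \<le> 0 + e" if "e > 0" for e using that C(1) by simp
  then have "prob ?A \<le> 0" by (rule field_le_epsilon)
  then have "prob ?A = 0" using measure_nonneg[of P ?A] by linarith
  then show ?thesis by (subst (asm) prob_eq_0) (auto simp: AE_iff_measurable)
qed

text \<open>Averaging the Poisson kernels against x^(-1/2) over 0 < x \<le> 1 dominates |z|^(-1/2)
  for small z, up to a constant. Exchanging the integrals, each kernel has expectation at most C and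
  x^(-1/2) is integrable at 0.\<close>

lemma Z0_neg_moment: "integrable P (\<lambda>\<omega>. \<bar>Z0 \<omega>\<bar> powr (-1/2))"
proof -
  interpret PP: pair_sigma_finite P lborel ..
  obtain C where C: "C > 0" "\<And>x. x > 0 \<Longrightarrow> expectation (\<lambda>\<omega>. x / (x\<^sup>2 + (Z0 \<omega>)\<^sup>2)) \<le> C"
    using Z0_resolvent_bound by blast
  have low: "ennreal (\<bar>z\<bar> powr (-1/2)) \<le> 2 + 8 * (\<integral>\<^sup>+x. ennreal (x powr (-1/2)) * ennreal (x / (x\<^sup>2 + z\<^sup>2)) * indicator {0<..1} x \<partial>lborel)" for z :: real
  proof (cases "z = 0")
    case z: False
    show ?thesis
    proof (cases "2 * \<bar>z\<bar> \<le> 1")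
      case True
      \<comment> \<open>A lower bound of the integrand on [|z|, 2|z|], where x^2 + z^2 \<le> 5 |z|
        x. That interval has length |z|, and the factor 8 suffices because 8 exceeds 5 times the
        root of 2.\<close>
      define k where "k = (2 * \<bar>z\<bar>) powr (-1/2) * (1 / (5 * \<bar>z\<bar>))"
      have k: "k \<ge> 0" by (simp add: k_def)
      have "\<bar>z\<bar> powr (-1/2) \<le> 8 * (k * \<bar>z\<bar>)"
      proof -
        have "(2::real) powr (-1/2) = inverse (2 powr (1/2))" by (metis minus_divide_left powr_minus)
        also have "(2::real) powr (1/2) = sqrt 2" by (simp add: powr_half_sqrt)
        also have "inverse (sqrt 2) \<ge> inverse (8/5::real)"
        proof (rule le_imp_inverse_le)
          show "sqrt 2 \<le> (8/5::real)" by (rule real_le_lsqrt) (auto simp: power2_eq_square)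
        qed simp
        finally have a: "2 powr (-1/2) \<ge> (5/8::real)" by simp
        have "8 * (k * \<bar>z\<bar>) = (8/5 * 2 powr (-1/2)) * \<bar>z\<bar> powr (-1/2)"
          using z by (simp add: k_def powr_mult)
        also have "\<dots> \<ge> 1 * \<bar>z\<bar> powr (-1/2)" using a by (intro mult_right_mono) auto
        finally show ?thesis by simp
      qed
      then have "ennreal (\<bar>z\<bar> powr (-1/2)) \<le> ennreal (8 * (k * \<bar>z\<bar>))" by (rule ennreal_leI)
      also have "\<dots> = 8 * (ennreal k * ennreal \<bar>z\<bar>)" using k by (simp add: ennreal_mult)
      also have "ennreal \<bar>z\<bar> = emeasure lborel {\<bar>z\<bar>..2 * \<bar>z\<bar>}" by simp
      also have "ennreal k * \<dots> = (\<integral>\<^sup>+x. ennreal k * indicator {\<bar>z\<bar>..2 * \<bar>z\<bar>} x \<partial>lborel)"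
        by (rule nn_integral_cmult_indicator[symmetric]) simp
      also have "\<dots> \<le> (\<integral>\<^sup>+x. ennreal (x powr (-1/2)) * ennreal (x / (x\<^sup>2 + z\<^sup>2)) * indicator {0<..1} x \<partial>lborel)"
      proof (intro nn_integral_mono)
        fix x :: real
        show "ennreal k * indicator {\<bar>z\<bar>..2 * \<bar>z\<bar>} x \<le> ennreal (x powr (-1/2)) * ennreal (x / (x\<^sup>2 + z\<^sup>2)) * indicator {0<..1} x"
        proof (cases "x \<in> {\<bar>z\<bar>..2 * \<bar>z\<bar>}")
          case x: True
          then have x0: "x > 0" "x \<le> 1" using z True by auto
          have "(2 * \<bar>z\<bar>) powr (-1/2) \<le> x powr (-1/2)" using x x0 by (intro powr_mono2') auto
          moreover have "1 / (5 * \<bar>z\<bar>) \<le> x / (x\<^sup>2 + z\<^sup>2)"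
          proof -
            have "x\<^sup>2 \<le> (2 * \<bar>z\<bar>)\<^sup>2" using x x0 by (intro power_mono) auto
            then have "x\<^sup>2 + z\<^sup>2 \<le> 5 * \<bar>z\<bar> * \<bar>z\<bar>" by (simp add: power2_eq_square)
            also have "\<dots> \<le> 5 * \<bar>z\<bar> * x" using x by (intro mult_left_mono) auto
            finally have "x\<^sup>2 + z\<^sup>2 \<le> 5 * \<bar>z\<bar> * x" .
            moreover have "x\<^sup>2 + z\<^sup>2 > 0" using x0 by (intro add_pos_nonneg) auto
            ultimately show ?thesis using z by (simp add: divide_le_eq le_divide_eq mult_ac)
          qed
          ultimately have "k \<le> x powr (-1/2) * (x / (x\<^sup>2 + z\<^sup>2))"
            unfolding k_def by (intro mult_mono) auto
          then show ?thesis using x x0 by (simp add: ennreal_leI flip: ennreal_mult)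
        qed simp
      qed
      finally show ?thesis by (simp add: add_increasing mult_left_mono)
    next
      case False
      \<comment> \<open>Away from 0 the additive constant 2 is the whole bound; 1/4 is a convenient
        point below |z| whose power is exactly 2.\<close>
      have "\<bar>z\<bar> powr (-1/2) \<le> (1/4) powr (-1/2)" using False by (intro powr_mono2') auto
      also have "(1/4::real) powr (-1/2) = 2"
      proof -
        have "(1/4::real) powr (-1/2) = inverse ((1/4) powr (1/2))" by (metis minus_divide_left powr_minus)
        also have "(1/4::real) powr (1/2) = 1/2" by (simp add: powr_half_sqrt real_sqrt_divide)
        finally show ?thesis by simp
      qed
      finally have "ennreal (\<bar>z\<bar> powr (-1/2)) \<le> ennreal 2" by (rule ennreal_leI)
      then show ?thesis by (simp add: add_increasing2)
    qed
  qed simp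
  have "(\<integral>\<^sup>+\<omega>. ennreal (\<bar>Z0 \<omega>\<bar> powr (-1/2)) \<partial>P) \<le> (\<integral>\<^sup>+\<omega>. 2 + 8 * (\<integral>\<^sup>+x. ennreal (x powr (-1/2)) * ennreal (x / (x\<^sup>2 + (Z0 \<omega>)\<^sup>2)) * indicator {0<..1} x \<partial>lborel) \<partial>P)"
    by (intro nn_integral_mono low)
  also have "\<dots> = 2 + 8 * (\<integral>\<^sup>+\<omega>. (\<integral>\<^sup>+x. ennreal (x powr (-1/2)) * ennreal (x / (x\<^sup>2 + (Z0 \<omega>)\<^sup>2)) * indicator {0<..1} x \<partial>lborel) \<partial>P)"
    by (subst nn_integral_add) (auto simp: nn_integral_cmult emeasure_space_1)
  also have "(\<integral>\<^sup>+\<omega>. (\<integral>\<^sup>+x. ennreal (x powr (-1/2)) * ennreal (x / (x\<^sup>2 + (Z0 \<omega>)\<^sup>2)) * indicator {0<..1} x \<partial>lborel) \<partial>P)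
     = (\<integral>\<^sup>+x. (\<integral>\<^sup>+\<omega>. ennreal (x powr (-1/2)) * ennreal (x / (x\<^sup>2 + (Z0 \<omega>)\<^sup>2)) * indicator {0<..1} x \<partial>P) \<partial>lborel)"
    by (rule PP.Fubini'[symmetric]) measurable
  also have "\<dots> \<le> (\<integral>\<^sup>+x. ennreal C * (ennreal (x powr (-1/2)) * indicator {0..1} x) \<partial>lborel)"
  proof (intro nn_integral_mono)
    fix x :: real
    show "(\<integral>\<^sup>+\<omega>. ennreal (x powr (-1/2)) * ennreal (x / (x\<^sup>2 + (Z0 \<omega>)\<^sup>2)) * indicator {0<..1} x \<partial>P)
      \<le> ennreal C * (ennreal (x powr (-1/2)) * indicator {0..1} x)"
    proof (cases "x \<in> {0<..1}")
      case True
      then have x: "x > 0" by simp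
      have "(\<integral>\<^sup>+\<omega>. ennreal (x powr (-1/2)) * ennreal (x / (x\<^sup>2 + (Z0 \<omega>)\<^sup>2)) * indicator {0<..1} x \<partial>P)
        = ennreal (x powr (-1/2)) * (\<integral>\<^sup>+\<omega>. ennreal (x / (x\<^sup>2 + (Z0 \<omega>)\<^sup>2)) \<partial>P)"
        using True by (simp add: nn_integral_cmult)
      also have "(\<integral>\<^sup>+\<omega>. ennreal (x / (x\<^sup>2 + (Z0 \<omega>)\<^sup>2)) \<partial>P) = ennreal (expectation (\<lambda>\<omega>. x / (x\<^sup>2 + (Z0 \<omega>)\<^sup>2)))"
        using x by (intro nn_integral_eq_integral resolvent_integrable) auto
      also have "ennreal (x powr (-1/2)) * \<dots> \<le> ennreal (x powr (-1/2)) * ennreal C"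
        using C(2)[OF x] by (intro mult_left_mono ennreal_leI) auto
      finally show ?thesis using True by (simp add: mult.commute)
    qed simp
  qed
  also have "\<dots> = ennreal C * ennreal 2"
    using nn_powr_0[of "-1/2" 1] by (simp add: nn_integral_cmult)
  finally have "(\<integral>\<^sup>+\<omega>. ennreal (\<bar>Z0 \<omega>\<bar> powr (-1/2)) \<partial>P) \<le> 2 + 8 * (ennreal C * ennreal 2)"
    by (simp add: add_left_mono mult_left_mono)
  also have "\<dots> < \<infinity>" by (simp add: ennreal_mult_less_top)
  finally show ?thesis by (intro integrableI_bounded) auto
qed

end

text \<open>Growth of order 1/2 only: a product of two such bounds, one in Y and one in Z, has
  finite expectation although Y and Z have no second moments.\<close>

lemma one_minus_cos_le: "1 - cos y \<le> 2 * \<bar>y\<bar> powr (1/2)" for y :: real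
proof (cases "\<bar>y\<bar> \<le> 1")
  case True
  have "1 - cos y \<le> \<bar>Re (iexp y - iexp 0)\<bar>" by (simp add: Re_exp)
  also have "\<dots> \<le> \<bar>y\<bar>" using norm_iexp_diff_le[of y 0] by (intro order_trans[OF abs_Re_le_cmod]) simp
  also have "\<bar>y\<bar> = \<bar>y\<bar> powr 1" by simp
  also have "\<dots> \<le> \<bar>y\<bar> powr (1/2)" using True by (intro powr_mono') auto
  finally show ?thesis using powr_ge_zero[of "\<bar>y\<bar>" "1/2"] by linarith
next
  case False
  have "1 \<le> \<bar>y\<bar> powr (1/2)" using False by (intro ge_one_powr_ge_zero) auto
  moreover have "1 - cos y \<le> 2" using cos_ge_minus_one[of y] by linarith
  ultimately show ?thesis by linarith
qed

lemma norm_le_norm: "0 \<le> a \<Longrightarrow> a \<le> b \<Longrightarrow> norm a \<le> norm b" for a b :: real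
  by simp

lemma integrable_exp_powr_half:
  fixes b :: real
  assumes b: "b > 0"
  shows "integrable lborel (\<lambda>t. 2 * exp (- (b * t)) * t powr (-1/2) * indicator {0<..} t)"
proof (rule integrable_dominated)
  have "integrable lborel (\<lambda>t. exp (- (b * t)) * indicator {0..} t)"
    using integral_exp_cos[OF b, of 0] by (auto simp: has_bochner_integral_iff)
  then show "integrable lborel (\<lambda>t. 2 * (t powr (-1/2) * indicator {0..1} t) + 2 * (exp (- (b * t)) * indicator {0..} t))"
    by (intro Bochner_Integration.integrable_add integrable_mult_right integrable_powr_0) auto
  have le0: "exp (- (b * t)) * t powr (-1/2) * indicator {0<..} t
    \<le> t powr (-1/2) * indicator {0..1} t + exp (- (b * t)) * indicator {0..} t" for t
  proof (cases "t > 0")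
    case True
    show ?thesis
    proof (cases "t \<le> 1")
      case t: True
      have "exp (- (b * t)) * t powr (-1/2) \<le> 1 * t powr (-1/2)" using b True by (intro mult_right_mono) auto
      moreover have "0 \<le> exp (- (b * t))" by simp
      ultimately have "exp (- (b * t)) * t powr (-1/2) \<le> t powr (-1/2) + exp (- (b * t))" by linarith
      then show ?thesis using True t by (simp add: indicator_def)
    next
      case False
      have "t powr (-1/2) \<le> t powr 0" using False by (intro powr_mono) auto
      then have "exp (- (b * t)) * t powr (-1/2) \<le> exp (- (b * t)) * 1" using True by (intro mult_left_mono) auto
      then show ?thesis using True False by (simp add: indicator_def)
    qed
  qed (auto simp: indicator_def)
  have le: "2 * exp (- (b * t)) * t powr (-1/2) * indicator {0<..} t
    \<le> 2 * (t powr (-1/2) * indicator {0..1} t) + 2 * (exp (- (b * t)) * indicator {0..} t)" for t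
    using mult_left_mono[OF le0[of t], of 2] by (simp only: mult.assoc distrib_left)
  show "AE t in lborel. norm (2 * exp (- (b * t)) * t powr (-1/2) * indicator {0<..} t)
    \<le> norm (2 * (t powr (-1/2) * indicator {0..1} t) + 2 * (exp (- (b * t)) * indicator {0..} t))"
    by (intro AE_I2 norm_le_norm le mult_nonneg_nonneg) (auto simp: indicator_def)
qed simp

section \<open>Covariances of parameter integrals\<close>

context prob_space begin

text \<open>The uncentred form of \<open>covariance\<close>. Each of its terms is a plain
  expectation, to which Fubini applies directly.\<close>

definition cv :: "('a \<Rightarrow> real) \<Rightarrow> ('a \<Rightarrow> real) \<Rightarrow> real" where
  "cv X Y = expectation (\<lambda>x. X x * Y x) - expectation X * expectation Y"

lemma cv_commute: "cv X Y = cv Y X"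
  by (simp add: cv_def mult.commute)

lemma covariance_eq_cv:
  assumes "integrable M X" "integrable M Y" "integrable M (\<lambda>x. X x * Y x)"
  shows "covariance M X Y = cv X Y"
proof -
  have "covariance M X Y = expectation (\<lambda>x. X x * Y x - expectation Y * X x - expectation X * Y x + expectation X * expectation Y)"
    by (simp add: covariance_def algebra_simps)
  also have "\<dots> = cv X Y" using assms by (simp add: cv_def prob_space algebra_simps)
  finally show ?thesis .
qed

lemma cv_affine:
  assumes "integrable M X" "integrable M Y" "integrable M (\<lambda>x. X x * Y x)"
  shows "cv (\<lambda>x. a + b * X x) (\<lambda>x. c + d * Y x) = b * d * cv X Y"
proof -
  have "expectation (\<lambda>x. (a + b * X x) * (c + d * Y x))
     = expectation (\<lambda>x. a * c + (a * d) * Y x + (b * c) * X x + (b * d) * (X x * Y x))"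
    by (simp add: algebra_simps)
  then show ?thesis using assms by (simp add: cv_def prob_space algebra_simps)
qed

text \<open>The product bound \<open>a t * A \<omega>\<close> makes both \<open>U\<close> and its
  product with \<open>G\<close> integrable on the product space, as Fubini needs for the two terms
  of \<open>cv\<close>.\<close>

lemma cv_integral:
  fixes U :: "real \<Rightarrow> 'a \<Rightarrow> real"
  assumes U [measurable]: "case_prod U \<in> borel_measurable (lborel \<Otimes>\<^sub>M M)"
    and a: "integrable lborel a" and A: "integrable M A" and G: "integrable M G"
    and AG: "integrable M (\<lambda>\<omega>. A \<omega> * \<bar>G \<omega>\<bar>)"
    and le: "\<And>t \<omega>. \<bar>U t \<omega>\<bar> \<le> a t * A \<omega>"
  shows "cv (\<lambda>\<omega>. \<integral>t. U t \<omega> \<partial>lborel) G = (\<integral>t. cv (U t) G \<partial>lborel)"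
    and "integrable lborel (\<lambda>t. cv (U t) G)"
proof -
  interpret LP: pair_sigma_finite lborel M ..
  have [measurable]: "G \<in> borel_measurable M" using G by auto
  have i1: "integrable (lborel \<Otimes>\<^sub>M M) (\<lambda>(t, \<omega>). U t \<omega>)"
    by (rule LP.integrable_prod_dominated[OF _ a A]) (use le in auto)
  have i2: "integrable (lborel \<Otimes>\<^sub>M M) (\<lambda>(t, \<omega>). U t \<omega> * G \<omega>)"
  proof (rule LP.integrable_prod_dominated[OF _ a AG])
    show "\<bar>case (x, y) of (t, \<omega>) \<Rightarrow> U t \<omega> * G \<omega>\<bar> \<le> a x * (A y * \<bar>G y\<bar>)" for x y
      using mult_right_mono[OF le[of x y], of "\<bar>G y\<bar>"] by (simp add: abs_mult mult.assoc)
  qed measurable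
  have j1: "integrable lborel (\<lambda>t. expectation (U t))"
    using LP.integrable_fst[OF i1] by simp
  have j2: "integrable lborel (\<lambda>t. expectation (\<lambda>\<omega>. U t \<omega> * G \<omega>))"
    using LP.integrable_fst[OF i2] by simp
  show "integrable lborel (\<lambda>t. cv (U t) G)"
    unfolding cv_def using j1 j2 by (intro Bochner_Integration.integrable_diff integrable_mult_left) auto
  have "(\<integral>t. cv (U t) G \<partial>lborel) = (\<integral>t. expectation (\<lambda>\<omega>. U t \<omega> * G \<omega>) \<partial>lborel) - (\<integral>t. expectation (U t) \<partial>lborel) * expectation G"
    unfolding cv_def using j1 j2 by simp
  also have "(\<integral>t. expectation (\<lambda>\<omega>. U t \<omega> * G \<omega>) \<partial>lborel) = expectation (\<lambda>\<omega>. \<integral>t. U t \<omega> * G \<omega> \<partial>lborel)"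
    by (rule LP.Fubini_integral[OF i2, symmetric])
  also have "\<dots> = expectation (\<lambda>\<omega>. (\<integral>t. U t \<omega> \<partial>lborel) * G \<omega>)" by simp
  also have "(\<integral>t. expectation (U t) \<partial>lborel) = expectation (\<lambda>\<omega>. \<integral>t. U t \<omega> \<partial>lborel)"
    by (rule LP.Fubini_integral[OF i1, symmetric])
  finally show "cv (\<lambda>\<omega>. \<integral>t. U t \<omega> \<partial>lborel) G = (\<integral>t. cv (U t) G \<partial>lborel)" by (simp add: cv_def)
qed

end

context sas_noise begin

lemma abs_moment:
  assumes Y: "stable_int f Y"
  shows "integrable P (\<lambda>x. \<bar>Y x\<bar>)" "integrable P Y"
    and "expectation (\<lambda>x. \<bar>Y x\<bar>) = powint \<alpha> f powr (1 / \<alpha>) * expectation (\<lambda>x. \<bar>Z0 x\<bar>)"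
proof -
  show *: "integrable P (\<lambda>x. \<bar>Y x\<bar>)"
    using Z0_integrable by (subst scale_transfer(1)[OF Y]) (auto simp: abs_mult)
  show "integrable P Y" using * stable_int_measurable[OF Y] by (subst integrable_norm_iff[symmetric]) auto
  show "expectation (\<lambda>x. \<bar>Y x\<bar>) = powint \<alpha> f powr (1 / \<alpha>) * expectation (\<lambda>x. \<bar>Z0 x\<bar>)"
    by (subst scale_transfer(2)[OF Y]) (auto simp: abs_mult)
qed

lemma half_moment:
  assumes Y: "stable_int f Y"
  shows "integrable P (\<lambda>\<omega>. \<bar>Y \<omega>\<bar> powr (1/2))"
    and "expectation (\<lambda>\<omega>. \<bar>Y \<omega>\<bar> powr (1/2)) = powint \<alpha> f powr (1 / (2 * \<alpha>)) * expectation (\<lambda>\<omega>. \<bar>Z0 \<omega>\<bar> powr (1/2))"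
proof -
  have [measurable]: "Y \<in> borel_measurable P" by (rule stable_int_measurable[OF Y])
  show "integrable P (\<lambda>\<omega>. \<bar>Y \<omega>\<bar> powr (1/2))"
  proof (rule integrable_dominated)
    show "integrable P (\<lambda>\<omega>. 1 + \<bar>Y \<omega>\<bar>)" using abs_moment(1)[OF Y] by simp
    have "x powr (1/2) \<le> 1 + x" if "x \<ge> 0" for x :: real
    proof (cases "x \<le> 1")
      case True
      have "x powr (1/2) \<le> 1 powr (1/2)" using True that by (intro powr_mono2) auto
      then show ?thesis using that by simp
    next
      case False
      have "x powr (1/2) \<le> x powr 1" using False by (intro powr_mono) auto
      then show ?thesis using that by simp
    qed
    then show "AE \<omega> in P. norm (\<bar>Y \<omega>\<bar> powr (1/2)) \<le> norm (1 + \<bar>Y \<omega>\<bar>)" by simp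
  qed simp
  show "expectation (\<lambda>\<omega>. \<bar>Y \<omega>\<bar> powr (1/2)) = powint \<alpha> f powr (1 / (2 * \<alpha>)) * expectation (\<lambda>\<omega>. \<bar>Z0 \<omega>\<bar> powr (1/2))"
    by (subst scale_transfer(2)[OF Y]) (auto simp: abs_mult powr_mult powr_powr mult.commute)
qed

lemma neg_moment:
  assumes Y: "stable_int f Y"
  shows "integrable P (\<lambda>x. \<bar>Y x\<bar> powr (-1/2))"
    and "expectation (\<lambda>x. \<bar>Y x\<bar> powr (-1/2)) = powint \<alpha> f powr (- 1 / (2 * \<alpha>)) * expectation (\<lambda>x. \<bar>Z0 x\<bar> powr (-1/2))"
proof -
  show "integrable P (\<lambda>x. \<bar>Y x\<bar> powr (-1/2))"
    using Z0_neg_moment by (subst scale_transfer(1)[OF Y]) (auto simp: abs_mult powr_mult)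
  show "expectation (\<lambda>x. \<bar>Y x\<bar> powr (-1/2)) = powint \<alpha> f powr (- 1 / (2 * \<alpha>)) * expectation (\<lambda>x. \<bar>Z0 x\<bar> powr (-1/2))"
    by (subst scale_transfer(2)[OF Y]) (auto simp: abs_mult powr_mult powr_powr mult.commute)
qed

lemma stable_int_nonzero:
  assumes Y: "stable_int f Y" and f: "powint \<alpha> f > 0"
  shows "AE \<omega> in P. Y \<omega> \<noteq> 0"
proof -
  have [measurable]: "Y \<in> borel_measurable P" by (rule stable_int_measurable[OF Y])
  have "AE \<omega> in P. powint \<alpha> f powr (1 / \<alpha>) * Z0 \<omega> \<noteq> 0"
    using Z0_nonzero f by auto
  then have "AE x in distr P borel Y. x \<noteq> 0"
    unfolding stable_int_scale[OF Y] by (subst AE_distr_iff) auto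
  then show ?thesis by (subst (asm) AE_distr_iff) auto
qed

lemma ln_square_integrable:
  assumes Y: "stable_int f Y"
  shows "sqint (\<lambda>x. ln \<bar>Y x\<bar>)"
proof -
  have [measurable]: "Y \<in> borel_measurable P" by (rule stable_int_measurable[OF Y])
  show ?thesis
  proof (rule integrable_dominated)
    show "integrable P (\<lambda>x. 16 * (\<bar>Y x\<bar> powr (1/2) + \<bar>Y x\<bar> powr (-1/2)))"
      using half_moment(1)[OF Y] neg_moment(1)[OF Y] by simp
    show "AE x in P. norm ((ln \<bar>Y x\<bar>)\<^sup>2) \<le> norm (16 * (\<bar>Y x\<bar> powr (1/2) + \<bar>Y x\<bar> powr (-1/2)))"
    proof (rule AE_I2)
      fix x
      show "norm ((ln \<bar>Y x\<bar>)\<^sup>2) \<le> norm (16 * (\<bar>Y x\<bar> powr (1/2) + \<bar>Y x\<bar> powr (-1/2)))"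
        using ln_square_le[of "\<bar>Y x\<bar>"] by (cases "Y x = 0") auto
    qed
  qed simp
qed

lemma ln_integrable:
  assumes Y: "stable_int f Y"
  shows "integrable P (\<lambda>x. ln \<bar>Y x\<bar>)"
proof -
  have [measurable]: "Y \<in> borel_measurable P" by (rule stable_int_measurable[OF Y])
  show ?thesis by (rule square_integrable_imp_integrable[OF _ ln_square_integrable[OF Y]]) simp
qed

lemma ln_scale:
  assumes f: "powint \<alpha> f > 0"
  shows "AE x in P. ln \<bar>powint \<alpha> f powr (1 / \<alpha>) * Z0 x\<bar> = ln (powint \<alpha> f) / \<alpha> + ln \<bar>Z0 x\<bar>"
  using Z0_nonzero
proof eventually_elim
  case (elim x)
  then show ?case using f \<alpha> by (simp add: abs_mult ln_mult ln_powr)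
qed

lemma ln_mean:
  assumes Y: "stable_int f Y" and f: "powint \<alpha> f > 0"
  shows "expectation (\<lambda>x. ln \<bar>Y x\<bar>) = ln (powint \<alpha> f) / \<alpha> + expectation (\<lambda>x. ln \<bar>Z0 x\<bar>)"
proof -
  have "expectation (\<lambda>x. ln \<bar>Y x\<bar>) = expectation (\<lambda>x. ln \<bar>powint \<alpha> f powr (1 / \<alpha>) * Z0 x\<bar>)"
    by (rule scale_transfer(2)[OF Y]) simp
  also have "\<dots> = expectation (\<lambda>x. ln (powint \<alpha> f) / \<alpha> + ln \<bar>Z0 x\<bar>)"
    using ln_scale[OF f] by (intro integral_cong_AE) auto
  finally show ?thesis using ln_integrable[OF stable_int_Z0] by (simp add: prob_space)
qed

definition cln :: "('a \<Rightarrow> real) \<Rightarrow> 'a \<Rightarrow> real" where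
  "cln Y x = ln \<bar>Y x\<bar> - expectation (\<lambda>x. ln \<bar>Y x\<bar>)"

text \<open>By \<open>cln_var\<close> this is the variance of the logarithm of every nondegenerate
  stable integral.\<close>

definition V0 :: real where "V0 = msq (cln Z0)"

lemma cln_props:
  assumes Y: "stable_int f Y"
  shows "cln Y \<in> borel_measurable P" "sqint (cln Y)" "integrable P (cln Y)" "expectation (cln Y) = 0"
proof -
  have [measurable]: "Y \<in> borel_measurable P" by (rule stable_int_measurable[OF Y])
  show "cln Y \<in> borel_measurable P" unfolding cln_def[abs_def] by simp
  show "sqint (cln Y)"
    unfolding cln_def using ln_integrable[OF Y] ln_square_integrable[OF Y] by (simp add: power2_diff)
  show "integrable P (cln Y)" "expectation (cln Y) = 0"
    unfolding cln_def[abs_def] using ln_integrable[OF Y] by (simp_all add: prob_space)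
qed

text \<open>The scale of a stable integral enters its logarithm as an additive constant, which
  centring removes.\<close>

lemma cln_var:
  assumes Y: "stable_int f Y" and f: "powint \<alpha> f > 0"
  shows "msq (cln Y) = V0"
proof -
  have "msq (cln Y)
     = msq (\<lambda>x. ln \<bar>powint \<alpha> f powr (1 / \<alpha>) * Z0 x\<bar> - expectation (\<lambda>x. ln \<bar>Y x\<bar>))"
    unfolding cln_def by (rule scale_transfer(2)[OF Y]) simp
  also have "\<dots> = V0" unfolding V0_def
  proof (rule integral_cong_AE)
    show "AE x in P. (ln \<bar>powint \<alpha> f powr (1 / \<alpha>) * Z0 x\<bar> - expectation (\<lambda>x. ln \<bar>Y x\<bar>))\<^sup>2 = (cln Z0 x)\<^sup>2"
      using ln_scale[OF f] by eventually_elim (simp add: ln_mean[OF Y f] cln_def)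
  qed (auto simp: cln_def)
  finally show ?thesis .
qed

lemma V0_nonneg: "V0 \<ge> 0" by (simp add: V0_def)

lemma cln_cov_le_V0:
  assumes Y: "stable_int f Y" "powint \<alpha> f > 0" and Z: "stable_int g Z" "powint \<alpha> g > 0"
  shows "\<bar>expectation (\<lambda>x. cln Y x * cln Z x)\<bar> \<le> V0"
  using cauchy_schwarz_integral(3)[OF cln_props(1)[OF Y(1)] cln_props(1)[OF Z(1)] cln_props(2)[OF Y(1)] cln_props(2)[OF Z(1)]]
  by (simp add: cln_var[OF Y] cln_var[OF Z] V0_nonneg)

text \<open>Cauchy-Schwarz after \<open>ln_diff_square_le\<close> separates a moment of order 1/2 of
  Y - Z, of size \<open>powint powr (1 / (2 * \<alpha>))\<close> before the root is taken, from a
  negative moment of Y or Z. The latter blows up as the scale shrinks, hence the lower bound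
  \<open>m\<close>. Centring can only decrease the mean square.\<close>

lemma ln_distance:
  assumes m: "m > 0"
  obtains K where "K \<ge> 0" "\<And>f g Y Z. stable_int f Y \<Longrightarrow> stable_int g Z \<Longrightarrow> powint \<alpha> f \<ge> m \<Longrightarrow> powint \<alpha> g \<ge> m \<Longrightarrow>
    msq (\<lambda>\<omega>. cln Y \<omega> - cln Z \<omega>) \<le> K * powint \<alpha> (\<lambda>u. f u - g u) powr (1 / (4 * \<alpha>))"
proof -
  define mh where "mh = expectation (\<lambda>\<omega>. \<bar>Z0 \<omega>\<bar> powr (1/2))"
  define mn where "mn = expectation (\<lambda>\<omega>. \<bar>Z0 \<omega>\<bar> powr (-1/2))"
  have nn: "mh \<ge> 0" "mn \<ge> 0" by (simp_all add: mh_def mn_def)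
  \<comment> \<open>Twice the constant 81 of \<open>ln_diff_square_le\<close>, once for each of its
    two summands.\<close>
  define K where "K = 162 * (sqrt mh * sqrt (m powr (- 1 / (2 * \<alpha>)) * mn))"
  have K: "K \<ge> 0" using nn by (simp add: K_def)
  show ?thesis
  proof (rule that[OF K])
    fix f g Y Z assume Y: "stable_int f Y" and Z: "stable_int g Z" and fm: "powint \<alpha> f \<ge> m" and gm: "powint \<alpha> g \<ge> m"
    have [measurable]: "Y \<in> borel_measurable P" "Z \<in> borel_measurable P"
      using stable_int_measurable Y Z by auto
    let ?d = "powint \<alpha> (\<lambda>u. f u - g u)"
    have D: "stable_int (\<lambda>u. f u - g u) (\<lambda>\<omega>. Y \<omega> - Z \<omega>)"
      using stable_int_lincomb[OF Y Z, of 1 "-1"] by simp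
    have one: "integrable P (\<lambda>\<omega>. \<bar>Y \<omega> - Z \<omega>\<bar> powr (1/4) * \<bar>W \<omega>\<bar> powr (-1/4))
       \<and> expectation (\<lambda>\<omega>. \<bar>Y \<omega> - Z \<omega>\<bar> powr (1/4) * \<bar>W \<omega>\<bar> powr (-1/4)) \<le> ?d powr (1 / (4 * \<alpha>)) * (K / 162)"
      if W: "stable_int w W" "powint \<alpha> w \<ge> m" for w W
    proof -
      have [measurable]: "W \<in> borel_measurable P" using stable_int_measurable W by auto
      have sq: "(x powr (1/4))\<^sup>2 = x powr (1/2)" "(x powr (-1/4))\<^sup>2 = x powr (-1/2)" for x :: real
        by (simp_all add: power2_eq_square flip: powr_add)
      have i: "sqint (\<lambda>\<omega>. \<bar>Y \<omega> - Z \<omega>\<bar> powr (1/4))" "sqint (\<lambda>\<omega>. \<bar>W \<omega>\<bar> powr (-1/4))"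
        unfolding sq by (rule half_moment(1)[OF D]) (rule neg_moment(1)[OF W(1)])
      have "expectation (\<lambda>\<omega>. \<bar>Y \<omega> - Z \<omega>\<bar> powr (1/4) * \<bar>W \<omega>\<bar> powr (-1/4))
        \<le> sqrt (msq (\<lambda>\<omega>. \<bar>Y \<omega> - Z \<omega>\<bar> powr (1/4))) * sqrt (msq (\<lambda>\<omega>. \<bar>W \<omega>\<bar> powr (-1/4)))"
        by (rule order_trans[OF abs_ge_self cauchy_schwarz_integral(3)[OF _ _ i]]) simp_all
      also have "msq (\<lambda>\<omega>. \<bar>Y \<omega> - Z \<omega>\<bar> powr (1/4)) = ?d powr (1 / (2 * \<alpha>)) * mh"
        unfolding sq mh_def by (rule half_moment(2)[OF D])
      also have "msq (\<lambda>\<omega>. \<bar>W \<omega>\<bar> powr (-1/4)) = powint \<alpha> w powr (- 1 / (2 * \<alpha>)) * mn"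
        unfolding sq mn_def by (rule neg_moment(2)[OF W(1)])
      also have "sqrt (?d powr (1 / (2 * \<alpha>)) * mh) = ?d powr (1 / (4 * \<alpha>)) * sqrt mh"
      proof -
        have "sqrt (?d powr (1 / (2 * \<alpha>))) = (?d powr (1 / (2 * \<alpha>))) powr (1/2)" by (simp add: powr_half_sqrt)
        also have "\<dots> = ?d powr (1 / (4 * \<alpha>))" by (simp add: powr_powr)
        finally show ?thesis by (simp add: real_sqrt_mult)
      qed
      also have "?d powr (1 / (4 * \<alpha>)) * sqrt mh * sqrt (powint \<alpha> w powr (- 1 / (2 * \<alpha>)) * mn)
         \<le> ?d powr (1 / (4 * \<alpha>)) * sqrt mh * sqrt (m powr (- 1 / (2 * \<alpha>)) * mn)"
      proof -
        have "powint \<alpha> w powr (- 1 / (2 * \<alpha>)) \<le> m powr (- 1 / (2 * \<alpha>))"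
          using W(2) m \<alpha> by (intro powr_mono2') auto
        then show ?thesis using nn by (intro mult_left_mono real_sqrt_le_mono mult_right_mono) auto
      qed
      also have "\<dots> = ?d powr (1 / (4 * \<alpha>)) * (K / 162)" by (simp add: K_def)
      finally show ?thesis using cauchy_schwarz_integral(1)[OF _ _ i] by simp
    qed
    note 1 = one[OF Y fm] and 2 = one[OF Z gm]
    have ie: "sqint (\<lambda>\<omega>. ln \<bar>Y \<omega>\<bar> - ln \<bar>Z \<omega>\<bar>)"
      using ln_square_integrable[OF Y] ln_square_integrable[OF Z]
        cauchy_schwarz_integral(1)[of "\<lambda>\<omega>. ln \<bar>Y \<omega>\<bar>" P "\<lambda>\<omega>. ln \<bar>Z \<omega>\<bar>"]
      by (simp add: power2_diff mult.assoc)
    have id: "integrable P (\<lambda>\<omega>. ln \<bar>Y \<omega>\<bar> - ln \<bar>Z \<omega>\<bar>)"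
      using ln_integrable[OF Y] ln_integrable[OF Z] by simp
    have "msq (\<lambda>\<omega>. cln Y \<omega> - cln Z \<omega>) = variance (\<lambda>\<omega>. ln \<bar>Y \<omega>\<bar> - ln \<bar>Z \<omega>\<bar>)"
      using ln_integrable[OF Y] ln_integrable[OF Z] by (simp add: cln_def algebra_simps)
    also have "\<dots> \<le> msq (\<lambda>\<omega>. ln \<bar>Y \<omega>\<bar> - ln \<bar>Z \<omega>\<bar>)"
      by (subst variance_eq[OF id ie]) simp
    also have "\<dots> \<le> expectation (\<lambda>\<omega>. 81 * (\<bar>Y \<omega> - Z \<omega>\<bar> powr (1/4) * \<bar>Y \<omega>\<bar> powr (-1/4) + \<bar>Y \<omega> - Z \<omega>\<bar> powr (1/4) * \<bar>Z \<omega>\<bar> powr (-1/4)))"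
    proof (rule integral_mono_AE[OF ie])
      show "integrable P (\<lambda>\<omega>. 81 * (\<bar>Y \<omega> - Z \<omega>\<bar> powr (1/4) * \<bar>Y \<omega>\<bar> powr (-1/4) + \<bar>Y \<omega> - Z \<omega>\<bar> powr (1/4) * \<bar>Z \<omega>\<bar> powr (-1/4)))"
        using 1 2 by (intro integrable_mult_right Bochner_Integration.integrable_add) blast+
      have "AE \<omega> in P. Y \<omega> \<noteq> 0" "AE \<omega> in P. Z \<omega> \<noteq> 0"
        using stable_int_nonzero Y Z fm gm m by force+
      then show "AE \<omega> in P. (ln \<bar>Y \<omega>\<bar> - ln \<bar>Z \<omega>\<bar>)\<^sup>2 \<le> 81 * (\<bar>Y \<omega> - Z \<omega>\<bar> powr (1/4) * \<bar>Y \<omega>\<bar> powr (-1/4) + \<bar>Y \<omega> - Z \<omega>\<bar> powr (1/4) * \<bar>Z \<omega>\<bar> powr (-1/4))"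
        by eventually_elim (rule ln_diff_square_le)
    qed
    also have "\<dots> = 81 * (expectation (\<lambda>\<omega>. \<bar>Y \<omega> - Z \<omega>\<bar> powr (1/4) * \<bar>Y \<omega>\<bar> powr (-1/4)) + expectation (\<lambda>\<omega>. \<bar>Y \<omega> - Z \<omega>\<bar> powr (1/4) * \<bar>Z \<omega>\<bar> powr (-1/4)))"
      using Bochner_Integration.integral_add[OF conjunct1[OF 1] conjunct1[OF 2]] by (simp only: integral_mult_right_zero)
    also have "\<dots> \<le> 81 * (?d powr (1 / (4 * \<alpha>)) * (K / 162) + ?d powr (1 / (4 * \<alpha>)) * (K / 162))"
      using 1 2 by (intro mult_left_mono add_mono) auto
    also have "\<dots> = K * ?d powr (1 / (4 * \<alpha>))" by simp
    finally show "msq (\<lambda>\<omega>. cln Y \<omega> - cln Z \<omega>) \<le> K * ?d powr (1 / (4 * \<alpha>))" .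
  qed
qed

section \<open>Covariances of logarithms\<close>

text \<open>Equal to ln (sqrt (b^2 + x^2)) - ln b: a logarithm smoothed at scale b and normalised to
  vanish at 0. It is the value of the Frullani integral of \<open>log_ker\<close>.\<close>

definition log_reg :: "real \<Rightarrow> real \<Rightarrow> real" where
  "log_reg b x = ln (1 + x\<^sup>2 / b\<^sup>2) / 2"

definition log_ker :: "real \<Rightarrow> real \<Rightarrow> real \<Rightarrow> real" where
  "log_ker b t x = exp (- (b * t)) * (1 - cos (t * x)) / t * indicator {0<..} t"

text \<open>The covariance of cos (s Y) and cos (t Z) for the integrals Y of \<open>f\<close> and Z
  of \<open>g\<close>, written with the product-to-sum formula and characteristic functions. It is
  stated in terms of \<open>f\<close> and \<open>g\<close> alone.\<close>

definition cos_cov :: "(real \<Rightarrow> real) \<Rightarrow> (real \<Rightarrow> real) \<Rightarrow> real \<Rightarrow> real \<Rightarrow> real" where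
  "cos_cov f g s t = (exp (- powint \<alpha> (\<lambda>u. s * f u + t * g u)) + exp (- powint \<alpha> (\<lambda>u. s * f u - t * g u))) / 2
     - exp (- powint \<alpha> (\<lambda>u. s * f u)) * exp (- powint \<alpha> (\<lambda>u. t * g u))"

lemma log_ker_measurable [measurable]: "(\<lambda>p. log_ker b (fst p) (snd p)) \<in> borel_measurable (borel \<Otimes>\<^sub>M borel)"
  unfolding log_ker_def by measurable

lemma log_ker_measurable2 [measurable]: "log_ker b t \<in> borel_measurable borel"
  unfolding log_ker_def[abs_def] by measurable

lemma log_ker_integral:
  assumes "b > 0"
  shows "integrable lborel (\<lambda>t. log_ker b t x)" "(\<integral>t. log_ker b t x \<partial>lborel) = log_reg b x"
  using integral_log_kernel[OF assms, of x] unfolding log_ker_def log_reg_def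
  by (auto simp: has_bochner_integral_iff)

definition log_wt :: "real \<Rightarrow> real \<Rightarrow> real" where
  "log_wt b t = 2 * exp (- (b * t)) * t powr (-1/2) * indicator {0<..} t"

lemma log_ker_bound: "\<bar>log_ker b t x\<bar> \<le> log_wt b t * \<bar>x\<bar> powr (1/2)"
proof (cases "t > 0")
  case True
  have "\<bar>log_ker b t x\<bar> = exp (- (b * t)) * ((1 - cos (t * x)) / t)"
    using True by (simp add: log_ker_def abs_mult abs_divide)
  also have "\<dots> \<le> exp (- (b * t)) * (2 * \<bar>t * x\<bar> powr (1/2) / t)"
    using True by (intro mult_left_mono divide_right_mono one_minus_cos_le) auto
  also have "\<bar>t * x\<bar> powr (1/2) = t powr (1/2) * \<bar>x\<bar> powr (1/2)"
    using True by (simp add: abs_mult powr_mult)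
  also have "exp (- (b * t)) * (2 * (t powr (1/2) * \<bar>x\<bar> powr (1/2)) / t) = 2 * exp (- (b * t)) * (t powr (1/2) / t) * \<bar>x\<bar> powr (1/2)"
    by simp
  also have "t powr (1/2) / t = t powr (-1/2)" using True powr_diff[of t "1/2" 1] by simp
  finally show ?thesis using True by (simp add: log_wt_def)
qed (simp add: log_ker_def log_wt_def)

lemma log_wt_nonneg: "0 \<le> log_wt b t"
  by (simp add: log_wt_def)

lemma log_wt_integrable: "b > 0 \<Longrightarrow> integrable lborel (log_wt b)"
  using integrable_exp_powr_half[of b] by (simp add: log_wt_def[abs_def])

lemma log_reg_bound:
  assumes "b > 0"
  shows "\<bar>log_reg b x\<bar> \<le> (\<integral>t. log_wt b t \<partial>lborel) * \<bar>x\<bar> powr (1/2)"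
proof -
  have "\<bar>log_reg b x\<bar> \<le> (\<integral>t. \<bar>log_ker b t x\<bar> \<partial>lborel)"
    unfolding log_ker_integral(2)[OF assms, symmetric] by (rule integral_abs_bound)
  also have "\<dots> \<le> (\<integral>t. log_wt b t * \<bar>x\<bar> powr (1/2) \<partial>lborel)"
    using log_ker_integral(1)[OF assms] log_wt_integrable[OF assms]
    by (intro integral_mono log_ker_bound integrable_abs integrable_mult_left) auto
  finally show ?thesis by simp
qed

lemma half_product_integrable:
  assumes Y: "stable_int f Y" and Z: "stable_int g Z"
  shows "integrable P (\<lambda>\<omega>. \<bar>Y \<omega>\<bar> powr (1/2) * \<bar>Z \<omega>\<bar> powr (1/2))"
proof -
  have [measurable]: "Y \<in> borel_measurable P" "Z \<in> borel_measurable P"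
    using stable_int_measurable Y Z by auto
  have "(\<bar>x\<bar> powr (1/2))\<^sup>2 = \<bar>x\<bar>" for x :: real by (simp add: power2_eq_square flip: powr_add)
  then show ?thesis using abs_moment(1)[OF Y] abs_moment(1)[OF Z]
    by (intro cauchy_schwarz_integral(1)) auto
qed

lemma log_ker_cov:
  assumes Y: "stable_int f Y" and Z: "stable_int g Z"
  shows "cv (\<lambda>\<omega>. log_ker b t (Z \<omega>)) (\<lambda>\<omega>. log_ker b s (Y \<omega>))
    = exp (- (b * t)) / t * indicator {0<..} t * (exp (- (b * s)) / s * indicator {0<..} s) * cos_cov f g s t"
proof -
  have [measurable]: "Y \<in> borel_measurable P" "Z \<in> borel_measurable P"
    using stable_int_measurable Y Z by auto
  let ?c = "exp (- (b * t)) / t * indicator {0<..} t" and ?d = "exp (- (b * s)) / s * indicator {0<..} s"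
  have i: "integrable P (\<lambda>\<omega>. cos (t * Z \<omega>))" "integrable P (\<lambda>\<omega>. cos (s * Y \<omega>))"
    by (rule integrable_const_bound[of _ 1]; simp)+
  have "\<bar>cos x * cos y\<bar> \<le> 1" for x y :: real
    using mult_mono[OF abs_cos_le_one[of x] abs_cos_le_one[of y]] by (simp add: abs_mult)
  then have i2: "integrable P (\<lambda>\<omega>. cos (t * Z \<omega>) * cos (s * Y \<omega>))"
    by (intro integrable_const_bound[of _ 1]) auto
  have "cv (\<lambda>\<omega>. log_ker b t (Z \<omega>)) (\<lambda>\<omega>. log_ker b s (Y \<omega>))
     = cv (\<lambda>\<omega>. ?c + (- ?c) * cos (t * Z \<omega>)) (\<lambda>\<omega>. ?d + (- ?d) * cos (s * Y \<omega>))"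
    by (simp add: log_ker_def algebra_simps diff_divide_distrib)
  also have "\<dots> = (- ?c) * (- ?d) * cv (\<lambda>\<omega>. cos (t * Z \<omega>)) (\<lambda>\<omega>. cos (s * Y \<omega>))"
    by (rule cv_affine[OF i i2])
  also have "cv (\<lambda>\<omega>. cos (t * Z \<omega>)) (\<lambda>\<omega>. cos (s * Y \<omega>)) = cos_cov f g s t"
  proof -
    have st: "stable_int (\<lambda>u. s * f u + t * g u) (\<lambda>\<omega>. s * Y \<omega> + t * Z \<omega>)"
      by (rule stable_int_lincomb[OF Y Z])
    have dt: "stable_int (\<lambda>u. s * f u - t * g u) (\<lambda>\<omega>. s * Y \<omega> - t * Z \<omega>)"
      using stable_int_lincomb[OF Y Z, of s "-t"] by simp
    have sy: "stable_int (\<lambda>u. s * f u) (\<lambda>\<omega>. s * Y \<omega>)" using stable_int_lincomb[OF Y Y, of s 0] by simp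
    have tz: "stable_int (\<lambda>u. t * g u) (\<lambda>\<omega>. t * Z \<omega>)" using stable_int_lincomb[OF Z Z, of t 0] by simp
    have j: "integrable P (\<lambda>\<omega>. cos (s * Y \<omega> + t * Z \<omega>))" "integrable P (\<lambda>\<omega>. cos (s * Y \<omega> - t * Z \<omega>))"
      by (rule integrable_const_bound[of _ 1]; simp)+
    have "expectation (\<lambda>\<omega>. cos (t * Z \<omega>) * cos (s * Y \<omega>))
      = expectation (\<lambda>\<omega>. (cos (s * Y \<omega> + t * Z \<omega>) + cos (s * Y \<omega> - t * Z \<omega>)) / 2)"
      by (simp add: cos_add cos_diff mult.commute)
    also have "\<dots> = (expectation (\<lambda>\<omega>. cos (s * Y \<omega> + t * Z \<omega>)) + expectation (\<lambda>\<omega>. cos (s * Y \<omega> - t * Z \<omega>))) / 2"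
      using j by simp
    finally show ?thesis
      using expectation_cos[OF st, of 1] expectation_cos[OF dt, of 1] expectation_cos[OF sy, of 1] expectation_cos[OF tz, of 1]
      by (simp add: cv_def cos_cov_def)
  qed
  finally show ?thesis by simp
qed

text \<open>Two applications of \<open>cv_integral\<close>: first the logarithm of Y is expanded
  while that of Z is kept, then, for each fixed s, that of Z. Domination by half powers reduces the
  integrability of all products to first absolute moments.\<close>

lemma log_reg_cov:
  assumes Y: "stable_int f Y" and Z: "stable_int g Z" and b: "b > 0"
  defines "w \<equiv> \<lambda>t. exp (- (b * t)) / t * indicator {0<..} t"
  shows "cv (\<lambda>x. log_reg b (Y x)) (\<lambda>x. log_reg b (Z x)) = (\<integral>s. (\<integral>t. w t * w s * cos_cov f g s t \<partial>lborel) \<partial>lborel)"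
    and "integrable lborel (\<lambda>s. \<integral>t. w t * w s * cos_cov f g s t \<partial>lborel)"
    and "\<And>s. integrable lborel (\<lambda>t. w t * w s * cos_cov f g s t)"
proof -
  have [measurable]: "Y \<in> borel_measurable P" "Z \<in> borel_measurable P"
    using stable_int_measurable Y Z by auto
  have [measurable]: "log_reg b \<in> borel_measurable borel" unfolding log_reg_def[abs_def] by measurable
  let ?k = "\<integral>t. log_wt b t \<partial>lborel"
  have k: "?k \<ge> 0" by (simp add: log_wt_nonneg)
  have reg_int: "integrable P (\<lambda>x. log_reg b (W x))" if W: "stable_int w W" for w W
  proof (rule integrable_dominated[OF integrable_mult_right[OF half_moment(1)[OF W], of ?k]])
    have [measurable]: "W \<in> borel_measurable P" using stable_int_measurable W by auto
    show "(\<lambda>x. log_reg b (W x)) \<in> borel_measurable P" by measurable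
    show "AE x in P. norm (log_reg b (W x)) \<le> norm (?k * \<bar>W x\<bar> powr (1/2))"
      using log_reg_bound[OF b] by (intro AE_I2) (metis abs_ge_self order_trans real_norm_def)
  qed
  have m: "case_prod (\<lambda>t x. log_ker b t (W x)) \<in> borel_measurable (lborel \<Otimes>\<^sub>M P)" if [measurable]: "W \<in> borel_measurable P" for W
    unfolding log_ker_def by measurable
  have prod: "integrable P (\<lambda>x. \<bar>Y x\<bar> powr (1/2) * \<bar>log_reg b (Z x)\<bar>)"
  proof (rule integrable_dominated[OF integrable_mult_right[OF half_product_integrable[OF Y Z], of ?k]])
    show "AE x in P. norm (\<bar>Y x\<bar> powr (1/2) * \<bar>log_reg b (Z x)\<bar>) \<le> norm (?k * (\<bar>Y x\<bar> powr (1/2) * \<bar>Z x\<bar> powr (1/2)))"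
    proof (rule AE_I2)
      fix x
      have "\<bar>Y x\<bar> powr (1/2) * \<bar>log_reg b (Z x)\<bar> \<le> \<bar>Y x\<bar> powr (1/2) * (?k * \<bar>Z x\<bar> powr (1/2))"
        by (intro mult_left_mono log_reg_bound b) auto
      then show "norm (\<bar>Y x\<bar> powr (1/2) * \<bar>log_reg b (Z x)\<bar>) \<le> norm (?k * (\<bar>Y x\<bar> powr (1/2) * \<bar>Z x\<bar> powr (1/2)))"
        using k log_wt_nonneg[of b] by (simp add: abs_mult mult_ac)
    qed
  qed measurable
  note 1 = cv_integral[OF m log_wt_integrable[OF b] half_moment(1)[OF Y] reg_int[OF Z] prod log_ker_bound, simplified]
  have ker_int: "integrable P (\<lambda>x. log_ker b s (Y x))" for s
  proof (rule integrable_dominated[OF integrable_mult_right[OF half_moment(1)[OF Y], of "log_wt b s"]])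
    show "AE x in P. norm (log_ker b s (Y x)) \<le> norm (log_wt b s * \<bar>Y x\<bar> powr (1/2))"
      using log_ker_bound by (intro AE_I2) (metis abs_ge_self order_trans real_norm_def)
  qed measurable
  have prod2: "integrable P (\<lambda>x. \<bar>Z x\<bar> powr (1/2) * \<bar>log_ker b s (Y x)\<bar>)" for s
  proof (rule integrable_dominated[OF integrable_mult_right[OF half_product_integrable[OF Y Z], of "log_wt b s"]])
    show "AE x in P. norm (\<bar>Z x\<bar> powr (1/2) * \<bar>log_ker b s (Y x)\<bar>) \<le> norm (log_wt b s * (\<bar>Y x\<bar> powr (1/2) * \<bar>Z x\<bar> powr (1/2)))"
    proof (rule AE_I2)
      fix x
      have "\<bar>Z x\<bar> powr (1/2) * \<bar>log_ker b s (Y x)\<bar> \<le> \<bar>Z x\<bar> powr (1/2) * (log_wt b s * \<bar>Y x\<bar> powr (1/2))"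
        by (intro mult_left_mono log_ker_bound) auto
      then show "norm (\<bar>Z x\<bar> powr (1/2) * \<bar>log_ker b s (Y x)\<bar>) \<le> norm (log_wt b s * (\<bar>Y x\<bar> powr (1/2) * \<bar>Z x\<bar> powr (1/2)))"
        using k log_wt_nonneg[of b] by (simp add: abs_mult mult_ac)
    qed
  qed measurable
  note 2 = cv_integral[OF m log_wt_integrable[OF b] half_moment(1)[OF Z] ker_int prod2 log_ker_bound, simplified]
  have "cv (\<lambda>x. log_ker b s (Y x)) (\<lambda>x. log_reg b (Z x)) = (\<integral>t. w t * w s * cos_cov f g s t \<partial>lborel)" for s
    using 2(1)[of s] by (simp add: cv_commute[of "\<lambda>x. log_ker b s (Y x)"] log_ker_integral(2)[OF b] log_ker_cov[OF Y Z] w_def)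
  with 1 show "cv (\<lambda>x. log_reg b (Y x)) (\<lambda>x. log_reg b (Z x)) = (\<integral>s. (\<integral>t. w t * w s * cos_cov f g s t \<partial>lborel) \<partial>lborel)"
    "integrable lborel (\<lambda>s. \<integral>t. w t * w s * cos_cov f g s t \<partial>lborel)"
    by (simp_all add: log_ker_integral(2)[OF b])
  show "integrable lborel (\<lambda>t. w t * w s * cos_cov f g s t)" for s
    using 2(2)[of s] by (simp add: log_ker_cov[OF Y Z] w_def)
qed

text \<open>As b = 1/(n + 1) tends to 0 the term - ln b diverges, but it is deterministic and drops
  out of the covariance. What is left, \<open>G n\<close>, tends to ln |x| under a square integrable
  bound.\<close>

lemma log_reg_tendsto:
  assumes Y: "stable_int f Y" "powint \<alpha> f > 0" and Z: "stable_int g Z" "powint \<alpha> g > 0"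
  shows "(\<lambda>n. cv (\<lambda>\<omega>. log_reg (1 / Suc n) (Y \<omega>)) (\<lambda>\<omega>. log_reg (1 / Suc n) (Z \<omega>)))
     \<longlonglongrightarrow> expectation (\<lambda>\<omega>. cln Y \<omega> * cln Z \<omega>)"
proof -
  have [measurable]: "Y \<in> borel_measurable P" "Z \<in> borel_measurable P"
    using stable_int_measurable Y Z by auto
  define G where "G n x = ln ((1 / Suc n)\<^sup>2 + x\<^sup>2) / 2" for n and x :: real
  \<comment> \<open>Since the smoothing scale is at most 1, \<open>G n x\<close> lies between ln |x|
    and ln (1 + |x|).\<close>
  define B where "B x = \<bar>ln \<bar>x\<bar>\<bar> + 9 * \<bar>x\<bar> powr (1/8)" for x :: real
  have [measurable]: "G n \<in> borel_measurable borel" for n unfolding G_def[abs_def] by measurable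
  have [measurable]: "B \<in> borel_measurable borel" unfolding B_def[abs_def] by measurable
  have reg: "log_reg (1 / Suc n) x = - ln (1 / Suc n) + 1 * G n x" for n x
  proof -
    have "ln (1 + x\<^sup>2 / (1 / Suc n)\<^sup>2) = ln (((1 / Suc n)\<^sup>2 + x\<^sup>2) / (1 / Suc n)\<^sup>2)"
      by (simp add: add_divide_distrib)
    also have "\<dots> = ln ((1 / Suc n)\<^sup>2 + x\<^sup>2) - ln ((1 / Suc n)\<^sup>2)"
      by (rule ln_divide_pos) (auto intro!: add_pos_nonneg)
    also have "ln ((1 / real (Suc n))\<^sup>2) = 2 * ln (1 / Suc n)"
      by (subst ln_realpow) auto
    finally show ?thesis by (simp add: log_reg_def G_def)
  qed
  have GB: "\<bar>G n x\<bar> \<le> B x" if "x \<noteq> 0" for n x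
  proof -
    have e: "1 / real (Suc n) \<le> 1" by simp
    have "ln (x\<^sup>2) \<le> ln ((1 / Suc n)\<^sup>2 + x\<^sup>2)" using that by (subst ln_le_cancel_iff) (auto intro!: add_pos_nonneg)
    moreover have "ln (x\<^sup>2) = 2 * ln \<bar>x\<bar>" using that by (subst power2_abs[symmetric], subst ln_realpow) auto
    ultimately have 1: "ln \<bar>x\<bar> \<le> G n x" by (simp add: G_def)
    have "(1 / real (Suc n))\<^sup>2 \<le> 1\<^sup>2" using e by (intro power_mono) auto
    then have "(1 / Suc n)\<^sup>2 + x\<^sup>2 \<le> (1 + \<bar>x\<bar>)\<^sup>2" by (simp add: power2_sum)
    then have "ln ((1 / Suc n)\<^sup>2 + x\<^sup>2) \<le> ln ((1 + \<bar>x\<bar>)\<^sup>2)"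
      using that by (subst ln_le_cancel_iff) (auto intro!: add_pos_nonneg add_nonneg_pos)
    also have "\<dots> = 2 * ln (1 + \<bar>x\<bar>)" by (subst ln_realpow) auto
    also have "ln (1 + \<bar>x\<bar>) \<le> 9 * \<bar>x\<bar> powr (1/8)" by (rule ln_one_plus_le) simp
    finally have 2: "G n x \<le> 9 * \<bar>x\<bar> powr (1/8)" by (simp add: G_def)
    have "0 \<le> 9 * \<bar>x\<bar> powr (1/8)" by simp
    with 1 2 show ?thesis unfolding B_def by linarith
  qed
  have Gl: "(\<lambda>n. G n x) \<longlonglongrightarrow> ln \<bar>x\<bar>" if "x \<noteq> 0" for x
  proof -
    have "(\<lambda>n. 1 / real (Suc n)) \<longlonglongrightarrow> 0" using LIMSEQ_inverse_real_of_nat by (simp add: inverse_eq_divide)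
    then have "(\<lambda>n. G n x) \<longlonglongrightarrow> ln (0\<^sup>2 + x\<^sup>2) / 2"
      unfolding G_def using that by (intro tendsto_intros) auto
    moreover have "ln (x\<^sup>2) = 2 * ln \<bar>x\<bar>" using that by (subst power2_abs[symmetric], subst ln_realpow) auto
    ultimately show ?thesis by simp
  qed
  have B2: "sqint (\<lambda>\<omega>. B (W \<omega>))" and B1: "integrable P (\<lambda>\<omega>. B (W \<omega>))" if W: "stable_int w W" for w W
  proof -
    have [measurable]: "W \<in> borel_measurable P" using stable_int_measurable W by auto
    show 2: "sqint (\<lambda>\<omega>. B (W \<omega>))"
    proof (rule integrable_dominated)
      show "integrable P (\<lambda>\<omega>. 2 * (ln \<bar>W \<omega>\<bar>)\<^sup>2 + 162 * (1 + \<bar>W \<omega>\<bar>))"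
        using ln_square_integrable[OF W] abs_moment(1)[OF W] by simp
      have "(B x)\<^sup>2 \<le> 2 * (ln \<bar>x\<bar>)\<^sup>2 + 162 * (1 + \<bar>x\<bar>)" for x
      proof -
        have "(B x)\<^sup>2 \<le> 2 * \<bar>ln \<bar>x\<bar>\<bar>\<^sup>2 + 2 * (9 * \<bar>x\<bar> powr (1/8))\<^sup>2"
          unfolding B_def using sum_squares_bound[of "\<bar>ln \<bar>x\<bar>\<bar>" "9 * \<bar>x\<bar> powr (1/8)"] by (simp add: power2_sum)
        also have "(9 * \<bar>x\<bar> powr (1/8))\<^sup>2 = 81 * \<bar>x\<bar> powr (1/4)"
          by (simp add: power_mult_distrib power2_eq_square flip: powr_add)
        also have "\<bar>x\<bar> powr (1/4) \<le> 1 + \<bar>x\<bar>"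
        proof (cases "\<bar>x\<bar> \<le> 1")
          case True
          have "\<bar>x\<bar> powr (1/4) \<le> 1 powr (1/4)" using True by (intro powr_mono2) auto
          then show ?thesis by simp
        next
          case False
          have "\<bar>x\<bar> powr (1/4) \<le> \<bar>x\<bar> powr 1" using False by (intro powr_mono) auto
          then show ?thesis by simp
        qed
        finally show ?thesis by simp
      qed
      then show "AE \<omega> in P. norm ((B (W \<omega>))\<^sup>2) \<le> norm (2 * (ln \<bar>W \<omega>\<bar>)\<^sup>2 + 162 * (1 + \<bar>W \<omega>\<bar>))"
        by (intro AE_I2) (simp add: abs_of_nonneg)
    qed measurable
    show "integrable P (\<lambda>\<omega>. B (W \<omega>))" by (rule square_integrable_imp_integrable[OF _ 2]) measurable
  qed
  have BB: "integrable P (\<lambda>\<omega>. B (Y \<omega>) * B (Z \<omega>))"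
    by (rule cauchy_schwarz_integral(1)[OF _ _ B2[OF Y(1)] B2[OF Z(1)]]) measurable
  have Y0: "AE \<omega> in P. Y \<omega> \<noteq> 0" and Z0: "AE \<omega> in P. Z \<omega> \<noteq> 0"
    using stable_int_nonzero[OF Y] stable_int_nonzero[OF Z] by auto
  have l1: "integrable P (\<lambda>\<omega>. G n (W \<omega>)) \<and> (\<lambda>n. expectation (\<lambda>\<omega>. G n (W \<omega>))) \<longlonglongrightarrow> expectation (\<lambda>\<omega>. ln \<bar>W \<omega>\<bar>)"
    if W: "stable_int w W" "AE \<omega> in P. W \<omega> \<noteq> 0" for w W n
  proof
    have [measurable]: "W \<in> borel_measurable P" using stable_int_measurable W by auto
    show "(\<lambda>n. expectation (\<lambda>\<omega>. G n (W \<omega>))) \<longlonglongrightarrow> expectation (\<lambda>\<omega>. ln \<bar>W \<omega>\<bar>)"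
    proof (rule integral_dominated_convergence[OF _ _ B1[OF W(1)]])
      show "AE \<omega> in P. (\<lambda>n. G n (W \<omega>)) \<longlonglongrightarrow> ln \<bar>W \<omega>\<bar>" using W(2) by eventually_elim (rule Gl)
      show "AE \<omega> in P. norm (G n (W \<omega>)) \<le> B (W \<omega>)" for n using W(2) by eventually_elim (simp add: GB)
    qed measurable
    show "integrable P (\<lambda>\<omega>. G n (W \<omega>))"
    proof (rule integrable_dominated[OF B1[OF W(1)]])
      show "AE \<omega> in P. norm (G n (W \<omega>)) \<le> norm (B (W \<omega>))"
        using W(2) by eventually_elim (use GB in \<open>force intro: order_trans[OF _ abs_ge_self]\<close>)
    qed measurable
  qed
  have GGB: "AE \<omega> in P. norm (G n (Y \<omega>) * G n (Z \<omega>)) \<le> B (Y \<omega>) * B (Z \<omega>)" for n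
    using Y0 Z0 by eventually_elim (auto simp: abs_mult intro!: mult_mono GB order_trans[OF abs_ge_zero GB])
  have l2: "(\<lambda>n. expectation (\<lambda>\<omega>. G n (Y \<omega>) * G n (Z \<omega>))) \<longlonglongrightarrow> expectation (\<lambda>\<omega>. ln \<bar>Y \<omega>\<bar> * ln \<bar>Z \<omega>\<bar>)"
  proof (rule integral_dominated_convergence[OF _ _ BB])
    show "AE \<omega> in P. (\<lambda>n. G n (Y \<omega>) * G n (Z \<omega>)) \<longlonglongrightarrow> ln \<bar>Y \<omega>\<bar> * ln \<bar>Z \<omega>\<bar>"
      using Y0 Z0 by eventually_elim (intro tendsto_mult Gl)
    show "AE \<omega> in P. norm (G n (Y \<omega>) * G n (Z \<omega>)) \<le> B (Y \<omega>) * B (Z \<omega>)" for n by (rule GGB)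
  qed measurable
  have i2: "integrable P (\<lambda>\<omega>. G n (Y \<omega>) * G n (Z \<omega>))" for n
  proof (rule integrable_dominated[OF BB])
    show "AE \<omega> in P. norm (G n (Y \<omega>) * G n (Z \<omega>)) \<le> norm (B (Y \<omega>) * B (Z \<omega>))"
      using GGB[of n] by eventually_elim (use order_trans abs_ge_self in fastforce)
  qed measurable
  have "(\<lambda>n. cv (\<lambda>\<omega>. G n (Y \<omega>)) (\<lambda>\<omega>. G n (Z \<omega>)))
     \<longlonglongrightarrow> expectation (\<lambda>\<omega>. ln \<bar>Y \<omega>\<bar> * ln \<bar>Z \<omega>\<bar>) - expectation (\<lambda>\<omega>. ln \<bar>Y \<omega>\<bar>) * expectation (\<lambda>\<omega>. ln \<bar>Z \<omega>\<bar>)"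
    unfolding cv_def using l1[OF Y(1) Y0] l1[OF Z(1) Z0] by (intro tendsto_diff tendsto_mult l2) auto
  moreover have "cv (\<lambda>\<omega>. log_reg (1 / Suc n) (Y \<omega>)) (\<lambda>\<omega>. log_reg (1 / Suc n) (Z \<omega>)) = cv (\<lambda>\<omega>. G n (Y \<omega>)) (\<lambda>\<omega>. G n (Z \<omega>))" for n
    unfolding reg using l1[OF Y(1) Y0] l1[OF Z(1) Z0] i2 by (subst cv_affine) auto
  moreover have "expectation (\<lambda>\<omega>. cln Y \<omega> * cln Z \<omega>)
     = expectation (\<lambda>\<omega>. ln \<bar>Y \<omega>\<bar> * ln \<bar>Z \<omega>\<bar>) - expectation (\<lambda>\<omega>. ln \<bar>Y \<omega>\<bar>) * expectation (\<lambda>\<omega>. ln \<bar>Z \<omega>\<bar>)"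
  proof -
    have "integrable P (\<lambda>\<omega>. ln \<bar>Y \<omega>\<bar> * ln \<bar>Z \<omega>\<bar>)"
      by (rule cauchy_schwarz_integral(1)[OF _ _ ln_square_integrable[OF Y(1)] ln_square_integrable[OF Z(1)]]) measurable
    then show ?thesis
      using covariance_eq_cv[OF ln_integrable[OF Y(1)] ln_integrable[OF Z(1)]]
      by (simp add: covariance_def cv_def cln_def)
  qed
  ultimately show ?thesis by simp
qed

text \<open>The covariance of logarithms is a limit of integrals of \<open>cos_cov\<close>, so
  equality of the latter suffices. This gives stationarity without any comparison of joint
  laws.\<close>

lemma cln_cov_cong:
  assumes Y: "stable_int f Y" "powint \<alpha> f > 0" and Z: "stable_int g Z" "powint \<alpha> g > 0"
    and Y': "stable_int f' Y'" "powint \<alpha> f' > 0" and Z': "stable_int g' Z'" "powint \<alpha> g' > 0"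
    and eq: "\<And>s t. cos_cov f g s t = cos_cov f' g' s t"
  shows "expectation (\<lambda>x. cln Y x * cln Z x) = expectation (\<lambda>x. cln Y' x * cln Z' x)"
proof -
  have "cv (\<lambda>x. log_reg (1 / Suc n) (Y x)) (\<lambda>x. log_reg (1 / Suc n) (Z x))
     = cv (\<lambda>x. log_reg (1 / Suc n) (Y' x)) (\<lambda>x. log_reg (1 / Suc n) (Z' x))" for n
    by (subst log_reg_cov(1)[OF Y(1) Z(1)], simp, subst log_reg_cov(1)[OF Y'(1) Z'(1)], simp, simp add: eq)
  then show ?thesis
    using LIMSEQ_unique[OF log_reg_tendsto[OF Y Z]] log_reg_tendsto[OF Y' Z'] by simp
qed

text \<open>Each exponent differs from the sum a + c of the separate ones by at most four overlaps
  times q. The smallness condition keeps this below half of a + c, so half of the exponential decay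
  in s and t survives while the overlap appears as a factor.\<close>

lemma cos_cov_bound:
  assumes f: "in_Lp \<alpha> f" and g: "in_Lp \<alpha> g" and fm: "powint \<alpha> f \<ge> m" and gm: "powint \<alpha> g \<ge> m"
    and rho: "4 * crossint \<alpha> f g \<le> m" and st: "s > 0" "t > 0"
  shows "\<bar>cos_cov f g s t\<bar> \<le> 4 * crossint \<alpha> f g * (s powr (\<alpha> / 2) * exp (- (m / 2 * s powr \<alpha>))) * (t powr (\<alpha> / 2) * exp (- (m / 2 * t powr \<alpha>)))"
proof -
  let ?r = "crossint \<alpha> f g"
  define a where "a = s powr \<alpha> * powint \<alpha> f"
  define c where "c = t powr \<alpha> * powint \<alpha> g"
  define q where "q = s powr (\<alpha> / 2) * t powr (\<alpha> / 2)"
  have q: "q \<ge> 0" "2 * q \<le> s powr \<alpha> + t powr \<alpha>"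
  proof -
    show "q \<ge> 0" by (simp add: q_def)
    show "2 * q \<le> s powr \<alpha> + t powr \<alpha>"
      using sum_squares_bound[of "s powr (\<alpha> / 2)" "t powr (\<alpha> / 2)"] by (simp add: powr_half_squared q_def)
  qed
  have sf: "in_Lp \<alpha> (\<lambda>u. s * f u)" "powint \<alpha> (\<lambda>u. s * f u) = a"
    using f st by (auto simp: powint_cmult a_def intro: in_Lp_cmult)
  have X: "\<bar>powint \<alpha> (\<lambda>u. s * f u + e * t * g u) - a - c\<bar> \<le> 4 * ?r * q" if "\<bar>e\<bar> = 1" for e
  proof -
    have tg: "in_Lp \<alpha> (\<lambda>u. e * t * g u)" "powint \<alpha> (\<lambda>u. e * t * g u) = c"
      using g st that by (auto simp: powint_cmult c_def abs_mult intro: in_Lp_cmult)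
    have "crossint \<alpha> (\<lambda>u. s * f u) (\<lambda>u. e * t * g u) = (\<integral>u. q * (\<bar>f u\<bar> powr (\<alpha> / 2) * \<bar>g u\<bar> powr (\<alpha> / 2)) \<partial>lborel)"
      unfolding crossint_def using st that
      by (intro Bochner_Integration.integral_cong) (auto simp: abs_mult powr_mult q_def)
    also have "\<dots> = q * ?r" by (simp add: crossint_def)
    finally have "crossint \<alpha> (\<lambda>u. s * f u) (\<lambda>u. e * t * g u) = q * ?r" .
    then show ?thesis using in_Lp_add(2)[OF \<alpha> sf(1) tg(1)] sf(2) tg(2) by (simp add: mult_ac)
  qed
  have half: "4 * ?r * q \<le> (a + c) / 2"
  proof -
    have "4 * ?r * q \<le> m * ((s powr \<alpha> + t powr \<alpha>) / 2)"
    proof -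
      have "0 \<le> m" using rho crossint_nonneg[of \<alpha> f g] by linarith
      then show ?thesis using rho q by (intro mult_mono) auto
    qed
    also have "\<dots> \<le> (a + c) / 2"
      using mult_left_mono[OF fm, of "s powr \<alpha>"] mult_left_mono[OF gm, of "t powr \<alpha>"]
      by (simp add: a_def c_def algebra_simps)
    finally show ?thesis .
  qed
  have E: "\<bar>exp (- x) - exp (- (a + c))\<bar> \<le> 4 * ?r * q * exp (- (a + c) / 2)" if x: "\<bar>x - a - c\<bar> \<le> 4 * ?r * q" for x
  proof -
    have *: "\<bar>exp (- x) - exp (- y)\<bar> \<le> \<bar>x - y\<bar> * exp (- z)" if "z \<le> x" "z \<le> y" for x y z :: real
    proof -
      have **: "exp (- x) - exp (- y) \<le> \<bar>x - y\<bar> * exp (- z)" if "z \<le> x" "x \<le> y" for x y z :: real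
      proof -
        have "1 - exp (x - y) \<le> y - x" using exp_ge_add_one_self[of "x - y"] by linarith
        then have "exp (- x) * (1 - exp (x - y)) \<le> exp (- z) * (y - x)"
          using that by (intro mult_mono) auto
        then show ?thesis using that by (simp add: right_diff_distrib mult.commute flip: exp_add)
      qed
      show ?thesis
      proof (cases "x \<le> y")
        case True
        then show ?thesis using **[of z x y] that by simp
      next
        case False
        then show ?thesis using **[of z y x] that by (simp add: abs_minus_commute)
      qed
    qed
    have "\<bar>exp (- x) - exp (- (a + c))\<bar> \<le> \<bar>x - (a + c)\<bar> * exp (- ((a + c) / 2))"
      using x half q(1) crossint_nonneg[of \<alpha> f g] by (intro *) (auto simp: a_def c_def abs_le_iff)
    also have "\<dots> \<le> 4 * ?r * q * exp (- ((a + c) / 2))"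
      using x by (intro mult_right_mono) (auto simp: algebra_simps)
    finally show ?thesis by (simp only: minus_divide_left)
  qed
  have tg: "powint \<alpha> (\<lambda>u. t * g u) = c" using st by (simp add: powint_cmult c_def)
  have "cos_cov f g s t = ((exp (- powint \<alpha> (\<lambda>u. s * f u + t * g u)) - exp (- (a + c)))
     + (exp (- powint \<alpha> (\<lambda>u. s * f u - t * g u)) - exp (- (a + c)))) / 2"
    unfolding cos_cov_def sf(2) tg by (simp add: exp_diff exp_minus field_simps exp_add)
  also have "\<bar>\<dots>\<bar> \<le> 4 * ?r * q * exp (- (a + c) / 2)"
    using E[OF X[of 1]] E[OF X[of "-1"]] by simp
  finally have 1: "\<bar>cos_cov f g s t\<bar> \<le> 4 * ?r * q * exp (- (a + c) / 2)" .
  have e: "m / 2 * s powr \<alpha> \<le> a / 2" "m / 2 * t powr \<alpha> \<le> c / 2"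
    using mult_left_mono[OF fm, of "s powr \<alpha>"] mult_left_mono[OF gm, of "t powr \<alpha>"]
    by (simp_all add: a_def c_def mult.commute)
  have "exp (- (a + c) / 2) = exp (- (a / 2) + - (c / 2))" by (simp add: add_divide_distrib)
  also have "\<dots> \<le> exp (- (m / 2 * s powr \<alpha>) + - (m / 2 * t powr \<alpha>))"
    unfolding exp_le_cancel_iff by (intro add_mono le_imp_neg_le e)
  finally have "exp (- (a + c) / 2) \<le> exp (- (m / 2 * s powr \<alpha>) + - (m / 2 * t powr \<alpha>))" .
  then have "4 * ?r * q * exp (- (a + c) / 2) \<le> 4 * ?r * q * (exp (- (m / 2 * s powr \<alpha>)) * exp (- (m / 2 * t powr \<alpha>)))"
    unfolding exp_add by (rule mult_left_mono) (use q in simp)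
  with 1 show ?thesis by (simp add: q_def mult_ac)
qed

text \<open>For small overlap \<open>cos_cov_bound\<close> is integrated against the logarithm
  kernels, uniformly in the smoothing b, and b tends to 0. For large overlap Cauchy-Schwarz already
  suffices, since the overlap is then bounded below.\<close>

lemma cln_cov_bound:
  assumes m: "m > 0"
  obtains K where "K \<ge> 0" "\<And>f g Y Z. stable_int f Y \<Longrightarrow> stable_int g Z \<Longrightarrow> powint \<alpha> f \<ge> m \<Longrightarrow> powint \<alpha> g \<ge> m \<Longrightarrow>
    \<bar>expectation (\<lambda>x. cln Y x * cln Z x)\<bar> \<le> K * crossint \<alpha> f g"
proof -
  define v where "v = (\<lambda>t. t powr (\<alpha> / 2 - 1) * exp (- (m / 2 * t powr \<alpha>)) * indicator {0<..} t)"
  define W where "W = (\<integral>t. v t \<partial>lborel)"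
  have vi: "integrable lborel v" unfolding v_def using \<alpha> m by (intro integrable_weight) auto
  have v0: "v t \<ge> 0" for t by (simp add: v_def)
  have W: "W \<ge> 0" unfolding W_def using v0 by simp
  \<comment> \<open>The first summand serves overlaps with four times their value at most m; the
    second serves the others, for which 1 < 4 overlap / m.\<close>
  define K where "K = 4 * W * W + 4 * V0 / m"
  have K: "K \<ge> 0" using W V0_nonneg m by (simp add: K_def)
  show ?thesis
  proof (rule that[OF K])
    fix f g Y Z assume Y: "stable_int f Y" and Z: "stable_int g Z" and fm: "powint \<alpha> f \<ge> m" and gm: "powint \<alpha> g \<ge> m"
    let ?r = "crossint \<alpha> f g"
    have f0: "powint \<alpha> f > 0" and g0: "powint \<alpha> g > 0" using fm gm m by auto
    show "\<bar>expectation (\<lambda>x. cln Y x * cln Z x)\<bar> \<le> K * ?r"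
    proof (cases "4 * ?r \<le> m")
      case False
      have "V0 * 1 \<le> V0 * (4 * ?r / m)" using False m V0_nonneg by (intro mult_left_mono) (auto simp: le_divide_eq)
      then have "V0 \<le> V0 * (4 * ?r / m)" by simp
      also have "\<dots> = 4 * V0 / m * ?r" by simp
      also have "\<dots> \<le> K * ?r" using W by (intro mult_right_mono) (auto simp: K_def)
      finally show ?thesis using cln_cov_le_V0[OF Y f0 Z g0] by linarith
    next
      case True
      have "\<bar>cv (\<lambda>x. log_reg b (Y x)) (\<lambda>x. log_reg b (Z x))\<bar> \<le> 4 * ?r * W * W" if b: "b > 0" for b
      proof -
        define w where "w = (\<lambda>t. exp (- (b * t)) / t * indicator {0<..} t)"
        have L: "cv (\<lambda>x. log_reg b (Y x)) (\<lambda>x. log_reg b (Z x)) = (\<integral>s. (\<integral>t. w t * w s * cos_cov f g s t \<partial>lborel) \<partial>lborel)"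
          "integrable lborel (\<lambda>s. \<integral>t. w t * w s * cos_cov f g s t \<partial>lborel)"
          using log_reg_cov(1,2)[OF Y Z b] by (simp_all only: w_def)
        have L3: "integrable lborel (\<lambda>t. w t * w s * cos_cov f g s t)" for s
          using log_reg_cov(3)[OF Y Z b, of s] by (simp only: w_def)
        have w: "\<bar>w t * (w s * cos_cov f g s t)\<bar> \<le> 4 * ?r * v s * v t" for s t
        proof (cases "s > 0 \<and> t > 0")
          case True
          then have st: "s > 0" "t > 0" by auto
          have wle: "w t \<le> 1 / t" "w s \<le> 1 / s" "w t \<ge> 0" "w s \<ge> 0"
            using st b by (auto simp: w_def divide_right_mono)
          have "\<bar>w t * (w s * cos_cov f g s t)\<bar> = (w t * w s) * \<bar>cos_cov f g s t\<bar>"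
            using wle by (simp add: abs_mult)
          also have "\<dots> \<le> (1 / t * (1 / s)) * (4 * ?r * (s powr (\<alpha> / 2) * exp (- (m / 2 * s powr \<alpha>))) * (t powr (\<alpha> / 2) * exp (- (m / 2 * t powr \<alpha>))))"
            using wle st by (intro mult_mono cos_cov_bound stable_int_in_Lp[OF Y] stable_int_in_Lp[OF Z] fm gm \<open>4 * ?r \<le> m\<close>) auto
          also have "\<dots> = 4 * ?r * ((s powr (\<alpha> / 2) / s) * exp (- (m / 2 * s powr \<alpha>))) * ((t powr (\<alpha> / 2) / t) * exp (- (m / 2 * t powr \<alpha>)))"
            by simp
          also have "\<dots> = 4 * ?r * v s * v t"
            using st powr_diff[of s "\<alpha> / 2" 1] powr_diff[of t "\<alpha> / 2" 1] by (simp add: v_def)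
          finally show ?thesis .
        next
          case False
          then show ?thesis by (auto simp: w_def v_def)
        qed
        have inner: "\<bar>\<integral>t. w t * w s * cos_cov f g s t \<partial>lborel\<bar> \<le> 4 * ?r * v s * W" for s
        proof -
          have "\<bar>\<integral>t. w t * w s * cos_cov f g s t \<partial>lborel\<bar> \<le> (\<integral>t. \<bar>w t * w s * cos_cov f g s t\<bar> \<partial>lborel)"
            by (rule integral_abs_bound)
          also have "\<dots> \<le> (\<integral>t. 4 * ?r * v s * v t \<partial>lborel)"
            using w[of _ s] by (intro integral_mono integrable_abs integrable_mult_right L3 vi) (simp only: mult.assoc)
          finally show ?thesis by (simp add: W_def)
        qed
        have "\<bar>cv (\<lambda>x. log_reg b (Y x)) (\<lambda>x. log_reg b (Z x))\<bar> \<le> (\<integral>s. \<bar>\<integral>t. w t * w s * cos_cov f g s t \<partial>lborel\<bar> \<partial>lborel)"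
          unfolding L(1) by (rule integral_abs_bound)
        also have "\<dots> \<le> (\<integral>s. 4 * ?r * v s * W \<partial>lborel)"
          using inner L(2) vi by (intro integral_mono integrable_abs integrable_mult_right integrable_mult_left) auto
        finally show ?thesis by (simp add: W_def)
      qed
      then have "\<bar>expectation (\<lambda>x. cln Y x * cln Z x)\<bar> \<le> 4 * ?r * W * W"
        by (intro tendsto_upperbound[OF tendsto_rabs[OF log_reg_tendsto[OF Y f0 Z g0]]]) (auto intro!: always_eventually)
      also have "\<dots> = (4 * W * W) * ?r" by simp
      also have "\<dots> \<le> K * ?r" using m V0_nonneg by (intro mult_right_mono) (auto simp: K_def)
      finally show ?thesis .
    qed
  qed
qed

end

context prob_space begin

section \<open>Convergence to the normal law by approximation\<close>

lemma expectation_sum_square: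
  fixes Z :: "'i \<Rightarrow> 'a \<Rightarrow> real"
  assumes "\<And>p. p \<in> F \<Longrightarrow> Z p \<in> borel_measurable M" "\<And>p. p \<in> F \<Longrightarrow> sqint (Z p)"
  shows "sqint (\<lambda>x. \<Sum>p\<in>F. c p * Z p x)"
    and "msq (\<lambda>x. \<Sum>p\<in>F. c p * Z p x) = (\<Sum>p\<in>F. \<Sum>q\<in>F. c p * c q * expectation (\<lambda>x. Z p x * Z q x))"
proof -
  have e: "(\<Sum>p\<in>F. c p * Z p x)\<^sup>2 = (\<Sum>p\<in>F. \<Sum>q\<in>F. c p * c q * (Z p x * Z q x))" for x
    by (simp add: power2_eq_square sum_product mult_ac)
  have i: "integrable M (\<lambda>x. Z p x * Z q x)" if "p \<in> F" "q \<in> F" for p q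
    using assms that by (intro cauchy_schwarz_integral(1)) auto
  show "sqint (\<lambda>x. \<Sum>p\<in>F. c p * Z p x)"
    unfolding e by (intro Bochner_Integration.integrable_sum integrable_mult_right i)
  show "msq (\<lambda>x. \<Sum>p\<in>F. c p * Z p x) = (\<Sum>p\<in>F. \<Sum>q\<in>F. c p * c q * expectation (\<lambda>x. Z p x * Z q x))"
    unfolding e by (simp add: i Bochner_Integration.integral_sum)
qed

lemma expectation_abs_le_sqrt:
  assumes [measurable]: "Y \<in> borel_measurable M" and i: "integrable M (\<lambda>x. (Y x)\<^sup>2 :: real)"
  shows "integrable M Y" "expectation (\<lambda>x. \<bar>Y x\<bar>) \<le> sqrt (msq Y)"
proof -
  show "integrable M Y" by (rule square_integrable_imp_integrable[OF _ i]) simp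
  show "expectation (\<lambda>x. \<bar>Y x\<bar>) \<le> sqrt (msq Y)"
    using cauchy_schwarz_integral(2)[of Y M "\<lambda>_. 1"] i by (simp add: prob_space)
qed

lemma char_diff_L2:
  assumes [measurable]: "Y \<in> borel_measurable M" "Z \<in> borel_measurable M"
    and i: "sqint (\<lambda>x. Y x - Z x)"
  shows "norm (char (distr M borel Y) \<theta> - char (distr M borel Z) \<theta>) \<le> \<bar>\<theta>\<bar> * sqrt (msq (\<lambda>x. Y x - Z x))"
proof -
  note e = expectation_abs_le_sqrt[OF _ i]
  show ?thesis
    by (rule order_trans[OF char_diff_le mult_left_mono]) (use e in auto)
qed

lemma L2_triangle:
  assumes [measurable]: "Y \<in> borel_measurable M" "Z \<in> borel_measurable M"
    and i: "sqint Y" "integrable M (\<lambda>x. (Z x)\<^sup>2 :: real)"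
  shows "sqint (\<lambda>x. Y x + Z x)" "sqint (\<lambda>x. Y x - Z x)"
    and "sqrt (msq (\<lambda>x. Y x + Z x)) \<le> sqrt (msq Y) + sqrt (msq Z)"
    and "\<bar>sqrt (msq Y) - sqrt (msq Z)\<bar> \<le> sqrt (msq (\<lambda>x. Y x - Z x))"
proof -
  have gen: "sqint (\<lambda>x. A x + B x) \<and>
     sqrt (msq (\<lambda>x. A x + B x)) \<le> sqrt (msq A) + sqrt (msq B)"
    if [measurable]: "A \<in> borel_measurable M" "B \<in> borel_measurable M"
      and i: "sqint A" "integrable M (\<lambda>x. (B x)\<^sup>2 :: real)" for A B
  proof
    have ab: "integrable M (\<lambda>x. A x * B x)" by (rule cauchy_schwarz_integral(1)[OF _ _ i]) simp_all
    then show "sqint (\<lambda>x. A x + B x)" using i by (simp add: power2_sum mult.assoc)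
    let ?a = "sqrt (msq A)" and ?b = "sqrt (msq B)"
    have "msq (\<lambda>x. A x + B x) = ?a\<^sup>2 + ?b\<^sup>2 + 2 * expectation (\<lambda>x. A x * B x)"
      using i ab by (simp add: power2_sum mult.assoc)
    also have "\<dots> \<le> ?a\<^sup>2 + ?b\<^sup>2 + 2 * (?a * ?b)"
      using order_trans[OF abs_ge_self cauchy_schwarz_integral(3)[OF _ _ i]] by simp
    also have "\<dots> = (?a + ?b)\<^sup>2" by (simp add: power2_sum)
    finally show "sqrt (msq (\<lambda>x. A x + B x)) \<le> ?a + ?b"
      by (intro real_le_lsqrt) (auto simp del: real_sqrt_pow2)
  qed
  show "sqint (\<lambda>x. Y x + Z x)"
    "sqrt (msq (\<lambda>x. Y x + Z x)) \<le> sqrt (msq Y) + sqrt (msq Z)"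
    using gen[of Y Z] i by auto
  show d: "sqint (\<lambda>x. Y x - Z x)" using gen[of Y "\<lambda>x. - Z x"] i by auto
  have "sqrt (msq Y) \<le> sqrt (msq (\<lambda>x. Y x - Z x)) + sqrt (msq Z)"
    using gen[of "\<lambda>x. Y x - Z x" Z] i d by auto
  moreover have "sqrt (msq Z) \<le> sqrt (msq (\<lambda>x. Y x - Z x)) + sqrt (msq Y)"
    using gen[of "\<lambda>x. - (Y x - Z x)" Y] i d by (auto simp: power2_commute)
  ultimately show "\<bar>sqrt (msq Y) - sqrt (msq Z)\<bar> \<le> sqrt (msq (\<lambda>x. Y x - Z x))"
    by (auto simp: abs_le_iff)
qed

lemma iid_sum_square:
  fixes T :: "nat \<Rightarrow> 'a \<Rightarrow> real"
  assumes ind: "indep_vars (\<lambda>_. borel) T UNIV" and law: "\<And>i. distr M borel (T i) = distr M borel (T 0)"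
    and sq: "sqint (T 0)" and mean: "expectation (T 0) = 0"
  shows "\<And>i. T i \<in> borel_measurable M" "\<And>i. sqint (T i)" "\<And>i. expectation (T i) = 0"
    "\<And>i. msq (T i) = msq (T 0)"
    "sqint (\<lambda>\<omega>. \<Sum>i<k. T i \<omega>)"
    "msq (\<lambda>\<omega>. \<Sum>i<k. T i \<omega>) = real k * msq (T 0)"
proof -
  show [measurable]: "T i \<in> borel_measurable M" for i using ind by (simp add: indep_vars_def2)
  show s: "sqint (T i)" for i
  proof -
    have "integrable (distr M borel (T i)) (\<lambda>x. x\<^sup>2)" unfolding law[of i] using sq by (simp add: integrable_distr_eq)
    then show ?thesis by (simp add: integrable_distr_eq)
  qed
  show m: "expectation (T i) = 0" for i
  proof -
    have "expectation (T i) = integral\<^sup>L (distr M borel (T i)) (\<lambda>x. x)" by (simp add: integral_distr)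
    also have "\<dots> = 0" unfolding law[of i] using mean by (simp add: integral_distr)
    finally show ?thesis .
  qed
  show e: "msq (T i) = msq (T 0)" for i
  proof -
    have "msq (T i) = integral\<^sup>L (distr M borel (T i)) (\<lambda>x. x\<^sup>2)" by (simp add: integral_distr)
    also have "\<dots> = msq (T 0)" unfolding law[of i] by (simp add: integral_distr)
    finally show ?thesis .
  qed
  have int: "integrable M (T i)" for i using expectation_abs_le_sqrt(1)[OF _ s] by simp
  have c: "expectation (\<lambda>\<omega>. T i \<omega> * T j \<omega>) = 0" if "i \<noteq> j" for i j
  proof -
    have "expectation (\<lambda>\<omega>. \<Prod>l\<in>{i, j}. T l \<omega>) = (\<Prod>l\<in>{i, j}. expectation (T l))"
      by (rule indep_vars_lebesgue_integral[OF _ indep_vars_subset[OF ind subset_UNIV] int]) simp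
    then show ?thesis using that m by simp
  qed
  note X = expectation_sum_square[of "{..<k}" T "\<lambda>_. 1"]
  show "sqint (\<lambda>\<omega>. \<Sum>i<k. T i \<omega>)" using X(1) s by simp
  have "msq (\<lambda>\<omega>. \<Sum>i<k. T i \<omega>) = (\<Sum>i<k. \<Sum>j<k. expectation (\<lambda>\<omega>. T i \<omega> * T j \<omega>))"
    using X(2) s by simp
  also have "\<dots> = (\<Sum>i<k. \<Sum>j<k. if j = i then msq (T 0) else 0)"
    using c e by (intro sum.cong) (auto simp: power2_eq_square)
  also have "\<dots> = real k * msq (T 0)" by (simp add: sum.delta')
  finally show "msq (\<lambda>\<omega>. \<Sum>i<k. T i \<omega>) = real k * msq (T 0)" .
qed

text \<open>The classical theorem normalises by the standard deviation of the sum. Replacing this by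
  \<open>sqrt N\<close> changes the variable by a deterministic factor, and the L2 error vanishes
  because k N / N tends to c. Zero variance is treated apart, as there is nothing to normalise
  by.\<close>

lemma iid_char_limit:
  fixes T :: "nat \<Rightarrow> 'a \<Rightarrow> real" and k :: "nat \<Rightarrow> nat"
  assumes ind: "indep_vars (\<lambda>_. borel) T UNIV" and law: "\<And>i. distr M borel (T i) = distr M borel (T 0)"
    and sq: "sqint (T 0)" and mean: "expectation (T 0) = 0"
    and k: "filterlim k at_top sequentially" and c: "(\<lambda>N. real (k N) / real N) \<longlonglongrightarrow> c"
  defines "\<tau> \<equiv> msq (T 0)"
  shows "(\<lambda>N. char (distr M borel (\<lambda>\<omega>. (\<Sum>i<k N. T i \<omega>) / sqrt (real N))) t)
     \<longlonglongrightarrow> complex_of_real (exp (- (c * \<tau> * t\<^sup>2) / 2))"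
proof (cases "\<tau> = 0")
  case True
  note I = iid_sum_square[OF ind law sq mean]
  note [measurable] = I(1)
  have z: "AE \<omega> in M. T i \<omega> = 0" for i
  proof -
    have "msq (T i) = 0" using I(4)[of i] True by (simp add: \<tau>_def)
    then have "AE \<omega> in M. (T i \<omega>)\<^sup>2 = 0"
      using I(2)[of i] by (subst (asm) integral_nonneg_eq_0_iff_AE) auto
    then show ?thesis by simp
  qed
  have "char (distr M borel (\<lambda>\<omega>. (\<Sum>i<k N. T i \<omega>) / sqrt (real N))) t = 1" for N
  proof -
    have "AE \<omega> in M. \<forall>i. T i \<omega> = 0" using z by (simp add: AE_all_countable)
    then have "AE \<omega> in M. (\<Sum>i<k N. T i \<omega>) / sqrt (real N) = 0" by eventually_elim simp
    then have "distr M borel (\<lambda>\<omega>. (\<Sum>i<k N. T i \<omega>) / sqrt (real N)) = distr M borel (\<lambda>\<omega>. 0)"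
      by (intro distr_cong_AE) auto
    then show ?thesis by (simp add: char_def integral_distr prob_space del: distr_const)
  qed
  then show ?thesis using True by simp
next
  case False
  have \<tau>: "\<tau> > 0"
  proof -
    have "\<tau> \<ge> 0" by (simp add: \<tau>_def)
    with False show ?thesis by simp
  qed
  note I = iid_sum_square[OF ind law sq mean]
  note [measurable] = I(1)
  have c0: "c \<ge> 0" by (rule LIMSEQ_le_const[OF c]) auto
  let ?s = "t * sqrt (c * \<tau>)"
  let ?A = "\<lambda>n \<omega>. (\<Sum>i<n. T i \<omega>) / sqrt (real n * (sqrt \<tau>)\<^sup>2)"
  have "weak_conv_m (\<lambda>n. distr M borel (?A n)) std_normal_distribution"
  proof (rule central_limit_theorem_zero_mean[OF ind I(3) _ I(2) _ law])
    show "sqrt \<tau> > 0" using \<tau> by simp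
    show "variance (T n) = (sqrt \<tau>)\<^sup>2" for n
      using \<tau> I(3)[of n] I(4)[of n] by (simp add: \<tau>_def)
  qed
  then have "(\<lambda>n. char (distr M borel (?A n)) ?s) \<longlonglongrightarrow> char std_normal_distribution ?s"
    by (intro levy_continuity1 real_distribution_distr) (auto intro: real_dist_normal_dist)
  then have "(\<lambda>N. char (distr M borel (?A (k N))) ?s) \<longlonglongrightarrow> char std_normal_distribution ?s"
    by (rule filterlim_compose[OF _ k])
  moreover have "char std_normal_distribution ?s = complex_of_real (exp (- (c * \<tau> * t\<^sup>2) / 2))"
    using \<tau> c0 by (simp add: char_std_normal_distribution power_mult_distrib mult_ac)
  ultimately have lim1: "(\<lambda>N. char (distr M borel (?A (k N))) ?s) \<longlonglongrightarrow> complex_of_real (exp (- (c * \<tau> * t\<^sup>2) / 2))"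
    by simp
  let ?D = "\<lambda>N. char (distr M borel (\<lambda>\<omega>. (\<Sum>i<k N. T i \<omega>) / sqrt (real N))) t - char (distr M borel (?A (k N))) ?s"
  have ev: "\<forall>\<^sub>F N in sequentially. k N \<ge> 1 \<and> N \<ge> 1"
    using filterlim_at_top[THEN iffD1, rule_format, OF k, of 1] eventually_ge_at_top[of 1] by eventually_elim auto
  have "(\<lambda>N. \<bar>t\<bar> * (sqrt \<tau> * \<bar>sqrt (real (k N) / real N) - sqrt c\<bar>)) \<longlonglongrightarrow> \<bar>t\<bar> * (sqrt \<tau> * \<bar>sqrt c - sqrt c\<bar>)"
    by (intro tendsto_intros c)
  then have lim2: "(\<lambda>N. \<bar>t\<bar> * (sqrt \<tau> * \<bar>sqrt (real (k N) / real N) - sqrt c\<bar>)) \<longlonglongrightarrow> 0" by simp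
  have lim3: "?D \<longlonglongrightarrow> 0"
  proof (rule Lim_null_comparison[OF _ lim2])
    show "\<forall>\<^sub>F N in sequentially. norm (?D N) \<le> \<bar>t\<bar> * (sqrt \<tau> * \<bar>sqrt (real (k N) / real N) - sqrt c\<bar>)"
      using ev
    proof eventually_elim
      case (elim N)
      let ?S = "\<lambda>\<omega>. \<Sum>i<k N. T i \<omega>"
      define r where "r = 1 / sqrt (real N) - sqrt c / sqrt (real (k N))"
      have e: "char (distr M borel (?A (k N))) ?s = char (distr M borel (\<lambda>\<omega>. sqrt c * ?S \<omega> / sqrt (real (k N)))) t"
      proof -
        have *: "?s * ?A (k N) \<omega> = t * (sqrt c * ?S \<omega> / sqrt (real (k N)))" for \<omega>
          using \<tau> by (simp add: real_sqrt_mult)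
        have ch: "char (distr M borel V) x = (CLINT \<omega>|M. iexp (x * V \<omega>))" if "V \<in> borel_measurable M" for V x
          using that unfolding char_def by (subst integral_distr) simp_all
        show ?thesis by (subst (1 2) ch) (measurable, simp only: *)
      qed
      have q: "?S \<omega> / sqrt (real N) - sqrt c * ?S \<omega> / sqrt (real (k N)) = r * ?S \<omega>" for \<omega>
        by (simp add: r_def algebra_simps)
      have "norm (?D N) \<le> \<bar>t\<bar> * sqrt (msq (\<lambda>\<omega>. r * ?S \<omega>))"
        unfolding e using I(5)[of "k N"]
        by (subst q[symmetric], intro char_diff_L2) (auto simp: q power_mult_distrib)
      also have "msq (\<lambda>\<omega>. r * ?S \<omega>) = r\<^sup>2 * (real (k N) * \<tau>)"
        using I(6)[of "k N"] by (simp add: power_mult_distrib \<tau>_def)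
      also have "sqrt (r\<^sup>2 * (real (k N) * \<tau>)) = sqrt \<tau> * \<bar>r * sqrt (real (k N))\<bar>"
        by (simp add: real_sqrt_mult abs_mult)
      also have "r * sqrt (real (k N)) = sqrt (real (k N) / real N) - sqrt c"
        using elim by (simp add: r_def algebra_simps real_sqrt_divide)
      finally show ?case .
    qed
  qed
  show ?thesis using tendsto_add[OF lim3 lim1] by simp
qed

lemma exp_neg_half_square_lipschitz:
  fixes x y :: real
  shows "\<bar>exp (- (x\<^sup>2) / 2) - exp (- (y\<^sup>2) / 2)\<bar> \<le> \<bar>x - y\<bar>"
proof -
  have d: "((\<lambda>x. exp (- (x\<^sup>2) / 2)) has_real_derivative - x * exp (- (x\<^sup>2) / 2)) (at x)" for x :: real
    by (auto intro!: derivative_eq_intros)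
  have b: "norm (- x * exp (- (x\<^sup>2) / 2)) \<le> 1" for x :: real
  proof -
    have "\<bar>x\<bar> \<le> 1 + x\<^sup>2 / 2"
    proof -
      have "0 \<le> (\<bar>x\<bar> - 1)\<^sup>2" by simp
      then show ?thesis by (simp add: power2_diff)
    qed
    also have "\<dots> \<le> exp (x\<^sup>2 / 2)" by (rule exp_ge_add_one_self)
    finally have "\<bar>x\<bar> * exp (- (x\<^sup>2 / 2)) \<le> exp (x\<^sup>2 / 2) * exp (- (x\<^sup>2 / 2))" by (intro mult_right_mono) auto
    then show ?thesis by (simp add: abs_mult flip: exp_add)
  qed
  show ?thesis
    using field_differentiable_bound[of UNIV "\<lambda>x. exp (- (x\<^sup>2) / 2)" "\<lambda>x. - x * exp (- (x\<^sup>2) / 2)" 1 x y] d b by simp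
qed

lemma char_normal_law: "v \<ge> 0 \<Longrightarrow> char (normal_law 0 v) t = complex_of_real (exp (- ((sqrt v * t)\<^sup>2) / 2))"
proof -
  have "char (normal_law 0 v) t = char std_normal_distribution (sqrt v * t)"
    unfolding normal_law_def by (simp add: char_def integral_distr mult_ac)
  then show ?thesis by (simp add: char_std_normal_distribution)
qed

text \<open>The approximating sums may change with e, and so may the variances of their limits. No
  separate control of these is required: L2 closeness bounds both the difference of the
  characteristic functions and the difference of the standard deviations \<open>sqrt v\<close> and
  \<open>sqrt (c * \<tau>)\<close>.\<close>

theorem clt_approximation:
  fixes Y :: "nat \<Rightarrow> 'a \<Rightarrow> real"
  assumes Y [measurable]: "\<And>N. Y N \<in> borel_measurable M" and Y2: "\<And>N. sqint (Y N)"
    and v: "(\<lambda>N. msq (Y N)) \<longlonglongrightarrow> v"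
    and approx: "\<And>e. e > 0 \<Longrightarrow> \<exists>T k c. indep_vars (\<lambda>_. borel) T UNIV \<and> (\<forall>i. distr M borel (T i) = distr M borel (T 0)) \<and>
      sqint (T 0) \<and> expectation (T 0) = 0 \<and> filterlim k at_top sequentially \<and>
      (\<lambda>N. real (k N) / real N) \<longlonglongrightarrow> c \<and>
      (\<forall>\<^sub>F N in sequentially. msq (\<lambda>x. Y N x - (\<Sum>i<k N. T i x) / sqrt (real N)) \<le> e\<^sup>2)"
  shows "weak_conv_m (\<lambda>N. distr M borel (Y N)) (normal_law 0 v)"
proof (rule levy_continuity)
  show "real_distribution (distr M borel (Y N))" for N by (intro real_distribution_distr) simp
  show "real_distribution (normal_law 0 v)"
    unfolding normal_law_def by (intro prob_space.real_distribution_distr) (auto intro: prob_space_normal_density)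
  have v0: "v \<ge> 0" by (rule LIMSEQ_le_const[OF v]) auto
  fix t
  show "(\<lambda>N. char (distr M borel (Y N)) t) \<longlonglongrightarrow> char (normal_law 0 v) t"
  proof (rule tendstoI)
    fix e :: real assume e: "e > 0"
    \<comment> \<open>The replacement of Y by the sum and the replacement of the limiting variance
      cost |t| d each, together at most e/2; the limit for the sum itself is given e/4.\<close>
    define d where "d = e / (4 * (\<bar>t\<bar> + 1))"
    have d: "d > 0" "2 * \<bar>t\<bar> * d \<le> e / 2"
    proof -
      show "d > 0" using e by (simp add: d_def)
      have "\<bar>t\<bar> * d \<le> (\<bar>t\<bar> + 1) * d" using \<open>d > 0\<close> by (simp add: distrib_right)
      also have "\<dots> = e / 4" by (simp add: d_def field_simps add_nonneg_eq_0_iff)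
      finally show "2 * \<bar>t\<bar> * d \<le> e / 2" by simp
    qed
    obtain T k c where T: "indep_vars (\<lambda>_. borel) T UNIV" "\<And>i. distr M borel (T i) = distr M borel (T 0)"
      "sqint (T 0)" "expectation (T 0) = 0" and k: "filterlim k at_top sequentially"
      and c: "(\<lambda>N. real (k N) / real N) \<longlonglongrightarrow> c"
      and ap: "\<forall>\<^sub>F N in sequentially. msq (\<lambda>x. Y N x - (\<Sum>i<k N. T i x) / sqrt (real N)) \<le> d\<^sup>2"
      using approx[OF d(1)] by blast
    note I = iid_sum_square[OF T]
    note [measurable] = I(1)
    define \<tau> where "\<tau> = msq (T 0)"
    let ?W = "\<lambda>N x. (\<Sum>i<k N. T i x) / sqrt (real N)"
    have W2: "sqint (?W N)" "msq (?W N) = real (k N) / real N * \<tau>" for N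
      using I(5,6)[of "k N"] by (simp_all add: power_divide \<tau>_def)
    have c0: "c \<ge> 0" by (rule LIMSEQ_le_const[OF c]) auto
    have \<tau>0: "\<tau> \<ge> 0" by (simp add: \<tau>_def)
    have YW: "\<forall>\<^sub>F N in sequentially. sqrt (msq (\<lambda>x. Y N x - ?W N x)) \<le> d"
      using ap d by (auto elim!: eventually_mono intro!: real_le_lsqrt)
    have 1: "\<forall>\<^sub>F N in sequentially. norm (char (distr M borel (Y N)) t - char (distr M borel (?W N)) t) \<le> \<bar>t\<bar> * d"
      using YW
    proof eventually_elim
      case (elim N)
      have "norm (char (distr M borel (Y N)) t - char (distr M borel (?W N)) t) \<le> \<bar>t\<bar> * sqrt (msq (\<lambda>x. Y N x - ?W N x))"
        by (intro char_diff_L2 L2_triangle(2) Y2 W2) auto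
      also have "\<dots> \<le> \<bar>t\<bar> * d" using elim by (intro mult_left_mono) auto
      finally show ?case .
    qed
    have 2: "(\<lambda>N. char (distr M borel (?W N)) t) \<longlonglongrightarrow> complex_of_real (exp (- (c * \<tau> * t\<^sup>2) / 2))"
      unfolding \<tau>_def by (rule iid_char_limit[OF T k c])
    have 3: "\<bar>sqrt v - sqrt (c * \<tau>)\<bar> \<le> d"
    proof (rule tendsto_upperbound)
      show "(\<lambda>N. \<bar>sqrt (msq (Y N)) - sqrt (msq (?W N))\<bar>) \<longlonglongrightarrow> \<bar>sqrt v - sqrt (c * \<tau>)\<bar>"
        unfolding W2 by (intro tendsto_intros v c)
      show "\<forall>\<^sub>F N in sequentially. \<bar>sqrt (msq (Y N)) - sqrt (msq (?W N))\<bar> \<le> d"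
        using YW
      proof eventually_elim
        case (elim N)
        show ?case by (rule order_trans[OF L2_triangle(4) elim]) (auto intro: Y2 W2)
      qed
    qed simp
    have 4: "norm (complex_of_real (exp (- (c * \<tau> * t\<^sup>2) / 2)) - char (normal_law 0 v) t) \<le> \<bar>t\<bar> * d"
    proof -
      have "norm (complex_of_real (exp (- (c * \<tau> * t\<^sup>2) / 2)) - char (normal_law 0 v) t)
        = \<bar>exp (- ((sqrt (c * \<tau>) * t)\<^sup>2) / 2) - exp (- ((sqrt v * t)\<^sup>2) / 2)\<bar>"
        unfolding char_normal_law[OF v0] of_real_diff[symmetric] norm_of_real
        using c0 \<tau>0 by (simp add: power_mult_distrib)
      also have "\<dots> \<le> \<bar>sqrt (c * \<tau>) * t - sqrt v * t\<bar>" by (rule exp_neg_half_square_lipschitz)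
      also have "\<dots> = \<bar>t\<bar> * \<bar>sqrt v - sqrt (c * \<tau>)\<bar>"
        by (simp add: abs_minus_commute flip: abs_mult left_diff_distrib)
           (simp add: mult.commute abs_mult abs_minus_commute)
      also have "\<dots> \<le> \<bar>t\<bar> * d" using 3 by (intro mult_left_mono) auto
      finally show ?thesis .
    qed
    have "e / 4 > 0" using e by simp
    from tendstoD[OF 2 this] 1
    show "\<forall>\<^sub>F N in sequentially. dist (char (distr M borel (Y N)) t) (char (normal_law 0 v) t) < e"
    proof eventually_elim
      case (elim N)
      let ?a = "char (distr M borel (Y N)) t" and ?b = "char (distr M borel (?W N)) t"
        and ?c = "complex_of_real (exp (- (c * \<tau> * t\<^sup>2) / 2))" and ?d = "char (normal_law 0 v) t"
      have "dist ?a ?d \<le> dist ?a ?b + dist ?b ?c + dist ?c ?d"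
        using dist_triangle[of ?a ?d ?b] dist_triangle[of ?b ?d ?c] by linarith
      also have "\<dots> < \<bar>t\<bar> * d + e / 4 + \<bar>t\<bar> * d"
        using elim 4 by (intro add_less_le_mono add_le_less_mono) (simp_all only: dist_norm)
      also have "\<dots> \<le> e" using d(2) e by (simp add: field_simps)
      finally show ?case .
    qed
  qed
qed

end

section \<open>Decay of the wavelet kernel\<close>

lemma pos_power_pos: "x > 0 \<Longrightarrow> pos_power \<kappa> x = x powr \<kappa>"
  and pos_power_nonpos: "x \<le> 0 \<Longrightarrow> pos_power \<kappa> x = 0"
  and pos_power_nonneg: "0 \<le> pos_power \<kappa> x"
  by (auto simp: pos_power_def max_def)

lemma pos_power_measurable [measurable]: "pos_power \<kappa> \<in> borel_measurable borel"
  unfolding pos_power_def[abs_def] by measurable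

lemma pos_power_scale: "c > 0 \<Longrightarrow> pos_power \<kappa> (c * x) = c powr \<kappa> * pos_power \<kappa> x"
  by (cases "x > 0") (auto simp: pos_power_pos pos_power_nonpos powr_mult mult_le_0_iff)

lemma pos_power_window:
  fixes \<kappa> S u :: real
  assumes \<kappa>: "-1 < \<kappa>"
  shows "integrable lborel (\<lambda>s. pos_power \<kappa> (s + u) * indicator {-S..S} s)"
    and "- S \<le> u \<Longrightarrow> (\<integral>s. pos_power \<kappa> (s + u) * indicator {-S..S} s \<partial>lborel) \<le> (S + u) powr (\<kappa> + 1) / (\<kappa> + 1)"
proof -
  let ?g = "\<lambda>x. x powr \<kappa> * indicator {0..S + u} x"
  have i: "integrable lborel ?g" by (rule integrable_powr_0[OF \<kappa>])
  have i': "integrable lborel (\<lambda>s. ?g (u + 1 * s))" by (rule lborel_integrable_real_affine[OF i]) simp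
  have le: "pos_power \<kappa> (s + u) * indicator {-S..S} s \<le> ?g (u + 1 * s)" for s
    by (cases "s + u > 0") (auto simp: pos_power_pos pos_power_nonpos indicator_def add.commute)
  have nn: "0 \<le> pos_power \<kappa> (s + u) * indicator {-S..S} s" for s
    by (simp add: pos_power_nonneg)
  show j: "integrable lborel (\<lambda>s. pos_power \<kappa> (s + u) * indicator {-S..S} s)"
    by (rule integrable_dominated[OF i']) (use le nn in \<open>auto intro!: norm_le_norm AE_I2\<close>)
  assume S: "- S \<le> u"
  have "(\<integral>s. pos_power \<kappa> (s + u) * indicator {-S..S} s \<partial>lborel) \<le> (\<integral>s. ?g (u + 1 * s) \<partial>lborel)"
    by (rule integral_mono[OF j i' le])
  also have "\<dots> = (\<integral>x. ?g x \<partial>lborel)"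
    using lborel_integral_real_affine[of 1 ?g u] by simp
  also have "\<dots> = (S + u) powr (\<kappa> + 1) / (\<kappa> + 1)"
  proof (rule has_bochner_integral_integral_eq[OF has_bochner_integral_nn_integral])
    have "(\<integral>\<^sup>+x. ennreal (?g x) \<partial>lborel) = (\<integral>\<^sup>+x. ennreal (x powr \<kappa>) * indicator {0..S + u} x \<partial>lborel)"
      by (intro nn_integral_cong) (auto simp: indicator_def)
    then show "(\<integral>\<^sup>+x. ennreal (?g x) \<partial>lborel) = ennreal ((S + u) powr (\<kappa> + 1) / (\<kappa> + 1))"
      using nn_powr_0[OF \<kappa>, of "S + u"] S by simp
  qed (use \<kappa> in auto)
  finally show "(\<integral>s. pos_power \<kappa> (s + u) * indicator {-S..S} s \<partial>lborel) \<le> (S + u) powr (\<kappa> + 1) / (\<kappa> + 1)" .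
qed

text \<open>The binomial series converges at 3/4, hence absolutely at 1/2. Pulling Q powers of z out
  of the tail leaves a series that is bounded uniformly for |z| \<le> 1/2.\<close>

lemma gbinomial_remainder:
  fixes \<kappa> :: real
  obtains D where "D \<ge> 0" "\<And>z. \<bar>z\<bar> \<le> 1/2 \<Longrightarrow> \<bar>(1 + z) powr \<kappa> - (\<Sum>n<Q. (\<kappa> gchoose n) * z ^ n)\<bar> \<le> D * \<bar>z\<bar> ^ Q"
proof -
  let ?g = "\<lambda>n. \<kappa> gchoose n"
  have "summable (\<lambda>n. ?g n * (3/4) ^ n)" using gen_binomial_real[of "3/4" \<kappa>] by (simp add: sums_iff)
  then have "summable (\<lambda>n. norm (?g n * (1/2) ^ n))" by (rule powser_insidea) simp
  then have "summable (\<lambda>n. norm (?g (n + Q) * (1/2) ^ (n + Q)))"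
    by (rule summable_ignore_initial_segment)
  from summable_mult[OF this, of "2 ^ Q"] have s: "summable (\<lambda>n. \<bar>?g (n + Q)\<bar> * (1/2) ^ n)"
    by (simp add: abs_mult power_add power_one_over mult_ac)
  define D where "D = (\<Sum>n. \<bar>?g (n + Q)\<bar> * (1/2) ^ n)"
  have "D \<ge> 0" unfolding D_def by (intro suminf_nonneg s) simp
  moreover have "\<bar>(1 + z) powr \<kappa> - (\<Sum>n<Q. ?g n * z ^ n)\<bar> \<le> D * \<bar>z\<bar> ^ Q" if z: "\<bar>z\<bar> \<le> 1/2" for z
  proof -
    have "(\<lambda>n. ?g n * z ^ n) sums (1 + z) powr \<kappa>" using z by (intro gen_binomial_real) simp
    then have 1: "(\<lambda>n. ?g (n + Q) * z ^ (n + Q)) sums ((1 + z) powr \<kappa> - (\<Sum>n<Q. ?g n * z ^ n))"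
      by (rule sums_split_initial_segment)
    have le: "norm (?g (n + Q) * z ^ (n + Q)) \<le> \<bar>?g (n + Q)\<bar> * (1/2) ^ n * \<bar>z\<bar> ^ Q" for n
      using z by (auto simp: abs_mult power_add power_abs mult.assoc intro!: mult_left_mono mult_right_mono power_mono)
    have s2: "summable (\<lambda>n. \<bar>?g (n + Q)\<bar> * (1/2) ^ n * \<bar>z\<bar> ^ Q)" by (rule summable_mult2[OF s])
    have "\<bar>(1 + z) powr \<kappa> - (\<Sum>n<Q. ?g n * z ^ n)\<bar> = norm (\<Sum>n. ?g (n + Q) * z ^ (n + Q))"
      using 1 by (simp add: sums_iff)
    also have "\<dots> \<le> (\<Sum>n. \<bar>?g (n + Q)\<bar> * (1/2) ^ n * \<bar>z\<bar> ^ Q)"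
      by (rule norm_suminf_le[OF le s2])
    also have "\<dots> = D * \<bar>z\<bar> ^ Q" unfolding D_def by (rule suminf_mult2[OF s, symmetric])
    finally show ?thesis .
  qed
  ultimately show ?thesis by (rule that)
qed

locale wavelet_kernel =
  fixes \<kappa> :: real and \<psi> :: "real \<Rightarrow> real" and Q :: nat and S C :: real
  assumes \<kappa>: "-1 < \<kappa>" and \<psi>_meas [measurable]: "\<psi> \<in> borel_measurable borel"
    and \<psi>_bound: "\<And>s. \<bar>\<psi> s\<bar> \<le> C" and \<psi>_supp: "\<And>s. S < \<bar>s\<bar> \<Longrightarrow> \<psi> s = 0" and S: "S \<ge> 1"
    and Q: "Q \<ge> 1" and mom: "zero_moments Q \<psi>"
begin

definition h :: "real \<Rightarrow> real" where
  "h u = (\<integral>s. pos_power \<kappa> (s + u) * \<psi> s \<partial>lborel)"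

lemma C: "C \<ge> 0" using \<psi>_bound[of 0] by linarith

lemma \<psi>_le: "\<bar>\<psi> s\<bar> \<le> C * indicator {-S..S} s"
  using \<psi>_bound[of s] \<psi>_supp[of s] by (auto simp: indicator_def abs_le_iff)

lemma integrable_\<psi>_mult:
  assumes [measurable]: "g \<in> borel_measurable borel" and g: "\<And>s. \<bar>s\<bar> \<le> S \<Longrightarrow> \<bar>g s\<bar> \<le> B"
  shows "integrable lborel (\<lambda>s. g s * \<psi> s)"
proof (rule integrable_dominated)
  show "integrable lborel (\<lambda>s. B * C * indicator {-S..S} s)"
    by (intro integrable_mult_right integrable_real_indicator) (auto simp: emeasure_lborel_Icc_eq)
  have B: "B \<ge> 0" using g[of 0] S by simp
  have "\<bar>g s * \<psi> s\<bar> \<le> B * C * indicator {-S..S} s" for s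
  proof (cases "\<bar>s\<bar> \<le> S")
    case True
    have "\<bar>g s\<bar> * \<bar>\<psi> s\<bar> \<le> B * C" using g[OF True] \<psi>_bound[of s] B by (intro mult_mono) auto
    then show ?thesis using True by (simp add: abs_mult abs_le_iff)
  qed (use \<psi>_supp B C in \<open>auto simp: abs_mult\<close>)
  then show "AE s in lborel. norm (g s * \<psi> s) \<le> norm (B * C * indicator {-S..S} s)"
    by (intro AE_I2) (metis abs_ge_self order_trans real_norm_def)
qed measurable

lemma moment_integrable: "integrable lborel (\<lambda>s. \<psi> s * s ^ n)"
  using integrable_\<psi>_mult[of "\<lambda>s. s ^ n" "S ^ n"] by (simp add: power_abs power_mono mult.commute)

lemma \<psi>_integrable: "integrable lborel \<psi>"
  using moment_integrable[of 0] by simp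

lemma h_integrable: "integrable lborel (\<lambda>s. pos_power \<kappa> (s + u) * \<psi> s)"
proof (rule integrable_dominated[OF integrable_mult_right[OF pos_power_window(1)[OF \<kappa>, of u S], of C]])
  have "\<bar>pos_power \<kappa> (s + u) * \<psi> s\<bar> \<le> C * (pos_power \<kappa> (s + u) * indicator {-S..S} s)" for s
    using mult_left_mono[OF \<psi>_le[of s] pos_power_nonneg[of \<kappa> "s + u"]] by (simp add: abs_mult pos_power_nonneg mult_ac)
  then show "AE s in lborel. norm (pos_power \<kappa> (s + u) * \<psi> s) \<le> norm (C * (pos_power \<kappa> (s + u) * indicator {-S..S} s))"
    by (intro AE_I2) (metis abs_ge_self order_trans real_norm_def)
qed measurable

lemma h_measurable [measurable]: "h \<in> borel_measurable borel"
  unfolding h_def[abs_def] by measurable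

lemma h_zero: "u \<le> - S \<Longrightarrow> h u = 0"
proof -
  assume u: "u \<le> - S"
  have "pos_power \<kappa> (s + u) * \<psi> s = 0" for s
  proof (cases "s + u > 0")
    case True
    then have "S < \<bar>s\<bar>" using u by linarith
    then show ?thesis using \<psi>_supp by simp
  qed (simp add: pos_power_nonpos)
  then have "(\<lambda>s. pos_power \<kappa> (s + u) * \<psi> s) = (\<lambda>s. 0)" by blast
  then show "h u = 0" by (simp add: h_def)
qed

lemma h_bound_local:
  assumes u: "- S \<le> u"
  shows "\<bar>h u\<bar> \<le> C * ((S + u) powr (\<kappa> + 1) / (\<kappa> + 1))"
proof -
  have "\<bar>h u\<bar> \<le> (\<integral>s. \<bar>pos_power \<kappa> (s + u) * \<psi> s\<bar> \<partial>lborel)" unfolding h_def by (rule integral_abs_bound)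
  also have "\<dots> \<le> (\<integral>s. C * (pos_power \<kappa> (s + u) * indicator {-S..S} s) \<partial>lborel)"
  proof (rule integral_mono)
    show "\<bar>pos_power \<kappa> (s + u) * \<psi> s\<bar> \<le> C * (pos_power \<kappa> (s + u) * indicator {-S..S} s)" for s
      using mult_left_mono[OF \<psi>_le[of s] pos_power_nonneg[of \<kappa> "s + u"]] by (simp add: abs_mult pos_power_nonneg mult_ac)
  qed (intro integrable_abs h_integrable integrable_mult_right pos_power_window(1) \<kappa>)+
  also have "\<dots> = C * (\<integral>s. pos_power \<kappa> (s + u) * indicator {-S..S} s \<partial>lborel)" by simp
  also have "\<dots> \<le> C * ((S + u) powr (\<kappa> + 1) / (\<kappa> + 1))"
    by (intro mult_left_mono pos_power_window(2) \<kappa> u C)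
  finally show ?thesis .
qed

text \<open>For u \<ge> 2 S the ratio s/u is at most 1/2 on the support, so (s + u)^\<kappa> expands
  in powers of s/u. The vanishing moments remove every term of order below Q, and the remainder is
  of size u^\<kappa> (S/u)^Q.\<close>

lemma h_bound_tail:
  obtains D where "D \<ge> 0" "\<And>u. u \<ge> 2 * S \<Longrightarrow> \<bar>h u\<bar> \<le> D * u powr (\<kappa> - real Q)"
proof -
  obtain D where D: "D \<ge> 0" "\<And>z. \<bar>z\<bar> \<le> 1/2 \<Longrightarrow> \<bar>(1 + z) powr \<kappa> - (\<Sum>n<Q. (\<kappa> gchoose n) * z ^ n)\<bar> \<le> D * \<bar>z\<bar> ^ Q"
    using gbinomial_remainder by blast
  define D' where "D' = D * S ^ Q * C * (2 * S)"
  have "\<bar>h u\<bar> \<le> D' * u powr (\<kappa> - real Q)" if u: "u \<ge> 2 * S" for u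
  proof -
    have u0: "u > 0" using u S by simp
    define R where "R z = (1 + z) powr \<kappa> - (\<Sum>n<Q. (\<kappa> gchoose n) * z ^ n)" for z
    have [measurable]: "R \<in> borel_measurable borel" unfolding R_def[abs_def] by measurable
    have zs: "\<bar>s / u\<bar> \<le> 1/2" if "\<bar>s\<bar> \<le> S" for s
    proof -
      have "\<bar>s\<bar> * 2 \<le> u" using that u by simp
      then show ?thesis using u0 by (simp add: abs_divide field_simps)
    qed
    have Rb: "\<bar>R (s / u)\<bar> \<le> D * S ^ Q / u ^ Q" if s: "\<bar>s\<bar> \<le> S" for s
    proof -
      have "\<bar>R (s / u)\<bar> \<le> D * \<bar>s / u\<bar> ^ Q" unfolding R_def by (rule D(2)[OF zs[OF s]])
      also have "\<bar>s / u\<bar> ^ Q = \<bar>s\<bar> ^ Q / u ^ Q" using u0 by (simp add: abs_divide power_divide)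
      also have "D * (\<bar>s\<bar> ^ Q / u ^ Q) \<le> D * (S ^ Q / u ^ Q)"
        using D(1) u0 s by (intro mult_left_mono divide_right_mono power_mono) auto
      finally show ?thesis by simp
    qed
    have iR: "integrable lborel (\<lambda>s. R (s / u) * \<psi> s)" by (rule integrable_\<psi>_mult[OF _ Rb]) measurable
    have eq: "pos_power \<kappa> (s + u) * \<psi> s = (\<Sum>n<Q. (u powr \<kappa> * (\<kappa> gchoose n) / u ^ n) * (\<psi> s * s ^ n)) + u powr \<kappa> * (R (s / u) * \<psi> s)" for s
    proof (cases "\<bar>s\<bar> \<le> S")
      case True
      have p: "s + u > 0" using True u S by linarith
      have su: "s + u = u * (1 + s / u)" using u0 by (simp add: field_simps)
      have z1: "0 \<le> 1 + s / u" using abs_le_D2[OF zs[OF True]] by linarith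
      have "pos_power \<kappa> (s + u) = u powr \<kappa> * (1 + s / u) powr \<kappa>"
        using p u0 z1 by (simp add: pos_power_pos su powr_mult del: distrib_left)
      also have "\<dots> = u powr \<kappa> * ((\<Sum>n<Q. (\<kappa> gchoose n) * (s / u) ^ n) + R (s / u))" by (simp add: R_def)
      finally show ?thesis
        by (simp add: distrib_right distrib_left sum_distrib_left sum_distrib_right power_divide mult_ac)
    qed (use \<psi>_supp in auto)
    have "h u = (\<integral>s. (\<Sum>n<Q. (u powr \<kappa> * (\<kappa> gchoose n) / u ^ n) * (\<psi> s * s ^ n)) + u powr \<kappa> * (R (s / u) * \<psi> s) \<partial>lborel)"
      unfolding h_def eq ..
    also have "\<dots> = (\<integral>s. (\<Sum>n<Q. (u powr \<kappa> * (\<kappa> gchoose n) / u ^ n) * (\<psi> s * s ^ n)) \<partial>lborel) + (\<integral>s. u powr \<kappa> * (R (s / u) * \<psi> s) \<partial>lborel)"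
      by (intro Bochner_Integration.integral_add Bochner_Integration.integrable_sum integrable_mult_right moment_integrable iR)
    also have "(\<integral>s. (\<Sum>n<Q. (u powr \<kappa> * (\<kappa> gchoose n) / u ^ n) * (\<psi> s * s ^ n)) \<partial>lborel)
        = (\<Sum>n<Q. \<integral>s. (u powr \<kappa> * (\<kappa> gchoose n) / u ^ n) * (\<psi> s * s ^ n) \<partial>lborel)"
      by (intro Bochner_Integration.integral_sum integrable_mult_right moment_integrable)
    also have "\<dots> = 0" using mom by (intro sum.neutral) (auto simp: zero_moments_def)
    finally have "h u = u powr \<kappa> * (\<integral>s. R (s / u) * \<psi> s \<partial>lborel)" by simp
    then have "\<bar>h u\<bar> = u powr \<kappa> * \<bar>\<integral>s. R (s / u) * \<psi> s \<partial>lborel\<bar>" by (simp add: abs_mult)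
    also have "\<dots> \<le> u powr \<kappa> * (D * S ^ Q / u ^ Q * C * (2 * S))"
    proof (rule mult_left_mono)
      have "\<bar>\<integral>s. R (s / u) * \<psi> s \<partial>lborel\<bar> \<le> (\<integral>s. \<bar>R (s / u) * \<psi> s\<bar> \<partial>lborel)" by (rule integral_abs_bound)
      also have "\<dots> \<le> (\<integral>s. D * S ^ Q / u ^ Q * C * indicator {-S..S} s \<partial>lborel)"
      proof (rule integral_mono)
        show "integrable lborel (\<lambda>s. D * S ^ Q / u ^ Q * C * indicator {-S..S} s)"
          by (intro integrable_mult_right integrable_real_indicator) (auto simp: emeasure_lborel_Icc_eq)
        fix s
        show "\<bar>R (s / u) * \<psi> s\<bar> \<le> D * S ^ Q / u ^ Q * C * indicator {-S..S} s"
        proof (cases "\<bar>s\<bar> \<le> S")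
          case True
          have "\<bar>R (s / u)\<bar> * \<bar>\<psi> s\<bar> \<le> (D * S ^ Q / u ^ Q) * C"
            using Rb[OF True] \<psi>_bound[of s] D(1) S u0 by (intro mult_mono) auto
          then show ?thesis using True by (simp add: abs_mult abs_le_iff)
        qed (use \<psi>_supp D(1) S u0 C in \<open>auto simp: abs_mult\<close>)
      qed (use iR in simp)
      also have "\<dots> = D * S ^ Q / u ^ Q * C * (2 * S)" using S by simp
      finally show "\<bar>\<integral>s. R (s / u) * \<psi> s \<partial>lborel\<bar> \<le> D * S ^ Q / u ^ Q * C * (2 * S)" .
    qed simp
    also have "\<dots> = D' * (u powr \<kappa> / u powr real Q)" using u0 by (simp add: D'_def powr_realpow)
    also have "u powr \<kappa> / u powr real Q = u powr (\<kappa> - real Q)" by (simp add: powr_diff)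
    finally show ?thesis .
  qed
  moreover have "D' \<ge> 0" using D(1) S C by (simp add: D'_def)
  ultimately show ?thesis using that by blast
qed

text \<open>Three ranges of u: no contribution up to - S, the crude bound up to 2 S, and the tail
  estimate beyond.\<close>

lemma h_envelope:
  assumes q: "real Q - \<kappa> > 0"
  obtains E where "E \<ge> 0" "\<And>u. \<bar>h u\<bar> \<le> E * env (real Q - \<kappa>) u"
proof -
  let ?q = "real Q - \<kappa>"
  obtain D where D: "D \<ge> 0" "\<And>u. u \<ge> 2 * S \<Longrightarrow> \<bar>h u\<bar> \<le> D * u powr (\<kappa> - real Q)"
    using h_bound_tail by blast
  define B where "B = C * ((3 * S) powr (\<kappa> + 1) / (\<kappa> + 1))"
  have B: "B \<ge> 0" using C \<kappa> by (simp add: B_def)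
  \<comment> \<open>The first factor compensates the smallest value of the envelope on the middle
    range; the second comes from u \<ge> (1 + u) / 2 in the tail.\<close>
  define E where "E = B * (1 + 2 * S) powr ?q + D * 2 powr ?q"
  have E: "E \<ge> 0" using B D by (simp add: E_def)
  have "\<bar>h u\<bar> \<le> E * env ?q u" for u
  proof -
    consider "u \<le> - S" | "- S \<le> u" "u \<le> 2 * S" | "u \<ge> 2 * S" by linarith
    then show ?thesis
    proof cases
      case 1
      then show ?thesis using h_zero E by simp
    next
      case 2
      have "\<bar>h u\<bar> \<le> C * ((S + u) powr (\<kappa> + 1) / (\<kappa> + 1))" by (rule h_bound_local[OF 2(1)])
      also have "\<dots> \<le> B" unfolding B_def using 2 \<kappa> C
        by (intro mult_left_mono divide_right_mono powr_mono2) auto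
      also have "B = B * ((1 + 2 * S) powr ?q * (1 + 2 * S) powr (- ?q))" using S by (simp flip: powr_add)
      also have "\<dots> \<le> B * ((1 + 2 * S) powr ?q * env ?q u)"
        using 2 S q B by (intro mult_left_mono powr_mono2') auto
      also have "\<dots> \<le> E * env ?q u" using D by (simp add: E_def distrib_right)
      finally show ?thesis .
    next
      case 3
      have u: "u \<ge> 1" using 3 S by simp
      have "\<bar>h u\<bar> \<le> D * u powr (- ?q)" using D(2)[OF 3] by simp
      also have "u powr (- ?q) \<le> ((1 + u) / 2) powr (- ?q)"
        using u q by (intro powr_mono2') auto
      also have "((1 + u) / 2) powr (- ?q) = 2 powr ?q * (1 + u) powr (- ?q)"
      proof -
        have "(x / 2) powr (- q) = 2 powr q * x powr (- q)" for x q :: real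
        proof -
          have "x powr (- q) = (x / 2) powr (- q) * 2 powr (- q)" by (simp only: powr_divide) simp
          moreover have "2 powr q * 2 powr (- q) = (1::real)" unfolding powr_add[symmetric] by simp
          ultimately show ?thesis by (metis mult.commute mult.assoc mult.right_neutral)
        qed
        then show ?thesis .
      qed
      finally have "\<bar>h u\<bar> \<le> D * (2 powr ?q * (1 + u) powr (- ?q))" using D(1) by (simp add: mult_left_mono)
      also have "\<dots> \<le> E * env ?q u" using B u by (simp add: E_def distrib_right)
      finally show ?thesis .
    qed
  qed
  with E show ?thesis by (rule that)
qed

text \<open>After scaling this is Gamma (\<kappa> + 1) divided by l^(\<kappa> + 1). Only positivity
  is used, to divide by the Laplace transform of the power.\<close>

lemma gamma_kernel:
  assumes l: "l > 0"
  shows "integrable lborel (\<lambda>x. pos_power \<kappa> x * exp (- (l * x)))" "(\<integral>x. pos_power \<kappa> x * exp (- (l * x)) \<partial>lborel) > 0"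
proof -
  have "((\<lambda>t. t powr ((\<kappa> + 1) - 1) / exp t) has_integral Gamma (\<kappa> + 1)) {0..}"
    using \<kappa> by (intro Gamma_integral_real) simp
  then have "(\<integral>\<^sup>+t. ennreal (t powr \<kappa> / exp t) * indicator {0..} t \<partial>lborel) = ennreal (Gamma (\<kappa> + 1))"
    by (intro nn_integral_has_integral_lebesgue') auto
  also have "(\<integral>\<^sup>+t. ennreal (t powr \<kappa> / exp t) * indicator {0..} t \<partial>lborel) = (\<integral>\<^sup>+t. ennreal (pos_power \<kappa> t * exp (- t)) \<partial>lborel)"
    by (intro nn_integral_cong) (auto simp: pos_power_def max_def indicator_def exp_minus divide_inverse)
  finally have "has_bochner_integral lborel (\<lambda>t. pos_power \<kappa> t * exp (- t)) (Gamma (\<kappa> + 1))"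
    using \<kappa> by (intro has_bochner_integral_nn_integral) (auto simp: pos_power_nonneg intro: less_imp_le Gamma_real_pos)
  then have i: "integrable lborel (\<lambda>t. pos_power \<kappa> t * exp (- t))" and v: "(\<integral>t. pos_power \<kappa> t * exp (- t) \<partial>lborel) = Gamma (\<kappa> + 1)"
    by (auto simp: has_bochner_integral_iff)
  have e: "pos_power \<kappa> (0 + l * x) * exp (- (0 + l * x)) = l powr \<kappa> * (pos_power \<kappa> x * exp (- (l * x)))" for x
    using l by (simp add: pos_power_scale)
  have "integrable lborel (\<lambda>x. l powr \<kappa> * (pos_power \<kappa> x * exp (- (l * x))))"
    using lborel_integrable_real_affine[OF i, of l 0] l unfolding e by simp
  then show "integrable lborel (\<lambda>x. pos_power \<kappa> x * exp (- (l * x)))" using l by simp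
  have "Gamma (\<kappa> + 1) = \<bar>l\<bar> *\<^sub>R (\<integral>x. pos_power \<kappa> (0 + l * x) * exp (- (0 + l * x)) \<partial>lborel)"
    unfolding v[symmetric] using l by (intro lborel_integral_real_affine) simp
  also have "\<dots> = l * (l powr \<kappa> * (\<integral>x. pos_power \<kappa> x * exp (- (l * x)) \<partial>lborel))"
    unfolding e using l by simp
  finally have "0 < l * (l powr \<kappa> * (\<integral>x. pos_power \<kappa> x * exp (- (l * x)) \<partial>lborel))"
    using Gamma_real_pos[of "\<kappa> + 1"] \<kappa> by simp
  then show "(\<integral>x. pos_power \<kappa> x * exp (- (l * x)) \<partial>lborel) > 0" using l by (simp add: zero_less_mult_iff)
qed

text \<open>The Laplace transform of \<open>h\<close> is that of \<open>x\<^sub>+\<^sup>\<kappa>\<close> times \<open>\<integral> \<psi> s exp (l s) ds\<close>.\<close>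

lemma h_nonzero: "\<not> (AE u in lborel. h u = 0)"
proof
  assume z: "AE u in lborel. h u = 0"
  let ?\<mu> = "\<integral>s. \<psi> s * s ^ Q \<partial>lborel"
  have exp_int: "integrable lborel (\<lambda>s. exp (l * s) * \<psi> s)" if "l > 0" for l
    by (rule integrable_\<psi>_mult[where B="exp (l * S)"]) (use that in \<open>auto simp: abs_le_iff\<close>)
  \<comment> \<open>If \<open>h\<close> vanished, so would its Laplace transform; cancelling the
    positive Gamma factor leaves the exponential moments of the wavelet.\<close>
  have L: "(\<integral>s. exp (l * s) * \<psi> s \<partial>lborel) = 0" if l: "l > 0" for l
  proof -
    let ?G = "\<lambda>x. pos_power \<kappa> x * exp (- (l * x))"
    have sh: "pos_power \<kappa> (s + u) * exp (- (l * u)) = exp (l * s) * ?G (s + 1 * u)" for s u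
    proof -
      have "exp (- (l * u)) = exp (l * s) * exp (- (l * (s + 1 * u)))"
        by (subst exp_add[symmetric]) (simp add: algebra_simps)
      then show ?thesis by simp
    qed
    have intu: "integrable lborel (\<lambda>u. exp (l * s) * ?G (s + 1 * u))" for s
      by (intro integrable_mult_right lborel_integrable_real_affine gamma_kernel(1) l) simp
    have valu: "(\<integral>u. exp (l * s) * ?G (s + 1 * u) \<partial>lborel) = exp (l * s) * (\<integral>x. ?G x \<partial>lborel)" for s
      using lborel_integral_real_affine[of 1 ?G s] by simp
    have int: "integrable (lborel \<Otimes>\<^sub>M lborel) (\<lambda>(s, u). exp (l * s) * ?G (s + 1 * u) * \<psi> s)"
    proof (rule lborel_pair.Fubini_integrable)
      have "(\<integral>u. norm (exp (l * s) * ?G (s + 1 * u) * \<psi> s) \<partial>lborel) = (\<integral>x. ?G x \<partial>lborel) * norm (exp (l * s) * \<psi> s)" for s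
        using valu[of s] by (simp add: abs_mult pos_power_nonneg)
      then show "integrable lborel (\<lambda>s. \<integral>u. norm (case (s, u) of (s, u) \<Rightarrow> exp (l * s) * ?G (s + 1 * u) * \<psi> s) \<partial>lborel)"
        using exp_int[OF l] by (simp add: integrable_norm)
      show "AE s in lborel. integrable lborel (\<lambda>u. case (s, u) of (s, u) \<Rightarrow> exp (l * s) * ?G (s + 1 * u) * \<psi> s)"
        using intu by (intro AE_I2) (simp only: prod.case, rule integrable_mult_left, simp)
    qed measurable
    have "0 = (\<integral>u. h u * exp (- (l * u)) \<partial>lborel)"
      using z by (intro integral_eq_zero_AE[symmetric]) auto
    also have "\<dots> = (\<integral>u. (\<integral>s. exp (l * s) * ?G (s + 1 * u) * \<psi> s \<partial>lborel) \<partial>lborel)"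
    proof (rule Bochner_Integration.integral_cong[OF refl])
      fix u
      have "h u * exp (- (l * u)) = (\<integral>s. pos_power \<kappa> (s + u) * \<psi> s * exp (- (l * u)) \<partial>lborel)"
        unfolding h_def by simp
      also have "\<dots> = (\<integral>s. exp (l * s) * ?G (s + 1 * u) * \<psi> s \<partial>lborel)"
      proof (rule Bochner_Integration.integral_cong[OF refl])
        fix s
        show "pos_power \<kappa> (s + u) * \<psi> s * exp (- (l * u)) = exp (l * s) * ?G (s + 1 * u) * \<psi> s"
          unfolding sh[symmetric] by (simp only: mult_ac)
      qed
      finally show "h u * exp (- (l * u)) = (\<integral>s. exp (l * s) * ?G (s + 1 * u) * \<psi> s \<partial>lborel)" .
    qed
    also have "\<dots> = (\<integral>s. (\<integral>u. exp (l * s) * ?G (s + 1 * u) * \<psi> s \<partial>lborel) \<partial>lborel)"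
      by (rule lborel_pair.Fubini_integral[OF int])
    also have "\<dots> = (\<integral>s. (\<integral>x. ?G x \<partial>lborel) * (exp (l * s) * \<psi> s) \<partial>lborel)"
    proof (rule Bochner_Integration.integral_cong[OF refl])
      fix s
      have "(\<integral>u. exp (l * s) * ?G (s + 1 * u) * \<psi> s \<partial>lborel) = (\<integral>u. exp (l * s) * ?G (s + 1 * u) \<partial>lborel) * \<psi> s"
        by (rule integral_mult_left_zero)
      then show "(\<integral>u. exp (l * s) * ?G (s + 1 * u) * \<psi> s \<partial>lborel) = (\<integral>x. ?G x \<partial>lborel) * (exp (l * s) * \<psi> s)"
        unfolding valu by (simp only: mult_ac)
    qed
    also have "\<dots> = (\<integral>x. ?G x \<partial>lborel) * (\<integral>s. exp (l * s) * \<psi> s \<partial>lborel)" by simp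
    finally show ?thesis using gamma_kernel(2)[OF l] by simp
  qed
  \<comment> \<open>Expanding exp (l s) to order Q, the moments below Q vanish and the Q-th one
    appears with the factor l^Q / Q!, while the remainder is of order l^(Q + 1). Letting l tend to 0
    would make the Q-th moment zero, against \<open>zero_moments\<close>.\<close>
  define K where "K = exp S * S ^ Suc Q * C * (2 * S) * fact Q"
  have key: "\<bar>?\<mu>\<bar> \<le> K * l" if l: "0 < l" "l \<le> 1" for l
  proof -
    define R where "R s = exp (l * s) - (\<Sum>m<Suc Q. (l * s) ^ m / fact m)" for s
    have [measurable]: "R \<in> borel_measurable borel" unfolding R_def[abs_def] by measurable
    have Rb: "\<bar>R s\<bar> \<le> exp S * (l ^ Suc Q * S ^ Suc Q)" if s: "\<bar>s\<bar> \<le> S" for s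
    proof -
      obtain t where t: "\<bar>t\<bar> \<le> \<bar>l * s\<bar>" "exp (l * s) = (\<Sum>m<Suc Q. (l * s) ^ m / fact m) + exp t / fact (Suc Q) * (l * s) ^ Suc Q"
        using Maclaurin_exp_le[of "l * s" "Suc Q"] by blast
      have "\<bar>l * s\<bar> \<le> 1 * S" unfolding abs_mult using l s by (intro mult_mono) auto
      then have ts: "t \<le> S" using t(1) by linarith
      have f1: "1 \<le> (fact (Suc Q) :: real)" by (rule fact_ge_1)
      have "\<bar>R s\<bar> = exp t / fact (Suc Q) * (\<bar>l\<bar> ^ Suc Q * \<bar>s\<bar> ^ Suc Q)"
        unfolding R_def t(2) by (simp add: abs_mult power_abs power_mult_distrib del: power_Suc fact_Suc)
      also have "\<dots> \<le> (exp S / 1) * (l ^ Suc Q * S ^ Suc Q)"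
        using l s ts f1 by (intro mult_mono frac_le power_mono) (auto simp del: power_Suc fact_Suc)
      finally show ?thesis by simp
    qed
    have iR: "integrable lborel (\<lambda>s. R s * \<psi> s)" by (rule integrable_\<psi>_mult[OF _ Rb]) measurable
    have im: "integrable lborel (\<lambda>s. (l ^ m / fact m) * (\<psi> s * s ^ m))" for m
      by (intro integrable_mult_right moment_integrable)
    have e: "exp (l * s) * \<psi> s = (\<Sum>m<Suc Q. (l ^ m / fact m) * (\<psi> s * s ^ m)) + R s * \<psi> s" for s
    proof -
      have "(\<Sum>m<Suc Q. (l ^ m / fact m) * (\<psi> s * s ^ m)) = (\<Sum>m<Suc Q. (l * s) ^ m / fact m) * \<psi> s"
        unfolding sum_distrib_right by (intro sum.cong) (simp_all add: power_mult_distrib mult_ac)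
      then show ?thesis by (simp add: R_def left_diff_distrib del: sum.lessThan_Suc)
    qed
    have "0 = (\<integral>s. (\<Sum>m<Suc Q. (l ^ m / fact m) * (\<psi> s * s ^ m)) + R s * \<psi> s \<partial>lborel)"
      using L[OF l(1)] unfolding e by simp
    also have "\<dots> = (\<integral>s. (\<Sum>m<Suc Q. (l ^ m / fact m) * (\<psi> s * s ^ m)) \<partial>lborel) + (\<integral>s. R s * \<psi> s \<partial>lborel)"
      by (intro Bochner_Integration.integral_add Bochner_Integration.integrable_sum im iR)
    also have "(\<integral>s. (\<Sum>m<Suc Q. (l ^ m / fact m) * (\<psi> s * s ^ m)) \<partial>lborel) = (\<Sum>m<Suc Q. \<integral>s. (l ^ m / fact m) * (\<psi> s * s ^ m) \<partial>lborel)"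
      by (intro Bochner_Integration.integral_sum im)
    also have "\<dots> = (\<Sum>m<Suc Q. (l ^ m / fact m) * (\<integral>s. \<psi> s * s ^ m \<partial>lborel))" by simp
    also have "\<dots> = l ^ Q / fact Q * ?\<mu>"
      using mom by (simp add: zero_moments_def)
    finally have "l ^ Q / fact Q * ?\<mu> = - (\<integral>s. R s * \<psi> s \<partial>lborel)" by simp
    then have "\<bar>l ^ Q / fact Q * ?\<mu>\<bar> \<le> (\<integral>s. \<bar>R s * \<psi> s\<bar> \<partial>lborel)"
      using integral_abs_bound[of lborel "\<lambda>s. R s * \<psi> s"] by simp
    also have "\<dots> \<le> (\<integral>s. exp S * (l ^ Suc Q * S ^ Suc Q) * C * indicator {-S..S} s \<partial>lborel)"
    proof (rule integral_mono)
      show "integrable lborel (\<lambda>s. exp S * (l ^ Suc Q * S ^ Suc Q) * C * indicator {-S..S} s)"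
        by (intro integrable_mult_right integrable_real_indicator) (auto simp: emeasure_lborel_Icc_eq)
      fix s
      show "\<bar>R s * \<psi> s\<bar> \<le> exp S * (l ^ Suc Q * S ^ Suc Q) * C * indicator {-S..S} s"
      proof (cases "\<bar>s\<bar> \<le> S")
        case True
        have "\<bar>R s\<bar> * \<bar>\<psi> s\<bar> \<le> exp S * (l ^ Suc Q * S ^ Suc Q) * C"
          using Rb[OF True] \<psi>_bound[of s] l S by (intro mult_mono) auto
        then show ?thesis using True by (simp add: abs_mult abs_le_iff)
      qed (use \<psi>_supp l S C in \<open>auto simp: abs_mult\<close>)
    qed (use iR in simp)
    also have "\<dots> = l ^ Q / fact Q * (K * l)" using S by (simp add: K_def mult_ac)
    finally have "l ^ Q / fact Q * \<bar>?\<mu>\<bar> \<le> l ^ Q / fact Q * (K * l)"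
      using l by (simp add: abs_mult)
    moreover have "l ^ Q / fact Q > 0" using l by simp
    ultimately show ?thesis by (rule mult_left_le_imp_le)
  qed
  have K: "K \<ge> 0" using S C by (simp add: K_def)
  have "\<bar>?\<mu>\<bar> \<le> 0 + e" if e: "e > 0" for e
  proof -
    define l where "l = min 1 (e / (K + 1))"
    have l: "0 < l" "l \<le> 1" using e K by (auto simp: l_def)
    have "\<bar>?\<mu>\<bar> \<le> K * l" by (rule key[OF l])
    also have "\<dots> \<le> (K + 1) * (e / (K + 1))" using K l by (intro mult_mono) (auto simp: l_def)
    also have "\<dots> = e" using K by simp
    finally show ?thesis by simp
  qed
  then have "\<bar>?\<mu>\<bar> \<le> 0" by (rule field_le_epsilon)
  then show False using mom by (simp add: zero_moments_def)
qed

end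

section \<open>Exchanging the time integral and the stochastic integral\<close>

text \<open>A Jensen inequality for the weight |\<phi>|, with a constant. It rests on the elementary
  bound of |x| by \<open>l powr (1 - p) * |x| powr p + l\<close>, whose free parameter l is
  optimised after integration.\<close>

lemma weighted_powr_bound:
  fixes g \<phi> :: "real \<Rightarrow> real" and p :: real
  assumes p: "1 < p" "p < 2" and [measurable]: "g \<in> borel_measurable borel" "\<phi> \<in> borel_measurable borel"
    and i1: "integrable lborel (\<lambda>t. \<bar>\<phi> t\<bar>)" and i2: "integrable lborel (\<lambda>t. \<bar>g t\<bar> powr p * \<bar>\<phi> t\<bar>)"
  shows "\<bar>\<integral>t. g t * \<phi> t \<partial>lborel\<bar> powr p \<le> 4 * (\<integral>t. \<bar>g t\<bar> powr p * \<bar>\<phi> t\<bar> \<partial>lborel) * (\<integral>t. \<bar>\<phi> t\<bar> \<partial>lborel) powr (p - 1)"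
proof -
  define J where "J = (\<integral>t. \<bar>g t\<bar> powr p * \<bar>\<phi> t\<bar> \<partial>lborel)"
  define F where "F = (\<integral>t. \<bar>\<phi> t\<bar> \<partial>lborel)"
  define I where "I = \<bar>\<integral>t. g t * \<phi> t \<partial>lborel\<bar>"
  have nn: "J \<ge> 0" "F \<ge> 0" "I \<ge> 0" by (simp_all add: J_def F_def I_def)
  have young: "\<bar>x\<bar> \<le> l powr (1 - p) * \<bar>x\<bar> powr p + l" if "l > 0" for x l :: real
  proof (cases "\<bar>x\<bar> \<le> l")
    case True
    then show ?thesis using add_increasing[of "l powr (1 - p) * \<bar>x\<bar> powr p" "\<bar>x\<bar>" l] by simp
  next
    case False
    have "\<bar>x\<bar> = \<bar>x\<bar> powr (1 - p) * \<bar>x\<bar> powr p" using False that by (simp flip: powr_add)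
    also have "\<dots> \<le> l powr (1 - p) * \<bar>x\<bar> powr p" using False that p by (intro mult_right_mono powr_mono2') auto
    finally show ?thesis using that by linarith
  qed
  have key: "I \<le> l powr (1 - p) * J + l * F" if l: "l > 0" for l
  proof -
    have le: "\<bar>g t * \<phi> t\<bar> \<le> l powr (1 - p) * (\<bar>g t\<bar> powr p * \<bar>\<phi> t\<bar>) + l * \<bar>\<phi> t\<bar>" for t
      using mult_right_mono[OF young[OF l, of "g t"], of "\<bar>\<phi> t\<bar>"] by (simp add: abs_mult algebra_simps)
    have ib: "integrable lborel (\<lambda>t. l powr (1 - p) * (\<bar>g t\<bar> powr p * \<bar>\<phi> t\<bar>) + l * \<bar>\<phi> t\<bar>)"
      by (intro Bochner_Integration.integrable_add integrable_mult_right i1 i2)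
    have ig: "integrable lborel (\<lambda>t. \<bar>g t * \<phi> t\<bar>)"
      by (rule integrable_dominated[OF ib]) (auto intro!: AE_I2 order_trans[OF le abs_ge_self])
    have "I \<le> (\<integral>t. \<bar>g t * \<phi> t\<bar> \<partial>lborel)" unfolding I_def by (rule integral_abs_bound)
    also have "\<dots> \<le> (\<integral>t. l powr (1 - p) * (\<bar>g t\<bar> powr p * \<bar>\<phi> t\<bar>) + l * \<bar>\<phi> t\<bar> \<partial>lborel)"
      by (rule integral_mono[OF ig ib le])
    also have "\<dots> = l powr (1 - p) * J + l * F"
      using i1 i2 by (simp add: J_def F_def)
    finally show ?thesis .
  qed
  show ?thesis
  proof (cases "J > 0 \<and> F > 0")
    case True
    \<comment> \<open>The value at which both terms of the bound coincide. This gives I \<le> 2 l F,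
      and 2^p \<le> 4 explains the constant.\<close>
    define l where "l = (J / F) powr (1 / p)"
    have l: "l > 0" using True by (simp add: l_def)
    have lp: "l powr p = J / F" using True p by (simp add: l_def powr_powr)
    have "l powr (1 - p) * J = l * F"
      using l True by (simp add: powr_diff lp)
    with key[OF l] have "I \<le> 2 * (l * F)" by (simp add: mult.commute)
    then have "I powr p \<le> (2 * (l * F)) powr p" using nn p by (intro powr_mono2) auto
    also have "\<dots> = 2 powr p * (J / F * F powr p)" using l True by (simp add: powr_mult lp)
    also have "J / F * F powr p = J * F powr (p - 1)" using True by (simp add: powr_diff)
    also have "2 powr p \<le> 2 powr (2::real)" using p by (intro powr_mono) auto
    also have "2 powr (2::real) = 4" by simp
    finally have "I powr p \<le> 4 * (J * F powr (p - 1))" using nn by (simp add: mult_right_mono)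
    then show ?thesis by (simp add: J_def F_def I_def mult.assoc)
  next
    case False
    have I0: "I = 0"
    proof (cases "F = 0")
      case True
      then have "AE t in lborel. \<phi> t = 0"
        using i1 unfolding F_def by (subst (asm) integral_nonneg_eq_0_iff_AE) auto
      then have "(\<integral>t. g t * \<phi> t \<partial>lborel) = 0" by (intro integral_eq_zero_AE) auto
      then show ?thesis by (simp add: I_def)
    next
      case F: False
      then have J: "J = 0" using False nn by linarith
      have "I \<le> 0 + e" if "e > 0" for e
        using key[of "e / F"] that F nn by (simp add: J)
      then have "I \<le> 0" by (rule field_le_epsilon)
      then show ?thesis using nn by simp
    qed
    then have "\<bar>\<integral>t. g t * \<phi> t \<partial>lborel\<bar> powr p = 0" using p by (simp add: I_def)
    moreover have "0 \<le> 4 * (\<integral>t. \<bar>g t\<bar> powr p * \<bar>\<phi> t\<bar> \<partial>lborel) * (\<integral>t. \<bar>\<phi> t\<bar> \<partial>lborel) powr (p - 1)"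
      by simp
    ultimately show ?thesis by linarith
  qed
qed

lemma floor_step_integral:
  fixes \<phi> :: "real \<Rightarrow> real" and a :: "int \<Rightarrow> real"
  assumes \<phi>: "integrable lborel \<phi>" and supp: "\<And>t. R < \<bar>t\<bar> \<Longrightarrow> \<phi> t = 0" and m: "m > 0"
  defines "K \<equiv> \<lceil>m * R\<rceil> + 1"
  shows "(\<integral>t. a \<lfloor>m * t\<rfloor> * \<phi> t \<partial>lborel) = (\<Sum>i\<in>{-K..K}. (\<integral>t. indicator {t. \<lfloor>m * t\<rfloor> = i} t * \<phi> t \<partial>lborel) * a i)"
    and "integrable lborel (\<lambda>t. a \<lfloor>m * t\<rfloor> * \<phi> t)"
proof -
  have [measurable]: "{t::real. \<lfloor>m * t\<rfloor> = i} \<in> sets borel" for i by measurable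
  have i: "integrable lborel (\<lambda>t. indicator {t. \<lfloor>m * t\<rfloor> = i} t * \<phi> t)" for i
    using integrable_real_mult_indicator[OF _ \<phi>, of "{t. \<lfloor>m * t\<rfloor> = i}"] by (simp add: mult.commute)
  have e: "a \<lfloor>m * t\<rfloor> * \<phi> t = (\<Sum>i\<in>{-K..K}. a i * (indicator {t. \<lfloor>m * t\<rfloor> = i} t * \<phi> t))" for t
  proof (cases "\<bar>t\<bar> \<le> R")
    case True
    have "\<bar>m * t\<bar> \<le> m * R" using True m by (simp add: abs_mult)
    also have "\<dots> \<le> of_int \<lceil>m * R\<rceil>" by (rule le_of_int_ceiling)
    finally have "\<lfloor>m * t\<rfloor> \<in> {-K..K}" unfolding K_def by (auto simp: abs_le_iff floor_le_iff le_floor_iff)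
    then have "(\<Sum>i\<in>{-K..K}. a i * (indicator {t. \<lfloor>m * t\<rfloor> = i} t * \<phi> t)) = (\<Sum>i\<in>{\<lfloor>m * t\<rfloor>}. a i * (indicator {t. \<lfloor>m * t\<rfloor> = i} t * \<phi> t))"
      by (intro sum.mono_neutral_right) auto
    then show ?thesis by simp
  qed (use supp in auto)
  show "(\<integral>t. a \<lfloor>m * t\<rfloor> * \<phi> t \<partial>lborel) = (\<Sum>i\<in>{-K..K}. (\<integral>t. indicator {t. \<lfloor>m * t\<rfloor> = i} t * \<phi> t \<partial>lborel) * a i)"
    unfolding e by (subst Bochner_Integration.integral_sum) (use i in \<open>auto simp: mult.commute\<close>)
  show "integrable lborel (\<lambda>t. a \<lfloor>m * t\<rfloor> * \<phi> t)"
    unfolding e by (intro Bochner_Integration.integrable_sum integrable_mult_right i)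
qed

context sas_noise begin

text \<open>Time is discretised: with t rounded down to a grid both integrals become finite linear
  combinations, for which the exchange is linearity. As the grid is refined, the kernels converge in
  L^\<alpha> and the random integrals in mean, both at a positive power of the mesh because H > 0,
  and \<open>stable_int_limit\<close> concludes.\<close>

lemma stochastic_fubini:
  fixes X :: "real \<Rightarrow> 'a \<Rightarrow> real" and \<phi> :: "real \<Rightarrow> real" and H B R :: real
  assumes X: "linear_fractional_stable_motion P \<alpha> H M X" and H: "0 < H" "H < 1"
    and \<phi>m [measurable]: "\<phi> \<in> borel_measurable borel" and \<phi>B: "\<And>t. \<bar>\<phi> t\<bar> \<le> B" and \<phi>R: "\<And>t. R < \<bar>t\<bar> \<Longrightarrow> \<phi> t = 0"
  defines "k \<equiv> \<lambda>t u. pos_power (H - 1 / \<alpha>) (t - u) - pos_power (H - 1 / \<alpha>) (- u)"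
  shows "stable_int (\<lambda>u. \<integral>t. k t u * \<phi> t \<partial>lborel) (\<lambda>x. \<integral>t. X t x * \<phi> t \<partial>lborel)"
proof -
  interpret LP: pair_sigma_finite lborel P ..
  define \<kappa> where "\<kappa> = H - 1 / \<alpha>"
  have \<kappa>: "-1 < \<kappa>"
  proof -
    have "1 / \<alpha> < 1" using \<alpha> by simp
    then show ?thesis using H by (simp add: \<kappa>_def)
  qed
  have kX: "stable_int (k t) (X t)" for t
    using X by (simp add: linear_fractional_stable_motion_def k_def)
  have [measurable]: "(\<lambda>p. X (fst p) (snd p)) \<in> borel_measurable (borel \<Otimes>\<^sub>M P)"
    using X by (simp add: linear_fractional_stable_motion_def case_prod_beta')
  have [measurable]: "X t \<in> borel_measurable P" for t by (rule stable_int_measurable[OF kX])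
  have [measurable]: "k t \<in> borel_measurable borel" for t unfolding k_def by measurable
  have kL: "in_Lp \<alpha> (k t)" for t by (rule stable_int_in_Lp[OF kX])
  \<comment> \<open>The scale of a unit increment. Dilation and translation of the kernel reduce
    every increment to it, giving |t - s|^(\<alpha> H) A: self-similarity and stationarity of
    increments at the level of \<open>powint\<close>.\<close>
  define A where "A = powint \<alpha> (k 1)"
  have A0: "A \<ge> 0" by (simp add: A_def)
  have kp: "powint \<alpha> (k \<delta>) = \<delta> powr (\<alpha> * H) * A" if "\<delta> > 0" for \<delta>
  proof -
    have e: "k \<delta> u = \<delta> powr \<kappa> * k 1 (0 + (1 / \<delta>) * u)" for u
    proof -
      have "pos_power \<kappa> (\<delta> - u) = \<delta> powr \<kappa> * pos_power \<kappa> (1 - u / \<delta>)"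
        using pos_power_scale[OF that, of \<kappa> "1 - u / \<delta>"] that by (simp add: right_diff_distrib)
      moreover have "pos_power \<kappa> (- u) = \<delta> powr \<kappa> * pos_power \<kappa> (- (u / \<delta>))"
        using pos_power_scale[OF that, of \<kappa> "- (u / \<delta>)"] that by simp
      ultimately show ?thesis by (simp add: k_def \<kappa>_def[symmetric] right_diff_distrib)
    qed
    have "A = \<bar>1 / \<delta>\<bar> *\<^sub>R (\<integral>u. \<bar>k 1 (0 + (1 / \<delta>) * u)\<bar> powr \<alpha> \<partial>lborel)"
      unfolding A_def powint_def using that by (intro lborel_integral_real_affine) simp
    then have "(\<integral>u. \<bar>k 1 (0 + (1 / \<delta>) * u)\<bar> powr \<alpha> \<partial>lborel) = \<delta> * A"
      using that by (simp add: field_simps)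
    then have "powint \<alpha> (k \<delta>) = (\<delta> powr \<kappa>) powr \<alpha> * (\<delta> * A)"
      using powint_cmult[of \<alpha> "\<delta> powr \<kappa>" "\<lambda>u. k 1 (0 + (1 / \<delta>) * u)"] unfolding e[abs_def] powint_def by simp
    also have "\<dots> = \<delta> powr (\<kappa> * \<alpha> + 1) * A" using that by (simp add: powr_powr powr_add)
    also have "\<kappa> * \<alpha> + 1 = \<alpha> * H" using \<alpha> by (simp add: \<kappa>_def algebra_simps)
    finally show ?thesis .
  qed
  have kd0: "powint \<alpha> (\<lambda>u. k t u - k s u) = \<bar>t - s\<bar> powr (\<alpha> * H) * A" if "s \<le> t" for s t
  proof (cases "s = t")
    case False
    have "(\<lambda>u. k t u - k s u) = (\<lambda>u. k (t - s) (u - s))" by (auto simp: k_def algebra_simps)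
    then show ?thesis using powint_shift[of \<alpha> "k (t - s)" s] kp[of "t - s"] that False by simp
  qed (simp add: powint_def)
  have kd: "powint \<alpha> (\<lambda>u. k t u - k s u) = \<bar>t - s\<bar> powr (\<alpha> * H) * A" for s t
  proof (cases "s \<le> t")
    case False
    have "powint \<alpha> (\<lambda>u. k t u - k s u) = powint \<alpha> (\<lambda>u. k s u - k t u)"
      unfolding powint_def by (simp add: abs_minus_commute)
    then show ?thesis using kd0[of t s] False by (simp add: abs_minus_commute)
  qed (rule kd0)
  define c0 where "c0 = A powr (1 / \<alpha>) * expectation (\<lambda>x. \<bar>Z0 x\<bar>)"
  have c0: "c0 \<ge> 0" by (simp add: c0_def)
  have dX: "stable_int (\<lambda>u. k t u - k s u) (\<lambda>x. X t x - X s x)" for s t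
    using stable_int_lincomb[OF kX[of t] kX[of s], of 1 "-1"] by simp
  have EX: "integrable P (\<lambda>x. X t x - X s x)" "expectation (\<lambda>x. \<bar>X t x - X s x\<bar>) = \<bar>t - s\<bar> powr H * c0" for s t
  proof -
    show "integrable P (\<lambda>x. X t x - X s x)" by (rule abs_moment(2)[OF dX])
    have "(\<bar>t - s\<bar> powr (\<alpha> * H) * A) powr (1 / \<alpha>) = \<bar>t - s\<bar> powr H * A powr (1 / \<alpha>)"
      using A0 \<alpha> by (simp add: powr_mult powr_powr)
    then show "expectation (\<lambda>x. \<bar>X t x - X s x\<bar>) = \<bar>t - s\<bar> powr H * c0"
      using abs_moment(3)[OF dX, of t s] by (simp add: kd c0_def)
  qed
  have X0: "AE x in P. X 0 x = 0"
  proof -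
    have k0: "powint \<alpha> (k 0) = 0" by (simp add: k_def powint_def)
    have "expectation (\<lambda>x. \<bar>X 0 x\<bar>) = 0" using abs_moment(3)[OF kX[of 0]] k0 by simp
    then show ?thesis using abs_moment(1)[OF kX[of 0]] by (subst (asm) integral_nonneg_eq_0_iff_AE) auto
  qed
  have EX0: "expectation (\<lambda>x. \<bar>X t x\<bar>) = \<bar>t\<bar> powr H * c0" for t
  proof -
    have "expectation (\<lambda>x. \<bar>X t x\<bar>) = expectation (\<lambda>x. \<bar>X t x - X 0 x\<bar>)"
      using X0 by (intro integral_cong_AE) auto
    then show ?thesis using EX(2)[of t 0] by simp
  qed
  define R' where "R' = max R 0"
  have \<phi>R': "\<phi> t = 0" if "R' < \<bar>t\<bar>" for t using \<phi>R[of t] that by (simp add: R'_def)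
  have \<phi>le: "\<bar>\<phi> t\<bar> \<le> B * indicator {-R'..R'} t" for t
    using \<phi>B[of t] \<phi>R'[of t] by (auto simp: indicator_def abs_le_iff)
  have B0: "B \<ge> 0" using \<phi>B[of 0] by linarith
  have ind: "integrable lborel (indicator {-R'..R'} :: real \<Rightarrow> real)"
    by (intro integrable_real_indicator) (auto simp: emeasure_lborel_Icc_eq)
  have \<phi>i: "integrable lborel \<phi>"
    by (rule integrable_dominated[OF integrable_mult_right[OF ind, of B]])
       (use \<phi>le B0 in auto)
  define F where "F = (\<integral>t. \<bar>\<phi> t\<bar> \<partial>lborel)"
  have F0: "F \<ge> 0" by (simp add: F_def)
  let ?f = "\<lambda>u. \<integral>t. k t u * \<phi> t \<partial>lborel" and ?Y = "\<lambda>x. \<integral>t. X t x * \<phi> t \<partial>lborel"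
  have XP: "(\<lambda>(t, x). X t x * \<phi> t) \<in> borel_measurable (lborel \<Otimes>\<^sub>M P)"
    by measurable
  have Ymeas: "?Y \<in> borel_measurable P"
  proof (rule lborel.borel_measurable_lebesgue_integral)
    have sw: "(\<lambda>p. (snd p, fst p)) \<in> P \<Otimes>\<^sub>M lborel \<rightarrow>\<^sub>M borel \<Otimes>\<^sub>M P" by measurable
    have Xm: "(\<lambda>p. X (fst p) (snd p)) \<in> borel_measurable (borel \<Otimes>\<^sub>M P)" by measurable
    have [measurable]: "(\<lambda>p. X (snd p) (fst p)) \<in> borel_measurable (P \<Otimes>\<^sub>M lborel)"
      using measurable_compose[OF sw Xm] by simp
    show "(\<lambda>(x, t). X t x * \<phi> t) \<in> borel_measurable (P \<Otimes>\<^sub>M lborel)" by measurable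
  qed
  have fmeas: "?f \<in> borel_measurable borel" unfolding k_def by measurable
  have iXP: "integrable (lborel \<Otimes>\<^sub>M P) (\<lambda>(t, x). X t x * \<phi> t)"
  proof (rule LP.Fubini_integrable[OF XP])
    have "(\<integral>x. norm (X t x * \<phi> t) \<partial>P) = \<bar>t\<bar> powr H * c0 * \<bar>\<phi> t\<bar>" for t
      by (simp add: abs_mult EX0)
    moreover have "integrable lborel (\<lambda>t. \<bar>t\<bar> powr H * c0 * \<bar>\<phi> t\<bar>)"
    proof (rule integrable_dominated[OF integrable_mult_right[OF integrable_abs[OF \<phi>i], of "R' powr H * c0"]])
      have "\<bar>t\<bar> powr H * c0 * \<bar>\<phi> t\<bar> \<le> R' powr H * c0 * \<bar>\<phi> t\<bar>" for t
      proof (cases "\<bar>t\<bar> \<le> R'")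
        case True
        then show ?thesis using H c0 by (intro mult_right_mono powr_mono2) auto
      qed (use \<phi>R' in auto)
      then show "AE t in lborel. norm (\<bar>t\<bar> powr H * c0 * \<bar>\<phi> t\<bar>) \<le> norm (R' powr H * c0 * \<bar>\<phi> t\<bar>)"
        using c0 by (intro AE_I2 norm_le_norm) auto
    qed measurable
    ultimately show "integrable lborel (\<lambda>t. \<integral>x. norm (case (t, x) of (t, x) \<Rightarrow> X t x * \<phi> t) \<partial>P)" by simp
    show "AE t in lborel. integrable P (\<lambda>x. case (t, x) of (t, x) \<Rightarrow> X t x * \<phi> t)"
      using abs_moment(2)[OF kX] by simp
  qed
  have AEX: "AE x in P. integrable lborel (\<lambda>t. X t x * \<phi> t)"
    using LP.AE_integrable_snd[OF iXP] by simp
  have kint: "integrable lborel (\<lambda>t. k t u * \<phi> t)" for u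
  proof -
    have "integrable lborel (\<lambda>t. pos_power \<kappa> (t - u) * \<phi> t)"
    proof (rule integrable_dominated[OF integrable_mult_right[OF pos_power_window(1)[OF \<kappa>, of "- u" R'], of B]])
      have "\<bar>pos_power \<kappa> (t - u) * \<phi> t\<bar> \<le> B * (pos_power \<kappa> (t + - u) * indicator {-R'..R'} t)" for t
        using mult_left_mono[OF \<phi>le[of t] pos_power_nonneg[of \<kappa> "t - u"]] by (simp add: abs_mult pos_power_nonneg mult_ac)
      then show "AE t in lborel. norm (pos_power \<kappa> (t - u) * \<phi> t) \<le> norm (B * (pos_power \<kappa> (t + - u) * indicator {-R'..R'} t))"
        by (intro AE_I2) (metis abs_ge_self order_trans real_norm_def)
    qed measurable
    then show ?thesis using \<phi>i by (simp add: k_def \<kappa>_def[symmetric] left_diff_distrib)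
  qed
  define m where "m n = real (Suc n)" for n
  have m: "m n > 0" for n by (simp add: m_def)
  define \<tau> where "\<tau> n t = of_int \<lfloor>m n * t\<rfloor> / m n" for n t
  have \<tau>: "\<bar>\<tau> n t - t\<bar> \<le> 1 / m n" for n t
  proof -
    have "\<bar>of_int \<lfloor>m n * t\<rfloor> - m n * t\<bar> \<le> 1" by linarith
    then have "\<bar>of_int \<lfloor>m n * t\<rfloor> - m n * t\<bar> / m n \<le> 1 / m n" using m[of n] by (intro divide_right_mono) auto
    moreover have "\<tau> n t - t = (of_int \<lfloor>m n * t\<rfloor> - m n * t) / m n" using m[of n] by (simp add: \<tau>_def field_simps)
    ultimately show ?thesis using m[of n] by (simp add: abs_divide)
  qed
  have [measurable]: "\<tau> n \<in> borel_measurable borel" for n unfolding \<tau>_def[abs_def] by measurable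
  define K where "K n = \<lceil>m n * R\<rceil> + 1" for n
  \<comment> \<open>\<open>stable_int_sum\<close> wants a nonempty index set. The range can be empty
    only when R is negative; then \<phi> vanishes identically and the default index 0 carries the
    coefficient 0.\<close>
  define I where "I n = (if {- K n..K n} = {} then {0} else {- K n..K n})" for n
  define ci where "ci n i = (\<integral>t. indicator {t. \<lfloor>m n * t\<rfloor> = i} t * \<phi> t \<partial>lborel)" for n i
  have step: "(\<integral>t. a \<lfloor>m n * t\<rfloor> * \<phi> t \<partial>lborel) = (\<Sum>i\<in>I n. ci n i * a i)" for a n
  proof -
    define K' where "K' = \<lceil>m n * R'\<rceil> + 1"
    have 1: "(\<integral>t. a \<lfloor>m n * t\<rfloor> * \<phi> t \<partial>lborel) = (\<Sum>i\<in>{-K'..K'}. ci n i * a i)"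
      unfolding ci_def K'_def by (rule floor_step_integral(1)[OF \<phi>i \<phi>R' m])
    have 2: "(\<integral>t. a \<lfloor>m n * t\<rfloor> * \<phi> t \<partial>lborel) = (\<Sum>i\<in>{- K n..K n}. ci n i * a i)"
      unfolding ci_def K_def by (rule floor_step_integral(1)[OF \<phi>i \<phi>R m])
    show ?thesis
    proof (cases "{- K n..K n} = {}")
      case True
      have "\<phi> t = 0" for t
      proof (cases "R < \<bar>t\<bar>")
        case False
        then have "0 \<le> m n * R" using m[of n] by (intro mult_nonneg_nonneg) auto
        then have "K n \<ge> 0" by (simp add: K_def)
        then show ?thesis using True by simp
      qed (rule \<phi>R)
      then show ?thesis using 2 True by (simp add: ci_def)
    next
      case False
      then show ?thesis using 2 by (simp add: I_def)
    qed
  qed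
  define Fm where "Fm n = (\<lambda>u. \<Sum>i\<in>I n. ci n i * k (of_int i / m n) u)" for n
  define Zm where "Zm n = (\<lambda>x. \<Sum>i\<in>I n. ci n i * X (of_int i / m n) x)" for n
  have st: "stable_int (Fm n) (Zm n)" for n
    unfolding Fm_def Zm_def by (rule stable_int_sum) (auto simp: I_def intro: kX)
  have Fe: "Fm n u = (\<integral>t. k (\<tau> n t) u * \<phi> t \<partial>lborel)" for n u
    unfolding Fm_def \<tau>_def by (rule step[symmetric])
  have Ze: "Zm n x = (\<integral>t. X (\<tau> n t) x * \<phi> t \<partial>lborel)" for n x
    unfolding Zm_def \<tau>_def by (rule step[symmetric])
  have stepi: "integrable lborel (\<lambda>t. a \<lfloor>m n * t\<rfloor> * \<phi> t)" for a n
    by (rule floor_step_integral(2)[OF \<phi>i \<phi>R m])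
  have mlim: "(\<lambda>n. 1 / m n) \<longlonglongrightarrow> 0"
    using LIMSEQ_inverse_real_of_nat by (simp add: m_def inverse_eq_divide)
  have mlimp: "(\<lambda>n. (1 / m n) powr p) \<longlonglongrightarrow> 0" if "p > 0" for p
  proof -
    have "(\<lambda>n. (1 / m n) powr p) \<longlonglongrightarrow> 0 powr p"
      by (rule tendsto_powr'[OF mlim tendsto_const]) (use that in \<open>auto simp: m_def intro!: always_eventually\<close>)
    then show ?thesis using that by simp
  qed
  have FmL: "in_Lp \<alpha> (Fm n)" for n by (rule stable_int_in_Lp[OF st])
  \<comment> \<open>\<open>weighted_powr_bound\<close> moves the power under the time integral.
    After exchanging the integrals, the inner one is the scale of an increment over a time of at
    most 1/m.\<close>
  have Jint: "in_Lp \<alpha> (\<lambda>u. Fm n u - ?f u) \<and> powint \<alpha> (\<lambda>u. Fm n u - ?f u) \<le> 4 * F powr (\<alpha> - 1) * ((1 / m n) powr (\<alpha> * H) * A * F)" for n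
  proof -
    let ?g = "\<lambda>t u. k (\<tau> n t) u - k t u"
    have [measurable]: "(\<lambda>(t, u). ?g t u) \<in> borel_measurable (lborel \<Otimes>\<^sub>M lborel)" unfolding k_def by measurable
    have ub: "(\<integral>u. \<bar>?g t u\<bar> powr \<alpha> * \<bar>\<phi> t\<bar> \<partial>lborel) \<le> (1 / m n) powr (\<alpha> * H) * A * \<bar>\<phi> t\<bar>" for t
    proof -
      have "(\<integral>u. \<bar>?g t u\<bar> powr \<alpha> * \<bar>\<phi> t\<bar> \<partial>lborel) = \<bar>\<tau> n t - t\<bar> powr (\<alpha> * H) * A * \<bar>\<phi> t\<bar>"
        using kd[of "\<tau> n t" t] by (simp add: powint_def)
      also have "\<dots> \<le> (1 / m n) powr (\<alpha> * H) * A * \<bar>\<phi> t\<bar>"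
        using \<tau>[of n t] A0 \<alpha> H by (intro mult_right_mono powr_mono2) auto
      finally show ?thesis .
    qed
    have ib: "integrable lborel (\<lambda>t. (1 / m n) powr (\<alpha> * H) * A * \<bar>\<phi> t\<bar>)" using \<phi>i by simp
    have it: "integrable lborel (\<lambda>t. \<integral>u. \<bar>?g t u\<bar> powr \<alpha> * \<bar>\<phi> t\<bar> \<partial>lborel)"
      by (rule integrable_dominated[OF ib]) (measurable, intro AE_I2 norm_le_norm ub, simp)
    have ip: "integrable (lborel \<Otimes>\<^sub>M lborel) (\<lambda>(t, u). \<bar>?g t u\<bar> powr \<alpha> * \<bar>\<phi> t\<bar>)"
    proof (rule lborel_pair.Fubini_integrable)
      show "integrable lborel (\<lambda>t. \<integral>u. norm (case (t, u) of (t, u) \<Rightarrow> \<bar>?g t u\<bar> powr \<alpha> * \<bar>\<phi> t\<bar>) \<partial>lborel)"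
        using it by (simp add: abs_mult)
      show "AE t in lborel. integrable lborel (\<lambda>u. case (t, u) of (t, u) \<Rightarrow> \<bar>?g t u\<bar> powr \<alpha> * \<bar>\<phi> t\<bar>)"
        using in_LpD(2)[OF in_Lp_diff[OF \<alpha> kL kL]] by simp
    qed measurable
    have J1: "integrable lborel (\<lambda>u. \<integral>t. \<bar>?g t u\<bar> powr \<alpha> * \<bar>\<phi> t\<bar> \<partial>lborel)"
      by (rule lborel_pair.integrable_snd[OF ip])
    have J2: "(\<integral>u. (\<integral>t. \<bar>?g t u\<bar> powr \<alpha> * \<bar>\<phi> t\<bar> \<partial>lborel) \<partial>lborel) \<le> (1 / m n) powr (\<alpha> * H) * A * F"
    proof -
      have "(\<integral>u. (\<integral>t. \<bar>?g t u\<bar> powr \<alpha> * \<bar>\<phi> t\<bar> \<partial>lborel) \<partial>lborel) = (\<integral>t. (\<integral>u. \<bar>?g t u\<bar> powr \<alpha> * \<bar>\<phi> t\<bar> \<partial>lborel) \<partial>lborel)"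
        by (rule lborel_pair.Fubini_integral[OF ip])
      also have "\<dots> \<le> (\<integral>t. (1 / m n) powr (\<alpha> * H) * A * \<bar>\<phi> t\<bar> \<partial>lborel)" by (rule integral_mono[OF it ib ub])
      finally show ?thesis by (simp add: F_def)
    qed
    have AEu: "AE u in lborel. integrable lborel (\<lambda>t. \<bar>?g t u\<bar> powr \<alpha> * \<bar>\<phi> t\<bar>)"
      using lborel_pair.AE_integrable_snd[OF ip] by simp
    have d: "Fm n u - ?f u = (\<integral>t. ?g t u * \<phi> t \<partial>lborel)" for u
    proof -
      have "integrable lborel (\<lambda>t. k (\<tau> n t) u * \<phi> t)" unfolding \<tau>_def by (rule stepi)
      then show ?thesis unfolding Fe using kint[of u] by (simp add: left_diff_distrib)
    qed
    have le: "AE u in lborel. \<bar>Fm n u - ?f u\<bar> powr \<alpha> \<le> 4 * F powr (\<alpha> - 1) * (\<integral>t. \<bar>?g t u\<bar> powr \<alpha> * \<bar>\<phi> t\<bar> \<partial>lborel)"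
      using AEu
    proof eventually_elim
      case (elim u)
      have [measurable]: "(\<lambda>t. ?g t u) \<in> borel_measurable borel" unfolding k_def by measurable
      show ?case unfolding d F_def
        using weighted_powr_bound[OF \<alpha> _ \<phi>m integrable_abs[OF \<phi>i] elim] by (simp add: mult_ac)
    qed
    have ib2: "integrable lborel (\<lambda>u. 4 * F powr (\<alpha> - 1) * (\<integral>t. \<bar>?g t u\<bar> powr \<alpha> * \<bar>\<phi> t\<bar> \<partial>lborel))"
      using J1 by (rule integrable_mult_right)
    have [measurable]: "Fm n \<in> borel_measurable borel" using FmL by auto
    have iF: "integrable lborel (\<lambda>u. \<bar>Fm n u - ?f u\<bar> powr \<alpha>)"
    proof (rule integrable_dominated[OF ib2])
      show "AE u in lborel. norm (\<bar>Fm n u - ?f u\<bar> powr \<alpha>) \<le> norm (4 * F powr (\<alpha> - 1) * (\<integral>t. \<bar>?g t u\<bar> powr \<alpha> * \<bar>\<phi> t\<bar> \<partial>lborel))"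
        using le by eventually_elim (rule norm_le_norm, simp)
    qed (use fmeas in measurable)
    have "powint \<alpha> (\<lambda>u. Fm n u - ?f u) \<le> (\<integral>u. 4 * F powr (\<alpha> - 1) * (\<integral>t. \<bar>?g t u\<bar> powr \<alpha> * \<bar>\<phi> t\<bar> \<partial>lborel) \<partial>lborel)"
      unfolding powint_def by (rule integral_mono_AE[OF iF ib2 le])
    also have "\<dots> = 4 * F powr (\<alpha> - 1) * (\<integral>u. (\<integral>t. \<bar>?g t u\<bar> powr \<alpha> * \<bar>\<phi> t\<bar> \<partial>lborel) \<partial>lborel)"
      by (rule integral_mult_right_zero)
    also have "\<dots> \<le> 4 * F powr (\<alpha> - 1) * ((1 / m n) powr (\<alpha> * H) * A * F)"
      by (rule mult_left_mono[OF J2]) simp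
    finally show ?thesis using iF fmeas by (simp add: in_Lp_def)
  qed
  have fL: "in_Lp \<alpha> ?f"
  proof -
    have "in_Lp \<alpha> (\<lambda>u. Fm 0 u - (Fm 0 u - ?f u))" by (rule in_Lp_diff[OF \<alpha> FmL conjunct1[OF Jint]])
    then show ?thesis by simp
  qed
  show ?thesis
  proof (rule stable_int_limit[OF st fmeas Ymeas fL])
    have l: "(\<lambda>n. 4 * F powr (\<alpha> - 1) * ((1 / m n) powr (\<alpha> * H) * A * F)) \<longlonglongrightarrow> 4 * F powr (\<alpha> - 1) * (0 * A * F)"
      using \<alpha> H by (intro tendsto_intros mlimp) auto
    show "(\<lambda>n. powint \<alpha> (\<lambda>u. Fm n u - ?f u)) \<longlonglongrightarrow> 0"
      by (rule tendsto_zero_le[OF powint_nonneg conjunct2[OF Jint]]) (use l in simp)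
    have [measurable]: "Zm n \<in> borel_measurable P" for n by (rule stable_int_measurable[OF st])
    \<comment> \<open>The same comparison for the paths, in mean. Pathwise integrability in time is
      only almost sure, so the difference of the integrals is taken almost everywhere.\<close>
    have Dn: "integrable P (\<lambda>x. Zm n x - ?Y x) \<and> expectation (\<lambda>x. \<bar>Zm n x - ?Y x\<bar>) \<le> (1 / m n) powr H * c0 * F" for n
    proof -
      let ?g = "\<lambda>t x. X (\<tau> n t) x - X t x"
      have Xm: "(\<lambda>p. X (fst p) (snd p)) \<in> borel_measurable (borel \<Otimes>\<^sub>M P)" by measurable
      have s1: "(\<lambda>p. (fst p, snd p)) \<in> lborel \<Otimes>\<^sub>M P \<rightarrow>\<^sub>M borel \<Otimes>\<^sub>M P"
        and s2: "(\<lambda>p. (\<tau> n (fst p), snd p)) \<in> lborel \<Otimes>\<^sub>M P \<rightarrow>\<^sub>M borel \<Otimes>\<^sub>M P" by measurable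
      have "(\<lambda>p. X (\<tau> n (fst p)) (snd p)) \<in> borel_measurable (lborel \<Otimes>\<^sub>M P)"
        "(\<lambda>p. X (fst p) (snd p)) \<in> borel_measurable (lborel \<Otimes>\<^sub>M P)"
        using measurable_compose[OF s2 Xm] measurable_compose[OF s1 Xm] by simp_all
      then have [measurable]: "(\<lambda>(t, x). ?g t x) \<in> borel_measurable (lborel \<Otimes>\<^sub>M P)"
        unfolding case_prod_beta' by (rule borel_measurable_diff)
      have ub: "(\<integral>x. \<bar>?g t x * \<phi> t\<bar> \<partial>P) \<le> (1 / m n) powr H * c0 * \<bar>\<phi> t\<bar>" for t
      proof -
        have "(\<integral>x. \<bar>?g t x * \<phi> t\<bar> \<partial>P) = \<bar>\<tau> n t - t\<bar> powr H * c0 * \<bar>\<phi> t\<bar>"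
          using EX(2)[of "\<tau> n t" t] by (simp add: abs_mult)
        also have "\<dots> \<le> (1 / m n) powr H * c0 * \<bar>\<phi> t\<bar>"
          using \<tau>[of n t] c0 H by (intro mult_right_mono powr_mono2) auto
        finally show ?thesis .
      qed
      have ib: "integrable lborel (\<lambda>t. (1 / m n) powr H * c0 * \<bar>\<phi> t\<bar>)" using \<phi>i by simp
      have it: "integrable lborel (\<lambda>t. \<integral>x. \<bar>?g t x * \<phi> t\<bar> \<partial>P)"
        by (rule integrable_dominated[OF ib]) (measurable, intro AE_I2 norm_le_norm ub, simp)
      have ip: "integrable (lborel \<Otimes>\<^sub>M P) (\<lambda>(t, x). ?g t x * \<phi> t)"
      proof (rule LP.Fubini_integrable)
        show "integrable lborel (\<lambda>t. \<integral>x. norm (case (t, x) of (t, x) \<Rightarrow> ?g t x * \<phi> t) \<partial>P)"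
          using it by simp
        show "AE t in lborel. integrable P (\<lambda>x. case (t, x) of (t, x) \<Rightarrow> ?g t x * \<phi> t)"
          using EX(1) by simp
      qed measurable
      have ipa: "integrable (lborel \<Otimes>\<^sub>M P) (\<lambda>(t, x). \<bar>?g t x * \<phi> t\<bar>)"
        using integrable_abs[OF ip] by (simp add: case_prod_beta')
      have D: "AE x in P. Zm n x - ?Y x = (\<integral>t. ?g t x * \<phi> t \<partial>lborel)"
        using AEX
      proof eventually_elim
        case (elim x)
        have "integrable lborel (\<lambda>t. X (\<tau> n t) x * \<phi> t)" unfolding \<tau>_def by (rule stepi)
        then show ?case unfolding Ze using elim by (simp add: left_diff_distrib)
      qed
      have i1: "integrable P (\<lambda>x. \<integral>t. ?g t x * \<phi> t \<partial>lborel)" by (rule LP.integrable_snd[OF ip])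
      have i2: "integrable P (\<lambda>x. \<integral>t. \<bar>?g t x * \<phi> t\<bar> \<partial>lborel)" by (rule LP.integrable_snd[OF ipa])
      have int: "integrable P (\<lambda>x. Zm n x - ?Y x)"
        using D i1 Ymeas by (subst integrable_cong_AE[OF _ _ D]) auto
      have "expectation (\<lambda>x. \<bar>Zm n x - ?Y x\<bar>) = expectation (\<lambda>x. \<bar>\<integral>t. ?g t x * \<phi> t \<partial>lborel\<bar>)"
        using D Ymeas i1 by (intro integral_cong_AE) auto
      also have "\<dots> \<le> expectation (\<lambda>x. \<integral>t. \<bar>?g t x * \<phi> t\<bar> \<partial>lborel)"
        by (intro integral_mono integrable_abs i1 i2 integral_abs_bound)
      also have "\<dots> = (\<integral>t. (\<integral>x. \<bar>?g t x * \<phi> t\<bar> \<partial>P) \<partial>lborel)"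
        by (rule LP.Fubini_integral[OF ipa])
      also have "\<dots> \<le> (\<integral>t. (1 / m n) powr H * c0 * \<bar>\<phi> t\<bar> \<partial>lborel)"
        by (rule integral_mono[OF it ib ub])
      also have "\<dots> = (1 / m n) powr H * c0 * F" by (simp add: F_def)
      finally show ?thesis using int by blast
    qed
    show "tendsto_in_probability P Zm ?Y"
    proof (rule tip_L1)
      show "(\<lambda>n. expectation (\<lambda>x. \<bar>Zm n x - ?Y x\<bar>)) \<longlonglongrightarrow> 0"
      proof (rule tendsto_zero_le)
        have "(\<lambda>n. (1 / m n) powr H * c0 * F) \<longlonglongrightarrow> 0 * c0 * F"
          using H by (intro tendsto_intros mlimp) auto
        then show "(\<lambda>n. (1 / m n) powr H * c0 * F) \<longlonglongrightarrow> 0" by simp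
      qed (use Dn in auto)
    qed (use Dn Ymeas in auto)
  qed
qed

text \<open>The substitution t = a (n + s) with a = 2^j scales the power kernel and brings out
  \<open>h\<close>. The second power, in - u, does not depend on t and is annihilated by the zeroth
  moment of the wavelet.\<close>

lemma wavelet_coeff_stable:
  fixes X :: "real \<Rightarrow> 'a \<Rightarrow> real" and j n :: int
  assumes X: "linear_fractional_stable_motion P \<alpha> H M X" and H: "0 < H" "H < 1"
    and W: "wavelet_kernel (H - 1 / \<alpha>) \<psi> Q S0 C"
  shows "stable_int (\<lambda>u. 2 powr (real_of_int j * (H - 1 / \<alpha> + 1 / 2)) * wavelet_kernel.h (H - 1 / \<alpha>) \<psi> (real_of_int n - 2 powr (- real_of_int j) * u))
    (wavelet_coeff X \<psi> j n)"
proof -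
  define \<kappa> where "\<kappa> = H - 1 / \<alpha>"
  interpret W: wavelet_kernel \<kappa> \<psi> Q S0 C using W by (simp add: \<kappa>_def)
  define a where "a = 2 powr (real_of_int j)"
  have a: "a > 0" "2 powr (- real_of_int j) = 1 / a" "2 powr (- real_of_int j / 2) = a powr (-1/2)"
    by (simp_all add: a_def powr_minus_divide powr_powr)
  define \<phi> where "\<phi> t = a powr (-1/2) * \<psi> (1 / a * t - real_of_int n)" for t
  have [measurable]: "\<phi> \<in> borel_measurable borel" unfolding \<phi>_def[abs_def] by measurable
  have B: "\<bar>\<phi> t\<bar> \<le> a powr (-1/2) * C" for t
    using W.\<psi>_bound by (simp add: \<phi>_def abs_mult mult_left_mono)
  have R: "\<phi> t = 0" if "a * (S0 + \<bar>real_of_int n\<bar>) < \<bar>t\<bar>" for t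
  proof -
    have "S0 + \<bar>real_of_int n\<bar> < \<bar>1 / a * t\<bar>" using that a by (simp add: abs_mult abs_divide field_simps)
    then have "S0 < \<bar>1 / a * t - real_of_int n\<bar>" by linarith
    then show ?thesis using W.\<psi>_supp by (simp add: \<phi>_def)
  qed
  let ?k = "\<lambda>t u. pos_power (H - 1 / \<alpha>) (t - u) - pos_power (H - 1 / \<alpha>) (- u)"
  have st: "stable_int (\<lambda>u. \<integral>t. ?k t u * \<phi> t \<partial>lborel) (\<lambda>x. \<integral>t. X t x * \<phi> t \<partial>lborel)"
    by (rule stochastic_fubini[OF X H _ B R]) measurable
  have Y: "(\<lambda>x. \<integral>t. X t x * \<phi> t \<partial>lborel) = wavelet_coeff X \<psi> j n"
    unfolding wavelet_coeff_def[abs_def] \<phi>_def a ..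
  have f: "(\<integral>t. ?k t u * \<phi> t \<partial>lborel) = 2 powr (real_of_int j * (\<kappa> + 1 / 2)) * W.h (real_of_int n - 2 powr (- real_of_int j) * u)" for u
  proof -
    define v where "v = real_of_int n - 1 / a * u"
    have e: "?k (a * real_of_int n + a * s) u * \<phi> (a * real_of_int n + a * s)
      = a powr (-1/2) * (a powr \<kappa> * (pos_power \<kappa> (s + v) * \<psi> s) - pos_power \<kappa> (- u) * \<psi> s)" for s
    proof -
      have "a * real_of_int n + a * s - u = a * (s + v)" using a by (simp add: v_def field_simps)
      then have "pos_power (H - 1 / \<alpha>) (a * real_of_int n + a * s - u) = a powr \<kappa> * pos_power \<kappa> (s + v)"
        using pos_power_scale[OF a(1)] by (simp add: \<kappa>_def)
      moreover have "\<phi> (a * real_of_int n + a * s) = a powr (-1/2) * \<psi> s"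
        using a by (simp add: \<phi>_def distrib_left)
      ultimately show ?thesis by (simp add: \<kappa>_def[symmetric] algebra_simps)
    qed
    have m0: "(\<integral>s. \<psi> s \<partial>lborel) = 0" using W.mom W.Q by (auto simp: zero_moments_def dest: spec[of _ 0])
    have "(\<integral>t. ?k t u * \<phi> t \<partial>lborel) = \<bar>a\<bar> *\<^sub>R (\<integral>s. ?k (a * real_of_int n + a * s) u * \<phi> (a * real_of_int n + a * s) \<partial>lborel)"
      using a by (intro lborel_integral_real_affine) simp
    also have "\<dots> = a * (\<integral>s. a powr (-1/2) * (a powr \<kappa> * (pos_power \<kappa> (s + v) * \<psi> s) - pos_power \<kappa> (- u) * \<psi> s) \<partial>lborel)"
      unfolding e using a by simp
    also have "(\<integral>s. a powr (-1/2) * (a powr \<kappa> * (pos_power \<kappa> (s + v) * \<psi> s) - pos_power \<kappa> (- u) * \<psi> s) \<partial>lborel)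
      = a powr (-1/2) * (a powr \<kappa> * W.h v)"
      using W.h_integrable[of v] W.\<psi>_integrable m0 by (simp add: W.h_def)
    also have "a * (a powr (-1/2) * (a powr \<kappa> * W.h v)) = (a powr 1 * a powr (-1/2) * a powr \<kappa>) * W.h v" using a by simp
    also have "a powr 1 * a powr (-1/2) * a powr \<kappa> = a powr (\<kappa> + 1/2)" by (simp only: powr_add[symmetric]) (simp add: add.commute)
    also have "\<dots> = 2 powr (real_of_int j * (\<kappa> + 1 / 2))" by (simp add: a_def powr_powr)
    finally show ?thesis by (simp add: v_def a)
  qed
  show ?thesis using st unfolding f Y by (simp add: \<kappa>_def)
qed

end

section \<open>Envelopes and independent blocks\<close>

lemma envelope_le:
  fixes c p :: real
  assumes p: "p > 0" and d: "2 * d \<ge> b" "d \<ge> 0" "b \<ge> 0"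
  shows "(1 + d) powr (- p) \<le> 2 powr p * (1 + b) powr (- p)"
proof -
  have "(1 + d) powr (- p) \<le> ((1 + b) * (1 / 2)) powr (- p)"
    using assms by (intro powr_mono2') auto
  also have "\<dots> = (1 + b) powr (- p) * (1 / 2) powr (- p)" by (rule powr_mult)
  also have "(1 / 2) powr (- p) = 2 powr p"
  proof -
    have "(1 / 2) powr (- p) * 2 powr (- p) = 1 powr (- p)" for p :: real
      by (subst powr_mult[symmetric]) simp
    moreover have "2 powr p * 2 powr (- p) = (1::real)" unfolding powr_add[symmetric] by simp
    ultimately have "(1 / 2) powr (- p) * 2 powr (- p) = 2 powr p * 2 powr (- p)" by simp
    then show ?thesis by (rule mult_right_cancel[THEN iffD1, rotated]) simp
  qed
  finally show ?thesis by (simp add: mult.commute)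
qed

text \<open>Every u is at distance at least |x - y| / 2 from one of the two centres. There the
  envelope is bounded by a multiple of \<open>env p (x - y)\<close>, and the other factor is
  integrable because p > 1.\<close>

lemma envelope_convolution:
  fixes p :: real
  assumes p: "p > 1"
  obtains C where "C \<ge> 0" "\<And>x y. integrable lborel (\<lambda>u. env p (u - x) * env p (u - y))"
    "\<And>x y. (\<integral>u. env p (u - x) * env p (u - y) \<partial>lborel) \<le> C * env p (x - y)"
proof -
  define I where "I = (\<integral>u. env p u \<partial>lborel)"
  note e = integrable_envelope[OF p]
  have sh: "integrable lborel (\<lambda>u. env p (u - x))" "(\<integral>u. env p (u - x) \<partial>lborel) = I" for x
  proof -
    show "integrable lborel (\<lambda>u. env p (u - x))"
      using lborel_integrable_real_affine[OF e, of 1 "- x"] by simp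
    show "(\<integral>u. env p (u - x) \<partial>lborel) = I"
      using lborel_integral_real_affine[of 1 "\<lambda>u. env p u" "- x"] by (simp add: I_def)
  qed
  have le: "env p (u - x) * env p (u - y)
     \<le> 2 powr p * env p (x - y) * (env p (u - x) + env p (u - y))" for u x y
  proof (cases "2 * \<bar>u - y\<bar> \<ge> \<bar>x - y\<bar>")
    case True
    have "env p (u - x) * env p (u - y) \<le> env p (u - x) * (2 powr p * env p (x - y))"
      using p True by (intro mult_left_mono envelope_le) auto
    also have "\<dots> \<le> (env p (u - x) + env p (u - y)) * (2 powr p * env p (x - y))"
      by (intro mult_right_mono) auto
    finally show ?thesis by (simp add: mult_ac)
  next
    case False
    have tri: "\<bar>x - y\<bar> \<le> \<bar>u - y\<bar> + \<bar>u - x\<bar>"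
      using abs_triangle_ineq4[of "u - y" "u - x"] by simp
    have "a \<le> 2 * c" if "a \<le> b + c" "\<not> 2 * b \<ge> a" for a b c :: real using that by linarith
    from this[OF tri False] have f: "2 * \<bar>u - x\<bar> \<ge> \<bar>x - y\<bar>" .
    have "env p (u - x) * env p (u - y) \<le> (2 powr p * env p (x - y)) * env p (u - y)"
      using p f by (intro mult_right_mono envelope_le) auto
    also have "\<dots> \<le> (2 powr p * env p (x - y)) * (env p (u - x) + env p (u - y))"
      by (intro mult_left_mono) auto
    finally show ?thesis .
  qed
  have ib: "integrable lborel (\<lambda>u. 2 powr p * env p (x - y) * (env p (u - x) + env p (u - y)))" for x y
    by (intro integrable_mult_right Bochner_Integration.integrable_add sh)
  have i: "integrable lborel (\<lambda>u. env p (u - x) * env p (u - y))" for x y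
    by (rule integrable_dominated[OF ib[of x y]]) (simp, intro AE_I2 norm_le_norm le, simp)
  show ?thesis
  proof (rule that[of "2 powr p * (I + I)"])
    show "0 \<le> 2 powr p * (I + I)" by (simp add: I_def)
    fix x y
    show "integrable lborel (\<lambda>u. env p (u - x) * env p (u - y))" by (rule i)
    have "(\<integral>u. env p (u - x) * env p (u - y) \<partial>lborel)
      \<le> (\<integral>u. 2 powr p * env p (x - y) * (env p (u - x) + env p (u - y)) \<partial>lborel)"
      by (rule integral_mono[OF i ib le])
    also have "\<dots> = 2 powr p * (I + I) * env p (x - y)"
      using sh by simp
    finally show "(\<integral>u. env p (u - x) * env p (u - y) \<partial>lborel) \<le> 2 powr p * (I + I) * env p (x - y)" .
  qed
qed

lemma crossint_envelope:
  fixes p :: real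
  assumes p: "p > 1"
  obtains C where "C \<ge> 0" "\<And>f g E x y. E \<ge> 0 \<Longrightarrow>
    (\<And>u. \<bar>f u\<bar> powr (a / 2) \<le> E * env p (u - x)) \<Longrightarrow>
    (\<And>u. \<bar>g u\<bar> powr (a / 2) \<le> E * env p (u - y)) \<Longrightarrow>
    crossint a f g \<le> E\<^sup>2 * C * env p (x - y)"
proof -
  obtain C where C: "C \<ge> 0" "\<And>x y. integrable lborel (\<lambda>u. env p (u - x) * env p (u - y))"
    "\<And>x y. (\<integral>u. env p (u - x) * env p (u - y) \<partial>lborel) \<le> C * env p (x - y)"
    using envelope_convolution[OF p] by blast
  show ?thesis
  proof (rule that[OF C(1)])
    fix f g :: "real \<Rightarrow> real" and E x y :: real assume E: "E \<ge> 0"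
      and f: "\<And>u. \<bar>f u\<bar> powr (a / 2) \<le> E * env p (u - x)"
      and g: "\<And>u. \<bar>g u\<bar> powr (a / 2) \<le> E * env p (u - y)"
    have "crossint a f g \<le> (\<integral>u. E\<^sup>2 * (env p (u - x) * env p (u - y)) \<partial>lborel)"
      unfolding crossint_def
    proof (rule integral_mono_AE')
      show "integrable lborel (\<lambda>u. E\<^sup>2 * (env p (u - x) * env p (u - y)))"
        by (intro integrable_mult_right C)
      have "\<bar>f u\<bar> powr (a / 2) * \<bar>g u\<bar> powr (a / 2) \<le> (E * env p (u - x)) * (E * env p (u - y))" for u
        using E by (intro mult_mono f g) auto
      then show "AE u in lborel. \<bar>f u\<bar> powr (a / 2) * \<bar>g u\<bar> powr (a / 2) \<le> E\<^sup>2 * (env p (u - x) * env p (u - y))"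
        by (simp add: power2_eq_square mult_ac)
    qed simp
    also have "\<dots> = E\<^sup>2 * (\<integral>u. env p (u - x) * env p (u - y) \<partial>lborel)" by simp
    also have "\<dots> \<le> E\<^sup>2 * (C * env p (x - y))" by (intro mult_left_mono C) simp
    finally show "crossint a f g \<le> E\<^sup>2 * C * env p (x - y)" by (simp add: mult.assoc)
  qed
qed

lemma envelope_sum_int:
  fixes p :: real
  assumes p: "p > 1"
  obtains T where "T \<ge> 0" "\<And>A :: int set. finite A \<Longrightarrow> (\<Sum>k\<in>A. env p (real_of_int k)) \<le> T"
proof -
  have "summable (\<lambda>n. real n powr (- p))" using p by (simp add: summable_real_powr_iff)
  then have s: "summable (\<lambda>n. real (Suc n) powr (- p))" by (subst summable_Suc_iff)
  define T where "T = (\<Sum>n. real (Suc n) powr (- p))"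
  have T: "T \<ge> 0" unfolding T_def by (intro suminf_nonneg s) simp
  have "(\<Sum>k\<in>A. env p (real_of_int k)) \<le> 2 * T" if A: "finite A" for A :: "int set"
  proof -
    let ?e = "\<lambda>k::int. env p (real_of_int k)"
    have half: "sum ?e B \<le> T" if B: "finite B" "inj_on (\<lambda>k. nat \<bar>k\<bar>) B" for B
    proof -
      have "sum ?e B = (\<Sum>k\<in>B. real (Suc (nat \<bar>k\<bar>)) powr (- p))" by (intro sum.cong) auto
      also have "\<dots> = (\<Sum>n\<in>(\<lambda>k. nat \<bar>k\<bar>) ` B. real (Suc n) powr (- p))" by (simp add: sum.reindex[OF B(2)])
      also have "\<dots> \<le> T" unfolding T_def by (rule sum_le_suminf[OF s]) (use B in auto)
      finally show ?thesis .
    qed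
    have "sum ?e A = sum ?e (A \<inter> {0..}) + sum ?e (A \<inter> {..<0})"
      using A by (subst sum.union_disjoint[symmetric]) (auto intro!: sum.cong)
    also have "\<dots> \<le> T + T" using A by (intro add_mono half) (auto simp: inj_on_def)
    finally show ?thesis by simp
  qed
  then show ?thesis using that[of "2 * T"] T by simp
qed

text \<open>The centre x enters only through the index \<open>m0\<close> of its grid cell; shifting
  the summation index by \<open>m0\<close> leaves a sum over integers that no longer depends on
  x.\<close>

lemma envelope_sum_grid:
  fixes p \<delta> :: real
  assumes p: "p > 1" and \<delta>: "\<delta> > 0"
  obtains K where "K \<ge> 0" "\<And>(A :: int set) x. finite A \<Longrightarrow> (\<Sum>m\<in>A. env p (x - \<delta> * real_of_int m)) \<le> K"
proof -
  obtain T where T: "T \<ge> 0" "\<And>A :: int set. finite A \<Longrightarrow> (\<Sum>k\<in>A. env p (real_of_int k)) \<le> T"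
    using envelope_sum_int[OF p] by blast
  \<comment> \<open>Ensures c (1 + |m - m0|) \<le> 1 + |x - \<delta> m|: the minimum absorbs the
    cell of x and the spacing, the half absorbs 1 + |k| \<le> 2 |k| for a nonzero integer k.\<close>
  define c where "c = min 1 \<delta> / 2"
  have c: "c > 0" using \<delta> by (simp add: c_def)
  have "(\<Sum>m\<in>A. env p (x - \<delta> * real_of_int m)) \<le> c powr (- p) * T" if A: "finite A" for A :: "int set" and x
  proof -
    define m0 where "m0 = \<lfloor>x / \<delta>\<rfloor>"
    have le: "env p (x - \<delta> * real_of_int m) \<le> c powr (- p) * env p (real_of_int (m - m0))" for m
    proof -
      define k where "k = m - m0"
      define b where "b = min 1 \<delta>"
      have b: "0 < b" "b \<le> 1" "b \<le> \<delta>" using \<delta> by (auto simp: b_def)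
      have ge: "b * \<bar>real_of_int k\<bar> \<le> 1 + \<bar>x - \<delta> * real_of_int m\<bar>"
      proof -
        have f: "real_of_int m0 \<le> x / \<delta>" "x / \<delta> < real_of_int m0 + 1" unfolding m0_def by linarith+
        have "\<bar>real_of_int k\<bar> \<le> 1 + \<bar>x / \<delta> - real_of_int m\<bar>"
          using f unfolding k_def by linarith
        then have "b * \<bar>real_of_int k\<bar> \<le> b * (1 + \<bar>x / \<delta> - real_of_int m\<bar>)" using b by (intro mult_left_mono) auto
        also have "\<dots> \<le> 1 + \<delta> * \<bar>x / \<delta> - real_of_int m\<bar>"
          using b by (simp add: distrib_left add_mono mult_right_mono)
        also have "\<delta> * \<bar>x / \<delta> - real_of_int m\<bar> = \<bar>x - \<delta> * real_of_int m\<bar>"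
        proof -
          have "\<delta> * \<bar>x / \<delta> - real_of_int m\<bar> = \<bar>\<delta> * (x / \<delta> - real_of_int m)\<bar>" using \<delta> by (simp add: abs_mult)
          also have "\<delta> * (x / \<delta> - real_of_int m) = x - \<delta> * real_of_int m" using \<delta> by (simp add: right_diff_distrib)
          finally show ?thesis .
        qed
        finally show ?thesis .
      qed
      have "c * (1 + \<bar>real_of_int k\<bar>) \<le> 1 + \<bar>x - \<delta> * real_of_int m\<bar>"
      proof (cases "k = 0")
        case True
        then have "c * (1 + \<bar>real_of_int k\<bar>) \<le> 1" by (simp add: c_def)
        then show ?thesis by (rule order_trans) simp
      next
        case False
        then have "1 \<le> \<bar>real_of_int k\<bar>" by (simp flip: of_int_abs)
        then have "c * (1 + \<bar>real_of_int k\<bar>) \<le> c * (2 * \<bar>real_of_int k\<bar>)" using c by (intro mult_left_mono) auto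
        also have "\<dots> = b * \<bar>real_of_int k\<bar>" by (simp add: c_def b_def)
        finally show ?thesis using ge by simp
      qed
      then have "env p (x - \<delta> * real_of_int m) \<le> (c * (1 + \<bar>real_of_int k\<bar>)) powr (- p)"
        using c p by (intro powr_mono2') (auto intro!: mult_pos_pos add_pos_nonneg)
      then show ?thesis using c by (simp add: powr_mult k_def)
    qed
    have "(\<Sum>m\<in>A. env p (x - \<delta> * real_of_int m)) \<le> (\<Sum>m\<in>A. c powr (- p) * env p (real_of_int (m - m0)))"
      by (intro sum_mono le)
    also have "\<dots> = c powr (- p) * (\<Sum>k\<in>(\<lambda>m. m - m0) ` A. env p (real_of_int k))"
      by (subst sum.reindex) (auto simp: inj_on_def sum_distrib_left)
    also have "\<dots> \<le> c powr (- p) * T" using A by (intro mult_left_mono T) auto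
    finally show ?thesis .
  qed
  then show ?thesis using that[of "c powr (- p) * T"] T by simp
qed

text \<open>Schur's test: a product of two coefficients is at most the mean of their squares, the
  symmetry of \<open>k\<close> merges the two halves, and only row sums remain. The bound sees
  neither the number of summands nor their order.\<close>

lemma (in prob_space) schur_bound:
  fixes Z :: "'i \<Rightarrow> 'a \<Rightarrow> real"
  assumes F: "finite F" and Z: "\<And>p. p \<in> F \<Longrightarrow> Z p \<in> borel_measurable M" "\<And>p. p \<in> F \<Longrightarrow> sqint (Z p)"
    and k: "\<And>p q. p \<in> F \<Longrightarrow> q \<in> F \<Longrightarrow> \<bar>expectation (\<lambda>x. Z p x * Z q x)\<bar> \<le> k p q"
    and sym: "\<And>p q. k p q = k q p" and K: "\<And>p. p \<in> F \<Longrightarrow> (\<Sum>q\<in>F. k p q) \<le> K"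
  shows "msq (\<lambda>x. \<Sum>p\<in>F. c p * Z p x) \<le> K * (\<Sum>p\<in>F. (c p)\<^sup>2)"
proof -
  have "msq (\<lambda>x. \<Sum>p\<in>F. c p * Z p x) = (\<Sum>p\<in>F. \<Sum>q\<in>F. c p * c q * expectation (\<lambda>x. Z p x * Z q x))"
    by (rule expectation_sum_square(2)[OF Z])
  also have "\<dots> \<le> (\<Sum>p\<in>F. \<Sum>q\<in>F. ((c p)\<^sup>2 * k p q + (c q)\<^sup>2 * k q p) / 2)"
  proof (intro sum_mono)
    fix p q assume pq: "p \<in> F" "q \<in> F"
    have k0: "0 \<le> k p q" using k[OF pq] abs_ge_zero order_trans by blast
    have "2 * \<bar>c p * c q\<bar> \<le> (c p)\<^sup>2 + (c q)\<^sup>2"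
      using zero_le_power2[of "\<bar>c p\<bar> - \<bar>c q\<bar>"] by (simp add: power2_diff abs_mult)
    then have a: "\<bar>c p * c q\<bar> \<le> ((c p)\<^sup>2 + (c q)\<^sup>2) / 2" by simp
    have "c p * c q * expectation (\<lambda>x. Z p x * Z q x) \<le> \<bar>c p * c q\<bar> * \<bar>expectation (\<lambda>x. Z p x * Z q x)\<bar>"
      by (simp flip: abs_mult)
    also have "\<dots> \<le> ((c p)\<^sup>2 + (c q)\<^sup>2) / 2 * k p q"
      using a k[OF pq] by (intro mult_mono) auto
    finally show "c p * c q * expectation (\<lambda>x. Z p x * Z q x) \<le> ((c p)\<^sup>2 * k p q + (c q)\<^sup>2 * k q p) / 2"
      by (simp add: sym[of q p] distrib_right)
  qed
  also have "\<dots> = ((\<Sum>p\<in>F. \<Sum>q\<in>F. (c p)\<^sup>2 * k p q) + (\<Sum>p\<in>F. \<Sum>q\<in>F. (c q)\<^sup>2 * k q p)) / 2"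
    by (simp add: sum.distrib sum_divide_distrib add_divide_distrib)
  also have "(\<Sum>p\<in>F. \<Sum>q\<in>F. (c q)\<^sup>2 * k q p) = (\<Sum>p\<in>F. \<Sum>q\<in>F. (c p)\<^sup>2 * k p q)" by (rule sum.swap)
  also have "((\<Sum>p\<in>F. \<Sum>q\<in>F. (c p)\<^sup>2 * k p q) + (\<Sum>p\<in>F. \<Sum>q\<in>F. (c p)\<^sup>2 * k p q)) / 2 = (\<Sum>p\<in>F. (c p)\<^sup>2 * (\<Sum>q\<in>F. k p q))"
    by (simp only: sum_distrib_left[symmetric] mult_2[symmetric] nonzero_mult_div_cancel_left[of 2] zero_neq_numeral[symmetric] not_False_eq_True simp_thms)
  also have "\<dots> \<le> (\<Sum>p\<in>F. (c p)\<^sup>2 * K)" by (intro sum_mono mult_left_mono K) auto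
  finally show ?thesis by (simp add: sum_distrib_left mult.commute)
qed

text \<open>Besides convergence in L^a, the domination by 2|f| is essential: it lets the
  approximants inherit the envelope of \<open>f\<close>. The cut-off at |u| \<le> i gives them
  bounded support.\<close>

lemma simple_approximation:
  fixes f :: "real \<Rightarrow> real" and a :: real
  assumes f: "in_Lp a f" and a: "a > 0"
  obtains \<phi> where "\<And>i::nat. fin_simple (\<phi> i)" "\<And>i u. \<bar>\<phi> i u\<bar> \<le> 2 * \<bar>f u\<bar>" "\<And>i u. real i < \<bar>u\<bar> \<Longrightarrow> \<phi> i u = 0"
    "(\<lambda>i. powint a (\<lambda>u. \<phi> i u - f u)) \<longlonglongrightarrow> 0"
proof -
  have fm [measurable]: "f \<in> borel_measurable lborel" using f by auto
  obtain s where s: "\<And>i. simple_function lborel (s i)" "\<And>x. (\<lambda>i. s i x) \<longlonglongrightarrow> f x" "\<And>i x. \<bar>s i x\<bar> \<le> 2 * \<bar>f x\<bar>"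
    using borel_measurable_implies_sequence_metric[OF fm, of 0] by (auto simp: dist_real_def)
  define \<phi> where "\<phi> i u = s i u * indicator {- real i..real i} u" for i u
  have sm [measurable]: "s i \<in> borel_measurable lborel" for i using borel_measurable_simple_function[OF s(1)] .
  have [measurable]: "\<phi> i \<in> borel_measurable lborel" for i unfolding \<phi>_def[abs_def] by measurable
  have 1: "fin_simple (\<phi> i)" for i
    unfolding fin_simple_def
  proof
    show "simple_function lborel (\<phi> i)" unfolding \<phi>_def[abs_def]
      by (intro simple_function_mult s simple_function_indicator) simp
    have "emeasure lborel {u. \<phi> i u \<noteq> 0} \<le> emeasure lborel {- real i..real i}"
      by (intro emeasure_mono) (auto simp: \<phi>_def indicator_def split: if_splits)
    also have "\<dots> < \<infinity>" by simp
    finally show "emeasure lborel {u. \<phi> i u \<noteq> 0} < \<infinity>" .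
  qed
  have 2: "\<bar>\<phi> i u\<bar> \<le> 2 * \<bar>f u\<bar>" for i u using s(3)[of i u] by (simp add: \<phi>_def indicator_def)
  have 3: "\<phi> i u = 0" if "real i < \<bar>u\<bar>" for i u using that by (auto simp: \<phi>_def indicator_def)
  have "(\<lambda>i. powint a (\<lambda>u. \<phi> i u - f u)) \<longlonglongrightarrow> (\<integral>u. 0 \<partial>(lborel :: real measure))"
    unfolding powint_def
  proof (rule integral_dominated_convergence)
    show "integrable lborel (\<lambda>u. 3 powr a * \<bar>f u\<bar> powr a)" using f by (intro integrable_mult_right) auto
    have "(\<lambda>i. \<bar>\<phi> i u - f u\<bar> powr a) \<longlonglongrightarrow> 0" for u
    proof -
      obtain i0 where i0: "\<bar>u\<bar> \<le> real i0" using real_arch_simple by blast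
      have "\<forall>\<^sub>F i in sequentially. s i u = \<phi> i u"
        using eventually_ge_at_top[of i0] by eventually_elim (use i0 in \<open>auto simp: \<phi>_def indicator_def\<close>)
      with s(2)[of u] have "(\<lambda>i. \<phi> i u) \<longlonglongrightarrow> f u" by (rule Lim_transform_eventually)
      then have "(\<lambda>i. \<bar>\<phi> i u - f u\<bar>) \<longlonglongrightarrow> 0" by (intro tendsto_rabs_zero LIM_zero)
      then have "(\<lambda>i. \<bar>\<phi> i u - f u\<bar> powr a) \<longlonglongrightarrow> 0 powr a"
        by (rule tendsto_powr'[OF _ tendsto_const]) (use a in auto)
      then show ?thesis by simp
    qed
    then show "AE u in lborel. (\<lambda>i. \<bar>\<phi> i u - f u\<bar> powr a) \<longlonglongrightarrow> 0" by simp
    have "\<bar>\<phi> i u - f u\<bar> powr a \<le> 3 powr a * \<bar>f u\<bar> powr a" for i u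
    proof -
      have "\<bar>\<phi> i u - f u\<bar> \<le> 3 * \<bar>f u\<bar>" using 2[of i u] by linarith
      then have "\<bar>\<phi> i u - f u\<bar> powr a \<le> (3 * \<bar>f u\<bar>) powr a" using a by (intro powr_mono2) auto
      then show ?thesis by (simp add: powr_mult)
    qed
    then show "AE u in lborel. norm (\<bar>\<phi> i u - f u\<bar> powr a) \<le> 3 powr a * \<bar>f u\<bar> powr a" for i by simp
  qed measurable
  then show ?thesis using that[of \<phi>] 1 2 3 by simp
qed

context sas_noise begin

lemma M_law:
  assumes "A \<in> finite_lborel_sets" "B \<in> finite_lborel_sets" "measure lborel A = measure lborel B"
  shows "distr P borel (M A) = distr P borel (M B)"
proof (rule Levy_uniqueness)
  show "real_distribution (distr P borel (M A))" "real_distribution (distr P borel (M B))"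
    using assms by (intro real_distribution_distr M_measurable; simp)+
  show "char (distr P borel (M A)) = char (distr P borel (M B))"
    using assms by (auto simp: M_char)
qed

text \<open>The simple integrands of a block share a partition into level sets of the whole family; the
  translates of this partition make the blocks i.i.d.\<close>

lemma block_iid:
  fixes \<phi> :: "'i \<Rightarrow> real \<Rightarrow> real" and L :: real
  assumes I: "finite I" and \<phi>: "\<And>p. p \<in> I \<Longrightarrow> fin_simple (\<phi> p)"
    and supp: "\<And>p u. p \<in> I \<Longrightarrow> u \<notin> {0..<L} \<Longrightarrow> \<phi> p u = 0" and L: "L > 0"
    and \<Psi>: "\<Psi> \<in> borel_measurable (\<Pi>\<^sub>M p\<in>I. borel)"
  obtains T :: "nat \<Rightarrow> 'a \<Rightarrow> real" where "indep_vars (\<lambda>_. borel) T UNIV" "\<And>i. distr P borel (T i) = distr P borel (T 0)"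
    "\<And>i. AE \<omega> in P. T i \<omega> = \<Psi> (\<lambda>p\<in>I. S (\<lambda>u. \<phi> p (u - real i * L)) \<omega>)"
proof -
  \<comment> \<open>The joint profile of all integrands at u. It takes finitely many values, and on
    each of its level sets \<open>A v\<close> in the block all integrands are constant.\<close>
  define \<tau> where "\<tau> u = (\<lambda>p\<in>I. \<phi> p u)" for u
  define W where "W = \<tau> ` {0..<L}"
  have "W \<subseteq> PiE I (\<lambda>p. range (\<phi> p))" by (auto simp: W_def \<tau>_def)
  moreover have "finite (PiE I (\<lambda>p. range (\<phi> p)))" using I fin_simpleD(1)[OF \<phi>] by (intro finite_PiE) auto
  ultimately have W: "finite W" by (rule finite_subset)
  define r where "r = card W"
  have "W \<noteq> {}" using L by (simp add: W_def)
  then have r: "r > 0" using W by (simp add: r_def card_gt_0_iff)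
  obtain h where h: "bij_betw h {0..<r} W" using ex_bij_betw_nat_finite[OF W] by (auto simp: r_def)
  define A where "A v = {u\<in>{0..<L}. \<tau> u = v}" for v
  have mph [measurable]: "p \<in> I \<Longrightarrow> \<phi> p \<in> borel_measurable borel" for p using fin_simpleD(2)[OF \<phi>] .
  have Aset: "A v \<in> sets borel" if "v \<in> W" for v
  proof -
    have "v \<in> extensional I" using that by (auto simp: W_def \<tau>_def)
    then have "A v = {u\<in>{0..<L}. \<forall>p\<in>I. \<phi> p u = v p}"
      by (auto simp: A_def \<tau>_def fun_eq_iff extensional_def restrict_def)
    also have "\<dots> = {0..<L} \<inter> (\<Inter>p\<in>I. {u. \<phi> p u = v p})" by auto
    also have "\<dots> \<in> sets borel"
    proof (cases "I = {}")
      case False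
      have "(\<Inter>p\<in>I. {u. \<phi> p u = v p}) \<in> sets borel"
        using I False borel_measurable_vimage[OF mph] by (intro sets.finite_INT) (auto simp: vimage_def)
      then show ?thesis by auto
    qed simp
    finally show ?thesis .
  qed
  \<comment> \<open>The index k = i r + t encodes the block i and the atom t: \<open>B k\<close> is
    the t-th atom moved to the i-th block. A single disjoint sequence thus covers all
    blocks.\<close>
  define B where "B k = {u. u - real (k div r) * L \<in> A (h (k mod r))}" for k
  have hW: "h t \<in> W" if "t < r" for t using h that by (auto simp: bij_betw_def)
  have Bset: "B k \<in> sets borel" for k
  proof -
    have "(\<lambda>u. u - real (k div r) * L) -` A (h (k mod r)) \<inter> space borel \<in> sets borel"
      by (rule measurable_sets[OF _ Aset]) (use hW r in auto)
    then show ?thesis by (simp add: B_def vimage_def)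
  qed
  have Bloc: "real (k div r) * L \<le> u \<and> u < (real (k div r) + 1) * L" if "u \<in> B k" for u k
    using that by (auto simp: B_def A_def algebra_simps)
  have Bfin: "B k \<in> finite_lborel_sets" for k
  proof -
    have "emeasure lborel (B k) \<le> emeasure lborel {real (k div r) * L..(real (k div r) + 1) * L}"
      using Bloc by (intro emeasure_mono) (auto dest!: Bloc)
    also have "\<dots> < \<infinity>" by (simp add: emeasure_lborel_Icc_eq)
    finally show ?thesis using Bset by (simp add: finite_lborel_sets_def)
  qed
  have Bdis: "B k \<inter> B l = {}" if "k \<noteq> l" for k l
  proof (rule ccontr)
    assume "B k \<inter> B l \<noteq> {}"
    then obtain u where u: "u \<in> B k" "u \<in> B l" by auto
    have "real (k div r) * L < (real (l div r) + 1) * L" "real (l div r) * L < (real (k div r) + 1) * L"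
      using Bloc[OF u(1)] Bloc[OF u(2)] by linarith+
    then have "real (k div r) < real (l div r) + 1" "real (l div r) < real (k div r) + 1"
      using L by (simp_all only: mult_less_cancel_right_pos)
    then have d: "k div r = l div r" by linarith
    then have "h (k mod r) = h (l mod r)" using u by (auto simp: B_def A_def)
    then have "k mod r = l mod r" using h r by (auto simp: bij_betw_def inj_on_def)
    then show False using d that by (metis div_mult_mod_eq)
  qed
  have Bdf: "disjoint_family B" using Bdis by (auto simp: disjoint_family_on_def)
  have ind: "indep_vars (\<lambda>_. borel) (\<lambda>k. M (B k)) UNIV"
    by (rule M_indep[OF _ Bdf]) (use Bfin in auto)
  note [measurable] = M_measurable[OF Bfin]
  \<comment> \<open>\<open>h t p\<close> is the value of the integrand p on atom t, so the inner sum
    is the simple integral in terms of the noise of the atoms. The same function serves every block,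
    which makes the blocks equal in law.\<close>
  define \<Psi>' where "\<Psi>' x = \<Psi> (\<lambda>p\<in>I. \<Sum>t<r. h t p * x t)" for x :: "nat \<Rightarrow> real"
  have \<Psi>'m: "\<Psi>' \<in> borel_measurable (\<Pi>\<^sub>M t\<in>{..<r}. borel)"
  proof -
    have "(\<lambda>x. \<lambda>p\<in>I. \<Sum>t<r. h t p * x t) \<in> (\<Pi>\<^sub>M t\<in>{..<r}. borel) \<rightarrow>\<^sub>M (\<Pi>\<^sub>M p\<in>I. borel)"
      by (intro measurable_restrict borel_measurable_sum borel_measurable_times) (auto intro!: measurable_component_singleton)
    then show ?thesis unfolding \<Psi>'_def[abs_def] by (rule measurable_compose[OF _ \<Psi>])
  qed
  define T where "T i \<omega> = \<Psi>' (\<lambda>t\<in>{..<r}. M (B (i * r + t)) \<omega>)" for i \<omega>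
  show ?thesis
  proof (rule that[of T])
    let ?K = "\<lambda>i. {i * r..<i * r + r}"
    have dK: "disjoint_family_on ?K UNIV"
    proof -
      have "m = n" if "k \<in> ?K m" "k \<in> ?K n" for k m n
      proof -
        have "k div r = m" "k div r = n" using that r by (auto intro!: div_nat_eqI simp: mult.commute)
        then show ?thesis by simp
      qed
      then show ?thesis unfolding disjoint_family_on_def by blast
    qed
    have 1: "indep_vars (\<lambda>i. PiM (?K i) (\<lambda>_. borel)) (\<lambda>i \<omega>. restrict (\<lambda>k. M (B k) \<omega>) (?K i)) UNIV"
      by (rule indep_vars_restrict[OF ind _ dK]) simp
    have "indep_vars (\<lambda>_. borel) (\<lambda>i \<omega>. \<Psi>' (\<lambda>t\<in>{..<r}. (restrict (\<lambda>k. M (B k) \<omega>) (?K i)) (i * r + t))) UNIV"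
    proof (rule indep_vars_compose2[OF 1, where Y="\<lambda>i x. \<Psi>' (\<lambda>t\<in>{..<r}. x (i * r + t))"])
      fix i
      have "(\<lambda>x. \<lambda>t\<in>{..<r}. x (i * r + t)) \<in> PiM (?K i) (\<lambda>_. borel) \<rightarrow>\<^sub>M (\<Pi>\<^sub>M t\<in>{..<r}. (borel :: real measure))"
        by (intro measurable_restrict measurable_component_singleton) auto
      then show "(\<lambda>x. \<Psi>' (\<lambda>t\<in>{..<r}. x (i * r + t))) \<in> PiM (?K i) (\<lambda>_. borel) \<rightarrow>\<^sub>M borel"
        by (rule measurable_compose[OF _ \<Psi>'m])
    qed
    moreover have "(\<lambda>t\<in>{..<r}. (restrict (\<lambda>k. M (B k) \<omega>) (?K i)) (i * r + t)) = (\<lambda>t\<in>{..<r}. M (B (i * r + t)) \<omega>)" for i \<omega>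
      by (auto simp: fun_eq_iff)
    ultimately show "indep_vars (\<lambda>_. borel) T UNIV" by (simp add: T_def[abs_def])
    have law: "distr P (\<Pi>\<^sub>M t\<in>{..<r}. borel) (\<lambda>\<omega>. \<lambda>t\<in>{..<r}. M (B (i * r + t)) \<omega>) = (\<Pi>\<^sub>M t\<in>{..<r}. distr P borel (M (B t)))" for i
    proof -
      have "indep_vars (\<lambda>_. borel) (\<lambda>t. M (B (i * r + t))) UNIV"
        using Bfin Bdis by (intro M_indep) (auto simp: disjoint_family_on_def)
      then have "indep_vars (\<lambda>_. borel) (\<lambda>t. M (B (i * r + t))) {..<r}"
        by (rule indep_vars_subset) simp
      then have "distr P (\<Pi>\<^sub>M t\<in>{..<r}. borel) (\<lambda>\<omega>. \<lambda>t\<in>{..<r}. M (B (i * r + t)) \<omega>) = (\<Pi>\<^sub>M t\<in>{..<r}. distr P borel (M (B (i * r + t))))"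
        using r by (subst (asm) indep_vars_iff_distr_eq_PiM) auto
      also have "\<dots> = (\<Pi>\<^sub>M t\<in>{..<r}. distr P borel (M (B t)))"
      proof (rule PiM_cong[OF refl])
        fix t assume t: "t \<in> {..<r}"
        have e: "(i * r + t) div r = i" "(i * r + t) mod r = t" "t div r = 0" "t mod r = t" using t by auto
        have "emeasure lborel (B (i * r + t)) = emeasure lborel ((+) (- (real i * L)) -` B t \<inter> space lborel)"
          by (rule arg_cong[where f="emeasure lborel"]) (auto simp: B_def e)
        also have "\<dots> = emeasure (distr lborel borel ((+) (- (real i * L)))) (B t)"
          using Bset by (intro emeasure_distr[symmetric]) auto
        also have "\<dots> = emeasure lborel (B t)" by (simp add: lborel_distr_plus)
        finally have "measure lborel (B (i * r + t)) = measure lborel (B t)" by (simp add: measure_def)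
        then show "distr P borel (M (B (i * r + t))) = distr P borel (M (B t))" by (intro M_law Bfin)
      qed
      finally show ?thesis .
    qed
    have "distr P borel (T i) = distr (distr P (\<Pi>\<^sub>M t\<in>{..<r}. borel) (\<lambda>\<omega>. \<lambda>t\<in>{..<r}. M (B (i * r + t)) \<omega>)) borel \<Psi>'" for i
      by (subst distr_distr[OF \<Psi>'m]) (auto simp: T_def[abs_def] comp_def intro!: measurable_restrict)
    then have "distr P borel (T i) = distr (\<Pi>\<^sub>M t\<in>{..<r}. distr P borel (M (B t))) borel \<Psi>'" for i
      unfolding law .
    then show "distr P borel (T i) = distr P borel (T 0)" for i by simp
    fix i
    have "AE \<omega> in P. \<forall>p\<in>I. S (\<lambda>u. \<phi> p (u - real i * L)) \<omega> = (\<Sum>t<r. h t p * M (B (i * r + t)) \<omega>)"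
    proof (rule AE_finite_allI[OF I])
      fix p assume p: "p \<in> I"
      show "AE \<omega> in P. S (\<lambda>u. \<phi> p (u - real i * L)) \<omega> = (\<Sum>t<r. h t p * M (B (i * r + t)) \<omega>)"
      proof (rule S_rep)
        show "disjoint_family_on (\<lambda>t. B (i * r + t)) {..<r}" using Bdis by (auto simp: disjoint_family_on_def)
        show "B (i * r + t) \<in> finite_lborel_sets" for t by (rule Bfin)
        show "\<phi> p (u - real i * L) = h t p" if "t \<in> {..<r}" "u \<in> B (i * r + t)" for t u
        proof -
          have "(i * r + t) div r = i" "(i * r + t) mod r = t" using that by auto
          then have "\<tau> (u - real i * L) = h t" using that by (simp add: B_def A_def)
          then show ?thesis using p by (auto simp: \<tau>_def dest: fun_cong[of _ _ p])
        qed
        fix u assume u: "u \<notin> (\<Union>t<r. B (i * r + t))"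
        show "\<phi> p (u - real i * L) = 0"
        proof (rule ccontr)
          assume "\<phi> p (u - real i * L) \<noteq> 0"
          then have v: "u - real i * L \<in> {0..<L}" using supp[OF p] by blast
          then have "\<tau> (u - real i * L) \<in> W" by (auto simp: W_def)
          then obtain t where t: "t < r" "h t = \<tau> (u - real i * L)" using h by (auto simp: bij_betw_def image_iff)
          then have "u \<in> B (i * r + t)" using v by (simp add: B_def A_def)
          then show False using u t by auto
        qed
      qed simp
    qed
    then show "AE \<omega> in P. T i \<omega> = \<Psi> (\<lambda>p\<in>I. S (\<lambda>u. \<phi> p (u - real i * L)) \<omega>)"
    proof eventually_elim
      case (elim \<omega>)
      then have "(\<lambda>p\<in>I. \<Sum>t<r. h t p * (\<lambda>t\<in>{..<r}. M (B (i * r + t)) \<omega>) t) = (\<lambda>p\<in>I. S (\<lambda>u. \<phi> p (u - real i * L)) \<omega>)"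
        by (auto simp: fun_eq_iff)
      then show ?case by (simp add: T_def \<Psi>'_def)
    qed
  qed
qed

end

section \<open>Families of kernels with a common envelope\<close>

lemma le_powr_interpolate:
  fixes a b c s :: real
  assumes "0 \<le> c" "c \<le> a" "c \<le> b" "0 \<le> s" "s \<le> 1"
  shows "c \<le> a powr s * b powr (1 - s)"
proof (cases "c = 0")
  case False
  then have "c = c powr s * c powr (1 - s)" using assms by (simp flip: powr_add)
  also have "\<dots> \<le> a powr s * b powr (1 - s)" using assms by (intro mult_mono powr_mono2) auto
  finally show ?thesis .
qed simp

context sas_noise begin

text \<open>The class on which covariance estimates are uniform: scale at least \<open>m\<close>,
  envelope of fixed height and order centred at \<open>x\<close>. A kernel and its approximants can
  share the same constants, so mixed covariances are covered as well.\<close>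

definition admissible :: "real \<Rightarrow> real \<Rightarrow> real \<Rightarrow> (real \<Rightarrow> real) \<Rightarrow> real \<Rightarrow> ('a \<Rightarrow> real) \<Rightarrow> bool" where
  "admissible p m E f x Y \<longleftrightarrow> stable_int f Y \<and> m \<le> powint \<alpha> f \<and> (\<forall>u. \<bar>f u\<bar> powr (\<alpha> / 2) \<le> E * env p (u - x))"

lemma admissibleD:
  assumes "admissible p m E f x Y"
  shows "stable_int f Y" "m \<le> powint \<alpha> f" "\<bar>f u\<bar> powr (\<alpha> / 2) \<le> E * env p (u - x)"
  using assms by (auto simp: admissible_def)

lemma cln_cov_envelope:
  assumes p: "p > 1" and m: "m > 0" and E: "E \<ge> 0"
  obtains C where "C \<ge> 0" "\<And>f g Y Z x y. admissible p m E f x Y \<Longrightarrow> admissible p m E g y Z \<Longrightarrow>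
    \<bar>expectation (\<lambda>\<omega>. cln Y \<omega> * cln Z \<omega>)\<bar> \<le> C * env p (x - y)"
proof -
  obtain K where K: "K \<ge> 0" "\<And>f g Y Z. stable_int f Y \<Longrightarrow> stable_int g Z \<Longrightarrow> powint \<alpha> f \<ge> m \<Longrightarrow> powint \<alpha> g \<ge> m \<Longrightarrow>
    \<bar>expectation (\<lambda>\<omega>. cln Y \<omega> * cln Z \<omega>)\<bar> \<le> K * crossint \<alpha> f g" using cln_cov_bound[OF m] by blast
  obtain C where C: "C \<ge> 0" "\<And>f g E x y. E \<ge> 0 \<Longrightarrow>
    (\<And>u. \<bar>f u\<bar> powr (\<alpha> / 2) \<le> E * env p (u - x)) \<Longrightarrow>
    (\<And>u. \<bar>g u\<bar> powr (\<alpha> / 2) \<le> E * env p (u - y)) \<Longrightarrow>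
    crossint \<alpha> f g \<le> E\<^sup>2 * C * env p (x - y)" using crossint_envelope[OF p] by blast
  show ?thesis
  proof (rule that[of "K * (E\<^sup>2 * C)"])
    show "0 \<le> K * (E\<^sup>2 * C)" using K C by simp
    fix f g Y Z x y assume f: "admissible p m E f x Y" and g: "admissible p m E g y Z"
    have "\<bar>expectation (\<lambda>\<omega>. cln Y \<omega> * cln Z \<omega>)\<bar> \<le> K * crossint \<alpha> f g"
      by (rule K(2)[OF admissibleD(1)[OF f] admissibleD(1)[OF g] admissibleD(2)[OF f] admissibleD(2)[OF g]])
    also have "\<dots> \<le> K * (E\<^sup>2 * C * env p (x - y))"
      by (intro mult_left_mono K(1) C(2) E admissibleD(3)[OF f] admissibleD(3)[OF g])
    finally show "\<bar>expectation (\<lambda>\<omega>. cln Y \<omega> * cln Z \<omega>)\<bar> \<le> K * (E\<^sup>2 * C) * env p (x - y)"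
      by (simp add: mult.assoc)
  qed
qed

end

text \<open>The position on the time axis of the coefficient with octave \<open>fst q\<close> and
  index \<open>snd q\<close>. Distances between coefficients of different octaves are measured
  there.\<close>

definition site :: "int \<times> int \<Rightarrow> real" where
  "site q = 2 powr real_of_int (fst q) * real_of_int (snd q)"

lemma site_sum_bound:
  fixes p :: real
  assumes p: "p > 1" and J: "finite J"
  obtains K where "K \<ge> 0" "\<And>A x. (\<And>j. j \<in> J \<Longrightarrow> finite (A j)) \<Longrightarrow> (\<Sum>q\<in>(SIGMA j:J. A j). env p (x - site q)) \<le> K"
proof -
  have "\<exists>K\<ge>0. \<forall>(A :: int set) x. finite A \<longrightarrow> (\<Sum>m\<in>A. env p (x - 2 powr real_of_int j * real_of_int m)) \<le> K" for j
  proof -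
    have "2 powr real_of_int j > 0" by simp
    from envelope_sum_grid[OF p this] show ?thesis by metis
  qed
  then have "\<forall>j. \<exists>K. K\<ge>0 \<and> (\<forall>(A :: int set) x. finite A \<longrightarrow> (\<Sum>m\<in>A. env p (x - 2 powr real_of_int j * real_of_int m)) \<le> K)"
    by blast
  from choice[OF this] obtain K where K: "\<And>j. K j \<ge> 0" "\<And>j A x. finite (A :: int set) \<Longrightarrow> (\<Sum>m\<in>A. env p (x - 2 powr real_of_int j * real_of_int m)) \<le> K j"
    by blast
  show ?thesis
  proof (rule that[of "\<Sum>j\<in>J. K j"])
    show "0 \<le> (\<Sum>j\<in>J. K j)" using K by (simp add: sum_nonneg)
    fix A :: "int \<Rightarrow> int set" and x :: real assume A: "\<And>j. j \<in> J \<Longrightarrow> finite (A j)"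
    have "(\<Sum>q\<in>(SIGMA j:J. A j). env p (x - site q)) = (\<Sum>j\<in>J. \<Sum>m\<in>A j. env p (x - 2 powr real_of_int j * real_of_int m))"
      using A J by (subst sum.Sigma) (auto simp: site_def case_prod_beta')
    also have "\<dots> \<le> (\<Sum>j\<in>J. K j)" by (intro sum_mono K A)
    finally show "(\<Sum>q\<in>(SIGMA j:J. A j). env p (x - site q)) \<le> (\<Sum>j\<in>J. K j)" .
  qed
qed

context sas_noise begin

lemma admissible_sum_bound:
  assumes p: "p > 1" and m: "m > 0" and E: "E \<ge> 0" and J: "finite J"
  obtains K where "K \<ge> 0" "\<And>f Y A c. (\<And>q. fst q \<in> J \<Longrightarrow> admissible p m E (f q) (site q) (Y q)) \<Longrightarrow>
    (\<And>j. j \<in> J \<Longrightarrow> finite (A j)) \<Longrightarrow>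
    msq (\<lambda>\<omega>. \<Sum>q\<in>(SIGMA j:J. A j). c q * cln (Y q) \<omega>) \<le> K * (\<Sum>q\<in>(SIGMA j:J. A j). (c q)\<^sup>2)"
proof -
  obtain C where C: "C \<ge> 0" "\<And>f g Y Z x y. admissible p m E f x Y \<Longrightarrow> admissible p m E g y Z \<Longrightarrow>
    \<bar>expectation (\<lambda>\<omega>. cln Y \<omega> * cln Z \<omega>)\<bar> \<le> C * env p (x - y)" using cln_cov_envelope[OF p m E] by blast
  obtain K where K: "K \<ge> 0" "\<And>A x. (\<And>j. j \<in> J \<Longrightarrow> finite (A j)) \<Longrightarrow> (\<Sum>q\<in>(SIGMA j:J. A j). env p (x - site q)) \<le> K"
    using site_sum_bound[OF p J] by blast
  show ?thesis
  proof (rule that[of "C * K"])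
    show "0 \<le> C * K" using C K by simp
    fix f Y and A :: "int \<Rightarrow> int set" and c assume ad: "\<And>q. fst q \<in> J \<Longrightarrow> admissible p m E (f q) (site q) (Y q)"
      and A: "\<And>j. j \<in> J \<Longrightarrow> finite (A j)"
    show "msq (\<lambda>\<omega>. \<Sum>q\<in>(SIGMA j:J. A j). c q * cln (Y q) \<omega>) \<le> C * K * (\<Sum>q\<in>(SIGMA j:J. A j). (c q)\<^sup>2)"
    proof (rule schur_bound[where k="\<lambda>q r. C * env p (site q - site r)"])
      show "finite (SIGMA j:J. A j)" using A J by auto
      fix q assume q: "q \<in> (SIGMA j:J. A j)"
      then have a: "stable_int (f q) (Y q)" by (intro admissibleD(1)[OF ad]) auto
      show "cln (Y q) \<in> borel_measurable P" "sqint (cln (Y q))" using cln_props[OF a] by auto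
      have "(\<Sum>r\<in>(SIGMA j:J. A j). C * env p (site q - site r)) = C * (\<Sum>r\<in>(SIGMA j:J. A j). env p (site q - site r))"
        by (simp add: sum_distrib_left)
      also have "\<dots> \<le> C * K" by (intro mult_left_mono K(2) A C(1))
      finally show "(\<Sum>r\<in>(SIGMA j:J. A j). C * env p (site q - site r)) \<le> C * K" .
      fix r assume r: "r \<in> (SIGMA j:J. A j)"
      show "\<bar>expectation (\<lambda>\<omega>. cln (Y q) \<omega> * cln (Y r) \<omega>)\<bar> \<le> C * env p (site q - site r)"
        by (rule C(2)[OF ad ad]) (use q r in auto)
    qed (simp add: abs_minus_commute)
  qed
qed

text \<open>The covariance of two differences is at most \<eta>' by Cauchy-Schwarz and
  \<open>ln_distance\<close>, whatever the lag, and at most 4 C times the envelope in the lag,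
  whatever the approximation. Interpolating gives a Schur kernel that is both small and
  summable.\<close>

lemma admissible_difference_bound:
  assumes p: "p > 1" and m: "m > 0" and E: "E \<ge> 0" and J: "finite J" and e: "e > 0"
  obtains \<eta> where "\<eta> > 0" "\<And>f Y g Z A c. (\<And>q. fst q \<in> J \<Longrightarrow> admissible p m E (f q) (site q) (Y q)) \<Longrightarrow>
    (\<And>q. fst q \<in> J \<Longrightarrow> admissible p m E (g q) (site q) (Z q)) \<Longrightarrow>
    (\<And>q. fst q \<in> J \<Longrightarrow> powint \<alpha> (\<lambda>u. f q u - g q u) \<le> \<eta>) \<Longrightarrow>
    (\<And>j. j \<in> J \<Longrightarrow> finite (A j)) \<Longrightarrow>
    msq (\<lambda>\<omega>. \<Sum>q\<in>(SIGMA j:J. A j). c q * (cln (Y q) \<omega> - cln (Z q) \<omega>)) \<le> e * (\<Sum>q\<in>(SIGMA j:J. A j). (c q)\<^sup>2)"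
proof -
  obtain C where C: "C \<ge> 0" "\<And>f g Y Z x y. admissible p m E f x Y \<Longrightarrow> admissible p m E g y Z \<Longrightarrow>
    \<bar>expectation (\<lambda>\<omega>. cln Y \<omega> * cln Z \<omega>)\<bar> \<le> C * env p (x - y)" using cln_cov_envelope[OF p m E] by blast
  obtain K0 where K0: "K0 \<ge> 0" "\<And>f g Y Z. stable_int f Y \<Longrightarrow> stable_int g Z \<Longrightarrow> powint \<alpha> f \<ge> m \<Longrightarrow> powint \<alpha> g \<ge> m \<Longrightarrow>
    msq (\<lambda>\<omega>. cln Y \<omega> - cln Z \<omega>) \<le> K0 * powint \<alpha> (\<lambda>u. f u - g u) powr (1 / (4 * \<alpha>))"
    using ln_distance[OF m] by blast
  \<comment> \<open>The share of the small bound. The share 1 - s of the envelope leaves the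
    exponent p (1 - s) = (p + 1) / 2, still above 1.\<close>
  define s where "s = (p - 1) / (2 * p)"
  have s: "0 < s" "s \<le> 1" "0 \<le> s" and ps: "p * (1 - s) = (p + 1) / 2" using p by (auto simp: s_def field_simps)
  have p': "(p + 1) / 2 > 1" using p by simp
  obtain K where K: "K \<ge> 0" "\<And>A x. (\<And>j. j \<in> J \<Longrightarrow> finite (A j)) \<Longrightarrow> (\<Sum>q\<in>(SIGMA j:J. A j). env ((p + 1) / 2) (x - site q)) \<le> K"
    using site_sum_bound[OF p' J] by blast
  define c0 where "c0 = K0 powr s * (4 * C) powr (1 - s)"
  have c0: "c0 \<ge> 0" by (simp add: c0_def)
  \<comment> \<open>The exponent undoes the powers 1/(4 \<alpha>) of \<open>ln_distance\<close> and
    s of the interpolation; the 1 in the denominator guards against c0 K = 0.\<close>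
  define \<eta> where "\<eta> = (e / (c0 * K + 1)) powr (4 * \<alpha> / s)"
  have b: "c0 * K + 1 > 0" using c0 K by (simp add: add_nonneg_pos)
  have \<eta>: "\<eta> > 0" using e b by (simp add: \<eta>_def)
  define \<eta>' where "\<eta>' = K0 * \<eta> powr (1 / (4 * \<alpha>))"
  have \<eta>'0: "\<eta>' \<ge> 0" using K0 by (simp add: \<eta>'_def)
  have \<eta>'s: "\<eta>' powr s * (4 * C) powr (1 - s) * K \<le> e"
  proof -
    have "(\<eta> powr (1 / (4 * \<alpha>))) powr s = (e / (c0 * K + 1)) powr 1"
      using \<alpha> s by (simp add: \<eta>_def powr_powr)
    then have "(\<eta> powr (1 / (4 * \<alpha>))) powr s = e / (c0 * K + 1)" using e b by simp
    then have "\<eta>' powr s * (4 * C) powr (1 - s) * K = c0 * K * (e / (c0 * K + 1))"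
      by (simp add: \<eta>'_def powr_mult c0_def)
    also have "\<dots> \<le> (c0 * K + 1) * (e / (c0 * K + 1))" using e b by (intro mult_right_mono) auto
    also have "\<dots> = e" using b by simp
    finally show ?thesis .
  qed
  show ?thesis
  proof (rule that[OF \<eta>])
    fix f Y g Z and A :: "int \<Rightarrow> int set" and c
    assume ad: "\<And>q. fst q \<in> J \<Longrightarrow> admissible p m E (f q) (site q) (Y q)"
      and ad': "\<And>q. fst q \<in> J \<Longrightarrow> admissible p m E (g q) (site q) (Z q)"
      and d: "\<And>q. fst q \<in> J \<Longrightarrow> powint \<alpha> (\<lambda>u. f q u - g q u) \<le> \<eta>"
      and A: "\<And>j. j \<in> J \<Longrightarrow> finite (A j)"
    have Dsq: "cln (Y q) \<in> borel_measurable P" "cln (Z q) \<in> borel_measurable P"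
      "sqint (cln (Y q))" "sqint (cln (Z q))"
      "sqint (\<lambda>\<omega>. cln (Y q) \<omega> - cln (Z q) \<omega>)"
      "msq (\<lambda>\<omega>. cln (Y q) \<omega> - cln (Z q) \<omega>) \<le> \<eta>'" if "fst q \<in> J" for q
    proof -
      note a = admissibleD[OF ad[OF that]] and a' = admissibleD[OF ad'[OF that]]
      show 1: "cln (Y q) \<in> borel_measurable P" "cln (Z q) \<in> borel_measurable P"
        "sqint (cln (Y q))" "sqint (cln (Z q))"
        using cln_props[OF a(1)] cln_props[OF a'(1)] by auto
      show "sqint (\<lambda>\<omega>. cln (Y q) \<omega> - cln (Z q) \<omega>)" by (rule L2_triangle(2)[OF 1])
      have "msq (\<lambda>\<omega>. cln (Y q) \<omega> - cln (Z q) \<omega>) \<le> K0 * powint \<alpha> (\<lambda>u. f q u - g q u) powr (1 / (4 * \<alpha>))"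
        by (rule K0(2)[OF a(1) a'(1) a(2) a'(2)])
      also have "\<dots> \<le> \<eta>'" unfolding \<eta>'_def using d[OF that] \<alpha> by (intro mult_left_mono powr_mono2 K0) auto
      finally show "msq (\<lambda>\<omega>. cln (Y q) \<omega> - cln (Z q) \<omega>) \<le> \<eta>'" .
    qed
    let ?k = "\<lambda>q r. \<eta>' powr s * ((4 * C) powr (1 - s) * env ((p + 1) / 2) (site q - site r))"
    have "msq (\<lambda>\<omega>. \<Sum>q\<in>(SIGMA j:J. A j). c q * (cln (Y q) \<omega> - cln (Z q) \<omega>))
       \<le> (\<eta>' powr s * (4 * C) powr (1 - s) * K) * (\<Sum>q\<in>(SIGMA j:J. A j). (c q)\<^sup>2)"
    proof (rule schur_bound[where k="?k"])
      show "finite (SIGMA j:J. A j)" using A J by auto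
      fix q assume "q \<in> (SIGMA j:J. A j)"
      then have q: "fst q \<in> J" by auto
      show "(\<lambda>\<omega>. cln (Y q) \<omega> - cln (Z q) \<omega>) \<in> borel_measurable P" using Dsq[OF q] by auto
      show "sqint (\<lambda>\<omega>. cln (Y q) \<omega> - cln (Z q) \<omega>)" using Dsq[OF q] by auto
      have "(\<Sum>r\<in>(SIGMA j:J. A j). ?k q r) = \<eta>' powr s * (4 * C) powr (1 - s) * (\<Sum>r\<in>(SIGMA j:J. A j). env ((p + 1) / 2) (site q - site r))"
        by (simp add: sum_distrib_left mult.assoc)
      also have "\<dots> \<le> \<eta>' powr s * (4 * C) powr (1 - s) * K" by (intro mult_left_mono K(2) A) auto
      finally show "(\<Sum>r\<in>(SIGMA j:J. A j). ?k q r) \<le> \<eta>' powr s * (4 * C) powr (1 - s) * K" .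
      fix r assume "r \<in> (SIGMA j:J. A j)"
      then have r: "fst r \<in> J" by auto
      let ?I = "expectation (\<lambda>\<omega>. (cln (Y q) \<omega> - cln (Z q) \<omega>) * (cln (Y r) \<omega> - cln (Z r) \<omega>))"
      have 1: "\<bar>?I\<bar> \<le> \<eta>'"
      proof -
        have "\<bar>?I\<bar> \<le> sqrt (msq (\<lambda>\<omega>. cln (Y q) \<omega> - cln (Z q) \<omega>)) * sqrt (msq (\<lambda>\<omega>. cln (Y r) \<omega> - cln (Z r) \<omega>))"
          using Dsq[OF q] Dsq[OF r] by (intro cauchy_schwarz_integral(3)) auto
        also have "\<dots> \<le> sqrt \<eta>' * sqrt \<eta>'" using Dsq(6)[OF q] Dsq(6)[OF r] \<eta>'0 by (intro mult_mono real_sqrt_le_mono) auto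
        finally show ?thesis using \<eta>'0 by simp
      qed
      \<comment> \<open>Multiplied out, the differences give four covariances among original and
        approximating variables, each with the same envelope.\<close>
      have 2: "\<bar>?I\<bar> \<le> 4 * C * env p (site q - site r)"
      proof -
        have i: "integrable P (\<lambda>\<omega>. cln (Y q) \<omega> * cln (Y r) \<omega>)" "integrable P (\<lambda>\<omega>. cln (Y q) \<omega> * cln (Z r) \<omega>)"
          "integrable P (\<lambda>\<omega>. cln (Z q) \<omega> * cln (Y r) \<omega>)" "integrable P (\<lambda>\<omega>. cln (Z q) \<omega> * cln (Z r) \<omega>)"
          using Dsq[OF q] Dsq[OF r] by (auto intro!: cauchy_schwarz_integral(1))
        have eq: "?I = expectation (\<lambda>\<omega>. cln (Y q) \<omega> * cln (Y r) \<omega>) - expectation (\<lambda>\<omega>. cln (Y q) \<omega> * cln (Z r) \<omega>)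
           - expectation (\<lambda>\<omega>. cln (Z q) \<omega> * cln (Y r) \<omega>) + expectation (\<lambda>\<omega>. cln (Z q) \<omega> * cln (Z r) \<omega>)"
          using i by (simp add: algebra_simps)
        let ?e = "C * env p (site q - site r)"
        have "\<bar>a - b - c + d\<bar> \<le> 4 * e" if "\<bar>a\<bar> \<le> e" "\<bar>b\<bar> \<le> e" "\<bar>c\<bar> \<le> e" "\<bar>d\<bar> \<le> e" for a b c d e :: real
          using that by (simp add: abs_le_iff)
        from this[OF C(2)[OF ad[OF q] ad[OF r]] C(2)[OF ad[OF q] ad'[OF r]] C(2)[OF ad'[OF q] ad[OF r]] C(2)[OF ad'[OF q] ad'[OF r]]]
        show ?thesis unfolding eq by (simp add: mult.assoc)
      qed
      have "\<bar>?I\<bar> \<le> \<eta>' powr s * (4 * C * env p (site q - site r)) powr (1 - s)"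
        by (rule le_powr_interpolate[OF _ 1 2 s(3,2)]) simp
      also have "(4 * C * env p (site q - site r)) powr (1 - s) = (4 * C) powr (1 - s) * env (p * (1 - s)) (site q - site r)"
        by (simp only: powr_mult powr_powr) simp
      finally show "\<bar>?I\<bar> \<le> ?k q r" unfolding ps .
    qed (simp add: abs_minus_commute)
    also have "\<dots> \<le> e * (\<Sum>q\<in>(SIGMA j:J. A j). (c q)\<^sup>2)" by (intro mult_right_mono \<eta>'s sum_nonneg) auto
    finally show "msq (\<lambda>\<omega>. \<Sum>q\<in>(SIGMA j:J. A j). c q * (cln (Y q) \<omega> - cln (Z q) \<omega>)) \<le> e * (\<Sum>q\<in>(SIGMA j:J. A j). (c q)\<^sup>2)" .
  qed
qed

lemma cos_cov_shift: "cos_cov (\<lambda>u. f (u - x)) (\<lambda>u. g (u - x)) s t = cos_cov f g s t"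
  using powint_shift[of \<alpha> "\<lambda>u. s * f u + t * g u" x] powint_shift[of \<alpha> "\<lambda>u. s * f u - t * g u" x]
    powint_shift[of \<alpha> "\<lambda>u. s * f u" x] powint_shift[of \<alpha> "\<lambda>u. t * g u" x]
  by (simp add: cos_cov_def)

end

text \<open>What is used of the wavelet coefficients from here on: within an octave they are
  integrals of translates of one kernel, nondegenerate and with an envelope of summable order. The
  height of the envelope may depend on the octave.\<close>

locale stable_family = sas_noise P \<alpha> M for P :: "'a measure" and \<alpha> M +
  fixes F :: "int \<Rightarrow> real \<Rightarrow> real" and D :: "int \<Rightarrow> int \<Rightarrow> 'a \<Rightarrow> real" and p :: real
  assumes p: "p > 1" and Fpos: "\<And>j. powint \<alpha> (F j) > 0"
    and Fenv: "\<And>j. \<exists>E. \<forall>u. \<bar>F j u\<bar> powr (\<alpha> / 2) \<le> E * env p u"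
    and D: "\<And>j n. stable_int (\<lambda>u. F j (u - site (j, n))) (D j n)"
begin

lemma F_in_Lp: "in_Lp \<alpha> (F j)"
  using stable_int_in_Lp[OF D[of j 0]] by (simp add: site_def)

definition G :: "int \<times> int \<Rightarrow> 'a \<Rightarrow> real" where
  "G q = cln (D (fst q) (snd q))"

lemma D_pos: "powint \<alpha> (\<lambda>u. F j (u - x)) > 0"
  using Fpos by (simp add: powint_shift)

lemma G_props: "G q \<in> borel_measurable P" "sqint (G q)" "integrable P (G q)" "expectation (G q) = 0"
  unfolding G_def using cln_props[OF D] by auto

definition r :: "int \<Rightarrow> int \<Rightarrow> int \<Rightarrow> real" where
  "r j k l = expectation (\<lambda>x. G (j, l) x * G (k, 0) x)"

text \<open>Both kernels are translated by the site of (k, l). A step at the coarser octave k equals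
  2^(k - j) steps at the finer octave j, so the translated pair is again a pair of coefficients;
  this is why j \<le> k is required.\<close>

lemma G_cov_stationary:
  assumes "j \<le> k"
  shows "expectation (\<lambda>x. G (j, n) x * G (k, l) x) = r j k (n - 2 ^ nat (k - j) * l)"
proof -
  have pw: "2 powr real_of_int k = 2 powr real_of_int j * 2 ^ nat (k - j)"
  proof -
    have "2 powr real_of_int k = 2 powr (real_of_int j + real (nat (k - j)))" using assms by simp
    also have "\<dots> = 2 powr real_of_int j * 2 ^ nat (k - j)" unfolding powr_add by (simp add: powr_realpow)
    finally show ?thesis .
  qed
  have e: "site (j, n) = site (j, n - 2 ^ nat (k - j) * l) + site (k, l)" "site (k, 0) = 0"
    by (simp_all add: site_def pw algebra_simps)
  show ?thesis unfolding r_def G_def fst_conv snd_conv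
  proof (rule cln_cov_cong[OF D D_pos D D_pos D D_pos D D_pos])
    fix s t
    have "cos_cov (\<lambda>u. F j (u - site (j, n))) (\<lambda>u. F k (u - site (k, l))) s t
      = cos_cov (\<lambda>u. F j ((u - site (k, l)) - site (j, n - 2 ^ nat (k - j) * l))) (\<lambda>u. F k ((u - site (k, l)) - site (k, 0))) s t"
      unfolding e by (simp add: algebra_simps)
    also have "\<dots> = cos_cov (\<lambda>u. F j (u - site (j, n - 2 ^ nat (k - j) * l))) (\<lambda>u. F k (u - site (k, 0))) s t"
      by (rule cos_cov_shift)
    finally show "cos_cov (\<lambda>u. F j (u - site (j, n))) (\<lambda>u. F k (u - site (k, l))) s t
      = cos_cov (\<lambda>u. F j (u - site (j, n - 2 ^ nat (k - j) * l))) (\<lambda>u. F k (u - site (k, 0))) s t" .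
  qed
qed

text \<open>Both factors 2 leave room for approximants, which may lose half of the scale and may
  reach twice the size of the kernel.\<close>

lemma uniform_constants:
  assumes J: "finite J"
  obtains m E where "m > 0" "E \<ge> 0" "\<And>j. j \<in> J \<Longrightarrow> 2 * m \<le> powint \<alpha> (F j)"
    "\<And>j u. j \<in> J \<Longrightarrow> \<bar>2 * F j u\<bar> powr (\<alpha> / 2) \<le> E * env p u"
proof -
  have "\<forall>j. \<exists>E. \<forall>u. \<bar>F j u\<bar> powr (\<alpha> / 2) \<le> E * env p u" using Fenv by blast
  from choice[OF this] obtain E where E: "\<And>j u. \<bar>F j u\<bar> powr (\<alpha> / 2) \<le> E j * env p u" by blast
  define m where "m = Min (insert 1 ((\<lambda>j. powint \<alpha> (F j)) ` J)) / 2"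
  have "Min (insert 1 ((\<lambda>j. powint \<alpha> (F j)) ` J)) > 0" using J Fpos by (subst Min_gr_iff) auto
  then have m: "m > 0" by (simp add: m_def)
  have m2: "2 * m \<le> powint \<alpha> (F j)" if "j \<in> J" for j
    unfolding m_def using J that by simp
  define E' where "E' = (\<Sum>j\<in>J. 2 powr (\<alpha> / 2) * \<bar>E j\<bar>)"
  show ?thesis
  proof (rule that[OF m _ m2])
    show "E' \<ge> 0" by (simp add: E'_def sum_nonneg)
    fix j u assume j: "j \<in> J"
    have "\<bar>2 * F j u\<bar> powr (\<alpha> / 2) = 2 powr (\<alpha> / 2) * \<bar>F j u\<bar> powr (\<alpha> / 2)" by (simp add: abs_mult powr_mult)
    also have "\<dots> \<le> 2 powr (\<alpha> / 2) * (E j * env p u)" by (intro mult_left_mono E) simp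
    also have "\<dots> \<le> 2 powr (\<alpha> / 2) * (\<bar>E j\<bar> * env p u)" by (intro mult_left_mono mult_right_mono) auto
    also have "\<dots> = (2 powr (\<alpha> / 2) * \<bar>E j\<bar>) * env p u" by simp
    also have "\<dots> \<le> E' * env p u"
      unfolding E'_def using J j by (intro mult_right_mono member_le_sum) auto
    finally show "\<bar>2 * F j u\<bar> powr (\<alpha> / 2) \<le> E' * env p u" .
  qed
qed

lemma dominated_admissible:
  assumes st: "stable_int (\<lambda>u. \<phi> (u - site q)) Y" and m: "m \<le> powint \<alpha> \<phi>"
    and le: "\<And>u. \<bar>\<phi> u\<bar> \<le> \<bar>2 * F (fst q) u\<bar>"
    and E: "\<And>u. \<bar>2 * F (fst q) u\<bar> powr (\<alpha> / 2) \<le> E * env p u"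
  shows "admissible p m E (\<lambda>u. \<phi> (u - site q)) (site q) Y"
  unfolding admissible_def
proof (intro conjI allI)
  show "m \<le> powint \<alpha> (\<lambda>u. \<phi> (u - site q))" using m by (simp add: powint_shift)
  fix u
  have "\<bar>\<phi> (u - site q)\<bar> powr (\<alpha> / 2) \<le> \<bar>2 * F (fst q) (u - site q)\<bar> powr (\<alpha> / 2)"
    using le \<alpha> by (intro powr_mono2) auto
  then show "\<bar>\<phi> (u - site q)\<bar> powr (\<alpha> / 2) \<le> E * env p (u - site q)"
    using E order_trans by blast
qed (rule st)

lemma G_admissible:
  assumes "m > 0" "2 * m \<le> powint \<alpha> (F (fst q))" and E: "\<And>u. \<bar>2 * F (fst q) u\<bar> powr (\<alpha> / 2) \<le> E * env p u"
  shows "admissible p m E (\<lambda>u. F (fst q) (u - site q)) (site q) (D (fst q) (snd q))"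
  by (rule dominated_admissible[OF _ _ _ E]) (use D[of "fst q" "snd q"] assms in auto)

lemma r_bound:
  obtains C where "C \<ge> 0" "\<And>l. \<bar>r j k l\<bar> \<le> C * env p (0 - 2 powr real_of_int j * real_of_int l)"
proof -
  obtain m E where mE: "m > 0" "E \<ge> 0" "\<And>i. i \<in> {j, k} \<Longrightarrow> 2 * m \<le> powint \<alpha> (F i)"
    "\<And>i u. i \<in> {j, k} \<Longrightarrow> \<bar>2 * F i u\<bar> powr (\<alpha> / 2) \<le> E * env p u"
    using uniform_constants[of "{j, k}"] by auto
  obtain C where C: "C \<ge> 0" "\<And>f g Y Z x y. admissible p m E f x Y \<Longrightarrow> admissible p m E g y Z \<Longrightarrow>
    \<bar>expectation (\<lambda>\<omega>. cln Y \<omega> * cln Z \<omega>)\<bar> \<le> C * env p (x - y)" using cln_cov_envelope[OF p mE(1,2)] by blast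
  have "\<bar>r j k l\<bar> \<le> C * env p (0 - 2 powr real_of_int j * real_of_int l)" for l
  proof -
    have "\<bar>r j k l\<bar> \<le> C * env p (site (j, l) - site (k, 0))"
      unfolding r_def G_def fst_conv snd_conv
      by (rule C(2)[OF G_admissible[where q="(j, l)", unfolded fst_conv snd_conv] G_admissible[where q="(k, 0)", unfolded fst_conv snd_conv]])
         (use mE in auto)
    then show ?thesis by (simp add: site_def)
  qed
  with C(1) show ?thesis by (rule that)
qed

lemma r_summable: "(\<lambda>l. \<bar>r j k l\<bar>) summable_on UNIV" "r j k summable_on UNIV"
proof -
  obtain C where C: "C \<ge> 0" "\<And>l. \<bar>r j k l\<bar> \<le> C * env p (0 - 2 powr real_of_int j * real_of_int l)"
    using r_bound[of j k] by blast
  obtain K where K: "K \<ge> 0" "\<And>(A :: int set) x. finite A \<Longrightarrow> (\<Sum>l\<in>A. env p (x - 2 powr real_of_int j * real_of_int l)) \<le> K"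
    using envelope_sum_grid[OF p, of "2 powr real_of_int j"] by auto
  show s: "(\<lambda>l. \<bar>r j k l\<bar>) summable_on UNIV"
  proof (rule nonneg_bdd_above_summable_on)
    show "bdd_above (sum (\<lambda>l. \<bar>r j k l\<bar>) ` {F. F \<subseteq> UNIV \<and> finite F})"
    proof (rule bdd_aboveI2)
      fix A :: "int set" assume "A \<in> {F. F \<subseteq> UNIV \<and> finite F}"
      then have A: "finite A" by simp
      have "(\<Sum>l\<in>A. \<bar>r j k l\<bar>) \<le> C * (\<Sum>l\<in>A. env p (0 - 2 powr real_of_int j * real_of_int l))"
        unfolding sum_distrib_left by (intro sum_mono C)
      also have "\<dots> \<le> C * K" by (intro mult_left_mono K A C)
      finally show "(\<Sum>l\<in>A. \<bar>r j k l\<bar>) \<le> C * K" .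
    qed
  qed simp
  show "r j k summable_on UNIV"
    by (rule abs_summable_summable) (use s in simp)
qed

text \<open>The lower bound m survives because \<open>powint\<close> is continuous and exceeds m
  strictly at the limit. One radius for all octaves is the sum of the individual radii.\<close>

lemma approximants:
  assumes J: "finite J" and m: "\<And>j. j \<in> J \<Longrightarrow> m < powint \<alpha> (F j)" and \<eta>: "\<eta> > 0"
  obtains \<phi> and R :: real where "R \<ge> 0" "\<And>j. j \<in> J \<Longrightarrow> fin_simple (\<phi> j)" "\<And>j u. j \<in> J \<Longrightarrow> \<bar>\<phi> j u\<bar> \<le> \<bar>2 * F j u\<bar>"
    "\<And>j u. j \<in> J \<Longrightarrow> R < \<bar>u\<bar> \<Longrightarrow> \<phi> j u = 0" "\<And>j. j \<in> J \<Longrightarrow> powint \<alpha> (\<lambda>u. F j u - \<phi> j u) \<le> \<eta>"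
    "\<And>j. j \<in> J \<Longrightarrow> m \<le> powint \<alpha> (\<phi> j)"
proof -
  have "\<exists>\<phi> i. fin_simple \<phi> \<and> (\<forall>u. \<bar>\<phi> u\<bar> \<le> \<bar>2 * F j u\<bar>) \<and> (\<forall>u. real i < \<bar>u\<bar> \<longrightarrow> \<phi> u = 0) \<and>
    powint \<alpha> (\<lambda>u. F j u - \<phi> u) \<le> \<eta> \<and> m \<le> powint \<alpha> \<phi>" if j: "j \<in> J" for j
  proof -
    have "\<alpha> > 0" using \<alpha> by simp
    then obtain \<phi> where \<phi>: "\<And>i::nat. fin_simple (\<phi> i)" "\<And>i u. \<bar>\<phi> i u\<bar> \<le> 2 * \<bar>F j u\<bar>" "\<And>i u. real i < \<bar>u\<bar> \<Longrightarrow> \<phi> i u = 0"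
      "(\<lambda>i. powint \<alpha> (\<lambda>u. \<phi> i u - F j u)) \<longlonglongrightarrow> 0"
      using simple_approximation[OF F_in_Lp[of j]] by blast
    have "(\<lambda>i. powint \<alpha> (\<phi> i)) \<longlonglongrightarrow> powint \<alpha> (F j)"
      by (rule powint_tendsto[OF \<alpha> F_in_Lp fin_simple_in_Lp[OF \<phi>(1)] \<phi>(4)])
    then have "\<forall>\<^sub>F i in sequentially. m < powint \<alpha> (\<phi> i)" using m[OF j] by (rule order_tendstoD(1))
    moreover have "\<forall>\<^sub>F i in sequentially. powint \<alpha> (\<lambda>u. \<phi> i u - F j u) < \<eta>" using \<phi>(4) \<eta> by (rule order_tendstoD(2))
    ultimately have "\<forall>\<^sub>F i in sequentially. m < powint \<alpha> (\<phi> i) \<and> powint \<alpha> (\<lambda>u. \<phi> i u - F j u) < \<eta>" by eventually_elim simp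
    then obtain i where i: "m < powint \<alpha> (\<phi> i)" "powint \<alpha> (\<lambda>u. \<phi> i u - F j u) < \<eta>" by (auto simp: eventually_sequentially)
    have "powint \<alpha> (\<lambda>u. F j u - \<phi> i u) = powint \<alpha> (\<lambda>u. \<phi> i u - F j u)" unfolding powint_def by (simp add: abs_minus_commute)
    then show ?thesis using i \<phi>(1-3)[of i] by (intro exI[of _ "\<phi> i"] exI[of _ i]) (auto simp: abs_mult)
  qed
  then have "\<forall>j\<in>J. \<exists>\<phi> i. fin_simple \<phi> \<and> (\<forall>u. \<bar>\<phi> u\<bar> \<le> \<bar>2 * F j u\<bar>) \<and> (\<forall>u. real i < \<bar>u\<bar> \<longrightarrow> \<phi> u = 0) \<and>
    powint \<alpha> (\<lambda>u. F j u - \<phi> u) \<le> \<eta> \<and> m \<le> powint \<alpha> \<phi>" by blast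
  from bchoice[OF this] obtain \<phi> where "\<forall>j\<in>J. \<exists>i. fin_simple (\<phi> j) \<and> (\<forall>u. \<bar>\<phi> j u\<bar> \<le> \<bar>2 * F j u\<bar>) \<and> (\<forall>u. real i < \<bar>u\<bar> \<longrightarrow> \<phi> j u = 0) \<and>
    powint \<alpha> (\<lambda>u. F j u - \<phi> j u) \<le> \<eta> \<and> m \<le> powint \<alpha> (\<phi> j)" by blast
  from bchoice[OF this] obtain i where i: "\<forall>j\<in>J. fin_simple (\<phi> j) \<and> (\<forall>u. \<bar>\<phi> j u\<bar> \<le> \<bar>2 * F j u\<bar>) \<and> (\<forall>u. real (i j) < \<bar>u\<bar> \<longrightarrow> \<phi> j u = 0) \<and>
    powint \<alpha> (\<lambda>u. F j u - \<phi> j u) \<le> \<eta> \<and> m \<le> powint \<alpha> (\<phi> j)" by blast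
  show ?thesis
  proof (rule that[of "\<Sum>j\<in>J. real (i j)" \<phi>])
    fix j u assume j: "j \<in> J" and u: "(\<Sum>j\<in>J. real (i j)) < \<bar>u\<bar>"
    have "real (i j) \<le> (\<Sum>j\<in>J. real (i j))" using J j by (intro member_le_sum) auto
    then show "\<phi> j u = 0" using i j u by auto
  qed (use i in \<open>auto simp: sum_nonneg\<close>)
qed

end

section \<open>Weighted averages of logarithms\<close>

lemma sum_block_decomposition:
  fixes f :: "int \<Rightarrow> real"
  assumes b: "b \<ge> 0"
  shows "(\<Sum>n\<in>{0..<int k * b}. f n) = (\<Sum>i<k. \<Sum>s\<in>{0..<b}. f (s + int i * b))"
proof (induction k)
  case (Suc k)
  have "{0..<int (Suc k) * b} = {0..<int k * b} \<union> (\<lambda>s. s + int k * b) ` {0..<b}"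
  proof (intro set_eqI iffI)
    fix n assume n: "n \<in> {0..<int (Suc k) * b}"
    show "n \<in> {0..<int k * b} \<union> (\<lambda>s. s + int k * b) ` {0..<b}"
    proof (cases "n < int k * b")
      case False
      then have "n = (n - int k * b) + int k * b" "n - int k * b \<in> {0..<b}" using n by (auto simp: algebra_simps)
      then show ?thesis by blast
    qed (use n in auto)
  next
    fix n assume "n \<in> {0..<int k * b} \<union> (\<lambda>s. s + int k * b) ` {0..<b}"
    then have "(0 \<le> n \<and> n < int k * b) \<or> (int k * b \<le> n \<and> n < int k * b + b)" by auto
    moreover have "0 \<le> int k * b" "int (Suc k) * b = int k * b + b" using b by (simp_all add: algebra_simps)
    ultimately have "0 \<le> n" "n < int (Suc k) * b" using b by linarith+
    then show "n \<in> {0..<int (Suc k) * b}" by simp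
  qed
  then have "(\<Sum>n\<in>{0..<int (Suc k) * b}. f n) = (\<Sum>n\<in>{0..<int k * b}. f n) + (\<Sum>n\<in>(\<lambda>s. s + int k * b) ` {0..<b}. f n)"
    by (simp only:) (subst sum.union_disjoint, auto)
  also have "(\<Sum>n\<in>(\<lambda>s. s + int k * b) ` {0..<b}. f n) = (\<Sum>s\<in>{0..<b}. f (s + int k * b))"
    by (subst sum.reindex) (auto simp: inj_on_def)
  finally show ?case using Suc.IH by simp
qed simp

lemma sum_square_two_level:
  fixes x y :: real
  assumes Z: "finite Z" and X: "X \<subseteq> Z" and Y: "Y \<subseteq> Z"
  shows "(\<Sum>n\<in>Z. ((if n \<in> X then x else 0) - (if n \<in> Y then y else 0))\<^sup>2)
    = real (card X) * x\<^sup>2 - 2 * real (card (X \<inter> Y)) * (x * y) + real (card Y) * y\<^sup>2"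
proof -
  have "(\<Sum>n\<in>Z. ((if n \<in> X then x else 0) - (if n \<in> Y then y else 0))\<^sup>2)
    = (\<Sum>n\<in>Z. (if n \<in> X then x\<^sup>2 else 0) - (if n \<in> X \<inter> Y then 2 * (x * y) else 0) + (if n \<in> Y then y\<^sup>2 else 0))"
    by (intro sum.cong refl) (auto simp: power2_diff)
  also have "\<dots> = (\<Sum>n\<in>X. x\<^sup>2) - (\<Sum>n\<in>X \<inter> Y. 2 * (x * y)) + (\<Sum>n\<in>Y. y\<^sup>2)"
  proof -
    have *: "(\<Sum>n\<in>Z. if n \<in> U then c else 0) = (\<Sum>n\<in>U. c)" if "U \<subseteq> Z" for U and c :: real
      using Z that by (subst sum.inter_restrict[symmetric]) (auto simp: Int_absorb1)
    show ?thesis unfolding sum.distrib sum_subtractf using X Y by (simp only: *[OF X] *[OF Y] *[of "X \<inter> Y"] le_infI1)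
  qed
  finally show ?thesis by simp
qed

text \<open>For fixed l the inner sum runs over a window of lags around 0. All but boundedly many l
  have a window containing the finite set that nearly exhausts the series; the others contribute a
  bounded amount, which the division by m removes.\<close>

lemma toeplitz_average:
  fixes r :: "int \<Rightarrow> real" and c :: int
  assumes ra: "(\<lambda>l. \<bar>r l\<bar>) summable_on UNIV" and c: "c \<ge> 1"
  shows "(\<lambda>m::nat. (\<Sum>l\<in>{0..<int m}. \<Sum>n\<in>{0..<c * int m}. r (n - c * l)) / real m) \<longlonglongrightarrow> infsum r UNIV"
proof (rule LIMSEQ_I)
  fix e :: real assume e: "e > 0"
  define R where "R = infsum r UNIV"
  define T where "T = infsum (\<lambda>l. \<bar>r l\<bar>) UNIV"
  have rs: "r summable_on UNIV" by (rule abs_summable_summable) (use ra in simp)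
  have fin: "\<bar>sum r A\<bar> \<le> T" if "finite A" for A
  proof -
    have "\<bar>sum r A\<bar> \<le> (\<Sum>l\<in>A. \<bar>r l\<bar>)" by (rule sum_abs)
    also have "\<dots> \<le> T" unfolding T_def by (rule finite_sum_le_infsum[OF ra that]) auto
    finally show ?thesis .
  qed
  have "(r has_sum R) UNIV" unfolding R_def using rs by (rule has_sum_infsum)
  then have "\<forall>\<^sub>F A in finite_subsets_at_top UNIV. dist (sum r A) R < e / 2"
    using e unfolding has_sum_def by (intro tendstoD) auto
  then obtain F0 where F0: "finite F0" "\<And>A. finite A \<Longrightarrow> F0 \<subseteq> A \<Longrightarrow> \<bar>sum r A - R\<bar> < e / 2"
    by (auto simp: eventually_finite_subsets_at_top dist_real_def)
  have RT: "\<bar>R\<bar> \<le> T + e / 2" using F0(2)[OF F0(1) order_refl] fin[OF F0(1)] by linarith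
  obtain K where K: "K \<ge> 0" "F0 \<subseteq> {- K..K}"
  proof -
    have "bdd_above ((\<lambda>x. \<bar>x\<bar>) ` F0)" using F0(1) by auto
    then obtain k where "\<And>x. x \<in> F0 \<Longrightarrow> \<bar>x\<bar> \<le> k" by (auto simp: bdd_above_def)
    then have "F0 \<subseteq> {- \<bar>k\<bar>..\<bar>k\<bar>}" by (force simp: abs_le_iff)
    then show ?thesis using that[of "\<bar>k\<bar>"] by auto
  qed
  define inner where "inner m l = (\<Sum>n\<in>{0..<c * int m}. r (n - c * l))" for m l
  have inner_eq: "inner m l = sum r ((\<lambda>n. n - c * l) ` {0..<c * int m})" for m l
    unfolding inner_def by (subst sum.reindex) (auto simp: inj_on_def)
  \<comment> \<open>The crude error bound for any row, used for the at most 2 K rows near the two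
    ends.\<close>
  define H where "H = 2 * T + e / 2"
  have T0: "T \<ge> 0" unfolding T_def by (intro infsum_nonneg) simp
  have H0: "H \<ge> 0" using T0 e by (simp add: H_def)
  have all: "\<bar>inner m l - R\<bar> \<le> H" for m l
    using fin[of "(\<lambda>n. n - c * l) ` {0..<c * int m}"] RT unfolding inner_eq H_def by (simp add: abs_le_iff)
  have good: "\<bar>inner m l - R\<bar> \<le> e / 2" if l: "K \<le> l" "l < int m - K" for m l
  proof -
    have "F0 \<subseteq> (\<lambda>n. n - c * l) ` {0..<c * int m}"
    proof
      fix x assume "x \<in> F0"
      then have x: "- K \<le> x" "x \<le> K" using K by auto
      \<comment> \<open>Row l covers the lags from - c l to c (m - l) - 1. As c \<ge> 1, distance K
        of l from both ends makes this window contain [-K, K].\<close>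
      have "1 * l \<le> c * l" "1 * (int m - l) \<le> c * (int m - l)" using c l K by (intro mult_right_mono; linarith)+
      then have "x + c * l \<in> {0..<c * int m}" using x l by (auto simp: right_diff_distrib)
      moreover have "x = (x + c * l) - c * l" by simp
      ultimately show "x \<in> (\<lambda>n. n - c * l) ` {0..<c * int m}" by (rule rev_image_eqI)
    qed
    then show ?thesis using F0(2)[of "(\<lambda>n. n - c * l) ` {0..<c * int m}"] unfolding inner_eq by force
  qed
  have bound: "\<bar>(\<Sum>l\<in>{0..<int m}. inner m l) - real m * R\<bar> \<le> real m * (e / 2) + 2 * K * H" for m
  proof -
    have "(\<Sum>l\<in>{0..<int m}. inner m l) - real m * R = (\<Sum>l\<in>{0..<int m}. inner m l - R)"
      by (simp add: sum_subtractf)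
    also have "\<bar>\<dots>\<bar> \<le> (\<Sum>l\<in>{0..<int m}. \<bar>inner m l - R\<bar>)" by (rule sum_abs)
    also have "\<dots> \<le> (\<Sum>l\<in>{0..<int m}. e / 2 + (if l \<in> {0..<K} \<union> {int m - K..<int m} then H else 0))"
    proof (rule sum_mono)
      fix l assume l: "l \<in> {0..<int m}"
      show "\<bar>inner m l - R\<bar> \<le> e / 2 + (if l \<in> {0..<K} \<union> {int m - K..<int m} then H else 0)"
      proof (cases "l \<in> {0..<K} \<union> {int m - K..<int m}")
        case True
        then show ?thesis using all[of m l] e by simp
      next
        case False
        then have "K \<le> l" "l < int m - K" using l by auto
        then show ?thesis using good[of l m] False by simp
      qed
    qed
    also have "\<dots> = real m * (e / 2) + (\<Sum>l\<in>{0..<int m}. if l \<in> {0..<K} \<union> {int m - K..<int m} then H else 0)"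
      by (simp add: sum.distrib)
    also have "(\<Sum>l\<in>{0..<int m}. if l \<in> {0..<K} \<union> {int m - K..<int m} then H else 0) = real (card ({0..<int m} \<inter> ({0..<K} \<union> {int m - K..<int m}))) * H"
      by (subst sum.inter_restrict[symmetric]) auto
    also have "\<dots> \<le> real_of_int (2 * K) * H"
    proof (rule mult_right_mono[OF _ H0])
      have "card ({0..<int m} \<inter> ({0..<K} \<union> {int m - K..<int m})) \<le> card ({0..<K} \<union> {int m - K..<int m})"
        by (intro card_mono) auto
      also have "\<dots> \<le> card {0..<K} + card {int m - K..<int m}" by (rule card_Un_le)
      also have "\<dots> = nat (2 * K)" using K by simp
      finally show "real (card ({0..<int m} \<inter> ({0..<K} \<union> {int m - K..<int m}))) \<le> real_of_int (2 * K)" using K by linarith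
    qed
    finally show ?thesis by simp
  qed
  obtain m0 :: nat where m0: "real m0 > 4 * (2 * K * H) / e" using reals_Archimedean2 by blast
  have "norm ((\<Sum>l\<in>{0..<int m}. inner m l) / real m - R) < e" if m: "m \<ge> max 1 m0" for m
  proof -
    have mp: "real m > 0" using m by simp
    have "4 * (2 * K * H) / e < real m" using m0 m by linarith
    then have "4 * (2 * K * H) < real m * e" using e by (simp add: field_simps)
    moreover have "2 * K * H \<ge> 0" using K H0 by simp
    moreover have "2 * b < me" if "4 * b < me" "b \<ge> 0" for b me :: real using that by linarith
    ultimately have s: "2 * (2 * K * H) < real m * e" by blast
    have "norm ((\<Sum>l\<in>{0..<int m}. inner m l) / real m - R) = \<bar>(\<Sum>l\<in>{0..<int m}. inner m l) - real m * R\<bar> / real m"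
    proof -
      have "(\<Sum>l\<in>{0..<int m}. inner m l) / real m - R = ((\<Sum>l\<in>{0..<int m}. inner m l) - real m * R) / real m"
        using mp by (simp add: diff_divide_distrib)
      then show ?thesis by (simp add: abs_divide)
    qed
    also have "\<dots> \<le> (real m * (e / 2) + 2 * K * H) / real m" using bound mp by (intro divide_right_mono) auto
    also have "\<dots> < e" using s mp by (simp add: field_simps)
    finally show ?thesis .
  qed
  then show "\<exists>no. \<forall>m\<ge>no. norm ((\<Sum>l\<in>{0..<int m}. \<Sum>n\<in>{0..<c * int m}. r (n - c * l)) / real m - infsum r UNIV) < e"
    unfolding R_def[symmetric] inner_def[symmetric] by blast
qed

locale estimator_family = stable_family P \<alpha> M F D p
  for P :: "'a measure" and \<alpha> M F D p +
  fixes j0 j1 :: int and w :: "int \<Rightarrow> real" and Nc :: "int \<Rightarrow> nat \<Rightarrow> nat"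
  assumes Npos: "\<And>j N. j \<in> {j0..j1} \<Longrightarrow> 0 < N \<Longrightarrow> 0 < Nc j N"
    and Nlim: "\<And>j. j \<in> {j0..j1} \<Longrightarrow> (\<lambda>N. real (Nc j N) / real N) \<longlonglongrightarrow> 2 powr (- real_of_int j)"
begin

definition J :: "int set" where "J = {j0..j1}"

text \<open>The limiting weight: since \<open>Nc j N\<close> is asymptotic to N / 2^j, the
  coefficient of one variable in \<open>V\<close> behaves like \<open>a j / sqrt N\<close>.\<close>

definition a :: "int \<Rightarrow> real" where "a j = w j * 2 powr real_of_int j"

text \<open>How many coefficients of octave j fall into a time cell of length 2^j1, the spacing of
  the coarsest octave.\<close>

definition mesh :: "int \<Rightarrow> nat" where "mesh j = 2 ^ nat (j1 - j)"

definition V :: "nat \<Rightarrow> 'a \<Rightarrow> real" where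
  "V N x = (\<Sum>j\<in>J. w j * (sqrt (real N) / real (Nc j N)) * (\<Sum>n = 1..Nc j N. G (j, int n) x))"

definition cV :: "nat \<Rightarrow> int \<times> int \<Rightarrow> real" where
  "cV N q = (if snd q \<in> {1..int (Nc (fst q) N)} then w (fst q) * (sqrt (real N) / real (Nc (fst q) N)) else 0)"

text \<open>Idealised weights: constant on each octave, over exactly \<open>B\<close> cells of
  length 2^j1 beginning at time 0. For these the octaves are aligned, so that Toeplitz sums and
  blocks come out without remainders.\<close>

definition cW :: "nat \<Rightarrow> nat \<Rightarrow> int \<times> int \<Rightarrow> real" where
  "cW N B q = (if snd q \<in> {0..<int (B * mesh (fst q))} then a (fst q) / sqrt (real N) else 0)"

text \<open>A common range for both sets of weights. It contains 0, where the idealised weights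
  begin, although the estimator begins at index 1.\<close>

definition rng :: "nat \<Rightarrow> nat \<Rightarrow> int \<Rightarrow> int set" where
  "rng N B j = {0..int (max (Nc j N) (B * mesh j))}"

abbreviation "idx N B \<equiv> SIGMA j:J. rng N B j"

lemma finite_J: "finite J" by (simp add: J_def)
lemma finite_rng: "finite (rng N B j)" by (simp add: rng_def)
lemma rng_subset: "{0..<int (B * mesh j)} \<subseteq> rng N B j" "{1..int (Nc j N)} \<subseteq> rng N B j"
proof -
  have "{0..<int y} \<subseteq> {0..int (max x y)}" "{1..int x} \<subseteq> {0..int (max x y)}" for x y :: nat by auto
  then show "{0..<int (B * mesh j)} \<subseteq> rng N B j" "{1..int (Nc j N)} \<subseteq> rng N B j"
    unfolding rng_def by blast+
qed

lemma mesh_real: "j \<in> J \<Longrightarrow> real (mesh j) = 2 powr real_of_int (j1 - j)"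
proof -
  assume "j \<in> J"
  then have "real_of_int (j1 - j) = real (nat (j1 - j))" by (simp add: J_def)
  then show ?thesis unfolding mesh_def by (simp only: powr_realpow) simp
qed

lemma mesh_pos: "mesh j > 0" by (simp add: mesh_def)

lemma sum_idx: "(\<Sum>q\<in>idx N B. f q) = (\<Sum>j\<in>J. \<Sum>n\<in>rng N B j. f (j, n))"
  using finite_J finite_rng by (subst sum.Sigma) auto

lemma V_eq: "V N x = (\<Sum>q\<in>idx N B. cV N q * G q x)"
proof -
  have "(\<Sum>n\<in>rng N B j. cV N (j, n) * G (j, n) x) = w j * (sqrt (real N) / real (Nc j N)) * (\<Sum>n = 1..Nc j N. G (j, int n) x)" for j
  proof -
    have "(\<Sum>n\<in>rng N B j. cV N (j, n) * G (j, n) x) = (\<Sum>n\<in>{1..int (Nc j N)}. cV N (j, n) * G (j, n) x)"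
      by (rule sum.mono_neutral_right) (auto simp: rng_def cV_def)
    also have "\<dots> = (\<Sum>n = 1..Nc j N. cV N (j, int n) * G (j, int n) x)"
    proof -
      have "{1..int (Nc j N)} = int ` {1..Nc j N}" by (simp add: image_int_atLeastAtMost)
      then show ?thesis by (simp add: sum.reindex)
    qed
    also have "\<dots> = (\<Sum>n = 1..Nc j N. w j * (sqrt (real N) / real (Nc j N)) * G (j, int n) x)"
      by (intro sum.cong) (auto simp: cV_def)
    finally show ?thesis by (simp add: sum_distrib_left)
  qed
  then show ?thesis unfolding V_def sum_idx by simp
qed

lemma V_props: "V N \<in> borel_measurable P" "sqint (V N)"
proof -
  note [measurable] = G_props(1)
  show "V N \<in> borel_measurable P" unfolding V_def[abs_def] by measurable
  show "sqint (V N)" unfolding V_eq[where B=0]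
    by (rule expectation_sum_square(1)) (rule G_props)+
qed

lemma mesh_lim:
  assumes B: "(\<lambda>N. real (B N) / real N) \<longlonglongrightarrow> 2 powr (- real_of_int j1)" and j: "j \<in> J"
  shows "(\<lambda>N. real (B N * mesh j) / real N) \<longlonglongrightarrow> 2 powr (- real_of_int j)"
proof -
  have "(\<lambda>N. real (B N) / real N * real (mesh j)) \<longlonglongrightarrow> 2 powr (- real_of_int j1) * real (mesh j)"
    by (intro tendsto_intros B)
  also have "2 powr (- real_of_int j1) * real (mesh j) = 2 powr (- real_of_int j)"
    unfolding mesh_real[OF j] by (simp flip: powr_add)
  finally show ?thesis by simp
qed

text \<open>Expanding the squares leaves the sizes of the two index ranges and of their
  intersection, all asymptotic to N g with g = 2^(-j). In the limit the three terms are 1/g - 2/g +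
  1/g.\<close>

lemma coefficient_difference:
  assumes B: "(\<lambda>N. real (B N) / real N) \<longlonglongrightarrow> 2 powr (- real_of_int j1)"
  shows "(\<lambda>N. \<Sum>q\<in>idx N (B N). (cV N q - cW N (B N) q)\<^sup>2) \<longlonglongrightarrow> 0"
proof -
  have "(\<lambda>N. \<Sum>n\<in>rng N (B N) j. (cV N (j, n) - cW N (B N) (j, n))\<^sup>2) \<longlonglongrightarrow> 0" if j: "j \<in> J" for j
  proof -
    define g where "g = 2 powr (- real_of_int j)"
    have g: "g > 0" by (simp add: g_def)
    have ag: "a j = w j / g" by (simp add: a_def g_def powr_minus divide_inverse)
    have jj: "j \<in> {j0..j1}" using j by (simp add: J_def)
    let ?N = "\<lambda>N. real (Nc j N) / real N" and ?B = "\<lambda>N. real (B N * mesh j) / real N"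
    \<comment> \<open>The size of the intersection. One range starts at 1, the other at 0 with its
      end excluded, hence the - 1 in the second argument.\<close>
    let ?m = "\<lambda>N. real (min (Nc j N) (B N * mesh j - 1)) / real N"
    have l1: "?N \<longlonglongrightarrow> g" using Nlim[OF jj] by (simp add: g_def)
    have l2: "?B \<longlonglongrightarrow> g" unfolding g_def by (rule mesh_lim[OF B j])
    have l2': "(\<lambda>N. real (B N * mesh j - 1) / real N) \<longlonglongrightarrow> g"
    proof -
      have "(\<lambda>N. ?B N - real (B N * mesh j - 1) / real N) \<longlonglongrightarrow> 0"
      proof (rule tendsto_zero_le)
        show "(\<lambda>N. 1 / real N) \<longlonglongrightarrow> 0" by (rule lim_1_over_n)
        show "0 \<le> ?B N - real (B N * mesh j - 1) / real N" for N
          unfolding diff_divide_distrib[symmetric] by (intro divide_nonneg_nonneg) (simp_all only: of_nat_0_le_iff diff_ge_0_iff_ge of_nat_le_iff diff_le_self)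
        have "real k - real (k - 1) \<le> 1" for k :: nat by (cases k) auto
        then show "?B N - real (B N * mesh j - 1) / real N \<le> 1 / real N" for N
          by (simp only: diff_divide_distrib[symmetric] divide_right_mono of_nat_0_le_iff)
      qed
      from tendsto_diff[OF l2 this] show ?thesis by simp
    qed
    have l3: "?m \<longlonglongrightarrow> g"
    proof -
      have "(\<lambda>N. min (?N N) (real (B N * mesh j - 1) / real N)) \<longlonglongrightarrow> min g g" by (intro tendsto_min l1 l2')
      moreover have "?m N = min (?N N) (real (B N * mesh j - 1) / real N)" for N
        by (cases "N = 0") (auto simp: min_def divide_le_cancel of_nat_mono dest: of_nat_le_iff[THEN iffD1])
      ultimately show ?thesis by simp
    qed
    have eq: "\<forall>\<^sub>F N in sequentially. (w j)\<^sup>2 * (1 / ?N N - 2 / g * (?m N / ?N N) + ?B N / g\<^sup>2)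
       = (\<Sum>n\<in>rng N (B N) j. (cV N (j, n) - cW N (B N) (j, n))\<^sup>2)"
      using eventually_gt_at_top[of 0]
    proof eventually_elim
      case (elim N)
      have N: "real N > 0" using elim by simp
      have Nc: "real (Nc j N) > 0" using Npos[OF jj elim] by simp
      let ?x = "w j * (sqrt (real N) / real (Nc j N))" and ?y = "a j / sqrt (real N)"
      have "(\<Sum>n\<in>rng N (B N) j. (cV N (j, n) - cW N (B N) (j, n))\<^sup>2)
        = (\<Sum>n\<in>rng N (B N) j. ((if n \<in> {1..int (Nc j N)} then ?x else 0) - (if n \<in> {0..<int (B N * mesh j)} then ?y else 0))\<^sup>2)"
        unfolding cV_def cW_def fst_conv snd_conv ..
      also have "\<dots> = real (card {1..int (Nc j N)}) * ?x\<^sup>2 - 2 * real (card ({1..int (Nc j N)} \<inter> {0..<int (B N * mesh j)})) * (?x * ?y) + real (card {0..<int (B N * mesh j)}) * ?y\<^sup>2"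
        by (rule sum_square_two_level[OF finite_rng rng_subset(2,1)])
      also have "{1..int (Nc j N)} \<inter> {0..<int (B N * mesh j)} = {1..int (min (Nc j N) (B N * mesh j - 1))}"
      proof -
        have "{1..int x} \<inter> {0..<int y} = {1..int (min x (y - 1))}" for x y :: nat by auto
        then show ?thesis .
      qed
      also have "real (card {1..int (Nc j N)}) * ?x\<^sup>2 = (w j)\<^sup>2 * (1 / ?N N)"
        using N Nc by (simp add: power2_eq_square field_simps)
      also have "?x * ?y = (w j)\<^sup>2 / g / real (Nc j N)"
        using N Nc g by (simp add: ag power2_eq_square)
      also have "real (card {0..<int (B N * mesh j)}) * ?y\<^sup>2 = (w j)\<^sup>2 * (?B N / g\<^sup>2)"
        using N g by (simp add: ag power_divide power_mult_distrib mult_ac)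
      also have "2 * real (card {1..int (min (Nc j N) (B N * mesh j - 1))}) * ((w j)\<^sup>2 / g / real (Nc j N)) = (w j)\<^sup>2 * (2 / g * (?m N / ?N N))"
        using N Nc by simp
      finally show ?case by (simp add: algebra_simps)
    qed
    have "(\<lambda>N. (w j)\<^sup>2 * (1 / ?N N - 2 / g * (?m N / ?N N) + ?B N / g\<^sup>2)) \<longlonglongrightarrow> (w j)\<^sup>2 * (1 / g - 2 / g * (g / g) + g / g\<^sup>2)"
      using g by (intro tendsto_intros l1 l2 l3) auto
    also have "(w j)\<^sup>2 * (1 / g - 2 / g * (g / g) + g / g\<^sup>2) = 0" using g by (simp add: power2_eq_square)
    finally show ?thesis using eq by (rule Lim_transform_eventually)
  qed
  then have "(\<lambda>N. \<Sum>j\<in>J. \<Sum>n\<in>rng N (B N) j. (cV N (j, n) - cW N (B N) (j, n))\<^sup>2) \<longlonglongrightarrow> (\<Sum>j\<in>J. 0)"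
    by (intro tendsto_sum)
  then show ?thesis by (simp add: sum_idx)
qed

definition Rs :: "int \<Rightarrow> int \<Rightarrow> real" where
  "Rs j k = (if j \<le> k then infsum (r j k) UNIV else infsum (r k j) UNIV)"

text \<open>The factor with the maximum of j and k is the number of coefficients of the coarser
  octave per unit of time; each contributes one full sum over the lags of the finer octave.\<close>

definition vlim :: real where
  "vlim = (\<Sum>j\<in>J. \<Sum>k\<in>J. a j * a k * 2 powr (- real_of_int (max j k)) * Rs j k)"

lemma sum_cW:
  "(\<Sum>q\<in>idx N B. cW N B q * f q) = (\<Sum>j\<in>J. \<Sum>n\<in>{0..<int (B * mesh j)}. a j / sqrt (real N) * f (j, n))"
  unfolding sum_idx
proof (rule sum.cong[OF refl])
  fix j
  have "(\<Sum>n\<in>rng N B j. cW N B (j, n) * f (j, n)) = (\<Sum>n\<in>{0..<int (B * mesh j)}. cW N B (j, n) * f (j, n))"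
    by (rule sum.mono_neutral_right[OF finite_rng rng_subset(1)]) (auto simp: rng_def cW_def)
  also have "\<dots> = (\<Sum>n\<in>{0..<int (B * mesh j)}. a j / sqrt (real N) * f (j, n))"
    by (intro sum.cong) (auto simp: cW_def)
  finally show "(\<Sum>n\<in>rng N B j. cW N B (j, n) * f (j, n)) = (\<Sum>n\<in>{0..<int (B * mesh j)}. a j / sqrt (real N) * f (j, n))" .
qed

definition cc :: "nat \<Rightarrow> int \<Rightarrow> int \<Rightarrow> real" where
  "cc B j k = (\<Sum>n\<in>{0..<int (B * mesh j)}. \<Sum>l\<in>{0..<int (B * mesh k)}. expectation (\<lambda>x. G (j, n) x * G (k, l) x))"

lemma cc_commute: "cc B j k = cc B k j"
  unfolding cc_def by (subst sum.swap) (simp add: mult.commute)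

text \<open>Per cell the finer octave has 2^(k - j) times as many coefficients as the coarser one,
  which is the stride of \<open>toeplitz_average\<close>. The other order of the octaves follows by
  symmetry.\<close>

lemma cc_limit:
  assumes j: "j \<in> J" and k: "k \<in> J" and B: "filterlim B at_top sequentially"
  shows "(\<lambda>N. cc (B N) j k / real (B N)) \<longlonglongrightarrow> real (mesh (max j k)) * Rs j k"
proof -
  have main: "(\<lambda>N. cc (B N) j k / real (B N)) \<longlonglongrightarrow> real (mesh k) * infsum (r j k) UNIV" if j: "j \<in> J" and k: "k \<in> J" and jk: "j \<le> k" for j k
  proof -
    define c where "c = (2::int) ^ nat (k - j)"
    have c: "c \<ge> 1" by (simp add: c_def)
    have mm: "int (mesh j) = c * int (mesh k)"
    proof -
      have "nat (j1 - j) = nat (k - j) + nat (j1 - k)" using jk k by (simp add: J_def nat_add_distrib[symmetric])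
      then show ?thesis by (simp add: mesh_def c_def power_add)
    qed
    have e: "cc b j k = (\<Sum>l\<in>{0..<int (b * mesh k)}. \<Sum>n\<in>{0..<c * int (b * mesh k)}. r j k (n - c * l))" for b
    proof -
      have "int (b * mesh j) = c * int (b * mesh k)" using mm by simp
      then have "cc b j k = (\<Sum>n\<in>{0..<c * int (b * mesh k)}. \<Sum>l\<in>{0..<int (b * mesh k)}. r j k (n - c * l))"
        unfolding cc_def by (simp only: G_cov_stationary[OF jk] c_def)
      then show ?thesis by (subst sum.swap) simp
    qed
    have f: "filterlim (\<lambda>N. B N * mesh k) at_top sequentially"
    proof (rule filterlim_at_top_mono[OF B])
      show "\<forall>\<^sub>F N in sequentially. B N \<le> B N * mesh k" using mesh_pos[of k] by (intro always_eventually) auto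
    qed
    have "(\<lambda>N. cc (B N) j k / real (B N * mesh k)) \<longlonglongrightarrow> infsum (r j k) UNIV"
      unfolding e by (rule filterlim_compose[OF toeplitz_average[OF r_summable(1) c] f])
    from tendsto_mult[OF tendsto_const this, of "real (mesh k)"]
    show ?thesis using mesh_pos[of k] by simp
  qed
  show ?thesis
  proof (cases "j \<le> k")
    case True
    then show ?thesis using main[OF j k] by (simp add: Rs_def max_def)
  next
    case False
    then show ?thesis using main[OF k j] by (simp add: Rs_def max_def cc_commute[of _ j k])
  qed
qed

lemma W_variance:
  assumes B: "(\<lambda>N. real (B N) / real N) \<longlonglongrightarrow> 2 powr (- real_of_int j1)" and Bt: "filterlim B at_top sequentially"
  shows "(\<lambda>N. msq (\<lambda>x. \<Sum>q\<in>idx N (B N). cW N (B N) q * G q x)) \<longlonglongrightarrow> vlim"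
proof -
  have e: "msq (\<lambda>x. \<Sum>q\<in>idx N b. cW N b q * G q x) = (\<Sum>j\<in>J. \<Sum>k\<in>J. a j * a k * (cc b j k / real N))" for N b
  proof -
    have "msq (\<lambda>x. \<Sum>q\<in>idx N b. cW N b q * G q x)
       = (\<Sum>q\<in>idx N b. cW N b q * (\<Sum>q'\<in>idx N b. cW N b q' * expectation (\<lambda>x. G q x * G q' x)))"
      by (subst expectation_sum_square(2)) (auto simp: G_props sum_distrib_left mult.assoc)
    also have "\<dots> = (\<Sum>j\<in>J. \<Sum>n\<in>{0..<int (b * mesh j)}. a j / sqrt (real N) *
       (\<Sum>k\<in>J. \<Sum>l\<in>{0..<int (b * mesh k)}. a k / sqrt (real N) * expectation (\<lambda>x. G (j, n) x * G (k, l) x)))"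
      unfolding sum_cW ..
    also have "\<dots> = (\<Sum>j\<in>J. \<Sum>n\<in>{0..<int (b * mesh j)}. \<Sum>k\<in>J. a j * a k / real N * (\<Sum>l\<in>{0..<int (b * mesh k)}. expectation (\<lambda>x. G (j, n) x * G (k, l) x)))"
      by (simp add: sum_distrib_left field_simps)
    also have "\<dots> = (\<Sum>j\<in>J. \<Sum>k\<in>J. a j * a k * (cc b j k / real N))"
    proof (rule sum.cong[OF refl])
      fix j
      have "(\<Sum>n\<in>{0..<int (b * mesh j)}. \<Sum>k\<in>J. a j * a k / real N * (\<Sum>l\<in>{0..<int (b * mesh k)}. expectation (\<lambda>x. G (j, n) x * G (k, l) x)))
        = (\<Sum>k\<in>J. \<Sum>n\<in>{0..<int (b * mesh j)}. a j * a k / real N * (\<Sum>l\<in>{0..<int (b * mesh k)}. expectation (\<lambda>x. G (j, n) x * G (k, l) x)))"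
        by (rule sum.swap)
      also have "\<dots> = (\<Sum>k\<in>J. a j * a k * (cc b j k / real N))"
        by (simp only: sum_distrib_left[symmetric] cc_def[symmetric]) simp
      finally show "(\<Sum>n\<in>{0..<int (b * mesh j)}. \<Sum>k\<in>J. a j * a k / real N * (\<Sum>l\<in>{0..<int (b * mesh k)}. expectation (\<lambda>x. G (j, n) x * G (k, l) x)))
        = (\<Sum>k\<in>J. a j * a k * (cc b j k / real N))" .
    qed
    finally show ?thesis .
  qed
  have "(\<lambda>N. \<Sum>j\<in>J. \<Sum>k\<in>J. a j * a k * (cc (B N) j k / real N))
     \<longlonglongrightarrow> (\<Sum>j\<in>J. \<Sum>k\<in>J. a j * a k * (2 powr (- real_of_int (max j k)) * Rs j k))"
  proof (intro tendsto_sum tendsto_mult tendsto_const)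
    fix j k assume j: "j \<in> J" and k: "k \<in> J"
    have mk: "max j k \<in> J" using j k by (auto simp: J_def max_def)
    have "(\<lambda>N. (cc (B N) j k / real (B N)) * (real (B N) / real N)) \<longlonglongrightarrow> real (mesh (max j k)) * Rs j k * 2 powr (- real_of_int j1)"
      by (intro tendsto_mult cc_limit j k Bt B)
    also have "real (mesh (max j k)) * Rs j k * 2 powr (- real_of_int j1) = 2 powr (- real_of_int (max j k)) * Rs j k"
    proof -
      have "real (mesh (max j k)) * 2 powr (- real_of_int j1) = 2 powr (- real_of_int (max j k))"
        unfolding mesh_real[OF mk] powr_add[symmetric] by simp
      then show ?thesis by (simp only: mult_ac)
    qed
    finally have l: "(\<lambda>N. (cc (B N) j k / real (B N)) * (real (B N) / real N)) \<longlonglongrightarrow> 2 powr (- real_of_int (max j k)) * Rs j k" .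
    have "\<forall>\<^sub>F N in sequentially. B N \<ge> 1" using Bt by (simp add: filterlim_at_top)
    then have "\<forall>\<^sub>F N in sequentially. (cc (B N) j k / real (B N)) * (real (B N) / real N) = cc (B N) j k / real N"
      by eventually_elim simp
    with l show "(\<lambda>N. cc (B N) j k / real N) \<longlonglongrightarrow> 2 powr (- real_of_int (max j k)) * Rs j k"
      by (rule Lim_transform_eventually)
  qed
  then show ?thesis unfolding e vlim_def by (simp add: mult.assoc)
qed

text \<open>\<open>k N\<close> counts the complete blocks of l cells that fit into time N. The last
  bound holds for every N and serves to estimate sums of squared weights.\<close>

lemma floor_multiple_lim:
  assumes l: "l \<ge> (1::nat)"
  defines "k \<equiv> \<lambda>N::nat. nat \<lfloor>real N * 2 powr (- real_of_int j1) / real l\<rfloor>"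
  shows "(\<lambda>N. real (k N) / real N) \<longlonglongrightarrow> 2 powr (- real_of_int j1) / real l" "filterlim k at_top sequentially"
    "\<And>N. real (k N * l) \<le> real N * 2 powr (- real_of_int j1)"
proof -
  let ?g = "2 powr (- real_of_int j1) / real l"
  have g: "?g > 0" using l by simp
  have kb: "real (k N) \<le> real N * ?g" "real N * ?g - 1 \<le> real (k N)" for N
  proof -
    have "0 \<le> real N * ?g" using g by simp
    moreover have "real (k N) = of_int \<lfloor>real N * ?g\<rfloor>" using g by (simp add: k_def)
    ultimately show "real (k N) \<le> real N * ?g" "real N * ?g - 1 \<le> real (k N)" by linarith+
  qed
  show "real (k N * l) \<le> real N * 2 powr (- real_of_int j1)" for N
    using mult_right_mono[OF kb(1)[of N], of "real l"] l by simp
  show "(\<lambda>N. real (k N) / real N) \<longlonglongrightarrow> ?g"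
  proof (rule tendsto_sandwich)
    show "\<forall>\<^sub>F N in sequentially. ?g - 1 / real N \<le> real (k N) / real N"
      using eventually_gt_at_top[of 0]
    proof eventually_elim
      case (elim N)
      have "(real N * ?g - 1) / real N \<le> real (k N) / real N" by (intro divide_right_mono kb) simp
      then show ?case using elim by (simp add: diff_divide_distrib)
    qed
    show "\<forall>\<^sub>F N in sequentially. real (k N) / real N \<le> ?g"
      using eventually_gt_at_top[of 0]
    proof eventually_elim
      case (elim N)
      have "real (k N) / real N \<le> (real N * ?g) / real N" by (intro divide_right_mono kb) simp
      then show ?case using elim by simp
    qed
    have "(\<lambda>N. ?g - 1 / real N) \<longlonglongrightarrow> ?g - 0" by (intro tendsto_intros lim_1_over_n)
    then show "(\<lambda>N. ?g - 1 / real N) \<longlonglongrightarrow> ?g" by simp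
  qed simp
  show "filterlim k at_top sequentially"
    unfolding filterlim_at_top
  proof
    fix Z :: nat
    obtain N0 :: nat where N0: "real N0 > (real Z + 1) / ?g" using reals_Archimedean2 by blast
    show "\<forall>\<^sub>F N in sequentially. Z \<le> k N"
      using eventually_ge_at_top[of N0]
    proof eventually_elim
      case (elim N)
      have "(real Z + 1) / ?g < real N" using N0 elim by linarith
      then have "real Z + 1 < real N * ?g" using g by (simp only: pos_divide_less_eq)
      then have "real Z \<le> real (k N)" using kb(2)[of N] by linarith
      then show ?case by simp
    qed
  qed
qed

lemma block_lim:
  assumes l: "l \<ge> (1::nat)"
  defines "B \<equiv> \<lambda>N::nat. nat \<lfloor>real N * 2 powr (- real_of_int j1) / real l\<rfloor> * l"
  shows "(\<lambda>N. real (B N) / real N) \<longlonglongrightarrow> 2 powr (- real_of_int j1)" "filterlim B at_top sequentially"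
proof -
  note k = floor_multiple_lim[OF l]
  have "(\<lambda>N. real (nat \<lfloor>real N * 2 powr (- real_of_int j1) / real l\<rfloor>) / real N * real l) \<longlonglongrightarrow> 2 powr (- real_of_int j1) / real l * real l"
    by (intro tendsto_mult k(1) tendsto_const)
  then show "(\<lambda>N. real (B N) / real N) \<longlonglongrightarrow> 2 powr (- real_of_int j1)" using l by (simp add: B_def)
  show "filterlim B at_top sequentially"
    by (rule filterlim_at_top_mono[OF k(2)]) (use l in \<open>auto simp: B_def\<close>)
qed

lemma G_sum_bound:
  obtains K where "K \<ge> 0" "\<And>N B c. msq (\<lambda>x. \<Sum>q\<in>idx N B. c q * G q x) \<le> K * (\<Sum>q\<in>idx N B. (c q)\<^sup>2)"
proof -
  obtain m E where mE: "m > 0" "E \<ge> 0" "\<And>j. j \<in> J \<Longrightarrow> 2 * m \<le> powint \<alpha> (F j)"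
    "\<And>j u. j \<in> J \<Longrightarrow> \<bar>2 * F j u\<bar> powr (\<alpha> / 2) \<le> E * env p u" using uniform_constants[OF finite_J] by blast
  obtain K where K: "K \<ge> 0" "\<And>f Y A c. (\<And>q. fst q \<in> J \<Longrightarrow> admissible p m E (f q) (site q) (Y q)) \<Longrightarrow>
    (\<And>j. j \<in> J \<Longrightarrow> finite (A j)) \<Longrightarrow>
    msq (\<lambda>x. \<Sum>q\<in>(SIGMA j:J. A j). c q * cln (Y q) x) \<le> K * (\<Sum>q\<in>(SIGMA j:J. A j). (c q)\<^sup>2)"
    using admissible_sum_bound[OF p mE(1,2) finite_J] by blast
  show ?thesis
    by (rule that[OF K(1)], unfold G_def, rule K(2)[OF G_admissible[OF mE(1)] finite_rng]) (use mE in auto)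
qed

text \<open>The Schur bound converts the vanishing squared distance of the weights into mean square
  convergence.\<close>

lemma VW_limit:
  assumes B: "(\<lambda>N. real (B N) / real N) \<longlonglongrightarrow> 2 powr (- real_of_int j1)"
  shows "(\<lambda>N. msq (\<lambda>x. V N x - (\<Sum>q\<in>idx N (B N). cW N (B N) q * G q x))) \<longlonglongrightarrow> 0"
proof -
  obtain K where K: "K \<ge> 0" "\<And>N B c. msq (\<lambda>x. \<Sum>q\<in>idx N B. c q * G q x) \<le> K * (\<Sum>q\<in>idx N B. (c q)\<^sup>2)"
    using G_sum_bound by blast
  have e: "V N x - (\<Sum>q\<in>idx N (B N). cW N (B N) q * G q x) = (\<Sum>q\<in>idx N (B N). (cV N q - cW N (B N) q) * G q x)" for N x
    unfolding V_eq[where B="B N"] by (simp add: left_diff_distrib sum_subtractf)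
  have "(\<lambda>N. K * (\<Sum>q\<in>idx N (B N). (cV N q - cW N (B N) q)\<^sup>2)) \<longlonglongrightarrow> K * 0"
    by (intro tendsto_mult tendsto_const coefficient_difference B)
  then have l: "(\<lambda>N. K * (\<Sum>q\<in>idx N (B N). (cV N q - cW N (B N) q)\<^sup>2)) \<longlonglongrightarrow> 0" by simp
  show ?thesis unfolding e by (rule tendsto_zero_le[OF _ K(2) l]) simp
qed

text \<open>Square roots are compared because the L2 norm obeys the triangle inequality. Blocks of a
  single cell suffice, since independence plays no part in the variance.\<close>

lemma V_variance: "(\<lambda>N. msq (V N)) \<longlonglongrightarrow> vlim"
proof -
  note B = block_lim[of 1, simplified]
  define B where "B N = nat \<lfloor>real N * 2 powr (- real_of_int j1)\<rfloor>" for N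
  have Bl: "(\<lambda>N. real (B N) / real N) \<longlonglongrightarrow> 2 powr (- real_of_int j1)" "filterlim B at_top sequentially"
    using B unfolding B_def by simp_all
  let ?W = "\<lambda>N x. \<Sum>q\<in>idx N (B N). cW N (B N) q * G q x"
  have W: "?W N \<in> borel_measurable P" "sqint (?W N)" for N
    by (intro borel_measurable_sum borel_measurable_times G_props) (simp, rule expectation_sum_square(1), (rule G_props)+)
  have "(\<lambda>N. sqrt (msq (\<lambda>x. V N x - ?W N x))) \<longlonglongrightarrow> sqrt 0"
    by (intro tendsto_real_sqrt VW_limit Bl)
  then have l: "(\<lambda>N. sqrt (msq (\<lambda>x. V N x - ?W N x))) \<longlonglongrightarrow> 0" by simp
  have "(\<lambda>N. sqrt (msq (V N)) - sqrt (msq (?W N))) \<longlonglongrightarrow> 0"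
    by (rule Lim_null_comparison[OF _ l], rule always_eventually, rule allI, unfold real_norm_def, rule L2_triangle(4)[OF V_props(1) W(1) V_props(2) W(2)])
  moreover have "(\<lambda>N. sqrt (msq (?W N))) \<longlonglongrightarrow> sqrt vlim"
    by (intro tendsto_real_sqrt W_variance Bl)
  ultimately have "(\<lambda>N. sqrt (msq (V N)) - sqrt (msq (?W N)) + sqrt (msq (?W N))) \<longlonglongrightarrow> 0 + sqrt vlim"
    by (rule tendsto_add)
  then have "(\<lambda>N. (sqrt (msq (V N)))\<^sup>2) \<longlonglongrightarrow> (sqrt vlim)\<^sup>2"
    by (intro tendsto_power) simp
  moreover have "vlim \<ge> 0"
    by (rule LIMSEQ_le_const[OF W_variance[OF Bl]]) auto
  ultimately show ?thesis by simp
qed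

end

section \<open>Blocks with gaps and the normal limit\<close>

lemma fin_simple_shift:
  assumes "fin_simple g"
  shows "fin_simple (\<lambda>u. g (u - x))"
proof -
  note g = fin_simpleD[OF assms]
  have [measurable]: "g \<in> borel_measurable borel" by (rule g(2))
  have "range (\<lambda>u. g (u - x)) \<subseteq> range g" by auto
  then have "simple_function lborel (\<lambda>u. g (u - x))"
    using g(1) by (intro simple_function_borel_measurable) (auto intro: finite_subset)
  moreover have "emeasure lborel {u. g (u - x) \<noteq> 0} < \<infinity>"
  proof -
    have "emeasure lborel {u. g u \<noteq> 0} = emeasure (distr lborel borel ((+) (- x))) {u. g u \<noteq> 0}"
      by (simp add: lborel_distr_plus)
    also have "\<dots> = emeasure lborel {u. g (u - x) \<noteq> 0}" by (subst emeasure_distr) (auto simp: vimage_def)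
    finally show ?thesis using assms by (simp add: fin_simple_def)
  qed
  ultimately show ?thesis by (simp add: fin_simple_def)
qed

context estimator_family begin

lemma sum_cW_square:
  "(\<Sum>q\<in>idx N B. (cW N B q * of_bool (U q))\<^sup>2) = (\<Sum>j\<in>J. (a j)\<^sup>2 / real N * (\<Sum>n\<in>{0..<int (B * mesh j)}. of_bool (U (j, n))))"
proof -
  have "(\<Sum>q\<in>idx N B. (cW N B q * of_bool (U q))\<^sup>2) = (\<Sum>q\<in>idx N B. cW N B q * (cW N B q * of_bool (U q)))"
    by (intro sum.cong) (auto simp: power2_eq_square)
  also have "\<dots> = (\<Sum>j\<in>J. \<Sum>n\<in>{0..<int (B * mesh j)}. a j / sqrt (real N) * (cW N B (j, n) * of_bool (U (j, n))))"
    by (rule sum_cW)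
  also have "\<dots> = (\<Sum>j\<in>J. \<Sum>n\<in>{0..<int (B * mesh j)}. (a j)\<^sup>2 / real N * of_bool (U (j, n)))"
  proof (rule sum.cong[OF refl], rule sum.cong[OF refl])
    fix j n assume "n \<in> {0..<int (B * mesh j)}"
    then have "cW N B (j, n) = a j / sqrt (real N)" unfolding cW_def fst_conv snd_conv by (rule if_P)
    then show "a j / sqrt (real N) * (cW N B (j, n) * of_bool (U (j, n))) = (a j)\<^sup>2 / real N * of_bool (U (j, n))"
      by (simp add: power2_eq_square)
  qed
  finally show ?thesis by (simp only: sum_distrib_left)
qed

text \<open>A block has l \<open>mesh j\<close> coefficients at octave j, hence the same duration l
  2^j1 at every octave. One translation therefore moves all octaves simultaneously to the next
  block.\<close>

lemma site_shift:
  assumes "j \<in> J"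
  shows "site (j, s + int i * int (l * mesh j)) = site (j, s) + real i * (real l * 2 powr real_of_int j1)"
proof -
  have "2 powr real_of_int j * real (mesh j) = 2 powr real_of_int j1"
    unfolding mesh_real[OF assms] by (simp flip: powr_add)
  then show ?thesis unfolding site_def by (simp add: algebra_simps)
qed

text \<open>The margin depends on the octave because it is counted in coefficients, while the
  support radius that it must cover is a time. Working modulo the block length treats all blocks at
  once.\<close>

definition interior :: "(int \<Rightarrow> nat) \<Rightarrow> nat \<Rightarrow> int \<times> int \<Rightarrow> bool" where
  "interior b l q \<longleftrightarrow> snd q mod int (l * mesh (fst q)) \<in> {int (b (fst q))..<int (l * mesh (fst q)) - int (b (fst q))}"

lemma interior_shift: "interior b l (j, s + int i * int (l * mesh j)) \<longleftrightarrow> interior b l (j, s)"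
  unfolding interior_def fst_conv snd_conv by (simp only: mod_mult_self1)

lemma interior_base:
  assumes "s \<in> {0..<int (l * mesh j)}"
  shows "interior b l (j, s) \<longleftrightarrow> s \<in> {int (b j)..<int (l * mesh j) - int (b j)}"
proof -
  have "s mod int (l * mesh j) = s" using assms unfolding atLeastLessThan_iff by (intro mod_pos_pos_trivial) auto
  then show ?thesis unfolding interior_def fst_conv snd_conv by (simp only:)
qed

text \<open>Each of the k blocks discards at most \<open>b j\<close> indices at either end. The
  bound is free of l, so long blocks make the discarded proportion small.\<close>

lemma boundary_count:
  "(\<Sum>n\<in>{0..<int (k * l * mesh j)}. of_bool (\<not> interior b l (j, n))) \<le> real k * (2 * real (b j))"
proof -
  define m where "m = l * mesh j"
  have "(\<Sum>n\<in>{0..<int (k * l * mesh j)}. of_bool (\<not> interior b l (j, n)) :: real)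
     = (\<Sum>n\<in>{0..<int k * int m}. of_bool (\<not> interior b l (j, n)))" by (simp add: m_def mult.assoc)
  also have "\<dots> = (\<Sum>i<k. \<Sum>s\<in>{0..<int m}. of_bool (\<not> interior b l (j, s + int i * int m)))"
    by (rule sum_block_decomposition) simp
  also have "\<dots> = (\<Sum>i<k. \<Sum>s\<in>{0..<int m}. of_bool (\<not> interior b l (j, s)))"
    unfolding m_def interior_shift ..
  also have "\<dots> = real k * (\<Sum>s\<in>{0..<int m}. of_bool (\<not> interior b l (j, s)))" by simp
  also have "\<dots> \<le> real k * (2 * real (b j))"
  proof (rule mult_left_mono)
    have "(\<Sum>s\<in>{0..<int m}. of_bool (\<not> interior b l (j, s)) :: real) = real (card ({0..<int m} \<inter> {s. \<not> interior b l (j, s)}))"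
      by (subst sum_of_bool_eq) auto
    also have "{0..<int m} \<inter> {s. \<not> interior b l (j, s)} \<subseteq> {0..<int (b j)} \<union> {int m - int (b j)..<int m}"
      using interior_base[of _ l j b] unfolding m_def by auto
    then have "card ({0..<int m} \<inter> {s. \<not> interior b l (j, s)}) \<le> card ({0..<int (b j)} \<union> {int m - int (b j)..<int m})"
      by (intro card_mono) auto
    also have "\<dots> \<le> card {0..<int (b j)} + card {int m - int (b j)..<int m}" by (rule card_Un_le)
    also have "\<dots> = 2 * b j" by simp
    finally show "(\<Sum>s\<in>{0..<int m}. of_bool (\<not> interior b l (j, s))) \<le> 2 * real (b j)" by simp
  qed simp
  finally show ?thesis .
qed

text \<open>Regroups the retained terms by block, the form in which they are matched with the
  independent summands.\<close>

lemma block_sum: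
  "(\<Sum>q\<in>idx N (k * l). cW N (k * l) q * of_bool (interior b l q) * f q)
     = (\<Sum>i<k. \<Sum>j\<in>J. \<Sum>s\<in>{int (b j)..<int (l * mesh j) - int (b j)}. a j * f (j, s + int i * int (l * mesh j))) / sqrt (real N)"
proof -
  have "(\<Sum>q\<in>idx N (k * l). cW N (k * l) q * of_bool (interior b l q) * f q)
    = (\<Sum>q\<in>idx N (k * l). cW N (k * l) q * (of_bool (interior b l q) * f q))" by (simp only: mult.assoc)
  also have "\<dots> = (\<Sum>j\<in>J. \<Sum>n\<in>{0..<int (k * l * mesh j)}. a j / sqrt (real N) * (of_bool (interior b l (j, n)) * f (j, n)))"
    by (rule sum_cW)
  also have "\<dots> = (\<Sum>j\<in>J. \<Sum>i<k. (\<Sum>s\<in>{int (b j)..<int (l * mesh j) - int (b j)}. a j * f (j, s + int i * int (l * mesh j))) / sqrt (real N))"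
  proof (rule sum.cong[OF refl])
    fix j
    have sub: "{int (b j)..<int (l * mesh j) - int (b j)} \<subseteq> {0..<int (l * mesh j)}"
    proof -
      have "{int x..<y - int x} \<subseteq> {0..<y}" for x y by auto
      then show ?thesis .
    qed
    have "(\<Sum>n\<in>{0..<int (k * l * mesh j)}. a j / sqrt (real N) * (of_bool (interior b l (j, n)) * f (j, n)))
      = (\<Sum>n\<in>{0..<int k * int (l * mesh j)}. a j / sqrt (real N) * (of_bool (interior b l (j, n)) * f (j, n)))"
      by (simp add: mult.assoc)
    also have "\<dots> = (\<Sum>i<k. \<Sum>s\<in>{0..<int (l * mesh j)}. a j / sqrt (real N) * (of_bool (interior b l (j, s)) * f (j, s + int i * int (l * mesh j))))"
      by (subst sum_block_decomposition) (simp, simp only: interior_shift)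
    also have "\<dots> = (\<Sum>i<k. (\<Sum>s\<in>{int (b j)..<int (l * mesh j) - int (b j)}. a j * f (j, s + int i * int (l * mesh j))) / sqrt (real N))"
    proof (rule sum.cong[OF refl])
      fix i
      have "(\<Sum>s\<in>{0..<int (l * mesh j)}. a j / sqrt (real N) * (of_bool (interior b l (j, s)) * f (j, s + int i * int (l * mesh j))))
        = (\<Sum>s\<in>{int (b j)..<int (l * mesh j) - int (b j)}. a j / sqrt (real N) * (of_bool (interior b l (j, s)) * f (j, s + int i * int (l * mesh j))))"
        by (rule sum.mono_neutral_right[OF _ sub]) (auto simp: interior_base simp del: of_nat_mult)
      also have "\<dots> = (\<Sum>s\<in>{int (b j)..<int (l * mesh j) - int (b j)}. a j * f (j, s + int i * int (l * mesh j)) / sqrt (real N))"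
      proof (rule sum.cong[OF refl])
        fix s assume "s \<in> {int (b j)..<int (l * mesh j) - int (b j)}"
        then have "interior b l (j, s)" using sub interior_base[of s l j b] by blast
        then show "a j / sqrt (real N) * (of_bool (interior b l (j, s)) * f (j, s + int i * int (l * mesh j))) = a j * f (j, s + int i * int (l * mesh j)) / sqrt (real N)"
          by simp
      qed
      finally show "(\<Sum>s\<in>{0..<int (l * mesh j)}. a j / sqrt (real N) * (of_bool (interior b l (j, s)) * f (j, s + int i * int (l * mesh j))))
        = (\<Sum>s\<in>{int (b j)..<int (l * mesh j) - int (b j)}. a j * f (j, s + int i * int (l * mesh j))) / sqrt (real N)"
        by (simp only: sum_divide_distrib)
    qed
    finally show "(\<Sum>n\<in>{0..<int (k * l * mesh j)}. a j / sqrt (real N) * (of_bool (interior b l (j, n)) * f (j, n)))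
      = (\<Sum>i<k. (\<Sum>s\<in>{int (b j)..<int (l * mesh j) - int (b j)}. a j * f (j, s + int i * int (l * mesh j))) / sqrt (real N))" .
  qed
  also have "\<dots> = (\<Sum>i<k. \<Sum>j\<in>J. (\<Sum>s\<in>{int (b j)..<int (l * mesh j) - int (b j)}. a j * f (j, s + int i * int (l * mesh j))) / sqrt (real N))"
    by (rule sum.swap)
  finally show ?thesis by (simp only: sum_divide_distrib)
qed

text \<open>Discarding the coefficients within distance \<open>b\<close> of the block boundaries makes the summands of
  different blocks functions of the noise on disjoint intervals, hence independent.\<close>

lemma independent_blocks:
  assumes \<phi>: "\<And>j. j \<in> J \<Longrightarrow> fin_simple (\<phi> j)" and supp: "\<And>j u. j \<in> J \<Longrightarrow> R < \<bar>u\<bar> \<Longrightarrow> \<phi> j u = 0"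
    and pos: "\<And>j. j \<in> J \<Longrightarrow> powint \<alpha> (\<phi> j) > 0" and b: "\<And>j. R \<le> 2 powr real_of_int j * real (b j)" and l: "l \<ge> 1"
  defines "Y \<equiv> \<lambda>q. S (\<lambda>u. \<phi> (fst q) (u - site q))"
  obtains T :: "nat \<Rightarrow> 'a \<Rightarrow> real" where "indep_vars (\<lambda>_. borel) T UNIV" "\<And>i. distr P borel (T i) = distr P borel (T 0)"
    "\<And>i. AE \<omega> in P. T i \<omega> = (\<Sum>j\<in>J. \<Sum>s\<in>{int (b j)..<int (l * mesh j) - int (b j)}. a j * cln (Y (j, s + int i * int (l * mesh j))) \<omega>)"
proof -
  define L where "L = real l * 2 powr real_of_int j1"
  define A where "A j = {int (b j)..<int (l * mesh j) - int (b j)}" for j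
  define I where "I = (SIGMA j:J. A j)"
  define \<phi>' where "\<phi>' q = (\<lambda>u. \<phi> (fst q) (u - site q))" for q
  define m where "m q = expectation (\<lambda>\<omega>. ln \<bar>Y q \<omega>\<bar>)" for q
  define \<Psi> where "\<Psi> y = (\<Sum>q\<in>I. a (fst q) * (ln \<bar>y q\<bar> - m q))" for y
  have L: "L > 0" using l by (simp add: L_def)
  have I: "finite I" unfolding I_def A_def using finite_J by auto
  have fs: "fin_simple (\<lambda>u. \<phi> j (u - x))" if "j \<in> J" for j x by (rule fin_simple_shift[OF \<phi>[OF that]])
  have st: "stable_int (\<lambda>u. \<phi> (fst q) (u - site q)) (Y q)" if "fst q \<in> J" for q
    unfolding Y_def by (rule stable_int_simple[OF fs[OF that]])
  have supp': "\<phi>' q u = 0" if q: "q \<in> I" and u: "u \<notin> {0..<L}" for q u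
  proof -
    obtain j s where qs: "q = (j, s)" and j: "j \<in> J" and s: "s \<in> A j" using q by (auto simp: I_def)
    \<comment> \<open>Integrality turns the strict upper bound into one with + 1. After scaling this
      gives \<open>site q + R < L\<close> strictly, as the block is half open.\<close>
    have s': "int (b j) \<le> s" "s + int (b j) + 1 \<le> int (l * mesh j)" using s unfolding A_def atLeastLessThan_iff by linarith+
    have "real (b j) \<le> real_of_int s" "real_of_int s + real (b j) + 1 \<le> real (l * mesh j)"
      using s'(1) of_int_le_iff[where 'a=real, THEN iffD2, OF s'(2)] by simp_all
    moreover define x where "x = 2 powr real_of_int j"
    have x: "x > 0" by (simp add: x_def)
    ultimately have m: "x * real (b j) \<le> x * real_of_int s" "x * (real_of_int s + real (b j) + 1) \<le> x * real (l * mesh j)"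
      by (simp_all only: mult_left_mono less_imp_le)
    have "x * real (l * mesh j) = L"
      using mesh_real[OF j] by (simp add: L_def x_def flip: powr_add)
    with m(2) have "x * real_of_int s + x * real (b j) + x \<le> L" by (simp add: distrib_left)
    moreover have "R \<le> x * real (b j)" using b[of j] by (simp add: x_def)
    moreover have "site q = x * real_of_int s" by (simp add: qs site_def x_def)
    ultimately have "R \<le> site q" "site q + R < L" using m(1) x by linarith+
    then have "R < \<bar>u - site q\<bar>" using u by auto
    then show ?thesis using supp[OF j] by (simp add: \<phi>'_def qs)
  qed
  have \<Psi>: "\<Psi> \<in> borel_measurable (\<Pi>\<^sub>M p\<in>I. borel)" unfolding \<Psi>_def[abs_def] by measurable
  have fs': "fin_simple (\<phi>' q)" if "q \<in> I" for q unfolding \<phi>'_def using that by (intro fs) (auto simp: I_def)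
  obtain T :: "nat \<Rightarrow> 'a \<Rightarrow> real" where T: "indep_vars (\<lambda>_. borel) T UNIV" "\<And>i. distr P borel (T i) = distr P borel (T 0)"
    "\<And>i. AE \<omega> in P. T i \<omega> = \<Psi> (\<lambda>p\<in>I. S (\<lambda>u. \<phi>' p (u - real i * L)) \<omega>)"
    using block_iid[where \<phi>=\<phi>', OF I fs' supp' L \<Psi>] by blast
  show ?thesis
  proof (rule that[OF T(1,2)])
    fix i
    have e: "\<Psi> (\<lambda>p\<in>I. S (\<lambda>u. \<phi>' p (u - real i * L)) \<omega>)
      = (\<Sum>j\<in>J. \<Sum>s\<in>A j. a j * cln (Y (j, s + int i * int (l * mesh j))) \<omega>)" for \<omega>
    proof -
      have "\<Psi> (\<lambda>p\<in>I. S (\<lambda>u. \<phi>' p (u - real i * L)) \<omega>) = (\<Sum>q\<in>I. a (fst q) * (ln \<bar>S (\<lambda>u. \<phi>' q (u - real i * L)) \<omega>\<bar> - m q))"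
        unfolding \<Psi>_def by (intro sum.cong) auto
      also have "\<dots> = (\<Sum>j\<in>J. \<Sum>s\<in>A j. a j * (ln \<bar>S (\<lambda>u. \<phi>' (j, s) (u - real i * L)) \<omega>\<bar> - m (j, s)))"
        unfolding I_def by (subst sum.Sigma) (auto simp: finite_J A_def case_prod_beta')
      also have "\<dots> = (\<Sum>j\<in>J. \<Sum>s\<in>A j. a j * cln (Y (j, s + int i * int (l * mesh j))) \<omega>)"
      proof (rule sum.cong[OF refl], rule sum.cong[OF refl])
        fix j s assume j: "j \<in> J"
        let ?q = "(j, s + int i * int (l * mesh j))"
        have "(\<lambda>u. \<phi>' (j, s) (u - real i * L)) = (\<lambda>u. \<phi> (fst ?q) (u - site ?q))"
          unfolding site_shift[OF j] \<phi>'_def L_def fst_conv by (simp add: algebra_simps)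
        then have 1: "S (\<lambda>u. \<phi>' (j, s) (u - real i * L)) = Y ?q" unfolding Y_def by (simp only:)
        \<comment> \<open>The mean depends on the octave only, so the centring built into the
          function of the first block is correct for all blocks.\<close>
        have mq: "m q = ln (powint \<alpha> (\<phi> j)) / \<alpha> + expectation (\<lambda>\<omega>. ln \<bar>Z0 \<omega>\<bar>)" if "fst q = j" for q
          unfolding m_def using ln_mean[OF st[of q]] pos[OF j] j that by (simp add: powint_shift)
        have "m (j, s) = m ?q" using mq[of "(j, s)"] mq[of ?q] by (simp only: fst_conv)
        then show "a j * (ln \<bar>S (\<lambda>u. \<phi>' (j, s) (u - real i * L)) \<omega>\<bar> - m (j, s)) = a j * cln (Y ?q) \<omega>"
          unfolding 1 cln_def m_def by (simp only:)
      qed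
      finally show ?thesis .
    qed
    show "AE \<omega> in P. T i \<omega> = (\<Sum>j\<in>J. \<Sum>s\<in>{int (b j)..<int (l * mesh j) - int (b j)}. a j * cln (Y (j, s + int i * int (l * mesh j))) \<omega>)"
      using T(3)[of i] unfolding e A_def .
  qed
qed

text \<open>Three errors of at most e/3 each: idealising the weights, which vanishes with N;
  replacing the kernels by simple functions, small by \<open>admissible_difference_bound\<close>;
  and dropping the margins, small for long blocks. The approximants come first, as they determine
  the margins, and the block length is chosen last.\<close>

lemma block_approximation:
  assumes e: "e > 0"
  shows "\<exists>T k c. indep_vars (\<lambda>_. borel) T UNIV \<and> (\<forall>i. distr P borel (T i) = distr P borel (T 0)) \<and>
      sqint (T 0) \<and> expectation (T 0) = 0 \<and> filterlim k at_top sequentially \<and>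
      (\<lambda>N. real (k N) / real N) \<longlonglongrightarrow> c \<and>
      (\<forall>\<^sub>F N in sequentially. msq (\<lambda>x. V N x - (\<Sum>i<k N. T i x) / sqrt (real N)) \<le> e\<^sup>2)"
proof -
  define d where "d = (e / 3)\<^sup>2"
  have d: "d > 0" "sqrt d = e / 3" using e by (simp_all add: d_def)
  obtain m E where mE: "m > 0" "E \<ge> 0" "\<And>j. j \<in> J \<Longrightarrow> 2 * m \<le> powint \<alpha> (F j)"
    "\<And>j u. j \<in> J \<Longrightarrow> \<bar>2 * F j u\<bar> powr (\<alpha> / 2) \<le> E * env p u" using uniform_constants[OF finite_J] by blast
  obtain K where K: "K \<ge> 0" "\<And>f Y A c. (\<And>q. fst q \<in> J \<Longrightarrow> admissible p m E (f q) (site q) (Y q)) \<Longrightarrow>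
    (\<And>j. j \<in> J \<Longrightarrow> finite (A j)) \<Longrightarrow>
    msq (\<lambda>x. \<Sum>q\<in>(SIGMA j:J. A j). c q * cln (Y q) x) \<le> K * (\<Sum>q\<in>(SIGMA j:J. A j). (c q)\<^sup>2)"
    using admissible_sum_bound[OF p mE(1,2) finite_J] by blast
  \<comment> \<open>Bounds the sum of the squared idealised weights uniformly in N, so that the
    precision e' demanded of the kernels can be fixed in advance.\<close>
  define \<Gamma> where "\<Gamma> = (\<Sum>j\<in>J. (a j)\<^sup>2 * (2 powr (- real_of_int j1) * real (mesh j)))"
  have \<Gamma>: "\<Gamma> \<ge> 0" unfolding \<Gamma>_def by (intro sum_nonneg) simp
  define e' where "e' = d / (\<Gamma> + 1)"
  have e': "e' > 0" "e' * \<Gamma> \<le> d" using d \<Gamma> by (auto simp: e'_def field_simps)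
  obtain \<eta> where \<eta>: "\<eta> > 0" "\<And>f Y g Z A c. (\<And>q. fst q \<in> J \<Longrightarrow> admissible p m E (f q) (site q) (Y q)) \<Longrightarrow>
    (\<And>q. fst q \<in> J \<Longrightarrow> admissible p m E (g q) (site q) (Z q)) \<Longrightarrow>
    (\<And>q. fst q \<in> J \<Longrightarrow> powint \<alpha> (\<lambda>u. f q u - g q u) \<le> \<eta>) \<Longrightarrow>
    (\<And>j. j \<in> J \<Longrightarrow> finite (A j)) \<Longrightarrow>
    msq (\<lambda>x. \<Sum>q\<in>(SIGMA j:J. A j). c q * (cln (Y q) x - cln (Z q) x)) \<le> e' * (\<Sum>q\<in>(SIGMA j:J. A j). (c q)\<^sup>2)"
    using admissible_difference_bound[OF p mE(1,2) finite_J e'(1)] by blast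
  have mF: "m < powint \<alpha> (F j)" if "j \<in> J" for j using mE(1) mE(3)[OF that] by linarith
  obtain R \<phi> where \<phi>: "R \<ge> 0" "\<And>j. j \<in> J \<Longrightarrow> fin_simple (\<phi> j)" "\<And>j u. j \<in> J \<Longrightarrow> \<bar>\<phi> j u\<bar> \<le> \<bar>2 * F j u\<bar>"
    "\<And>j u. j \<in> J \<Longrightarrow> R < \<bar>u\<bar> \<Longrightarrow> \<phi> j u = 0" "\<And>j. j \<in> J \<Longrightarrow> powint \<alpha> (\<lambda>u. F j u - \<phi> j u) \<le> \<eta>"
    "\<And>j. j \<in> J \<Longrightarrow> m \<le> powint \<alpha> (\<phi> j)" by (rule approximants[OF finite_J mF \<eta>(1)]) (assumption, rule that)
  define b where "b j = nat \<lceil>R / 2 powr real_of_int j\<rceil>" for j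
  have b: "R \<le> 2 powr real_of_int j * real (b j)" for j
  proof -
    have "R / 2 powr real_of_int j \<le> real (b j)" unfolding b_def by linarith
    then show ?thesis by (simp add: field_simps)
  qed
  \<comment> \<open>Divided by l, this bounds the sum of the squared weights in the margins; l is
    then taken large against K \<Lambda> / d.\<close>
  define \<Lambda> where "\<Lambda> = (\<Sum>j\<in>J. (a j)\<^sup>2 * (2 powr (- real_of_int j1) * (2 * real (b j))))"
  obtain l :: nat where "real l > max 1 (K * \<Lambda> / d)" using reals_Archimedean2 by blast
  then have l: "l \<ge> 1" "K * \<Lambda> / d \<le> real l" by auto
  have Kl: "K * (\<Lambda> / real l) \<le> d" using l d(1) by (simp add: field_simps)
  define k where "k = (\<lambda>N::nat. nat \<lfloor>real N * 2 powr (- real_of_int j1) / real l\<rfloor>)"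
  have kl: "(\<lambda>N. real (k N) / real N) \<longlonglongrightarrow> 2 powr (- real_of_int j1) / real l" "filterlim k at_top sequentially"
    using floor_multiple_lim(1,2)[OF l(1)] unfolding k_def .
  have kl3: "real (k N * l) \<le> real N * 2 powr (- real_of_int j1)" for N
    using floor_multiple_lim(3)[OF l(1)] unfolding k_def .
  have Bl: "(\<lambda>N. real (k N * l) / real N) \<longlonglongrightarrow> 2 powr (- real_of_int j1)" using block_lim(1)[OF l(1)] unfolding k_def .
  define Y where "Y q = S (\<lambda>u. \<phi> (fst q) (u - site q))" for q
  have pos: "powint \<alpha> (\<phi> j) > 0" if "j \<in> J" for j using \<phi>(6)[OF that] mE(1) by linarith
  obtain T where T: "indep_vars (\<lambda>_. borel) T UNIV" "\<And>i. distr P borel (T i) = distr P borel (T 0)"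
    "\<And>i. AE x in P. T i x = (\<Sum>j\<in>J. \<Sum>s\<in>{int (b j)..<int (l * mesh j) - int (b j)}. a j * cln (Y (j, s + int i * int (l * mesh j))) x)"
    using independent_blocks[where \<phi>=\<phi> and R=R, OF \<phi>(2,4) pos b l(1), folded Y_def] by blast
  have Yst: "stable_int (\<lambda>u. \<phi> (fst q) (u - site q)) (Y q)" if "fst q \<in> J" for q
    unfolding Y_def using \<phi>(2)[OF that] by (intro stable_int_simple fin_simple_shift)
  have Yad: "admissible p m E (\<lambda>u. \<phi> (fst q) (u - site q)) (site q) (Y q)" if "fst q \<in> J" for q
    by (rule dominated_admissible[OF Yst \<phi>(6) \<phi>(3) mE(4)]) (use that in auto)
  have Gad: "admissible p m E (\<lambda>u. F (fst q) (u - site q)) (site q) (D (fst q) (snd q))" if "fst q \<in> J" for q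
    by (rule G_admissible[OF mE(1,3,4)]) (use that in auto)
  define H where "H q = cln (Y q)" for q
  have H: "H q \<in> borel_measurable P" "sqint (H q)" "integrable P (H q)" "expectation (H q) = 0" if "fst q \<in> J" for q
    unfolding H_def using cln_props[OF Yst[OF that]] by auto
  have Tm [measurable]: "T i \<in> borel_measurable P" for i using T(1) by (auto simp: indep_vars_def)
  let ?A = "\<lambda>j. {int (b j)..<int (l * mesh j) - int (b j)}"
  define T0 where "T0 x = (\<Sum>q\<in>(SIGMA j:J. ?A j). a (fst q) * H q x)" for x
  have "T0 x = (\<Sum>j\<in>J. \<Sum>s\<in>?A j. a j * H (j, s) x)" for x
    unfolding T0_def using finite_J by (subst sum.Sigma) (auto simp: case_prod_beta')
  then have T0: "AE x in P. T 0 x = T0 x" using T(3)[of 0] unfolding H_def by simp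
  have T0m [measurable]: "T0 \<in> borel_measurable P" unfolding T0_def[abs_def] by (intro borel_measurable_sum borel_measurable_times H) auto
  have 1: "sqint (T 0)"
  proof -
    have "sqint T0" unfolding T0_def by (rule expectation_sum_square(1)) (use H in auto)
    moreover have "AE x in P. (T0 x)\<^sup>2 = (T 0 x)\<^sup>2" using T0 by eventually_elim simp
    ultimately show ?thesis by (subst integrable_cong_AE[where g="\<lambda>x. (T0 x)\<^sup>2"]) (auto intro: T0[THEN AE_mp])
  qed
  have 2: "expectation (T 0) = 0"
  proof -
    have "expectation (T 0) = expectation T0" using T0 by (intro integral_cong_AE) auto
    also have "\<dots> = (\<Sum>q\<in>(SIGMA j:J. ?A j). a (fst q) * expectation (H q))"
      unfolding T0_def using H(3) by (subst Bochner_Integration.integral_sum) auto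
    also have "\<dots> = 0" using H(4) by (intro sum.neutral) auto
    finally show ?thesis .
  qed
  have "\<forall>\<^sub>F N in sequentially. msq (\<lambda>x. V N x - (\<Sum>q\<in>idx N (k N * l). cW N (k N * l) q * G q x)) < d"
    by (rule order_tendstoD(2)[OF VW_limit[OF Bl] d(1)])
  then have 3: "\<forall>\<^sub>F N in sequentially. msq (\<lambda>x. V N x - (\<Sum>i<k N. T i x) / sqrt (real N)) \<le> e\<^sup>2"
    using eventually_gt_at_top[of 0]
  proof eventually_elim
    case (elim N)
    define c where "c q = cW N (k N * l) q" for q
    let ?I = "idx N (k N * l)"
    let ?X1 = "\<lambda>x. V N x - (\<Sum>q\<in>?I. c q * G q x)"
    let ?X2 = "\<lambda>x. \<Sum>q\<in>?I. c q * (G q x - H q x)"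
    let ?X3 = "\<lambda>x. \<Sum>q\<in>?I. c q * of_bool (\<not> interior b l q) * H q x"
    have kN: "real (k N) / real N \<le> 2 powr (- real_of_int j1) / real l" "real (k N * l) / real N \<le> 2 powr (- real_of_int j1)"
      using kl3[of N] elim(2) l(1) by (simp_all add: field_simps)
    have GH: "(\<lambda>x. G q x - H q x) \<in> borel_measurable P" "sqint (\<lambda>x. G q x - H q x)" if "fst q \<in> J" for q
      using L2_triangle(2)[OF G_props(1) H(1)[OF that] G_props(2) H(2)[OF that]] G_props(1) H(1)[OF that] by auto
    have X1: "?X1 \<in> borel_measurable P" "sqint ?X1"
    proof -
      have W: "(\<lambda>x. \<Sum>q\<in>?I. c q * G q x) \<in> borel_measurable P" "sqint (\<lambda>x. \<Sum>q\<in>?I. c q * G q x)"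
        by (intro borel_measurable_sum borel_measurable_times G_props) (simp, rule expectation_sum_square(1), (rule G_props)+)
      show "?X1 \<in> borel_measurable P" by (intro borel_measurable_diff V_props W)
      show "sqint ?X1" by (rule L2_triangle(2)[OF V_props(1) W(1) V_props(2) W(2)])
    qed
    have X2: "?X2 \<in> borel_measurable P" "sqint ?X2"
      by (intro borel_measurable_sum borel_measurable_times GH, auto)[1] (rule expectation_sum_square(1); use GH in auto)
    have X3: "?X3 \<in> borel_measurable P" "sqint ?X3"
      by (intro borel_measurable_sum borel_measurable_times H, auto)[1] (rule expectation_sum_square(1); use H in auto)
    have b1: "sqrt (msq ?X1) \<le> e / 3"
      using elim(1) unfolding c_def d(2)[symmetric] by (intro real_sqrt_le_mono) simp
    have b2: "sqrt (msq ?X2) \<le> e / 3"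
      unfolding d(2)[symmetric]
    proof (rule real_sqrt_le_mono)
      have sh: "powint \<alpha> (\<lambda>u. F (fst q) (u - site q) - \<phi> (fst q) (u - site q)) \<le> \<eta>" if "fst q \<in> J" for q
        using \<phi>(5)[OF that] powint_shift[of \<alpha> "\<lambda>u. F (fst q) u - \<phi> (fst q) u" "site q"] by simp
      have "msq ?X2 \<le> e' * (\<Sum>q\<in>?I. (c q)\<^sup>2)"
        unfolding G_def H_def by (rule \<eta>(2)[OF Gad Yad sh finite_rng])
      also have "(\<Sum>q\<in>?I. (c q)\<^sup>2) = (\<Sum>q\<in>?I. (cW N (k N * l) q * of_bool True)\<^sup>2)" by (simp add: c_def)
      also have "\<dots> = (\<Sum>j\<in>J. (a j)\<^sup>2 * (real (k N * l) / real N * real (mesh j)))" unfolding sum_cW_square by simp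
      also have "e' * \<dots> \<le> e' * \<Gamma>"
        unfolding \<Gamma>_def using e'(1) kN(2) by (intro mult_left_mono sum_mono mult_right_mono) auto
      also have "\<dots> \<le> d" by (rule e'(2))
      finally show "msq ?X2 \<le> d" .
    qed
    have b3: "sqrt (msq ?X3) \<le> e / 3"
      unfolding d(2)[symmetric]
    proof (rule real_sqrt_le_mono)
      have "msq ?X3 \<le> K * (\<Sum>q\<in>?I. (c q * of_bool (\<not> interior b l q))\<^sup>2)"
        unfolding H_def by (rule K(2)[OF Yad finite_rng])
      also have "(\<Sum>q\<in>?I. (c q * of_bool (\<not> interior b l q))\<^sup>2)
        = (\<Sum>j\<in>J. (a j)\<^sup>2 / real N * (\<Sum>n\<in>{0..<int (k N * l * mesh j)}. of_bool (\<not> interior b l (j, n))))"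
        unfolding c_def by (rule sum_cW_square)
      also have "\<dots> \<le> (\<Sum>j\<in>J. (a j)\<^sup>2 / real N * (real (k N) * (2 * real (b j))))"
        by (intro sum_mono mult_left_mono boundary_count) simp
      also have "\<dots> = (\<Sum>j\<in>J. (a j)\<^sup>2 * (real (k N) / real N * (2 * real (b j))))" by simp
      also have "\<dots> \<le> (\<Sum>j\<in>J. (a j)\<^sup>2 * (2 powr (- real_of_int j1) / real l * (2 * real (b j))))"
        by (intro sum_mono mult_left_mono mult_right_mono kN) auto
      also have "\<dots> = \<Lambda> / real l" unfolding \<Lambda>_def sum_divide_distrib by simp
      finally have "msq ?X3 \<le> K * (\<Lambda> / real l)" using K(1) by (simp add: mult_left_mono)
      then show "msq ?X3 \<le> d" using Kl by linarith
    qed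
    have X23: "(\<lambda>x. ?X2 x + ?X3 x) \<in> borel_measurable P" "sqint (\<lambda>x. ?X2 x + ?X3 x)"
      by (rule borel_measurable_add[OF X2(1) X3(1)]) (rule L2_triangle(1)[OF X2(1) X3(1) X2(2) X3(2)])
    have "sqrt (msq (\<lambda>x. ?X1 x + (?X2 x + ?X3 x))) \<le> e"
      using L2_triangle(3)[OF X1(1) X23(1) X1(2) X23(2)] L2_triangle(3)[OF X2(1) X3(1) X2(2) X3(2)] b1 b2 b3 by argo
    then have s: "msq (\<lambda>x. ?X1 x + (?X2 x + ?X3 x)) \<le> e\<^sup>2" using e by (simp add: real_le_rsqrt sqrt_le_D)
    have eqX: "AE x in P. V N x - (\<Sum>i<k N. T i x) / sqrt (real N) = ?X1 x + (?X2 x + ?X3 x)"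
    proof -
      have "AE x in P. \<forall>i. T i x = (\<Sum>j\<in>J. \<Sum>s\<in>?A j. a j * H (j, s + int i * int (l * mesh j)) x)"
        unfolding AE_all_countable H_def using T(3) by blast
      then show ?thesis
      proof eventually_elim
        case (elim x)
        have "(\<Sum>i<k N. T i x) / sqrt (real N) = (\<Sum>q\<in>?I. c q * of_bool (interior b l q) * H q x)"
          unfolding c_def block_sum using elim by (simp only:)
        moreover have "(\<Sum>q\<in>?I. c q * H q x) = (\<Sum>q\<in>?I. c q * of_bool (interior b l q) * H q x) + ?X3 x"
          unfolding sum.distrib[symmetric] by (intro sum.cong) auto
        ultimately show ?case by (simp add: right_diff_distrib sum_subtractf)
      qed
    qed
    have "msq (\<lambda>x. V N x - (\<Sum>i<k N. T i x) / sqrt (real N)) = msq (\<lambda>x. ?X1 x + (?X2 x + ?X3 x))"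
    proof (rule integral_cong_AE)
      show "(\<lambda>x. (V N x - (\<Sum>i<k N. T i x) / sqrt (real N))\<^sup>2) \<in> borel_measurable P" using V_props(1)[of N] by measurable
      show "(\<lambda>x. (?X1 x + (?X2 x + ?X3 x))\<^sup>2) \<in> borel_measurable P"
        by (intro borel_measurable_power borel_measurable_add[OF X1(1) X23(1)])
      show "AE x in P. (V N x - (\<Sum>i<k N. T i x) / sqrt (real N))\<^sup>2 = (?X1 x + (?X2 x + ?X3 x))\<^sup>2"
        using eqX by eventually_elim (simp only:)
    qed
    with s show ?case by simp
  qed
  have "\<forall>i. distr P borel (T i) = distr P borel (T 0)" using T(2) by blast
  with T(1) 1 2 kl 3 show ?thesis by blast
qed

theorem V_clt: "weak_conv_m (\<lambda>N. distr P borel (V N)) (normal_law 0 vlim)"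
  by (rule clt_approximation[OF V_props V_variance block_approximation])

end

context sas_noise begin

section \<open>Wavelet coefficients\<close>

text \<open>The second claim says that the logarithm of the scale is affine in the octave. The
  amplitude contributes \<kappa> + 1/2 per octave and the dilation of the kernel adds 1/\<alpha>,
  which together make H + 1/2: the slope that the estimator reads off.\<close>

lemma wavelet_stable_family:
  fixes X :: "real \<Rightarrow> 'a \<Rightarrow> real"
  assumes X: "linear_fractional_stable_motion P \<alpha> H M X" and H: "0 < H" "H < 1"
    and W: "wavelet_kernel (H - 1 / \<alpha>) \<psi> Q S0 C" and QH: "real Q - H > 1 / (\<alpha> * (\<alpha> - 1))"
  defines "F \<equiv> \<lambda>j u. 2 powr (real_of_int j * (H - 1 / \<alpha> + 1 / 2)) * wavelet_kernel.h (H - 1 / \<alpha>) \<psi> (- (2 powr (- real_of_int j)) * u)"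
  shows "stable_family P \<alpha> M F (wavelet_coeff X \<psi>) ((real Q - (H - 1 / \<alpha>)) * \<alpha> / 2)"
    and "ln (powint \<alpha> (F j)) / \<alpha> = real_of_int j * (H + 1 / 2) * ln 2 + ln (powint \<alpha> (F 0)) / \<alpha>"
proof -
  define \<kappa> where "\<kappa> = H - 1 / \<alpha>"
  define q where "q = real Q - \<kappa>"
  interpret W: wavelet_kernel \<kappa> \<psi> Q S0 C using W by (simp add: \<kappa>_def)
  have F: "F j u = 2 powr (real_of_int j * (\<kappa> + 1 / 2)) * W.h (- (2 powr (- real_of_int j)) * u)" for j u
    unfolding F_def \<kappa>_def ..
  have q: "q > 1 / (\<alpha> - 1)" "q > 0" and p: "q * \<alpha> / 2 > 1"
  proof -
    \<comment> \<open>Since q = Q - H + 1/\<alpha>, the hypothesis on Q becomes q > 1/(\<alpha> -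
      1). As \<alpha> < 2 gives \<alpha>/(\<alpha> - 1) > 2, it follows that q \<alpha> / 2 >
      1.\<close>
    have "1 / (\<alpha> - 1) = 1 / (\<alpha> * (\<alpha> - 1)) + 1 / \<alpha>" using \<alpha> by (simp add: field_simps)
    then show 1: "q > 1 / (\<alpha> - 1)" using QH by (simp add: q_def \<kappa>_def)
    have "1 / (\<alpha> - 1) > 0" using \<alpha> by simp
    then show "q > 0" using 1 by linarith
    have "1 / (\<alpha> - 1) * \<alpha> < q * \<alpha>" using 1 \<alpha> by (intro mult_strict_right_mono) auto
    moreover have "2 < 1 / (\<alpha> - 1) * \<alpha>" using \<alpha> by (simp add: field_simps)
    ultimately show "q * \<alpha> / 2 > 1" by linarith
  qed
  have D: "stable_int (\<lambda>u. F j (u - site (j, n))) (wavelet_coeff X \<psi> j n)" for j n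
  proof -
    have "2 powr (- real_of_int j) * (2 powr real_of_int j * real_of_int n) = real_of_int n"
      unfolding mult.assoc[symmetric] powr_add[symmetric] by simp
    then have "- (2 powr (- real_of_int j)) * (u - site (j, n)) = real_of_int n - 2 powr (- real_of_int j) * u" for u
      unfolding site_def fst_conv snd_conv right_diff_distrib by linarith
    then have "(\<lambda>u. F j (u - site (j, n))) = (\<lambda>u. 2 powr (real_of_int j * (H - 1 / \<alpha> + 1 / 2)) * wavelet_kernel.h (H - 1 / \<alpha>) \<psi> (real_of_int n - 2 powr (- real_of_int j) * u))"
      unfolding F_def by (simp only:)
    then show ?thesis using wavelet_coeff_stable[OF X H W] by simp
  qed
  have hi: "integrable lborel (\<lambda>u. \<bar>W.h u\<bar> powr \<alpha>)"
  proof -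
    have "(\<lambda>u. F 0 (u - site (0, 0))) = (\<lambda>u. W.h (- u))" unfolding F site_def by simp
    then have "integrable lborel (\<lambda>u. \<bar>W.h (- u)\<bar> powr \<alpha>)" using stable_int_in_Lp[OF D[of 0 0]] by (simp add: in_Lp_def)
    from lborel_integrable_real_affine[OF this, of "-1" 0] show ?thesis by simp
  qed
  have hpos: "powint \<alpha> W.h > 0"
  proof (rule ccontr)
    assume "\<not> powint \<alpha> W.h > 0"
    then have "(\<integral>u. \<bar>W.h u\<bar> powr \<alpha> \<partial>lborel) = 0" using powint_nonneg[of \<alpha> W.h] unfolding powint_def by linarith
    then have "AE u in lborel. \<bar>W.h u\<bar> powr \<alpha> = 0" using integral_nonneg_eq_0_iff_AE[OF hi] by simp
    then have "AE u in lborel. W.h u = 0" by eventually_elim (simp split: if_splits)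
    then show False using W.h_nonzero by simp
  qed
  have pF: "powint \<alpha> (F j) = 2 powr (real_of_int j * (\<kappa> + 1 / 2) * \<alpha> + real_of_int j) * powint \<alpha> W.h" for j
  proof -
    let ?c = "2 powr (- real_of_int j)"
    have "powint \<alpha> W.h = ?c * powint \<alpha> (\<lambda>u. W.h (- ?c * u))"
      unfolding powint_def by (subst lborel_integral_real_affine[where c="- ?c" and t=0]) simp_all
    then have "2 powr real_of_int j * powint \<alpha> W.h = (2 powr real_of_int j * ?c) * powint \<alpha> (\<lambda>u. W.h (- ?c * u))" by simp
    also have "2 powr real_of_int j * ?c = 1" by (simp flip: powr_add)
    finally show ?thesis unfolding F powint_cmult by (simp add: powr_add powr_powr)
  qed
  have Fpos: "powint \<alpha> (F j) > 0" for j unfolding pF using hpos by simp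
  obtain E where E: "E \<ge> 0" "\<And>u. \<bar>W.h u\<bar> \<le> E * env q u"
    using W.h_envelope q(2) unfolding q_def by blast
  have Fenv: "\<exists>E. \<forall>u. \<bar>F j u\<bar> powr (\<alpha> / 2) \<le> E * env (q * \<alpha> / 2) u" for j
  proof -
    define c where "c = 2 powr (- real_of_int j)"
    define d where "d = 2 powr (real_of_int j * (\<kappa> + 1 / 2))"
    \<comment> \<open>Dilating the envelope by c changes it by a constant factor only, because m (1
      + |u|) \<le> 1 + c |u|.\<close>
    define m where "m = min 1 c"
    have c: "c > 0" and d: "d > 0" and m: "m > 0" by (simp_all add: c_def d_def m_def)
    have "\<bar>F j u\<bar> powr (\<alpha> / 2) \<le> (d * E) powr (\<alpha> / 2) * m powr (- (q * \<alpha> / 2)) * env (q * \<alpha> / 2) u" for u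
    proof -
      have "m * (1 + \<bar>u\<bar>) \<le> 1 + c * \<bar>u\<bar>"
        using mult_right_mono[of m c "\<bar>u\<bar>"] by (simp add: m_def distrib_left add_mono)
      then have "(1 + c * \<bar>u\<bar>) powr (- q) \<le> (m * (1 + \<bar>u\<bar>)) powr (- q)" using m q by (intro powr_mono2') auto
      moreover have "\<bar>F j u\<bar> \<le> d * (E * (1 + c * \<bar>u\<bar>) powr (- q))"
        using mult_left_mono[OF E(2)[of "- c * u"], of d] c d by (simp add: F abs_mult c_def d_def)
      ultimately have "\<bar>F j u\<bar> \<le> d * (E * (m * (1 + \<bar>u\<bar>)) powr (- q))"
        using d E(1) by (meson mult_left_mono order_trans less_imp_le)
      then have "\<bar>F j u\<bar> powr (\<alpha> / 2) \<le> (d * (E * (m * (1 + \<bar>u\<bar>)) powr (- q))) powr (\<alpha> / 2)"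
        using \<alpha> by (intro powr_mono2) auto
      also have "\<dots> = (d * E) powr (\<alpha> / 2) * ((m * (1 + \<bar>u\<bar>)) powr (- q)) powr (\<alpha> / 2)"
        by (simp only: powr_mult mult.assoc)
      also have "((m * (1 + \<bar>u\<bar>)) powr (- q)) powr (\<alpha> / 2) = m powr (- (q * \<alpha> / 2)) * env (q * \<alpha> / 2) u"
        by (simp add: powr_powr powr_mult)
      finally show ?thesis by (simp only: mult.assoc)
    qed
    then show ?thesis by blast
  qed
  show "stable_family P \<alpha> M F (wavelet_coeff X \<psi>) ((real Q - (H - 1 / \<alpha>)) * \<alpha> / 2)"
    unfolding \<kappa>_def[symmetric] q_def[symmetric] by unfold_locales (fact p Fpos Fenv D)+
  have "(real_of_int j * (\<kappa> + 1 / 2) * \<alpha> + real_of_int j) / \<alpha> = real_of_int j * (\<kappa> + 1 / \<alpha> + 1 / 2)"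
    using \<alpha> by (simp add: field_simps)
  also have "\<kappa> + 1 / \<alpha> = H" by (simp add: \<kappa>_def)
  finally have "(real_of_int j * (\<kappa> + 1 / 2) * \<alpha> + real_of_int j) / \<alpha> = real_of_int j * (H + 1 / 2)" .
  moreover have "ln (powint \<alpha> (F j)) = (real_of_int j * (\<kappa> + 1 / 2) * \<alpha> + real_of_int j) * ln 2 + ln (powint \<alpha> W.h)"
    "ln (powint \<alpha> (F 0)) = ln (powint \<alpha> W.h)"
    unfolding pF using hpos by (simp_all add: ln_mult ln_powr)
  ultimately show "ln (powint \<alpha> (F j)) / \<alpha> = real_of_int j * (H + 1 / 2) * ln 2 + ln (powint \<alpha> (F 0)) / \<alpha>"
    by (simp add: add_divide_distrib flip: times_divide_eq_left)
qed

end

text \<open>The first two conjuncts certify the quantities in the last two: expectations of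
  nonintegrable functions and sums of nonsummable families default to 0, and a covariance or an
  \<open>asym_var\<close> built from defaults would be meaningless. Only ordered pairs of octaves
  occur, as \<open>asym_cov\<close> never uses the others.\<close>

theorem theorem7p1:
  fixes P :: "'a measure" and M :: "real set \<Rightarrow> 'a \<Rightarrow> real" and X :: "real \<Rightarrow> 'a \<Rightarrow> real"
    and \<psi> :: "real \<Rightarrow> real" and Q :: nat and \<alpha> H :: real
    and j0 j1 :: int and w :: "int \<Rightarrow> real" and Nc :: "int \<Rightarrow> nat \<Rightarrow> nat"
  defines "J \<equiv> {j0..j1}"
    and "d \<equiv> wavelet_coeff X \<psi>"
  assumes "prob_space P"
    and "1 < \<alpha>" and "\<alpha> < 2" and "0 < H" and "H < 1"
    and "sas_random_measure P \<alpha> M"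
    and "linear_fractional_stable_motion P \<alpha> H M X"
    and "\<psi> \<in> borel_measurable borel" and "bounded (range \<psi>)"
    and "compact (closure {t. \<psi> t \<noteq> 0})"
    and "1 \<le> Q" and "zero_moments Q \<psi>"
    and "(\<Sum>j\<in>J. w j) = 0" and "(\<Sum>j\<in>J. real_of_int j * w j) = 1"
    and "\<And>j N. j \<in> J \<Longrightarrow> 0 < N \<Longrightarrow> 0 < Nc j N"
    and "\<And>j. j \<in> J \<Longrightarrow>
           (\<lambda>N. real (Nc j N)) \<sim>[at_top] (\<lambda>N. 2 powr (- real_of_int j) * real N)"
    and "real Q - H > 1 / (\<alpha> * (\<alpha> - 1))"
  shows "(\<forall>j n. integrable P (\<lambda>\<omega>. (log 2 \<bar>d j n \<omega>\<bar>)\<^sup>2)) \<and>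
     (\<forall>j\<in>J. \<forall>k\<in>J. j \<le> k \<longrightarrow> log_cov P d j k summable_on UNIV) \<and>
     weak_conv_m
       (\<lambda>N. distr P borel (\<lambda>\<omega>. sqrt (real N) * (hurst_estimator J w Nc d N \<omega> - H)))
       (normal_law 0 (asym_var J w P d)) \<and>
     (\<lambda>N. real N * (\<integral>\<omega>. (hurst_estimator J w Nc d N \<omega> - H)\<^sup>2 \<partial>P)) \<longlonglongrightarrow> asym_var J w P d"
proof -
  note asm = assms(3-)
  interpret prob_space P by fact
  interpret sas_noise P \<alpha> M by unfold_locales fact+
  obtain C where C: "\<And>s. \<bar>\<psi> s\<bar> \<le> C" using asm(9) by (auto simp: bounded_iff)
  obtain S0 where S0: "\<And>x. x \<in> closure {t. \<psi> t \<noteq> 0} \<Longrightarrow> norm x \<le> S0"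
    using compact_imp_bounded[OF asm(10)] by (auto simp: bounded_iff)
  have supp: "\<psi> s = 0" if "max 1 S0 < \<bar>s\<bar>" for s
    using S0[of s] closure_subset[of "{t. \<psi> t \<noteq> 0}"] that by fastforce
  have "1 / \<alpha> < 1" using asm by simp
  then have "- 1 < H - 1 / \<alpha>" using asm(4) by linarith
  then have W: "wavelet_kernel (H - 1 / \<alpha>) \<psi> Q (max 1 S0) C"
    by unfold_locales (use asm C supp in auto)
  define F where "F = (\<lambda>j u. 2 powr (real_of_int j * (H - 1 / \<alpha> + 1 / 2)) * wavelet_kernel.h (H - 1 / \<alpha>) \<psi> (- (2 powr (- real_of_int j)) * u))"
  have fam: "stable_family P \<alpha> M F d ((real Q - (H - 1 / \<alpha>)) * \<alpha> / 2)"
    "ln (powint \<alpha> (F j)) / \<alpha> = real_of_int j * (H + 1 / 2) * ln 2 + ln (powint \<alpha> (F 0)) / \<alpha>" for j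
    unfolding F_def d_def by (rule wavelet_stable_family[OF asm(7) asm(4,5) W asm(17)])+
  interpret stable_family P \<alpha> M F d "(real Q - (H - 1 / \<alpha>)) * \<alpha> / 2" by (rule fam(1))
  have Nl: "(\<lambda>N. real (Nc j N) / real N) \<longlonglongrightarrow> 2 powr (- real_of_int j)" if j: "j \<in> J" for j
  proof -
    \<comment> \<open>Asymptotic equivalence is convergence of a quotient to 1, with 0/0 read as 1.
      For N > 0 the convention is not triggered and multiplication by ?g gives the ratio
      needed.\<close>
    let ?g = "2 powr (- real_of_int j)"
    have "(\<lambda>N. if real (Nc j N) = 0 \<and> ?g * real N = 0 then 1 else real (Nc j N) / (?g * real N)) \<longlonglongrightarrow> 1"
      using asm(16)[OF j] unfolding asymp_equiv_def .
    then have "(\<lambda>N. ?g * (if real (Nc j N) = 0 \<and> ?g * real N = 0 then 1 else real (Nc j N) / (?g * real N))) \<longlonglongrightarrow> ?g * 1"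
      by (intro tendsto_mult tendsto_const)
    then have l: "(\<lambda>N. ?g * (if real (Nc j N) = 0 \<and> ?g * real N = 0 then 1 else real (Nc j N) / (?g * real N))) \<longlonglongrightarrow> ?g" by simp
    show ?thesis
    proof (rule Lim_transform_eventually[OF l])
      show "\<forall>\<^sub>F N in sequentially. ?g * (if real (Nc j N) = 0 \<and> ?g * real N = 0 then 1 else real (Nc j N) / (?g * real N)) = real (Nc j N) / real N"
        using eventually_gt_at_top[of 0] by eventually_elim simp
    qed
  qed
  \<comment> \<open>The development uses natural logarithms; the passage from base 2 is absorbed
    into the weights.\<close>
  interpret E: estimator_family P \<alpha> M F d "(real Q - (H - 1 / \<alpha>)) * \<alpha> / 2" j0 j1 "\<lambda>j. w j / ln 2" Nc
    by unfold_locales (use asm(15) Nl in \<open>auto simp: J_def\<close>)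
  have EJ: "E.J = J" by (simp add: E.J_def J_def)
  define c where "c = ln (powint \<alpha> (F 0)) / \<alpha> + expectation (\<lambda>\<omega>. ln \<bar>Z0 \<omega>\<bar>)"
  have mean: "expectation (\<lambda>\<omega>. ln \<bar>d j n \<omega>\<bar>) = real_of_int j * (H + 1 / 2) * ln 2 + c" for j n
    using ln_mean[OF D D_pos, of j n] fam(2)[of j] by (simp add: powint_shift c_def)
  have G: "G (j, n) \<omega> = ln \<bar>d j n \<omega>\<bar> - (real_of_int j * (H + 1 / 2) * ln 2 + c)" for j n \<omega>
    by (simp add: G_def cln_def mean)
  \<comment> \<open>An identity for every N. Weights summing to 0 remove \<open>c\<close>, and the
    first moment 1 of the weights produces H + 1/2, whose 1/2 the estimator subtracts. For N = 0
    both sides vanish through the factor \<open>sqrt 0\<close>.\<close>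
  have est: "sqrt (real N) * (hurst_estimator J w Nc d N \<omega> - H) = E.V N \<omega>" for N \<omega>
  proof (cases "N = 0")
    case True
    then show ?thesis by (simp add: E.V_def)
  next
    case False
    have z: "(\<Sum>j\<in>J. w j * c / ln 2) = 0"
      using asm(13) by (simp flip: sum_divide_distrib sum_distrib_right)
    have Nc: "real (Nc j N) > 0" if "j \<in> J" for j using asm(15)[OF that] False by simp
    have "E.V N \<omega> = (\<Sum>j\<in>J. sqrt (real N) * (w j * (1 / real (Nc j N) * (\<Sum>n = 1..Nc j N. log 2 \<bar>d j (int n) \<omega>\<bar>))
        - (real_of_int j * w j * (H + 1 / 2) + w j * (c / ln 2))))"
      unfolding E.V_def EJ
    proof (rule sum.cong[OF refl])
      fix j assume j: "j \<in> J"
      have gs: "(\<Sum>n = 1..Nc j N. G (j, int n) \<omega>) = (\<Sum>n = 1..Nc j N. ln \<bar>d j (int n) \<omega>\<bar>) - real (Nc j N) * (real_of_int j * (H + 1 / 2) * ln 2 + c)"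
        unfolding G by (simp add: sum_subtractf)
      have ls: "(\<Sum>n = 1..Nc j N. log 2 \<bar>d j (int n) \<omega>\<bar>) = (\<Sum>n = 1..Nc j N. ln \<bar>d j (int n) \<omega>\<bar>) / ln 2"
        by (simp add: log_def sum_divide_distrib)
      show "w j / ln 2 * (sqrt (real N) / real (Nc j N)) * (\<Sum>n = 1..Nc j N. G (j, int n) \<omega>)
        = sqrt (real N) * (w j * (1 / real (Nc j N) * (\<Sum>n = 1..Nc j N. log 2 \<bar>d j (int n) \<omega>\<bar>))
        - (real_of_int j * w j * (H + 1 / 2) + w j * (c / ln 2)))"
        unfolding gs ls using Nc[OF j] by (simp add: field_simps)
    qed
    also have "\<dots> = sqrt (real N) * (hurst_estimator J w Nc d N \<omega> - H)"
      by (simp add: hurst_estimator_def sum_distrib_left[symmetric] sum_subtractf sum.distrib sum_distrib_right[symmetric] asm(13,14) z)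
    finally show ?thesis by simp
  qed
  have lc: "log_cov P d j k = (\<lambda>n. inverse ((ln 2)\<^sup>2) * r j k n)" for j k
  proof
    fix n
    have "log_cov P d j k n = expectation (\<lambda>\<omega>. G (j, n) \<omega> * G (k, 0) \<omega> / (ln 2)\<^sup>2)"
      unfolding log_cov_def covariance_def log_def G_def cln_def
      by (simp add: diff_divide_distrib[symmetric] power2_eq_square)
    then show "log_cov P d j k n = inverse ((ln 2)\<^sup>2) * r j k n" by (simp add: r_def divide_inverse mult.commute)
  qed
  have var: "asym_var J w P d = E.vlim"
    unfolding asym_var_def E.vlim_def EJ
  proof (rule sum.cong[OF refl], rule sum.cong[OF refl])
    fix j k
    have cmb: "x * y * u * v * (t * (inverse (s\<^sup>2) * R)) = (x / s * u') * (y / s * v') * t' * R"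
      if "u * v * t = u' * v' * t'" for x y s u v t u' v' t' R :: real
    proof -
      have "x * y * u * v * (t * (inverse (s\<^sup>2) * R)) = x * y * (inverse (s\<^sup>2) * R) * (u * v * t)" by (simp only: mult_ac)
      then show ?thesis unfolding that by (simp add: divide_inverse power2_eq_square mult_ac)
    qed
    \<comment> \<open>Both sides are 2^x. Here y is the coarser octave, so the last factor matches
      the one with the maximum in \<open>vlim\<close>; the second form covers the reversed order of
      the octaves.\<close>
    have pw: "2 powr (x / 2) * 2 powr (y / 2) * 2 powr ((x - y) / 2) = 2 powr x * 2 powr y * (2 powr (- y) :: real)"
      "2 powr (y / 2) * 2 powr (x / 2) * 2 powr ((x - y) / 2) = 2 powr y * 2 powr x * (2 powr (- y) :: real)" for x y :: real
      unfolding powr_add[symmetric] by (simp_all add: field_simps)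
    show "w j * w k * 2 powr (real_of_int j / 2) * 2 powr (real_of_int k / 2) * asym_cov P d j k
       = E.a j * E.a k * 2 powr (- real_of_int (max j k)) * E.Rs j k"
    proof (cases "j \<le> k")
      case True
      then have "asym_cov P d j k = 2 powr ((real_of_int j - real_of_int k) / 2) * (inverse ((ln 2)\<^sup>2) * E.Rs j k)" "max j k = k"
        by (simp_all add: asym_cov_def E.Rs_def lc infsum_cmult_right')
      then show ?thesis unfolding E.a_def by (simp only: cmb[OF pw(1)])
    next
      case False
      then have "asym_cov P d j k = 2 powr ((real_of_int k - real_of_int j) / 2) * (inverse ((ln 2)\<^sup>2) * E.Rs j k)" "max j k = j"
        by (simp_all add: asym_cov_def E.Rs_def lc infsum_cmult_right')
      then show ?thesis unfolding E.a_def by (simp only: cmb[OF pw(2)])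
    qed
  qed
  show ?thesis
  proof (intro conjI allI ballI impI)
    fix j n
    show "integrable P (\<lambda>\<omega>. (log 2 \<bar>d j n \<omega>\<bar>)\<^sup>2)"
      using ln_square_integrable[OF D[of j n]] by (simp add: log_def power_divide)
  next
    fix j k
    show "log_cov P d j k summable_on UNIV" unfolding lc by (intro summable_on_cmult_right r_summable)
  next
    show "weak_conv_m (\<lambda>N. distr P borel (\<lambda>\<omega>. sqrt (real N) * (hurst_estimator J w Nc d N \<omega> - H))) (normal_law 0 (asym_var J w P d))"
      unfolding est var by (rule E.V_clt)
  next
    have "real N * expectation (\<lambda>\<omega>. (hurst_estimator J w Nc d N \<omega> - H)\<^sup>2) = expectation (\<lambda>\<omega>. (E.V N \<omega>)\<^sup>2)" for N
      by (simp add: est[symmetric] power_mult_distrib)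
    then show "(\<lambda>N. real N * expectation (\<lambda>\<omega>. (hurst_estimator J w Nc d N \<omega> - H)\<^sup>2)) \<longlonglongrightarrow> asym_var J w P d"
      unfolding var by (simp add: E.V_variance)
  qed
qed

end
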